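(* Let $R=k[x_1,\ldots,x_e]/I$ be a graded ring with $\deg x_i=d_i\geq 1$, where $k$ is a field and $I$ is a homogeneous ideal, and let $\mathfrak{m}$ be its maximal homogeneous ideal. Let $M\subseteq L$ be a tight embedding of graded $R$-modules, and set $V=\mathfrak{m}L/\mathfrak{m}M$. Then there is a coefficient-wise inequality $$H_V(s)\,P_k^R(s,t)\preceq P_M^R(s,t)\prod_{i=1}^e(1+s^{d_i}t).$$
   Context: $k$ is a field, $k[x_1,\ldots,x_e]$ is the polynomial ring graded by $\deg x_i=d_i\geq1$, $I$ is a (proper) homogeneous ideal, $R=k[x_1,\ldots,x_e]/I$, $\mathfrak{m}$ is the maximal homogeneous ideal of $R$ (generated by the classes of $x_1,\ldots,x_e$), and $k=R/\mathfrak{m}$ as a graded $R$-module. Tight embedding: a graded $R$-module $M$ is tightly embeddable if there is a finitely generated graded $R$-module $L$ with $M$ a graded submodule of $L$ and $\mathfrak{m}M\subsetneq\mathfrak{m}L\subseteq M\subseteq L$; in this case $M\subseteq L$ is called a tight embedding. Betti numbers: for a finitely generated graded $R$-module $M$, $\beta_{i,j}^R(M)=\operatorname{rank}_k\operatorname{Ext}_R^{i,j}(M,k)$, where $i$ is the homological degree and $j$ the internal degree, normalized so that $\beta_{i,j}^R(M)$ is the number of basis elements of internal degree $j$ in the $i$-th module of a minimal graded free resolution of $M$ over $R$. The bigraded Poincaré series is $P_M^R(s,t)=\sum_{i,j}\beta_{i,j}^R(M)s^jt^i\in\mathbb{Z}[s^{\pm1}][[t]]$. Hilbert series: for a finite-dimensional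 graded $k$-vector space $V$, $H_V(s)=\sum_j\operatorname{rank}_k(V_j)s^j$. For two formal series in $\mathbb{Z}[s^{\pm1}][[t]]$, $\sum a_{i,j}s^jt^i\preceq\sum b_{i,j}s^jt^i$ means $a_{i,j}\leq b_{i,j}$ for all $i,j$. *)

theory Defs
  imports
    "HOL-Library.Poly_Mapping"
    "HOL-Library.FuncSet"
    "HOL-Algebra.QuotRing"
    "HOL-Computational_Algebra.Formal_Laurent_Series"
    "Jordan_Normal_Form.VS_Connect"
begin

section \<open>Graded algebras and graded modules\<close>

text \<open>A graded algebra over a field (the type \<open>'k\<close>) is a ring together with its
  homogeneous parts, indexed by the integers, and the structure map from \<open>'k\<close>.
  Accordingly a graded module is a module together with its homogeneous parts.\<close>

record ('r, 'k) graded_algebra = "'r ring" +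
  rgrade :: "int \<Rightarrow> 'r set"
  scalar :: "'k \<Rightarrow> 'r"

record ('r, 'm) graded_module = "('r, 'm) module" +
  mgrade :: "int \<Rightarrow> 'm set"

locale graded_module = module R M
  for R :: "('r, 'k, 'x) graded_algebra_scheme" (structure)
    and M :: "('r, 'm, 'y) graded_module_scheme" (structure) +
  assumes mgrade_subgroup: "subgroup (mgrade M j) (add_monoid M)"
    and mgrade_decomp: "x \<in> carrier M \<Longrightarrow>
      \<exists>!c. (\<forall>j. c j \<in> mgrade M j) \<and> finite {j. c j \<noteq> \<zero>\<^bsub>M\<^esub>} \<and>
           x = (\<Oplus>\<^bsub>M\<^esub>j\<in>{j. c j \<noteq> \<zero>\<^bsub>M\<^esub>}. c j)"
    and mgrade_smult: "\<lbrakk>r \<in> rgrade R i; x \<in> mgrade M j\<rbrakk> \<Longrightarrow> r \<odot>\<^bsub>M\<^esub> x \<in> mgrade M (i + j)"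

definition submod :: "('r, 'm, 'y) graded_module_scheme \<Rightarrow> 'm set \<Rightarrow> ('r, 'm, 'y) graded_module_scheme"
  where "submod L N = L\<lparr>carrier := N, mgrade := (\<lambda>j. N \<inter> mgrade L j)\<rparr>"

definition graded_submodule ::
    "('r, 'k, 'x) graded_algebra_scheme \<Rightarrow> 'm set \<Rightarrow> ('r, 'm, 'y) graded_module_scheme \<Rightarrow> bool"
  where "graded_submodule R N L \<longleftrightarrow>
    LinearCombinations.submodule R N L \<and> graded_module R (submod L N)"

text \<open>The fields \<open>mult\<close> and \<open>one\<close>, which every module record inherits from ring records, play
  no role for modules; they are left undefined below. The scalar multiplication on cosets
  follows the pattern of the library's \<open>rcoset_mult\<close>.\<close>

definition quot_module :: "('r, 'm, 'y) module_scheme \<Rightarrow> 'm set \<Rightarrow> ('r, 'm set) module"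
  where "quot_module M N =
    \<lparr>carrier = a_rcosets\<^bsub>M\<^esub> N, monoid.mult = undefined, one = undefined, zero = N, add = set_add M,
     module.smult = (\<lambda>r X. \<Union>x\<in>X. N +>\<^bsub>M\<^esub> (r \<odot>\<^bsub>M\<^esub> x))\<rparr>"

definition quot_graded_module ::
    "('r, 'm, 'y) graded_module_scheme \<Rightarrow> 'm set \<Rightarrow> ('r, 'm set) graded_module"
  where "quot_graded_module M N =
    module.extend (quot_module M N)
      (graded_module.fields (\<lambda>j. (\<lambda>x. N +>\<^bsub>M\<^esub> x) ` mgrade M j))"

definition regular_module :: "('r, 'k, 'x) graded_algebra_scheme \<Rightarrow> ('r, 'r) graded_module"
  where "regular_module R =
    \<lparr>carrier = carrier R, monoid.mult = monoid.mult R, one = one R, zero = zero R, add = add R,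
     module.smult = monoid.mult R, mgrade = rgrade R\<rparr>"

definition finitely_generated ::
    "('r, 'x) ring_scheme \<Rightarrow> ('r, 'm, 'y) module_scheme \<Rightarrow> bool"
  where "finitely_generated R M \<longleftrightarrow>
    (\<exists>A. finite A \<and> A \<subseteq> carrier M \<and> LinearCombinations.module.span R M A = carrier M)"

definition ideal_times ::
    "('r, 'x) ring_scheme \<Rightarrow> 'r set \<Rightarrow> ('r, 'm, 'y) module_scheme \<Rightarrow> 'm set \<Rightarrow> 'm set"
  where "ideal_times R J L N = LinearCombinations.module.span R L {a \<odot>\<^bsub>L\<^esub> x | a x. a \<in> J \<and> x \<in> N}"


section \<open>The ring \<open>k[x\<^sub>1,\<dots>,x\<^sub>e]/I\<close>\<close>

text \<open>The variables are indexed by \<open>0, \<dots>, e - 1\<close> and \<open>d i\<close> is the degree of the variable with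
  index \<open>i\<close>. Exponent vectors are finitely supported functions \<open>nat \<Rightarrow>\<^sub>0 nat\<close>.\<close>

definition wdegree :: "(nat \<Rightarrow> nat) \<Rightarrow> (nat \<Rightarrow>\<^sub>0 nat) \<Rightarrow> nat"
  where "wdegree d m = (\<Sum>i\<in>Poly_Mapping.keys m. Poly_Mapping.lookup m i * d i)"

definition poly_algebra ::
    "nat \<Rightarrow> (nat \<Rightarrow> nat) \<Rightarrow> ((nat \<Rightarrow>\<^sub>0 nat) \<Rightarrow>\<^sub>0 'k::field, 'k) graded_algebra"
  where "poly_algebra e d =
    \<lparr>carrier = {p. \<forall>m\<in>Poly_Mapping.keys p. Poly_Mapping.keys m \<subseteq> {..<e}},
     monoid.mult = (*), one = 1, zero = 0, add = (+),
     rgrade = (\<lambda>j. {p. \<forall>m\<in>Poly_Mapping.keys p. Poly_Mapping.keys m \<subseteq> {..<e} \<and> int (wdegree d m) = j}),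
     scalar = Poly_Mapping.single 0\<rparr>"

definition poly_var :: "nat \<Rightarrow> (nat \<Rightarrow>\<^sub>0 nat) \<Rightarrow>\<^sub>0 'k::field"
  where "poly_var i = Poly_Mapping.single (Poly_Mapping.single i 1) 1"

definition homogeneous_ideal :: "'r set \<Rightarrow> ('r, 'k, 'x) graded_algebra_scheme \<Rightarrow> bool"
  where "homogeneous_ideal I S \<longleftrightarrow> (\<exists>H \<subseteq> (\<Union>j. rgrade S j). I = genideal S H)"

definition quot_algebra ::
    "('r, 'k, 'x) graded_algebra_scheme \<Rightarrow> 'r set \<Rightarrow> ('r set, 'k) graded_algebra"
  where "quot_algebra S I =
    ring.extend (S Quot I)
      (graded_algebra.fields (\<lambda>j. (\<lambda>p. I +>\<^bsub>S\<^esub> p) ` rgrade S j) (\<lambda>c. I +>\<^bsub>S\<^esub> scalar S c))"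

definition irrelevant_ideal ::
    "nat \<Rightarrow> (nat \<Rightarrow> nat) \<Rightarrow> ((nat \<Rightarrow>\<^sub>0 nat) \<Rightarrow>\<^sub>0 'k::field) set \<Rightarrow> ((nat \<Rightarrow>\<^sub>0 nat) \<Rightarrow>\<^sub>0 'k) set set"
  where "irrelevant_ideal e d I =
    genideal (quot_algebra (poly_algebra e d) I) ((\<lambda>i. I +>\<^bsub>poly_algebra e d\<^esub> poly_var i) ` {..<e})"


section \<open>Tight embeddings\<close>

definition tight_embedding ::
    "('r, 'k, 'x) graded_algebra_scheme \<Rightarrow> 'r set \<Rightarrow> 'm set \<Rightarrow> ('r, 'm, 'y) graded_module_scheme \<Rightarrow> bool"
  where "tight_embedding R \<mm> M L \<longleftrightarrow>
    graded_module R L \<and> finitely_generated R L \<and> graded_submodule R M L \<and>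
    ideal_times R \<mm> L M \<subset> ideal_times R \<mm> L (carrier L) \<and>
    ideal_times R \<mm> L (carrier L) \<subseteq> M"


section \<open>Ext and Betti numbers\<close>

definition graded_free ::
    "('r, 'k, 'x) graded_algebra_scheme \<Rightarrow> ('r, 'm, 'y) graded_module_scheme \<Rightarrow> bool"
  where "graded_free R F \<longleftrightarrow> graded_module R F \<and>
    (\<exists>B \<subseteq> (\<Union>j. mgrade F j).
       \<not> LinearCombinations.module.lin_dep R F B \<and> LinearCombinations.module.span R F B = carrier F)"

text \<open>The graded complex \<open>\<cdots> \<rightarrow> F 2 \<rightarrow> F 1 \<rightarrow> F 0 \<rightarrow> M \<rightarrow> 0\<close>, where \<open>\<delta> i\<close> maps \<open>F (Suc i)\<close> to
  \<open>F i\<close>, is exact.\<close>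

definition free_resolution ::
    "('r, 'k, 'x) graded_algebra_scheme \<Rightarrow> ('r, 'm, 'y) graded_module_scheme \<Rightarrow>
     (nat \<Rightarrow> ('r, 'f) graded_module) \<Rightarrow> (nat \<Rightarrow> 'f \<Rightarrow> 'f) \<Rightarrow> ('f \<Rightarrow> 'm) \<Rightarrow> bool"
  where "free_resolution R M F \<delta> \<epsilon> \<longleftrightarrow>
    (\<forall>i. graded_free R (F i)) \<and>
    \<epsilon> \<in> module_hom R (F 0) M \<and> (\<forall>j. \<epsilon> ` mgrade (F 0) j \<subseteq> mgrade M j) \<and>
    (\<forall>i. \<delta> i \<in> module_hom R (F (Suc i)) (F i) \<and> (\<forall>j. \<delta> i ` mgrade (F (Suc i)) j \<subseteq> mgrade (F i) j)) \<and>
    \<epsilon> ` carrier (F 0) = carrier M \<and>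
    \<delta> 0 ` carrier (F 1) = {x \<in> carrier (F 0). \<epsilon> x = \<zero>\<^bsub>M\<^esub>} \<and>
    (\<forall>i. \<delta> (Suc i) ` carrier (F (Suc (Suc i))) = {x \<in> carrier (F (Suc i)). \<delta> i x = \<zero>\<^bsub>F i\<^esub>})"

text \<open>The homomorphisms \<open>F \<rightarrow> N\<close> that lower the internal degree by \<open>j\<close>, as a vector space. They are
  counted in internal degree \<open>j\<close>, so that a free module on one generator of degree \<open>j\<close>
  contributes to the maps into \<open>k\<close> exactly in degree \<open>j\<close>.\<close>

definition hom_space ::
    "('r, 'k, 'x) graded_algebra_scheme \<Rightarrow> ('r, 'f, 'y) graded_module_scheme \<Rightarrow>
     ('r, 'm, 'z) graded_module_scheme \<Rightarrow> int \<Rightarrow> ('k, 'f \<Rightarrow> 'm) module"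
  where "hom_space R F N j =
    \<lparr>carrier = {f \<in> module_hom R F N \<inter> extensional (carrier F).
                 \<forall>n. f ` mgrade F n \<subseteq> mgrade N (n - j)},
     monoid.mult = undefined, one = undefined,
     zero = (\<lambda>x\<in>carrier F. \<zero>\<^bsub>N\<^esub>),
     add = (\<lambda>f g. \<lambda>x\<in>carrier F. f x \<oplus>\<^bsub>N\<^esub> g x),
     module.smult = (\<lambda>c f. \<lambda>x\<in>carrier F. scalar R c \<odot>\<^bsub>N\<^esub> f x)\<rparr>"

definition cocycles ::
    "('r, 'k, 'x) graded_algebra_scheme \<Rightarrow> (nat \<Rightarrow> ('r, 'f) graded_module) \<Rightarrow> (nat \<Rightarrow> 'f \<Rightarrow> 'f) \<Rightarrow>
     ('r, 'm, 'z) graded_module_scheme \<Rightarrow> nat \<Rightarrow> int \<Rightarrow> ('f \<Rightarrow> 'm) set"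
  where "cocycles R F \<delta> N i j =
    {f \<in> carrier (hom_space R (F i) N j). \<forall>x\<in>carrier (F (Suc i)). f (\<delta> i x) = \<zero>\<^bsub>N\<^esub>}"

fun coboundaries ::
    "('r, 'k, 'x) graded_algebra_scheme \<Rightarrow> (nat \<Rightarrow> ('r, 'f) graded_module) \<Rightarrow> (nat \<Rightarrow> 'f \<Rightarrow> 'f) \<Rightarrow>
     ('r, 'm, 'z) graded_module_scheme \<Rightarrow> nat \<Rightarrow> int \<Rightarrow> ('f \<Rightarrow> 'm) set"
  where
    "coboundaries R F \<delta> N 0 j = {\<zero>\<^bsub>hom_space R (F 0) N j\<^esub>}"
  | "coboundaries R F \<delta> N (Suc i) j =
       (\<lambda>g. \<lambda>x\<in>carrier (F (Suc i)). g (\<delta> i x)) ` carrier (hom_space R (F i) N j)"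

definition cohomology ::
    "('r, 'k, 'x) graded_algebra_scheme \<Rightarrow> (nat \<Rightarrow> ('r, 'f) graded_module) \<Rightarrow> (nat \<Rightarrow> 'f \<Rightarrow> 'f) \<Rightarrow>
     ('r, 'm, 'z) graded_module_scheme \<Rightarrow> nat \<Rightarrow> int \<Rightarrow> ('k, ('f \<Rightarrow> 'm) set) module"
  where "cohomology R F \<delta> N i j =
    quot_module ((hom_space R (F i) N j)\<lparr>carrier := cocycles R F \<delta> N i j\<rparr>)
      (coboundaries R F \<delta> N i j)"

text \<open>Up to isomorphism Ext does not depend on the resolution, so one is picked by choice. The
  type \<open>nat \<Rightarrow> 'r\<close> accommodates free modules on countably many generators, hence a resolution of
  every finitely generated graded module over a quotient of a polynomial ring.\<close>

definition chosen_resolution ::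
    "('r, 'k, 'x) graded_algebra_scheme \<Rightarrow> ('r, 'm, 'y) graded_module_scheme \<Rightarrow>
     (nat \<Rightarrow> ('r, nat \<Rightarrow> 'r) graded_module) \<times> (nat \<Rightarrow> (nat \<Rightarrow> 'r) \<Rightarrow> (nat \<Rightarrow> 'r))"
  where "chosen_resolution R M = (SOME (F, \<delta>). \<exists>\<epsilon>. free_resolution R M F \<delta> \<epsilon>)"

definition Ext ::
    "('r, 'k, 'x) graded_algebra_scheme \<Rightarrow> nat \<Rightarrow> int \<Rightarrow> ('r, 'm, 'y) graded_module_scheme \<Rightarrow>
     ('r, 'n, 'z) graded_module_scheme \<Rightarrow> ('k, ((nat \<Rightarrow> 'r) \<Rightarrow> 'n) set) module"
  where "Ext R i j M N = (case chosen_resolution R M of (F, \<delta>) \<Rightarrow> cohomology R F \<delta> N i j)"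

definition betti ::
    "('r, 'k::field, 'x) graded_algebra_scheme \<Rightarrow> 'r set \<Rightarrow> ('r, 'm, 'y) graded_module_scheme \<Rightarrow>
     nat \<Rightarrow> int \<Rightarrow> nat"
  where "betti R \<mm> M i j =
    vectorspace.dim (class_ring :: 'k ring) (Ext R i j M (quot_graded_module (regular_module R) \<mm>))"


section \<open>Poincare series and Hilbert series\<close>

text \<open>Laurent polynomials in \<open>s\<close> over the integers embed into \<^typ>\<open>int fls\<close>, so series with
  coefficients in Laurent polynomials are rendered in \<^typ>\<open>int fls fps\<close>: the power series
  variable is \<open>t\<close>, the variable of the coefficients is \<open>s\<close>.\<close>

definition poincare_series ::
    "('r, 'k::field, 'x) graded_algebra_scheme \<Rightarrow> 'r set \<Rightarrow> ('r, 'm, 'y) graded_module_scheme \<Rightarrow>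
     int fls fps"
  where "poincare_series R \<mm> M = Abs_fps (\<lambda>i. Abs_fls (\<lambda>j. int (betti R \<mm> M i j)))"

definition graded_part ::
    "('r, 'k, 'x) graded_algebra_scheme \<Rightarrow> ('r, 'm, 'y) graded_module_scheme \<Rightarrow> int \<Rightarrow> ('k, 'm) module"
  where "graded_part R V j =
    \<lparr>carrier = mgrade V j, monoid.mult = undefined, one = undefined, zero = zero V, add = add V,
     module.smult = (\<lambda>c x. scalar R c \<odot>\<^bsub>V\<^esub> x)\<rparr>"

definition hilbert_series ::
    "('r, 'k::field, 'x) graded_algebra_scheme \<Rightarrow> ('r, 'm, 'y) graded_module_scheme \<Rightarrow> int fls"
  where "hilbert_series R V =
    Abs_fls (\<lambda>j. int (vectorspace.dim (class_ring :: 'k ring) (graded_part R V j)))"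

definition coeffwise_le :: "int fls fps \<Rightarrow> int fls fps \<Rightarrow> bool" (infix \<open>\<preceq>\<close> 50)
  where "A \<preceq> B \<longleftrightarrow> (\<forall>i j. fls_nth (fps_nth A i) j \<le> fls_nth (fps_nth B i) j)"

end

theory Submission
  imports Defs "HOL-Library.Nat_Bijection"
begin

text \<open>Write \<open>k\<close> for the residue field of \<open>R\<close> and \<open>x\<^sub>1, \<dots>, x\<^sub>e\<close> for the variables. The inequality
holds because \<open>V \<otimes> k\<close> is a retract, up to homotopy, of the mapping cone of
\<open>(x\<^sub>1, \<dots>, x\<^sub>e) : M\<^sup>e \<rightarrow> M\<close>. Let \<open>F\<close> be a free resolution of \<open>M\<close> and \<open>G\<close> one of \<open>k\<close>.

Into the cone: let \<open>v \<in> \<mm>L\<close> be homogeneous, \<open>v = \<Sum> x\<^sub>i l\<^sub>i\<close> with \<open>l\<^sub>i \<in> L\<close>. The map \<open>r \<mapsto> r v\<close> from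
\<open>R\<close> to \<open>M\<close> need not factor through \<open>k\<close>, but for \<open>r \<in> \<mm>\<close> one has \<open>r v = \<Sum> x\<^sub>i (r l\<^sub>i)\<close>, and
\<open>r l\<^sub>i \<in> \<mm>L \<subseteq> M\<close>. Thus its failure to factor through \<open>k\<close> is a combination of the variables with
values in \<open>M\<close>, and this is what is needed to lift it to a chain map from \<open>G\<close> to the cone of
\<open>(x\<^sub>1, \<dots>, x\<^sub>e) : F\<^sup>e \<rightarrow> F\<close>, given by maps \<open>\<phi>\<close> from \<open>G\<close> to \<open>F\<close> and \<open>\<phi>'\<^sub>i\<close> from \<open>G\<close>, one step up,
to \<open>F\<close> (lemma \<open>lifting_maps\<close>).

Out of the cone: a functional \<open>\<pi> : M \<rightarrow> k\<close> that kills \<open>\<mm>M\<close> lifts to a chain map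
\<open>\<psi> : F \<rightarrow> G\<close>. Since \<open>x\<^sub>i\<close> kills \<open>k\<close>, the chain map \<open>x\<^sub>i \<psi>\<close> has a null homotopy \<open>\<psi>'\<^sub>i\<close>, and \<open>\<psi>\<close> together
with the \<open>\<psi>'\<^sub>i\<close> is a chain map from the cone to \<open>G\<close> (lemma \<open>projection_maps\<close>).

The composite from \<open>G\<close> to \<open>G\<close> induces multiplication by \<open>\<pi>(v)\<close> on \<open>k\<close>, so it is homotopic to
\<open>\<pi>(v)\<close> times the identity (lemma \<open>retraction_homotopy\<close>). Now take for \<open>v\<close> and \<open>\<pi>\<close> dual systems for
the homogeneous parts of \<open>\<mm>L\<close> modulo \<open>\<mm>M\<close> (lemma \<open>tight_coordinates\<close>). After applying
\<open>Hom(-, k)\<close> the variables become zero, so the cohomology of the cone splits into the Ext spaces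
of \<open>M\<close>, and comparing dimensions (theorem \<open>retract_dim_inequality\<close>) gives
\<open>\<Sum>\<^sub>a dim V\<^sub>a \<beta>\<^sub>n\<^sub>,\<^sub>j\<^sub>-\<^sub>a(k) \<le> \<beta>\<^sub>n\<^sub>,\<^sub>j(M) + \<Sum>\<^sub>i \<beta>\<^sub>n\<^sub>-\<^sub>1\<^sub>,\<^sub>j\<^sub>-\<^sub>d\<^sub>i(M)\<close>. This is the asserted inequality with
\<open>1 + \<Sum>\<^sub>i s\<^sup>d\<^sup>i t\<close> in place of the product, whose remaining terms have nonnegative coefficients.

Betti numbers are defined through a resolution picked by choice, so it also has to be shown that a
resolution with values in the prescribed type exists (lemma \<open>locfin_resolution\<close>) and
that its cohomology is finite dimensional (lemma \<open>cohomology_finite\<close>). Both hold for graded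
modules that are bounded below with finite dimensional homogeneous parts, a class that is closed
under graded submodules, in contrast to finite generation, for which one would need the Hilbert basis
theorem.\<close>

section \<open>Linear algebra by means of functionals\<close>

text \<open>Eliminate one unknown and one equation at a time. All dimension comparisons below rest on this.\<close>

lemma homogeneous_system_solution:
  fixes M :: "'y \<Rightarrow> 'x \<Rightarrow> 'k::field"
  assumes "finite Y" "finite X" "card Y < card X"
  shows "\<exists>c. (\<exists>x\<in>X. c x \<noteq> 0) \<and> (\<forall>y\<in>Y. (\<Sum>x\<in>X. c x * M y x) = 0)"
  using assms
proof (induction Y arbitrary: X M rule: finite_induct)
  case empty
  then have "X \<noteq> {}" by auto
  then show ?case by (intro exI[of _ "\<lambda>_. 1"]) auto
next
  case (insert y Y)
  show ?case
  proof (cases "\<forall>x\<in>X. M y x = 0")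
    case True
    have "card Y < card X" using insert by simp
    from insert.IH[OF insert.prems(1) this, of M] obtain c where
      "\<exists>x\<in>X. c x \<noteq> 0" "\<forall>y\<in>Y. (\<Sum>x\<in>X. c x * M y x) = 0" by blast
    with True show ?thesis by (intro exI[of _ c]) auto
  next
    case False
    then obtain z where z: "z \<in> X" "M y z \<noteq> 0" by blast
    define X' where "X' = X - {z}"
    have X: "X = insert z X'" "z \<notin> X'" "finite X'" using z insert.prems by (auto simp: X'_def)
    define M' where "M' y' x = M y' x - M y' z * M y x / M y z" for y' x
    have "card Y < card X'" using insert X by simp
    from insert.IH[OF X(3) this, of M'] obtain c where c:
      "\<exists>x\<in>X'. c x \<noteq> 0" "\<And>y'. y' \<in> Y \<Longrightarrow> (\<Sum>x\<in>X'. c x * M' y' x) = 0" by blast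
    define c' where "c' = c(z := - (\<Sum>x\<in>X'. c x * M y x) / M y z)"
    have sum: "(\<Sum>x\<in>X'. c' x * f x) = (\<Sum>x\<in>X'. c x * f x)" for f
      using X by (intro sum.cong) (auto simp: c'_def)
    have cz: "c' z = - (\<Sum>x\<in>X'. c x * M y x) / M y z" by (simp add: c'_def)
    have "(\<Sum>x\<in>X. c' x * M y x) = 0"
      using X z sum cz by simp
    moreover have "(\<Sum>x\<in>X. c' x * M y' x) = 0" if "y' \<in> Y" for y'
    proof -
      have "(\<Sum>x\<in>X'. c x * M' y' x) = (\<Sum>x\<in>X'. c x * M y' x - (c x * M y x) * (M y' z / M y z))"
        by (intro sum.cong) (auto simp: M'_def algebra_simps)
      also have "\<dots> = (\<Sum>x\<in>X'. c x * M y' x) + c' z * M y' z"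
        by (simp add: sum_subtractf cz sum_divide_distrib sum_distrib_right)
      finally have "(\<Sum>x\<in>X'. c x * M y' x) + c' z * M y' z = 0" using c(2)[OF that] by simp
      then show ?thesis using X sum by (simp add: add.commute)
    qed
    moreover have "\<exists>x\<in>X. c' x \<noteq> 0" using c(1) X by (auto simp: c'_def)
    ultimately show ?thesis by (intro exI[of _ c']) auto
  qed
qed

text \<open>Finite dimensionality is handled through functionals rather than bases: functionals restrict to
subspaces and are composed with linear maps without any choices.\<close>

definition lin_functional :: "('k::field, 'h, 'y) module_scheme \<Rightarrow> ('h \<Rightarrow> 'k) \<Rightarrow> bool"
  where "lin_functional H \<kappa> \<longleftrightarrow>
    (\<forall>x\<in>carrier H. \<forall>y\<in>carrier H. \<kappa> (x \<oplus>\<^bsub>H\<^esub> y) = \<kappa> x + \<kappa> y) \<and>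
    (\<forall>c. \<forall>x\<in>carrier H. \<kappa> (c \<odot>\<^bsub>H\<^esub> x) = c * \<kappa> x)"

lemma lin_functionalD:
  assumes "lin_functional H \<kappa>"
  shows "x \<in> carrier H \<Longrightarrow> y \<in> carrier H \<Longrightarrow> \<kappa> (x \<oplus>\<^bsub>H\<^esub> y) = \<kappa> x + \<kappa> y"
    and "x \<in> carrier H \<Longrightarrow> \<kappa> (c \<odot>\<^bsub>H\<^esub> x) = c * \<kappa> x"
  using assms by (auto simp: lin_functional_def)

lemma lin_functional_zero:
  assumes "lin_functional H \<kappa>" "vectorspace (class_ring :: 'k::field ring) H"
  shows "\<kappa> \<zero>\<^bsub>H\<^esub> = 0"
proof -
  interpret vectorspace "class_ring :: 'k ring" H by fact
  have "\<kappa> (\<zero>\<^bsub>H\<^esub> \<oplus>\<^bsub>H\<^esub> \<zero>\<^bsub>H\<^esub>) = \<kappa> \<zero>\<^bsub>H\<^esub> + \<kappa> \<zero>\<^bsub>H\<^esub>" by (intro lin_functionalD[OF assms(1)]) auto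
  then show ?thesis by (metis M.r_zero M.zero_closed add_cancel_right_right)
qed

text \<open>A surjective linear map from a vector space to a structure not yet known to be a vector space;
the coset structures of the definitions are of this kind.\<close>

locale linear_quotient = H: vectorspace "class_ring :: 'k::field ring" H
  for H :: "('k::field, 'h, 'y) module_scheme" +
  fixes W :: "('k, 'w, 'z) module_scheme" and q :: "'h \<Rightarrow> 'w"
  assumes q_closed: "x \<in> carrier H \<Longrightarrow> q x \<in> carrier W"
    and q_surj: "w \<in> carrier W \<Longrightarrow> \<exists>x\<in>carrier H. q x = w"
    and q_add: "x \<in> carrier H \<Longrightarrow> y \<in> carrier H \<Longrightarrow> q (x \<oplus>\<^bsub>H\<^esub> y) = q x \<oplus>\<^bsub>W\<^esub> q y"
    and q_smult: "x \<in> carrier H \<Longrightarrow> q (c \<odot>\<^bsub>H\<^esub> x) = c \<odot>\<^bsub>W\<^esub> q x"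
    and q_zero: "q \<zero>\<^bsub>H\<^esub> = \<zero>\<^bsub>W\<^esub>"
begin

lemma vectorspace_W: "vectorspace (class_ring :: 'k ring) W"
proof (rule vs_criteria)
  show "field (class_ring :: 'k ring)" by (rule class_field)
  show "\<zero>\<^bsub>W\<^esub> \<in> carrier W" using q_closed[of "\<zero>\<^bsub>H\<^esub>"] q_zero by simp
  have lift: "\<exists>x. x \<in> carrier H \<and> w = q x" if "w \<in> carrier W" for w
    using q_surj[OF that] by blast
  note simps = q_add [symmetric] q_smult [symmetric] q_zero [symmetric] q_closed
  show "\<forall>v w. v \<in> carrier W \<and> w \<in> carrier W \<longrightarrow> v \<oplus>\<^bsub>W\<^esub> w \<in> carrier W"
  proof (intro allI impI, elim conjE)
    fix v w assume "v \<in> carrier W" "w \<in> carrier W"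
    then obtain x1 x2 where "x1 \<in> carrier H" "v = q x1" "x2 \<in> carrier H" "w = q x2"
      using lift by metis
    then show "v \<oplus>\<^bsub>W\<^esub> w \<in> carrier W" by (simp add: simps )
  qed
  show "\<forall>v\<in>carrier W. \<exists>u\<in>carrier W. v \<oplus>\<^bsub>W\<^esub> u = \<zero>\<^bsub>W\<^esub>"
  proof
    fix v assume "v \<in> carrier W"
    then obtain x where "x \<in> carrier H" "v = q x" using lift by blast
    then show "\<exists>u\<in>carrier W. v \<oplus>\<^bsub>W\<^esub> u = \<zero>\<^bsub>W\<^esub>"
      by (intro bexI[of _ "q (\<ominus>\<^bsub>H\<^esub> x)"]) (simp_all add: simps H.M.r_neg)
  qed
  show "\<forall>c v. c \<in> carrier class_ring \<and> v \<in> carrier W \<longrightarrow> c \<odot>\<^bsub>W\<^esub> v \<in> carrier W"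
  proof (intro allI impI, elim conjE)
    fix c v assume "v \<in> carrier W"
    then obtain x1 where "x1 \<in> carrier H" "v = q x1"
      using lift by metis
    then show "c \<odot>\<^bsub>W\<^esub> v \<in> carrier W" by (simp add: simps )
  qed
  show "\<forall>v w. v \<in> carrier W \<and> w \<in> carrier W \<longrightarrow> v \<oplus>\<^bsub>W\<^esub> w = w \<oplus>\<^bsub>W\<^esub> v"
  proof (intro allI impI, elim conjE)
    fix v w assume "v \<in> carrier W" "w \<in> carrier W"
    then obtain x1 x2 where "x1 \<in> carrier H" "v = q x1" "x2 \<in> carrier H" "w = q x2"
      using lift by metis
    then show "v \<oplus>\<^bsub>W\<^esub> w = w \<oplus>\<^bsub>W\<^esub> v" by (simp add: simps H.M.a_comm)
  qed
  show "\<forall>v w x. v \<in> carrier W \<and> w \<in> carrier W \<and> x \<in> carrier W \<longrightarrow>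
      v \<oplus>\<^bsub>W\<^esub> w \<oplus>\<^bsub>W\<^esub> x = v \<oplus>\<^bsub>W\<^esub> (w \<oplus>\<^bsub>W\<^esub> x)"
  proof (intro allI impI, elim conjE)
    fix v w x assume "v \<in> carrier W" "w \<in> carrier W" "x \<in> carrier W"
    then obtain x1 x2 x3 where "x1 \<in> carrier H" "v = q x1" "x2 \<in> carrier H" "w = q x2" "x3 \<in> carrier H" "x = q x3"
      using lift by metis
    then show "v \<oplus>\<^bsub>W\<^esub> w \<oplus>\<^bsub>W\<^esub> x = v \<oplus>\<^bsub>W\<^esub> (w \<oplus>\<^bsub>W\<^esub> x)" by (simp add: simps H.M.a_assoc)
  qed
  show "\<forall>v\<in>carrier W. v \<oplus>\<^bsub>W\<^esub> \<zero>\<^bsub>W\<^esub> = v"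
  proof (intro ballI)
    fix v assume "v \<in> carrier W"
    then obtain x1 where "x1 \<in> carrier H" "v = q x1"
      using lift by metis
    then show "v \<oplus>\<^bsub>W\<^esub> \<zero>\<^bsub>W\<^esub> = v" by (simp add: simps )
  qed
  show "\<forall>a b v. a \<in> carrier class_ring \<and> b \<in> carrier class_ring \<and> v \<in> carrier W \<longrightarrow>
      a \<otimes>\<^bsub>class_ring\<^esub> b \<odot>\<^bsub>W\<^esub> v = a \<odot>\<^bsub>W\<^esub> (b \<odot>\<^bsub>W\<^esub> v)"
  proof (intro allI impI, elim conjE)
    fix a b v assume "v \<in> carrier W"
    then obtain x1 where "x1 \<in> carrier H" "v = q x1"
      using lift by metis
    then show "a \<otimes>\<^bsub>class_ring\<^esub> b \<odot>\<^bsub>W\<^esub> v = a \<odot>\<^bsub>W\<^esub> (b \<odot>\<^bsub>W\<^esub> v)" using H.smult_assoc1[of a b x1] by (simp add: simps )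
  qed
  show "\<forall>v\<in>carrier W. \<one>\<^bsub>class_ring\<^esub> \<odot>\<^bsub>W\<^esub> v = v"
  proof (intro ballI)
    fix v assume "v \<in> carrier W"
    then obtain x1 where "x1 \<in> carrier H" "v = q x1"
      using lift by metis
    then show "\<one>\<^bsub>class_ring\<^esub> \<odot>\<^bsub>W\<^esub> v = v" using H.smult_one[of x1] by (simp add: simps )
  qed
  show "\<forall>a b v. a \<in> carrier class_ring \<and> b \<in> carrier class_ring \<and> v \<in> carrier W \<longrightarrow>
      (a \<oplus>\<^bsub>class_ring\<^esub> b) \<odot>\<^bsub>W\<^esub> v = a \<odot>\<^bsub>W\<^esub> v \<oplus>\<^bsub>W\<^esub> b \<odot>\<^bsub>W\<^esub> v"
  proof (intro allI impI, elim conjE)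
    fix a b v assume "v \<in> carrier W"
    then obtain x1 where "x1 \<in> carrier H" "v = q x1"
      using lift by metis
    then show "(a \<oplus>\<^bsub>class_ring\<^esub> b) \<odot>\<^bsub>W\<^esub> v = a \<odot>\<^bsub>W\<^esub> v \<oplus>\<^bsub>W\<^esub> b \<odot>\<^bsub>W\<^esub> v" using H.smult_l_distr[of a b x1] by (simp add: simps )
  qed
  show "\<forall>a v w. a \<in> carrier class_ring \<and> v \<in> carrier W \<and> w \<in> carrier W \<longrightarrow>
      a \<odot>\<^bsub>W\<^esub> (v \<oplus>\<^bsub>W\<^esub> w) = a \<odot>\<^bsub>W\<^esub> v \<oplus>\<^bsub>W\<^esub> a \<odot>\<^bsub>W\<^esub> w"
  proof (intro allI impI, elim conjE)
    fix a v w assume "v \<in> carrier W" "w \<in> carrier W"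
    then obtain x1 x2 where "x1 \<in> carrier H" "v = q x1" "x2 \<in> carrier H" "w = q x2"
      using lift by metis
    then show "a \<odot>\<^bsub>W\<^esub> (v \<oplus>\<^bsub>W\<^esub> w) = a \<odot>\<^bsub>W\<^esub> v \<oplus>\<^bsub>W\<^esub> a \<odot>\<^bsub>W\<^esub> w" using H.smult_r_distr[of a x1 x2] by (simp add: simps )
  qed
qed

text \<open>If \<open>m\<close> functionals detect whether \<open>q x\<close> is nonzero, any \<open>m + 1\<close> elements of the image satisfy a
linear relation: solve the homogeneous system for the values of the functionals on preimages.\<close>

lemma fin_dim_functionals:
  assumes lin: "\<And>i. i < m \<Longrightarrow> lin_functional H (\<kappa> i)"
    and ker: "\<And>x. x \<in> carrier H \<Longrightarrow> (\<And>i. i < m \<Longrightarrow> \<kappa> i x = 0) \<Longrightarrow> q x = \<zero>\<^bsub>W\<^esub>"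
  shows "vectorspace.fin_dim (class_ring :: 'k ring) W" "vectorspace.dim (class_ring :: 'k ring) W \<le> m"
proof -
  note q = q_closed q_surj q_add q_smult
  note vsH = H.vectorspace_axioms
  interpret W: vectorspace "class_ring :: 'k ring" W by (fact vectorspace_W)
  define r where "r w = (SOME x. x \<in> carrier H \<and> q x = w)" for w
  have r: "r w \<in> carrier H" "q (r w) = w" if "w \<in> carrier W" for w
    using someI_ex[of "\<lambda>x. x \<in> carrier H \<and> q x = w"] q(2)[OF that] unfolding r_def by blast+
  have bound: "finite A \<and> card A \<le> m" if A: "A \<subseteq> carrier W \<and> W.lin_indpt A" for A
  proof (rule ccontr)
    assume no: "\<not> (finite A \<and> card A \<le> m)"
    have "\<exists>A'\<subseteq>A. finite A' \<and> card A' = Suc m"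
    proof (cases "finite A")
      case True
      with no have "Suc m \<le> card A" by simp
      then show ?thesis using obtain_subset_with_card_n[of "Suc m" A] by (metis True finite_subset)
    next
      case False
      then show ?thesis using infinite_arbitrarily_large[OF False, of "Suc m"] by blast
    qed
    then obtain A' where A': "A' \<subseteq> A" "finite A'" "card A' = Suc m" by blast
    obtain c where c: "\<exists>x\<in>A'. c x \<noteq> 0" "\<forall>i\<in>{..<m}. (\<Sum>x\<in>A'. c x * \<kappa> i (r x)) = 0"
      using homogeneous_system_solution[of "{..<m}" A' "\<lambda>i x. \<kappa> i (r x)"] A' by auto
    define h where "h = (\<Oplus>\<^bsub>H\<^esub>x\<in>A'. c x \<odot>\<^bsub>H\<^esub> r x)"
    have A'W: "A' \<subseteq> carrier W" using A A' by auto
    have rH: "(\<lambda>x. c x \<odot>\<^bsub>H\<^esub> r x) \<in> A' \<rightarrow> carrier H" using r A'W by (auto intro!: H.smult_closed)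
    then have hH: "h \<in> carrier H" unfolding h_def by (intro H.finsum_closed) auto
    have kap: "\<kappa> i (\<Oplus>\<^bsub>H\<^esub>x\<in>B. c x \<odot>\<^bsub>H\<^esub> r x) = (\<Sum>x\<in>B. c x * \<kappa> i (r x))" if "finite B" "B \<subseteq> A'" "i < m" for B i
      using that
    proof (induction B rule: finite_induct)
      case empty
      then show ?case using lin_functional_zero[OF lin vsH] by simp
    next
      case (insert x F)
      have "(\<Oplus>\<^bsub>H\<^esub>x\<in>F. c x \<odot>\<^bsub>H\<^esub> r x) \<in> carrier H"
        using insert rH by (intro H.finsum_closed) auto
      moreover have "c x \<odot>\<^bsub>H\<^esub> r x \<in> carrier H" "r x \<in> carrier H" using insert rH r A'W by auto
      moreover have "(\<lambda>x. c x \<odot>\<^bsub>H\<^esub> r x) \<in> F \<rightarrow> carrier H" using insert rH by auto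
      ultimately show ?case using insert lin_functionalD[OF lin, of i] by simp
    qed
    have "q h = \<zero>\<^bsub>W\<^esub>"
      using ker[OF hH] kap[OF A'(2)] c(2) by (auto simp: h_def)
    moreover have "q h = W.lincomb c A'"
    proof -
      have "q h = (\<Oplus>\<^bsub>W\<^esub>x\<in>A'. q (c x \<odot>\<^bsub>H\<^esub> r x))" unfolding h_def
        using A'(2) rH
      proof (induction A' rule: finite_induct)
        case empty
        then show ?case using q_zero by simp
      next
        case (insert x F)
        then have 1: "(\<lambda>x. c x \<odot>\<^bsub>H\<^esub> r x) \<in> F \<rightarrow> carrier H" "c x \<odot>\<^bsub>H\<^esub> r x \<in> carrier H" by auto
        then have 2: "(\<lambda>x. q (c x \<odot>\<^bsub>H\<^esub> r x)) \<in> F \<rightarrow> carrier W" using q(1) by (simp add: Pi_def)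
        show ?case using insert 1 2 q(1,3) by (simp)
      qed
      also have "\<dots> = W.lincomb c A'" unfolding W.lincomb_def
      proof (rule W.finsum_cong')
        show "(\<lambda>v. c v \<odot>\<^bsub>W\<^esub> v) \<in> A' \<rightarrow> carrier W" using A'W by (auto intro!: W.smult_closed)
        show "q (c i \<odot>\<^bsub>H\<^esub> r i) = c i \<odot>\<^bsub>W\<^esub> i" if "i \<in> A'" for i
          using q(4)[OF r(1), of i "c i"] r(2)[of i] that A'W by auto
      qed simp
      finally show ?thesis .
    qed
    ultimately have "W.lin_dep A"
      using A' c(1) W.lin_dep_crit[of A' A c] by auto
    with A show False by blast
  qed
  have "\<exists>A. finite A \<and> maximal A (\<lambda>S. S \<subseteq> carrier W \<and> W.lin_indpt S)"
  proof (rule maximal_exists)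
    show "{} \<subseteq> carrier W \<and> W.lin_indpt {}" by (auto simp: W.lin_dep_def)
  qed (use bound in auto)
  then obtain A where A: "finite A" "maximal A (\<lambda>S. S \<subseteq> carrier W \<and> W.lin_indpt S)" by blast
  then have basis: "W.basis A" by (intro W.max_li_is_basis)
  then show "W.fin_dim" using A(1) by (auto simp: W.fin_dim_def W.basis_def)
  from W.dim_basis[OF A(1) basis] show "W.dim \<le> m"
    using bound[of A] A(2) by (simp add: maximal_def)
qed

end

lemma coordinates:
  assumes vs: "vectorspace (class_ring :: 'k::field ring) W"
    and fd: "vectorspace.fin_dim (class_ring :: 'k ring) W"
  shows "\<exists>b \<kappa>. (\<forall>i<vectorspace.dim (class_ring :: 'k ring) W. b i \<in> carrier W \<and> lin_functional W (\<kappa> i)) \<and>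
    (\<forall>i<vectorspace.dim (class_ring :: 'k ring) W. \<forall>j<vectorspace.dim (class_ring :: 'k ring) W. \<kappa> i (b j) = of_bool (i = j)) \<and>
    (\<forall>w\<in>carrier W. (\<forall>i<vectorspace.dim (class_ring :: 'k ring) W. \<kappa> i w = 0) \<longrightarrow> w = \<zero>\<^bsub>W\<^esub>)"
proof -
  interpret W: vectorspace "class_ring :: 'k ring" W by fact
  obtain B where B: "finite B" "W.basis B" using W.finite_basis_exists[OF fd] by blast
  have card: "W.dim = card B" using W.dim_basis[OF B] .
  have BW: "B \<subseteq> carrier W" using B(2) by (auto simp: W.basis_def)
  have crit: "\<exists>!a. a \<in> B \<rightarrow>\<^sub>E UNIV \<and> W.lincomb a B = w" if "w \<in> carrier W" for w
    using W.basis_criterion[OF B(1) BW] B(2) that by simp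
  define co where "co w = (THE a. a \<in> B \<rightarrow>\<^sub>E UNIV \<and> W.lincomb a B = w)" for w
  have co: "co w \<in> B \<rightarrow>\<^sub>E UNIV" "W.lincomb (co w) B = w" if "w \<in> carrier W" for w
    using theI'[OF crit[OF that]] unfolding co_def by auto
  have uniq: "co (W.lincomb a B) x = a x" if "x \<in> B" for a x
  proof -
    have "W.lincomb a B \<in> carrier W" using BW by (intro W.lincomb_closed) auto
    moreover have "W.lincomb (restrict a B) B = W.lincomb a B"
      using BW by (intro W.lincomb_cong) auto
    ultimately have "co (W.lincomb a B) = restrict a B"
      using crit[of "W.lincomb a B"] co[of "W.lincomb a B"] by (smt (verit, best) UNIV_I restrict_PiE_iff)
    then show ?thesis using that by simp
  qed
  obtain b where b: "bij_betw b {..<card B} B" using ex_bij_betw_nat_finite[OF B(1)] by (auto simp: atLeast0LessThan)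
  have bB: "b i \<in> B" if "i < card B" for i using b that by (auto simp: bij_betw_def)
  have lin: "lin_functional W (\<lambda>w. co w x)" if x: "x \<in> B" for x
    unfolding lin_functional_def
  proof (intro conjI ballI allI)
    fix v w assume vw: "v \<in> carrier W" "w \<in> carrier W"
    have "v \<oplus>\<^bsub>W\<^esub> w = W.lincomb (co v) B \<oplus>\<^bsub>W\<^esub> W.lincomb (co w) B" using co(2) vw by simp
    also have "\<dots> = W.lincomb (\<lambda>x. co v x + co w x) B"
      using W.lincomb_sum[OF B(1) BW, of "co v" "co w"] by simp
    finally show "co (v \<oplus>\<^bsub>W\<^esub> w) x = co v x + co w x" using uniq x by simp
  next
    fix c w assume w: "w \<in> carrier W"
    have "c \<odot>\<^bsub>W\<^esub> w = W.lincomb (\<lambda>x. c * co w x) B"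
      using W.lincomb_smult[OF BW, of "co w" c] co(2)[OF w] by simp
    then show "co (c \<odot>\<^bsub>W\<^esub> w) x = c * co w x" using uniq x by simp
  qed
  have delta: "co (b j) (b i) = of_bool (i = j)" if ij: "i < card B" "j < card B" for i j
  proof -
    have "W.lincomb (\<lambda>x. of_bool (x = b j)) B = b j"
    proof -
      have "W.lincomb (\<lambda>x. of_bool (x = b j)) B = (\<Oplus>\<^bsub>W\<^esub>x\<in>B. if b j = x then x else \<zero>\<^bsub>W\<^esub>)"
        unfolding W.lincomb_def
        using BW W.smult_one W.smult_l_null by (intro W.finsum_cong') (auto)
      also have "\<dots> = b j" using W.finsum_singleton[OF bB[OF ij(2)] B(1), of "\<lambda>x. x"] BW by auto
      finally show ?thesis .
    qed
    then have "co (b j) (b i) = of_bool (b i = b j)" using uniq[OF bB[OF ij(1)]] by metis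
    moreover have "b i = b j \<longleftrightarrow> i = j" using b ij by (auto simp: bij_betw_def inj_on_def)
    ultimately show ?thesis by simp
  qed
  have zero: "w = \<zero>\<^bsub>W\<^esub>" if w: "w \<in> carrier W" "\<forall>i<card B. co w (b i) = 0" for w
  proof -
    have 0: "co w x = 0" if "x \<in> B" for x
    proof -
      obtain i where "i < card B" "x = b i" using b \<open>x \<in> B\<close> by (auto simp: bij_betw_def)
      with w(2) show ?thesis by simp
    qed
    have "w = W.lincomb (co w) B" using co w by simp
    also have "\<dots> = \<zero>\<^bsub>W\<^esub>" unfolding W.lincomb_def
      using BW 0 W.smult_l_null by (intro W.finsum_all0) auto
    finally show ?thesis .
  qed
  show ?thesis unfolding card
  proof (intro exI[of _ b] exI[of _ "\<lambda>i w. co w (b i)"] conjI allI ballI impI)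
    fix i assume i: "i < card B"
    show "b i \<in> carrier W" using bB[OF i] BW by blast
    show "lin_functional W (\<lambda>w. co w (b i))" using lin[OF bB[OF i]] .
    show "co (b j) (b i) = of_bool (i = j)" if "j < card B" for j using delta[OF i that] .
  next
    fix w assume "w \<in> carrier W" "\<forall>i<card B. co w (b i) = 0"
    then show "w = \<zero>\<^bsub>W\<^esub>" by (rule zero)
  qed
qed

lemma (in linear_quotient) dual_basis:
  fixes m :: nat
  assumes lin: "\<And>i. i < m \<Longrightarrow> lin_functional H (\<kappa> i)"
    and ker: "\<And>x. x \<in> carrier H \<Longrightarrow> (\<And>i. i < m \<Longrightarrow> \<kappa> i x = 0) \<Longrightarrow> q x = \<zero>\<^bsub>W\<^esub>"
  obtains b \<kappa>' where
    "\<And>i. i < vectorspace.dim (class_ring :: 'k ring) W \<Longrightarrow> b i \<in> carrier H"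
    "\<And>i. i < vectorspace.dim (class_ring :: 'k ring) W \<Longrightarrow> lin_functional H (\<kappa>' i)"
    "\<And>i x. i < vectorspace.dim (class_ring :: 'k ring) W \<Longrightarrow> x \<in> carrier H \<Longrightarrow> q x = \<zero>\<^bsub>W\<^esub> \<Longrightarrow> \<kappa>' i x = 0"
    "\<And>i j. i < vectorspace.dim (class_ring :: 'k ring) W \<Longrightarrow> j < vectorspace.dim (class_ring :: 'k ring) W
       \<Longrightarrow> \<kappa>' i (b j) = of_bool (i = j)"
    "\<And>x. x \<in> carrier H \<Longrightarrow> (\<And>i. i < vectorspace.dim (class_ring :: 'k ring) W \<Longrightarrow> \<kappa>' i x = 0) \<Longrightarrow> q x = \<zero>\<^bsub>W\<^esub>"
proof -
  let ?D = "vectorspace.dim (class_ring :: 'k ring) W"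
  have "vectorspace.fin_dim (class_ring :: 'k ring) W"
    by (rule fin_dim_functionals(1)[of m \<kappa>]; use lin ker in blast)
  from coordinates[OF vectorspace_W this] obtain b \<kappa>' where c:
    "\<forall>i<?D. b i \<in> carrier W \<and> lin_functional W (\<kappa>' i)"
    "\<forall>i<?D. \<forall>j<?D. \<kappa>' i (b j) = of_bool (i = j)"
    "\<forall>w\<in>carrier W. (\<forall>i<?D. \<kappa>' i w = 0) \<longrightarrow> w = \<zero>\<^bsub>W\<^esub>"
    by (elim exE conjE)
  have b: "\<And>i. i < ?D \<Longrightarrow> b i \<in> carrier W" "\<And>i. i < ?D \<Longrightarrow> lin_functional W (\<kappa>' i)"
    "\<And>i j. i < ?D \<Longrightarrow> j < ?D \<Longrightarrow> \<kappa>' i (b j) = of_bool (i = j)"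
    "\<And>w. w \<in> carrier W \<Longrightarrow> (\<And>i. i < ?D \<Longrightarrow> \<kappa>' i w = 0) \<Longrightarrow> w = \<zero>\<^bsub>W\<^esub>"
    using c by blast+
  have "\<forall>i. \<exists>x. i < ?D \<longrightarrow> x \<in> carrier H \<and> q x = b i" using b(1) q_surj by blast
  then obtain b' where b': "\<And>i. i < ?D \<Longrightarrow> b' i \<in> carrier H \<and> q (b' i) = b i" by metis
  show ?thesis
  proof (rule that[of b' "\<lambda>i x. \<kappa>' i (q x)"])
    fix i assume i: "i < ?D"
    show "b' i \<in> carrier H" using b' i by blast
    show "lin_functional H (\<lambda>x. \<kappa>' i (q x))"
      using lin_functionalD[OF b(2)[OF i]] unfolding lin_functional_def by (auto simp: q_add q_smult q_closed)
    show "\<kappa>' i (q x) = 0" if "x \<in> carrier H" "q x = \<zero>\<^bsub>W\<^esub>" for x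
      using lin_functional_zero[OF b(2)[OF i] vectorspace_W] that by simp
    show "\<kappa>' i (q (b' j)) = of_bool (i = j)" if "j < ?D" for j using b' b(3) i that by simp
  next
    fix x assume "x \<in> carrier H" "\<And>i. i < ?D \<Longrightarrow> \<kappa>' i (q x) = 0"
    then show "q x = \<zero>\<^bsub>W\<^esub>" using b(4) q_closed by blast
  qed
qed

lemma lin_functional_combination:
  fixes H :: "('k::field, 'h, 'y) module_scheme"
  assumes "lin_functional H \<kappa>" "finite S" "\<And>s. s \<in> S \<Longrightarrow> lin_functional H (\<pi> s)"
  shows "lin_functional H (\<lambda>x. a * (\<kappa> x - (\<Sum>s\<in>S. c s * \<pi> s x)))"
  unfolding lin_functional_def
proof (intro conjI ballI allI)
  fix x y assume xy: "x \<in> carrier H" "y \<in> carrier H"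
  have "(\<Sum>s\<in>S. c s * \<pi> s (x \<oplus>\<^bsub>H\<^esub> y)) = (\<Sum>s\<in>S. c s * \<pi> s x) + (\<Sum>s\<in>S. c s * \<pi> s y)"
    using xy by (simp add: lin_functionalD(1)[OF assms(3)] ring_distribs sum.distrib)
  then show "a * (\<kappa> (x \<oplus>\<^bsub>H\<^esub> y) - (\<Sum>s\<in>S. c s * \<pi> s (x \<oplus>\<^bsub>H\<^esub> y))) =
      a * (\<kappa> x - (\<Sum>s\<in>S. c s * \<pi> s x)) + a * (\<kappa> y - (\<Sum>s\<in>S. c s * \<pi> s y))"
    using xy by (simp add: lin_functionalD(1)[OF assms(1)] algebra_simps)
next
  fix d x assume x: "x \<in> carrier H"
  have "(\<Sum>s\<in>S. c s * \<pi> s (d \<odot>\<^bsub>H\<^esub> x)) = d * (\<Sum>s\<in>S. c s * \<pi> s x)"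
    using x by (simp add: lin_functionalD(2)[OF assms(3)] sum_distrib_left mult.left_commute)
  then show "a * (\<kappa> (d \<odot>\<^bsub>H\<^esub> x) - (\<Sum>s\<in>S. c s * \<pi> s (d \<odot>\<^bsub>H\<^esub> x))) = d * (a * (\<kappa> x - (\<Sum>s\<in>S. c s * \<pi> s x)))"
    using x by (simp add: lin_functionalD(2)[OF assms(1)] algebra_simps)
qed

text \<open>Elements of \<open>Z\<close> and functionals on all of \<open>H\<close> that are dual to each other and see as much of \<open>Z\<close>
as the given functionals do. They are found one by one, by Gaussian elimination: if some given functional
does not vanish on a vector of \<open>Z\<close> that is killed by the functionals found so far, correct and
rescale it. Applied with functionals that define \<open>\<mm>M\<close>, this yields a basis of \<open>\<mm>L / \<mm>M\<close> together with
coordinates that extend to \<open>M\<close>.\<close>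

lemma dual_system_on_subspace:
  fixes H :: "('k::field, 'h, 'y) module_scheme" and N :: nat
  assumes vs: "vectorspace (class_ring :: 'k ring) H"
    and Z: "Z \<subseteq> carrier H" "\<And>x y. x \<in> Z \<Longrightarrow> y \<in> Z \<Longrightarrow> x \<oplus>\<^bsub>H\<^esub> y \<in> Z"
      "\<And>c x. x \<in> Z \<Longrightarrow> c \<odot>\<^bsub>H\<^esub> x \<in> Z"
    and lin: "\<And>i. i < N \<Longrightarrow> lin_functional H (\<kappa> i)"
  shows "\<exists>(m::nat) v \<pi>. (\<forall>s<m. v s \<in> Z \<and> lin_functional H (\<pi> s) \<and>
       (\<forall>x\<in>carrier H. (\<forall>i<N. \<kappa> i x = 0) \<longrightarrow> \<pi> s x = 0)) \<and>
     (\<forall>s<m. \<forall>t<m. \<pi> s (v t) = of_bool (s = t)) \<and>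
     (\<forall>z\<in>Z. (\<forall>s<m. \<pi> s z = 0) \<longrightarrow> (\<forall>i<N. \<kappa> i z = 0))"
  using lin
proof (induction N)
  case 0
  show ?case by (intro exI[of _ "0::nat"]) auto
next
  case (Suc N)
  interpret vectorspace "class_ring :: 'k ring" H by (fact vs)
  from Suc.IH[OF Suc.prems] obtain m :: nat and v \<pi> where IH: "(\<forall>s<m. v s \<in> Z \<and> lin_functional H (\<pi> s) \<and>
       (\<forall>x\<in>carrier H. (\<forall>i<N. \<kappa> i x = 0) \<longrightarrow> \<pi> s x = 0))"
     "(\<forall>s<m. \<forall>t<m. \<pi> s (v t) = of_bool (s = t))"
     "(\<forall>z\<in>Z. (\<forall>s<m. \<pi> s z = 0) \<longrightarrow> (\<forall>i<N. \<kappa> i z = 0))"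
    by fastforce
  have 1: "\<And>s. s < m \<Longrightarrow> v s \<in> Z" "\<And>s. s < m \<Longrightarrow> lin_functional H (\<pi> s)"
      "\<And>s x. s < m \<Longrightarrow> x \<in> carrier H \<Longrightarrow> (\<And>i. i < N \<Longrightarrow> \<kappa> i x = 0) \<Longrightarrow> \<pi> s x = 0"
    using IH(1) by blast+
  have 2: "\<And>s t. s < m \<Longrightarrow> t < m \<Longrightarrow> \<pi> s (v t) = of_bool (s = t)" using IH(2) by blast
  have 3: "\<And>z i. z \<in> Z \<Longrightarrow> (\<And>s. s < m \<Longrightarrow> \<pi> s z = 0) \<Longrightarrow> i < N \<Longrightarrow> \<kappa> i z = 0"
    using IH(3) by blast
  show ?case
  proof (cases "\<forall>z\<in>Z. (\<forall>s<m. \<pi> s z = 0) \<longrightarrow> \<kappa> N z = 0")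
    case True
    show ?thesis
    proof (intro exI[of _ m] exI[of _ v] exI[of _ \<pi>] conjI ballI allI impI)
      fix z i assume z: "z \<in> Z" "\<forall>s<m. \<pi> s z = 0" "i < Suc N"
      show "\<kappa> i z = 0"
      proof (cases "i = N")
        case True
        with \<open>\<forall>z\<in>Z. (\<forall>s<m. \<pi> s z = 0) \<longrightarrow> \<kappa> N z = 0\<close> z show ?thesis by blast
      next
        case False
        with z 3[of z i] show ?thesis by auto
      qed
    next
      fix s x assume "s < m" "x \<in> carrier H" "\<forall>i<Suc N. \<kappa> i x = 0"
      then show "\<pi> s x = 0" by (intro 1(3)) auto
    qed (use 1 2 in auto)
  next
    case False
    then obtain z where z: "z \<in> Z" "\<And>s. s < m \<Longrightarrow> \<pi> s z = 0" "\<kappa> N z \<noteq> 0" by blast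
    define \<pi>N where "\<pi>N x = inverse (\<kappa> N z) * (\<kappa> N x - (\<Sum>s<m. \<kappa> N (v s) * \<pi> s x))" for x
    have lN: "lin_functional H \<pi>N" unfolding \<pi>N_def
      by (rule lin_functional_combination) (use Suc.prems 1 in auto)
    have vz: "\<pi>N (v t) = 0" if "t < m" for t
    proof -
      have "(\<Sum>s<m. \<kappa> N (v s) * \<pi> s (v t)) = (\<Sum>s<m. if t = s then \<kappa> N (v s) else 0)"
        using 2 that by (intro sum.cong) auto
      also have "\<dots> = \<kappa> N (v t)" using that by simp
      finally show ?thesis by (simp add: \<pi>N_def)
    qed
    have zz: "\<pi>N z = 1" using z by (simp add: \<pi>N_def)
    have ker: "\<kappa> N y = 0" if "\<And>s. s < m \<Longrightarrow> \<pi> s y = 0" "\<pi>N y = 0" for y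
      using that z(3) by (simp add: \<pi>N_def)
    have kN: "\<pi>N x = 0" if "x \<in> carrier H" "\<And>i. i < Suc N \<Longrightarrow> \<kappa> i x = 0" for x
      using that 1(3)[of _ x] by (simp add: \<pi>N_def)
    show ?thesis
    proof (intro exI[of _ "Suc m"] exI[of _ "v(m := z)"] exI[of _ "\<pi>(m := \<pi>N)"] conjI ballI allI impI)
      fix s assume "s < Suc m"
      then show "(v(m := z)) s \<in> Z" using 1 z by (auto simp: less_Suc_eq)
      show "lin_functional H ((\<pi>(m := \<pi>N)) s)" using \<open>s < Suc m\<close> 1 lN by (auto simp: less_Suc_eq)
      show "(\<pi>(m := \<pi>N)) s x = 0" if "x \<in> carrier H" "\<forall>i<Suc N. \<kappa> i x = 0" for x
      proof (cases "s = m")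
        case True
        with kN[OF that(1)] that(2) show ?thesis by simp
      next
        case False
        with 1(3)[of s x] \<open>s < Suc m\<close> that show ?thesis by auto
      qed
      show "(\<pi>(m := \<pi>N)) s ((v(m := z)) t) = of_bool (s = t)" if "t < Suc m" for t
        using that \<open>s < Suc m\<close> 2 z vz zz by (auto simp: less_Suc_eq)
    next
      fix y i assume y: "y \<in> Z" "\<forall>s<Suc m. (\<pi>(m := \<pi>N)) s y = 0" "i < Suc N"
      have *: "\<pi> s y = 0" if "s < m" for s using y(2) that by (auto dest: spec[of _ s])
      have "\<pi>N y = 0" using y(2) by (auto dest: spec[of _ m])
      then show "\<kappa> i y = 0" using ker[OF *] 3[OF y(1) *] y(3) by (auto simp: less_Suc_eq)
    qed
  qed
qed

section \<open>Homogeneous components and graded homomorphisms\<close>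

text \<open>The homogeneous component of degree \<open>j\<close>, by the uniqueness of the decomposition.\<close>

definition gcomp :: "('r, 'm, 'y) graded_module_scheme \<Rightarrow> int \<Rightarrow> 'm \<Rightarrow> 'm"
  where "gcomp M j x = (THE c. (\<forall>j. c j \<in> mgrade M j) \<and> finite {j. c j \<noteq> \<zero>\<^bsub>M\<^esub>} \<and>
           x = (\<Oplus>\<^bsub>M\<^esub>j\<in>{j. c j \<noteq> \<zero>\<^bsub>M\<^esub>}. c j)) j"

context graded_module
begin

lemma mgrade_carrier: "x \<in> mgrade M j \<Longrightarrow> x \<in> carrier M"
  using subgroup.subset[OF mgrade_subgroup] by auto

lemma mgrade_zero [simp]: "\<zero>\<^bsub>M\<^esub> \<in> mgrade M j"
  using subgroup.one_closed[OF mgrade_subgroup] by simp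

lemma mgrade_add: "x \<in> mgrade M j \<Longrightarrow> y \<in> mgrade M j \<Longrightarrow> x \<oplus>\<^bsub>M\<^esub> y \<in> mgrade M j"
  using subgroup.m_closed[OF mgrade_subgroup] by simp

lemma mgrade_uminus: "x \<in> mgrade M j \<Longrightarrow> \<ominus>\<^bsub>M\<^esub> x \<in> mgrade M j"
  using subgroup.m_inv_closed[OF mgrade_subgroup] by (simp add: a_inv_def)

lemma mgrade_finsum: "(\<And>i. i \<in> S \<Longrightarrow> f i \<in> mgrade M j) \<Longrightarrow> (\<Oplus>\<^bsub>M\<^esub>i\<in>S. f i) \<in> mgrade M j"
proof (induction S rule: infinite_finite_induct)
  case (insert x F)
  then have "f \<in> F \<rightarrow> carrier M" "f x \<in> carrier M" using mgrade_carrier by auto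
  with insert show ?case by (simp add: mgrade_add)
qed auto

lemma gcomp_spec:
  assumes "x \<in> carrier M"
  shows "gcomp M j x \<in> mgrade M j" "finite {j. gcomp M j x \<noteq> \<zero>\<^bsub>M\<^esub>}"
    "x = (\<Oplus>\<^bsub>M\<^esub>j\<in>{j. gcomp M j x \<noteq> \<zero>\<^bsub>M\<^esub>}. gcomp M j x)"
  using theI'[OF mgrade_decomp[OF assms]] unfolding gcomp_def by auto

lemma gcomp_carrier [simp]: "x \<in> carrier M \<Longrightarrow> gcomp M j x \<in> carrier M"
  using gcomp_spec(1) mgrade_carrier by blast

lemma gcomp_unique:
  assumes "finite S" "\<And>j. c j \<in> mgrade M j" "\<And>j. j \<notin> S \<Longrightarrow> c j = \<zero>\<^bsub>M\<^esub>" "x = (\<Oplus>\<^bsub>M\<^esub>j\<in>S. c j)"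
  shows "gcomp M j x = c j"
proof -
  have c: "c j \<in> carrier M" for j using assms(2) mgrade_carrier by blast
  have fin: "finite {j. c j \<noteq> \<zero>\<^bsub>M\<^esub>}" by (rule finite_subset[OF _ assms(1)]) (use assms(3) in auto)
  have "x = (\<Oplus>\<^bsub>M\<^esub>j\<in>{j. c j \<noteq> \<zero>\<^bsub>M\<^esub>}. c j)" unfolding assms(4)
    by (rule M.add.finprod_mono_neutral_cong_right) (use assms c in auto)
  moreover have "x \<in> carrier M" using assms(4) c by (auto intro!: M.finsum_closed)
  ultimately have "(\<lambda>j. gcomp M j x) = c"
  proof -
    assume x: "x = (\<Oplus>\<^bsub>M\<^esub>j\<in>{j. c j \<noteq> \<zero>\<^bsub>M\<^esub>}. c j)" "x \<in> carrier M"
    have unique: "Ex1 P \<Longrightarrow> P a \<Longrightarrow> P b \<Longrightarrow> a = b" for P and a b :: "int \<Rightarrow> 'c" by blast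
    show ?thesis
      by (rule unique[OF mgrade_decomp[OF x(2)]]) (intro conjI allI gcomp_spec x fin assms(2))+
  qed
  then show ?thesis by metis
qed

lemma gcomp_sum:
  assumes "x \<in> carrier M" "finite S" "\<And>j. j \<notin> S \<Longrightarrow> gcomp M j x = \<zero>\<^bsub>M\<^esub>"
  shows "x = (\<Oplus>\<^bsub>M\<^esub>j\<in>S. gcomp M j x)"
proof -
  have "(\<Oplus>\<^bsub>M\<^esub>j\<in>S. gcomp M j x) = (\<Oplus>\<^bsub>M\<^esub>j\<in>{j. gcomp M j x \<noteq> \<zero>\<^bsub>M\<^esub>}. gcomp M j x)"
    by (rule M.add.finprod_mono_neutral_cong_right) (use assms in auto)
  then show ?thesis using gcomp_spec(3)[OF assms(1)] by simp
qed

lemma gcomp_homogeneous: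
  assumes "x \<in> mgrade M i" shows "gcomp M j x = (if j = i then x else \<zero>\<^bsub>M\<^esub>)"
  by (rule gcomp_unique[of "{i}"]) (use assms mgrade_carrier in auto)

lemma gcomp_zero [simp]: "gcomp M j \<zero>\<^bsub>M\<^esub> = \<zero>\<^bsub>M\<^esub>"
  using gcomp_homogeneous[of "\<zero>\<^bsub>M\<^esub>" j j] by simp

lemma gcomp_add:
  assumes x: "x \<in> carrier M" and y: "y \<in> carrier M"
  shows "gcomp M j (x \<oplus>\<^bsub>M\<^esub> y) = gcomp M j x \<oplus>\<^bsub>M\<^esub> gcomp M j y"
proof (rule gcomp_unique)
  let ?S = "{j. gcomp M j x \<noteq> \<zero>\<^bsub>M\<^esub>} \<union> {j. gcomp M j y \<noteq> \<zero>\<^bsub>M\<^esub>}"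
  show fin: "finite ?S" using gcomp_spec x y by auto
  show "gcomp M i x \<oplus>\<^bsub>M\<^esub> gcomp M i y \<in> mgrade M i" for i using gcomp_spec x y by (auto intro: mgrade_add)
  show "gcomp M i x \<oplus>\<^bsub>M\<^esub> gcomp M i y = \<zero>\<^bsub>M\<^esub>" if "i \<notin> ?S" for i using that by simp
  have "x = (\<Oplus>\<^bsub>M\<^esub>i\<in>?S. gcomp M i x)" "y = (\<Oplus>\<^bsub>M\<^esub>i\<in>?S. gcomp M i y)"
    using fin x y by (intro gcomp_sum; auto)+
  moreover have "(\<Oplus>\<^bsub>M\<^esub>i\<in>?S. gcomp M i x \<oplus>\<^bsub>M\<^esub> gcomp M i y) =
      (\<Oplus>\<^bsub>M\<^esub>i\<in>?S. gcomp M i x) \<oplus>\<^bsub>M\<^esub> (\<Oplus>\<^bsub>M\<^esub>i\<in>?S. gcomp M i y)"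
    using x y by (intro M.finsum_addf) auto
  ultimately show "x \<oplus>\<^bsub>M\<^esub> y = (\<Oplus>\<^bsub>M\<^esub>i\<in>?S. gcomp M i x \<oplus>\<^bsub>M\<^esub> gcomp M i y)" by simp
qed

lemma gcomp_finsum:
  assumes "\<And>i. i \<in> S \<Longrightarrow> f i \<in> carrier M"
  shows "gcomp M j (\<Oplus>\<^bsub>M\<^esub>i\<in>S. f i) = (\<Oplus>\<^bsub>M\<^esub>i\<in>S. gcomp M j (f i))"
  using assms
proof (induction S rule: infinite_finite_induct)
  case (insert x F)
  then have "f \<in> F \<rightarrow> carrier M" "f x \<in> carrier M" "(\<lambda>i. gcomp M j (f i)) \<in> F \<rightarrow> carrier M" by auto
  with insert show ?case by (simp add: gcomp_add M.finsum_closed)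
qed auto

lemma homogeneous_induct [consumes 1, case_names zero add]:
  assumes "x \<in> carrier M" and zero: "P \<zero>\<^bsub>M\<^esub>"
    and add: "\<And>x y j. x \<in> carrier M \<Longrightarrow> P x \<Longrightarrow> y \<in> mgrade M j \<Longrightarrow> P (y \<oplus>\<^bsub>M\<^esub> x)"
  shows "P x"
proof -
  have "finite S \<Longrightarrow> P (\<Oplus>\<^bsub>M\<^esub>j\<in>S. gcomp M j x)" for S
  proof (induction S rule: finite_induct)
    case empty
    then show ?case using zero by simp
  next
    case (insert i F)
    have "(\<Oplus>\<^bsub>M\<^esub>j\<in>F. gcomp M j x) \<in> carrier M" using assms(1) by (intro M.finsum_closed) auto
    from add[OF this insert.IH, of "gcomp M i x" i] show ?case
      using insert assms(1) gcomp_spec by auto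
  qed
  with gcomp_spec(2,3)[OF assms(1)] show ?thesis by metis
qed

end

text \<open>A grading is given by projections: the components of any homogeneous decomposition are the
values of the projections, which gives uniqueness.\<close>

lemma graded_moduleI:
  fixes M :: "('r, 'm, 'y) graded_module_scheme" and R :: "('r, 'k, 'x) graded_algebra_scheme"
  assumes "module R M"
    and sub: "\<And>j. subgroup (mgrade M j) (add_monoid M)"
    and sm: "\<And>r x i j. r \<in> rgrade R i \<Longrightarrow> x \<in> mgrade M j \<Longrightarrow> r \<odot>\<^bsub>M\<^esub> x \<in> mgrade M (i + j)"
    and p: "\<And>x j. x \<in> carrier M \<Longrightarrow> p j x \<in> mgrade M j"
    and p_add: "\<And>x y j. x \<in> carrier M \<Longrightarrow> y \<in> carrier M \<Longrightarrow> p j (x \<oplus>\<^bsub>M\<^esub> y) = p j x \<oplus>\<^bsub>M\<^esub> p j y"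
    and p_hom: "\<And>x i j. x \<in> mgrade M i \<Longrightarrow> p j x = (if j = i then x else \<zero>\<^bsub>M\<^esub>)"
    and p_sum: "\<And>x. x \<in> carrier M \<Longrightarrow> \<exists>S. finite S \<and> (\<forall>j. j \<notin> S \<longrightarrow> p j x = \<zero>\<^bsub>M\<^esub>) \<and> x = (\<Oplus>\<^bsub>M\<^esub>j\<in>S. p j x)"
  shows "graded_module R M"
proof -
  interpret module R M by fact
  have gc: "x \<in> carrier M" if "x \<in> mgrade M j" for x j using subgroup.subset[OF sub[of j]] that by auto
  have p_fs: "p j (\<Oplus>\<^bsub>M\<^esub>i\<in>S. c i) = (\<Oplus>\<^bsub>M\<^esub>i\<in>S. p j (c i))" if "finite S" "\<And>i. c i \<in> carrier M" for S c and j :: int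
    using that(1)
  proof (induction S rule: finite_induct)
    case empty
    have "\<zero>\<^bsub>M\<^esub> \<in> mgrade M j" using subgroup.one_closed[OF sub] by simp
    then show ?case using p_hom by auto
  next
    case (insert i F)
    have "(\<Oplus>\<^bsub>M\<^esub>i\<in>F. c i) \<in> carrier M" using that(2) by (intro M.finsum_closed) auto
    moreover have "(\<lambda>i. p j (c i)) \<in> F \<rightarrow> carrier M" "p j (c i) \<in> carrier M" "c i \<in> carrier M" "c \<in> F \<rightarrow> carrier M"
      using that(2) p gc by blast+
    ultimately show ?case using insert by (simp add: p_add)
  qed
  show ?thesis
  proof (rule graded_module.intro[OF module_axioms], rule graded_module_axioms.intro)
    show "subgroup (mgrade M j) (add_monoid M)" for j by (rule sub)
    show "r \<odot>\<^bsub>M\<^esub> x \<in> mgrade M (i + j)" if "r \<in> rgrade R i" "x \<in> mgrade M j" for r x i j using sm that .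
    fix x assume x: "x \<in> carrier M"
    obtain S where S: "finite S" "\<And>j. j \<notin> S \<Longrightarrow> p j x = \<zero>\<^bsub>M\<^esub>" "x = (\<Oplus>\<^bsub>M\<^esub>j\<in>S. p j x)"
      using p_sum[OF x] by blast
    have px: "p j x \<in> carrier M" for j using p[OF x] gc by blast
    show "\<exists>!c. (\<forall>j. c j \<in> mgrade M j) \<and> finite {j. c j \<noteq> \<zero>\<^bsub>M\<^esub>} \<and>
           x = (\<Oplus>\<^bsub>M\<^esub>j\<in>{j. c j \<noteq> \<zero>\<^bsub>M\<^esub>}. c j)"
    proof (rule ex1I[of _ "\<lambda>j. p j x"], intro conjI allI)
      show "p j x \<in> mgrade M j" for j using p x by blast
      show "finite {j. p j x \<noteq> \<zero>\<^bsub>M\<^esub>}" by (rule finite_subset[OF _ S(1)]) (use S(2) in auto)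
      have "(\<Oplus>\<^bsub>M\<^esub>j\<in>S. p j x) = (\<Oplus>\<^bsub>M\<^esub>j\<in>{j. p j x \<noteq> \<zero>\<^bsub>M\<^esub>}. p j x)"
        by (rule M.add.finprod_mono_neutral_cong_right) (use S px in auto)
      with S(3) show "x = (\<Oplus>\<^bsub>M\<^esub>j\<in>{j. p j x \<noteq> \<zero>\<^bsub>M\<^esub>}. p j x)" by simp
    next
      fix c assume c: "(\<forall>j. c j \<in> mgrade M j) \<and> finite {j. c j \<noteq> \<zero>\<^bsub>M\<^esub>} \<and>
           x = (\<Oplus>\<^bsub>M\<^esub>j\<in>{j. c j \<noteq> \<zero>\<^bsub>M\<^esub>}. c j)"
      then have cc: "c i \<in> carrier M" for i using gc by blast
      have "p j x = c j" for j
      proof -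
        have "p j x = (\<Oplus>\<^bsub>M\<^esub>i\<in>{j. c j \<noteq> \<zero>\<^bsub>M\<^esub>}. p j (c i))" using p_fs[of "{j. c j \<noteq> \<zero>\<^bsub>M\<^esub>}" c j] c cc by metis
        also have "\<dots> = (\<Oplus>\<^bsub>M\<^esub>i\<in>{j. c j \<noteq> \<zero>\<^bsub>M\<^esub>}. if j = i then c i else \<zero>\<^bsub>M\<^esub>)"
          using c cc by (intro M.finsum_cong') (auto simp: p_hom)
        also have "\<dots> = c j"
        proof (cases "c j = \<zero>\<^bsub>M\<^esub>")
          case True
          then have "(\<Oplus>\<^bsub>M\<^esub>i\<in>{j. c j \<noteq> \<zero>\<^bsub>M\<^esub>}. if j = i then c i else \<zero>\<^bsub>M\<^esub>) = \<zero>\<^bsub>M\<^esub>"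
            by (intro M.finsum_all0) auto
          with True show ?thesis by simp
        next
          case False
          then show ?thesis using c cc by (intro M.finsum_singleton) auto
        qed
        finally show ?thesis .
      qed
      then show "c = (\<lambda>j. p j x)" by auto
    qed
  qed
qed

definition ghom :: "('r, 'k, 'x) graded_algebra_scheme \<Rightarrow> int \<Rightarrow> ('r, 'm, 'y) graded_module_scheme \<Rightarrow>
    ('r, 'n, 'z) graded_module_scheme \<Rightarrow> ('m \<Rightarrow> 'n) \<Rightarrow> bool"
  where "ghom R a X Y f \<longleftrightarrow> f \<in> module_hom R X Y \<and> (\<forall>j. \<forall>x\<in>mgrade X j. f x \<in> mgrade Y (j + a))"

lemma ghomD:
  assumes "ghom R a X Y f"
  shows ghom_closed: "x \<in> carrier X \<Longrightarrow> f x \<in> carrier Y"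
    and ghom_add: "x \<in> carrier X \<Longrightarrow> y \<in> carrier X \<Longrightarrow> f (x \<oplus>\<^bsub>X\<^esub> y) = f x \<oplus>\<^bsub>Y\<^esub> f y"
    and ghom_smult: "r \<in> carrier R \<Longrightarrow> x \<in> carrier X \<Longrightarrow> f (r \<odot>\<^bsub>X\<^esub> x) = r \<odot>\<^bsub>Y\<^esub> f x"
    and ghom_grade: "x \<in> mgrade X j \<Longrightarrow> f x \<in> mgrade Y (j + a)"
  using assms by (auto simp: ghom_def module_hom_def Pi_def)

lemma ghomI:
  assumes "\<And>x. x \<in> carrier X \<Longrightarrow> f x \<in> carrier Y"
    and "\<And>x y. x \<in> carrier X \<Longrightarrow> y \<in> carrier X \<Longrightarrow> f (x \<oplus>\<^bsub>X\<^esub> y) = f x \<oplus>\<^bsub>Y\<^esub> f y"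
    and "\<And>r x. r \<in> carrier R \<Longrightarrow> x \<in> carrier X \<Longrightarrow> f (r \<odot>\<^bsub>X\<^esub> x) = r \<odot>\<^bsub>Y\<^esub> f x"
    and "\<And>x j. x \<in> mgrade X j \<Longrightarrow> f x \<in> mgrade Y (j + a)"
  shows "ghom R a X Y f"
  using assms by (auto simp: ghom_def module_hom_def Pi_def)

lemma ghom_mod_hom:
  assumes "ghom R a X Y f" "module R X" "module R Y"
  shows "mod_hom R X Y f"
  using assms by (auto simp: ghom_def mod_hom_def mod_hom_axioms_def)

lemma ghom_zero:
  assumes "ghom R a X Y f" "module R X" "module R Y"
  shows "f \<zero>\<^bsub>X\<^esub> = \<zero>\<^bsub>Y\<^esub>"
  using mod_hom.f0_is_0[OF ghom_mod_hom[OF assms]] .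

lemma ghom_uminus:
  assumes "ghom R a X Y f" "module R X" "module R Y"
  shows "x \<in> carrier X \<Longrightarrow> f (\<ominus>\<^bsub>X\<^esub> x) = \<ominus>\<^bsub>Y\<^esub> f x"
  using mod_hom.f_neg[OF ghom_mod_hom[OF assms]] .

lemma ghom_minus:
  assumes "ghom R a X Y f" "module R X" "module R Y"
  shows "x \<in> carrier X \<Longrightarrow> y \<in> carrier X \<Longrightarrow> f (x \<ominus>\<^bsub>X\<^esub> y) = f x \<ominus>\<^bsub>Y\<^esub> f y"
  using mod_hom.f_minus[OF ghom_mod_hom[OF assms]] .

lemma ghom_finsum:
  assumes "ghom R a X Y f" "module R X" "module R Y" "\<And>i. i \<in> S \<Longrightarrow> g i \<in> carrier X"
  shows "f (\<Oplus>\<^bsub>X\<^esub>i\<in>S. g i) = (\<Oplus>\<^bsub>Y\<^esub>i\<in>S. f (g i))"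
proof -
  interpret X: module R X by fact
  interpret Y: module R Y by fact
  show ?thesis using assms(4)
  proof (induction S rule: infinite_finite_induct)
    case (insert x F)
    then have "(\<lambda>i. f (g i)) \<in> F \<rightarrow> carrier Y" "f (g x) \<in> carrier Y" "g \<in> F \<rightarrow> carrier X" "g x \<in> carrier X"
      using ghom_closed[OF assms(1)] by auto
    with insert show ?case by (simp add: ghom_add[OF assms(1)])
  qed (simp_all add: ghom_zero[OF assms(1-3)])
qed

lemma ghom_comp:
  assumes "ghom R b Y Z g" "ghom R a X Y f" "c = a + b"
  shows "ghom R c X Z (\<lambda>x. g (f x))"
  by (rule ghomI) (use ghomD[OF assms(1)] ghomD[OF assms(2)] assms(3) in \<open>auto simp: add.assoc[symmetric]\<close>)

lemma ghom_id: "ghom R 0 X X (\<lambda>x. x)"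
  by (rule ghomI) auto

lemma ghom_const_zero:
  assumes "graded_module R Y" shows "ghom R a X Y (\<lambda>x. \<zero>\<^bsub>Y\<^esub>)"
proof -
  interpret Y: graded_module R Y by fact
  show ?thesis by (rule ghomI) auto
qed

lemma ghom_pointwise_add:
  assumes "graded_module R Y" "ghom R a X Y f" "ghom R a X Y g"
  shows "ghom R a X Y (\<lambda>x. f x \<oplus>\<^bsub>Y\<^esub> g x)"
proof -
  interpret Y: graded_module R Y by fact
  show ?thesis
    by (rule ghomI)
      (use ghomD[OF assms(2)] ghomD[OF assms(3)] in \<open>auto simp: Y.smult_r_distr Y.mgrade_add Y.M.a_ac\<close>)
qed

lemma ghom_pointwise_uminus:
  assumes "graded_module R Y" "ghom R a X Y f"
  shows "ghom R a X Y (\<lambda>x. \<ominus>\<^bsub>Y\<^esub> f x)"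
proof -
  interpret Y: graded_module R Y by fact
  show ?thesis
    by (rule ghomI)
      (use ghomD[OF assms(2)] in \<open>auto simp: Y.smult_r_minus Y.mgrade_uminus Y.M.minus_add\<close>)
qed

lemma ghom_pointwise_minus:
  assumes "graded_module R Y" "ghom R a X Y f" "ghom R a X Y g"
  shows "ghom R a X Y (\<lambda>x. f x \<ominus>\<^bsub>Y\<^esub> g x)"
  unfolding a_minus_def by (intro ghom_pointwise_add ghom_pointwise_uminus assms)

lemma ghom_pointwise_finsum:
  assumes "graded_module R Y" "finite S" "\<And>i. i \<in> S \<Longrightarrow> ghom R a X Y (f i)"
  shows "ghom R a X Y (\<lambda>x. \<Oplus>\<^bsub>Y\<^esub>i\<in>S. f i x)"
proof -
  interpret Y: graded_module R Y by fact
  have cl': "f i x \<in> carrier Y" if "i \<in> S" "x \<in> carrier X" for i x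
    using ghom_closed[OF assms(3)] that by auto
  then have cl: "(\<lambda>i. f i x) \<in> S \<rightarrow> carrier Y" if "x \<in> carrier X" for x
    using that by blast
  show ?thesis
  proof (rule ghomI)
    show "(\<Oplus>\<^bsub>Y\<^esub>i\<in>S. f i x) \<in> carrier Y" if "x \<in> carrier X" for x
      using cl[OF that] by (rule Y.M.finsum_closed)
    show "(\<Oplus>\<^bsub>Y\<^esub>i\<in>S. f i (x \<oplus>\<^bsub>X\<^esub> y)) = (\<Oplus>\<^bsub>Y\<^esub>i\<in>S. f i x) \<oplus>\<^bsub>Y\<^esub> (\<Oplus>\<^bsub>Y\<^esub>i\<in>S. f i y)"
      if "x \<in> carrier X" "y \<in> carrier X" for x y
    proof -
      have "(\<Oplus>\<^bsub>Y\<^esub>i\<in>S. f i (x \<oplus>\<^bsub>X\<^esub> y)) = (\<Oplus>\<^bsub>Y\<^esub>i\<in>S. f i x \<oplus>\<^bsub>Y\<^esub> f i y)"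
        using ghom_add[OF assms(3)] cl' that by (intro Y.M.finsum_cong') auto
      also have "\<dots> = (\<Oplus>\<^bsub>Y\<^esub>i\<in>S. f i x) \<oplus>\<^bsub>Y\<^esub> (\<Oplus>\<^bsub>Y\<^esub>i\<in>S. f i y)"
        using cl that by (intro Y.M.finsum_addf)
      finally show ?thesis .
    qed
    show "(\<Oplus>\<^bsub>Y\<^esub>i\<in>S. f i (r \<odot>\<^bsub>X\<^esub> x)) = r \<odot>\<^bsub>Y\<^esub> (\<Oplus>\<^bsub>Y\<^esub>i\<in>S. f i x)" if "r \<in> carrier R" "x \<in> carrier X" for r x
    proof -
      have "(\<Oplus>\<^bsub>Y\<^esub>i\<in>S. f i (r \<odot>\<^bsub>X\<^esub> x)) = (\<Oplus>\<^bsub>Y\<^esub>i\<in>S. r \<odot>\<^bsub>Y\<^esub> f i x)"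
        using ghom_smult[OF assms(3)] cl' that by (intro Y.M.finsum_cong') auto
      also have "\<dots> = r \<odot>\<^bsub>Y\<^esub> (\<Oplus>\<^bsub>Y\<^esub>i\<in>S. f i x)"
        using Y.finsum_smult_ldistr[OF assms(2) that(1)] cl[OF that(2)] by simp
      finally show ?thesis .
    qed
    show "(\<Oplus>\<^bsub>Y\<^esub>i\<in>S. f i x) \<in> mgrade Y (j + a)" if "x \<in> mgrade X j" for x j
      using ghom_grade[OF assms(3)] that by (intro Y.mgrade_finsum) auto
  qed
qed

lemma ghom_smult_homogeneous:
  assumes "graded_module R Y" "r \<in> rgrade R b" "r \<in> carrier R" "ghom R a X Y f" "c = a + b"
  shows "ghom R c X Y (\<lambda>x. r \<odot>\<^bsub>Y\<^esub> f x)"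
proof -
  interpret Y: graded_module R Y by fact
  show ?thesis
  proof (rule ghomI)
    fix s x assume "s \<in> carrier R" "x \<in> carrier X"
    then show "r \<odot>\<^bsub>Y\<^esub> f (s \<odot>\<^bsub>X\<^esub> x) = s \<odot>\<^bsub>Y\<^esub> (r \<odot>\<^bsub>Y\<^esub> f x)"
      using assms(3) ghom_smult[OF assms(4)] ghom_closed[OF assms(4)]
        Y.smult_assoc1[of r s "f x"] Y.smult_assoc1[of s r "f x"] Y.R.m_comm[of r s] by simp
  next
    fix x j assume "x \<in> mgrade X j"
    from Y.mgrade_smult[OF assms(2) ghom_grade[OF assms(4) this]] show "r \<odot>\<^bsub>Y\<^esub> f x \<in> mgrade Y (j + c)"
      by (simp add: assms(5) algebra_simps)
  qed (use assms ghomD[OF assms(4)] in \<open>auto simp: Y.smult_r_distr\<close>)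
qed

lemma gcomp_ghom:
  assumes X: "graded_module R X" and Y: "graded_module R Y" and f: "ghom R a X Y f" and x: "x \<in> carrier X"
  shows "gcomp Y (j + a) (f x) = f (gcomp X j x)"
proof -
  interpret X: graded_module R X by fact
  interpret Y: graded_module R Y by fact
  let ?S = "{j. gcomp X j x \<noteq> \<zero>\<^bsub>X\<^esub>}"
  have S: "finite ?S" using X.gcomp_spec x by blast
  have "gcomp Y (j + a) (f x) = f (gcomp X (j + a - a) x)"
  proof (rule Y.gcomp_unique[of "(\<lambda>i. i + a) ` ?S"])
    show "finite ((\<lambda>i. i + a) ` ?S)" using S by simp
    show "f (gcomp X (i - a) x) \<in> mgrade Y i" for i
      using ghom_grade[OF f X.gcomp_spec(1)[OF x, of "i - a"]] by simp
    show "f (gcomp X (i - a) x) = \<zero>\<^bsub>Y\<^esub>" if "i \<notin> (\<lambda>i. i + a) ` ?S" for i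
    proof -
      have "gcomp X (i - a) x = \<zero>\<^bsub>X\<^esub>" using that by (auto simp: image_iff)
      then show ?thesis using ghom_zero[OF f X.module_axioms Y.module_axioms] by simp
    qed
    have "f x = (\<Oplus>\<^bsub>Y\<^esub>i\<in>?S. f (gcomp X i x))"
      using ghom_finsum[OF f X.module_axioms Y.module_axioms, of ?S "\<lambda>i. gcomp X i x"] X.gcomp_spec(3)[OF x] x by simp
    also have "\<dots> = (\<Oplus>\<^bsub>Y\<^esub>i\<in>(\<lambda>i. i + a) ` ?S. f (gcomp X (i - a) x))"
      using ghom_closed[OF f] x by (subst Y.M.finsum_reindex) (auto simp: inj_on_def)
    finally show "f x = (\<Oplus>\<^bsub>Y\<^esub>i\<in>(\<lambda>i. i + a) ` ?S. f (gcomp X (i - a) x))" .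
  qed
  then show ?thesis by simp
qed

section \<open>Connected graded algebras and free graded modules\<close>

lemma regular_module_simps [simp]:
  "carrier (regular_module R) = carrier R" "zero (regular_module R) = zero R"
  "add (regular_module R) = add R" "module.smult (regular_module R) = monoid.mult R"
  "mgrade (regular_module R) = rgrade R"
  by (simp_all add: regular_module_def)

lemma finsum_regular_module [simp]: "finsum (regular_module R) f A = finsum R f A"
  by (simp add: finsum_def finprod_def)

lemma (in module) lincomb_mono_neutral:
  assumes "finite A'" "A \<subseteq> A'" "A' \<subseteq> carrier M" "\<And>b. b \<in> A' \<Longrightarrow> c b \<in> carrier R"
    and "\<And>b. b \<in> A' \<Longrightarrow> b \<notin> A \<Longrightarrow> c b = \<zero>"
  shows "lincomb c A' = lincomb c A"
  unfolding lincomb_def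
proof -
  have "c i \<odot>\<^bsub>M\<^esub> i = \<zero>\<^bsub>M\<^esub>" if "i \<in> A' - A" for i
    using assms that smult_l_null[of i] by auto
  then show "(\<Oplus>\<^bsub>M\<^esub>v\<in>A'. c v \<odot>\<^bsub>M\<^esub> v) = (\<Oplus>\<^bsub>M\<^esub>v\<in>A. c v \<odot>\<^bsub>M\<^esub> v)"
    using assms by (intro M.add.finprod_mono_neutral_cong_right) auto
qed

lemma a_inv_regular_module [simp]: "a_inv (regular_module R) x = a_inv R x"
  by (simp add: a_inv_def m_inv_def)

text \<open>The homogeneous part of degree \<open>j\<close> is finite dimensional, stated by a finite separating set of
functionals.\<close>

definition fin_graded_part :: "('r, 'k::field, 'x) graded_algebra_scheme \<Rightarrow> ('r, 'm, 'y) graded_module_scheme \<Rightarrow> int \<Rightarrow> bool"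
  where "fin_graded_part R Y j \<longleftrightarrow> (\<exists>K. finite K \<and> (\<forall>\<kappa>\<in>K. lin_functional (graded_part R Y j) \<kappa>) \<and>
    (\<forall>x\<in>mgrade Y j. (\<forall>\<kappa>\<in>K. \<kappa> x = 0) \<longrightarrow> x = \<zero>\<^bsub>Y\<^esub>))"

text \<open>The properties of \<open>k[x\<^sub>1, \<dots>, x\<^sub>e]/I\<close> that the argument uses. That quotients of polynomial
rings have them is shown at the end.\<close>

locale connected_algebra =
  fixes R :: "('r, 'k::field, 'x) graded_algebra_scheme" (structure)
    and e :: nat and d :: "nat \<Rightarrow> nat" and X :: "nat \<Rightarrow> 'r" and \<mm> :: "'r set"
  assumes R_cring: "cring R"
    and regular: "graded_module R (regular_module R)"
    and one_neq_zero: "\<one> \<noteq> \<zero>"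
    and scalar_add: "scalar R (a + b) = scalar R a \<oplus> scalar R b"
    and scalar_mult: "scalar R (a * b) = scalar R a \<otimes> scalar R b"
    and scalar_one: "scalar R 1 = \<one>"
    and rgrade_0: "rgrade R 0 = range (scalar R)"
    and rgrade_neg: "j < 0 \<Longrightarrow> rgrade R j \<subseteq> {\<zero>}"
    and rgrade_fin: "fin_graded_part R (regular_module R) j"
    and X_grade: "i < e \<Longrightarrow> X i \<in> rgrade R (int (d i))"
    and d_pos: "i < e \<Longrightarrow> 1 \<le> d i"
    and \<mm>_def: "\<mm> = genideal R (X ` {..<e})"
    and rgrade_pos: "0 < j \<Longrightarrow> rgrade R j \<subseteq> \<mm>"
begin

sublocale R: cring R by (fact R_cring)

sublocale RM: graded_module R "regular_module R"
  rewrites "carrier (regular_module R) = carrier R" and "zero (regular_module R) = zero R"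
    and "add (regular_module R) = add R" and "module.smult (regular_module R) = monoid.mult R"
    and "mgrade (regular_module R) = rgrade R"
  by (simp_all add: regular)

text \<open>The homogeneous bases that occur in the definition of a graded free module.\<close>

definition hbasis :: "('r, 'p, 'y) graded_module_scheme \<Rightarrow> 'p set \<Rightarrow> bool"
  where "hbasis P B \<longleftrightarrow> B \<subseteq> (\<Union>j. mgrade P j) \<and>
    \<not> LinearCombinations.module.lin_dep R P B \<and> LinearCombinations.module.span R P B = carrier P"

lemma graded_free_iff: "graded_free R P \<longleftrightarrow> graded_module R P \<and> (\<exists>B. hbasis P B)"
  by (auto simp: graded_free_def hbasis_def)

lemma gcomp_smult_homogeneous:
  assumes "graded_module R P" "b \<in> mgrade P i" "r \<in> carrier R"
  shows "gcomp P j (r \<odot>\<^bsub>P\<^esub> b) = gcomp (regular_module R) (j - i) r \<odot>\<^bsub>P\<^esub> b"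
proof -
  interpret P: graded_module R P by fact
  have b: "b \<in> carrier P" using assms P.mgrade_carrier by blast
  have "ghom R i (regular_module R) P (\<lambda>r. r \<odot>\<^bsub>P\<^esub> b)"
    by (rule ghomI) (use b assms(2) P.smult_assoc1 P.mgrade_smult in \<open>auto simp: P.smult_l_distr\<close>)
  from gcomp_ghom[OF regular assms(1) this, of r "j - i"] assms(3) show ?thesis by simp
qed

lemma ghom_eq_on_span:
  assumes P: "graded_module R P" and Y: "graded_module R Y" and f: "ghom R a P Y f" and g: "ghom R a' P Y g"
    and B: "B \<subseteq> carrier P" "LinearCombinations.module.span R P B = carrier P"
    and eq: "\<And>b. b \<in> B \<Longrightarrow> f b = g b" and x: "x \<in> carrier P"
  shows "f x = g x"
proof -
  interpret P: graded_module R P by fact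
  interpret Y: graded_module R Y by fact
  from x B(2) have "x \<in> P.span B" by simp
  then obtain c A where A: "finite A" "A \<subseteq> B" "c \<in> A \<rightarrow> carrier R" "x = P.lincomb c A"
    unfolding P.span_def by blast
  have AP: "b \<in> carrier P" if "b \<in> A" for b using A B that by blast
  have cR: "c b \<in> carrier R" if "b \<in> A" for b using A(3) that by blast
  have "f x = (\<Oplus>\<^bsub>Y\<^esub>b\<in>A. f (c b \<odot>\<^bsub>P\<^esub> b))" unfolding A(4) P.lincomb_def
    using AP cR by (intro ghom_finsum[OF f P.module_axioms Y.module_axioms]) auto
  also have "\<dots> = (\<Oplus>\<^bsub>Y\<^esub>b\<in>A. g (c b \<odot>\<^bsub>P\<^esub> b))"
    using AP cR A(2) eq ghom_closed[OF g] by (intro Y.finsum_cong') (auto simp: ghom_smult[OF f] ghom_smult[OF g])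
  also have "\<dots> = g x" unfolding A(4) P.lincomb_def
    using AP cR by (intro ghom_finsum[OF g P.module_axioms Y.module_axioms, symmetric]) auto
  finally show ?thesis .
qed

text \<open>A graded homomorphism on a free module may be prescribed on a homogeneous basis; the coefficients of
an element with respect to the basis are unique.\<close>

lemma free_extension:
  assumes P: "graded_module R P" and B: "hbasis P B" and Y: "graded_module R Y"
    and g: "\<And>b j. b \<in> B \<Longrightarrow> b \<in> mgrade P j \<Longrightarrow> g b \<in> mgrade Y (j + a)"
  shows "\<exists>f. ghom R a P Y f \<and> (\<forall>b\<in>B. f b = g b)"
proof -
  interpret P: graded_module R P by fact
  interpret Y: graded_module R Y by fact
  have BP: "B \<subseteq> carrier P" using B P.mgrade_carrier by (auto simp: hbasis_def)
  have indep: "P.lin_indpt B" and span: "P.span B = carrier P" using B by (auto simp: hbasis_def)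
  have gY: "g b \<in> carrier Y" if "b \<in> B" for b
    using B that g[OF that] Y.mgrade_carrier unfolding hbasis_def by blast
  have "\<exists>c. c \<in> B \<rightarrow> carrier R \<and> finite {b \<in> B. c b \<noteq> \<zero>} \<and>
      (\<forall>A. finite A \<longrightarrow> A \<subseteq> B \<longrightarrow> {b \<in> B. c b \<noteq> \<zero>} \<subseteq> A \<longrightarrow> x = P.lincomb c A)" if x: "x \<in> carrier P" for x
  proof -
    from x span have "x \<in> P.span B" by simp
    then obtain c A where A: "finite A" "A \<subseteq> B" "c \<in> A \<rightarrow> carrier R" "x = P.lincomb c A"
      unfolding P.span_def by blast
    define c' where "c' b = (if b \<in> A then c b else \<zero>)" for b
    have "x = P.lincomb c' A'" if A': "finite A'" "A' \<subseteq> B" "{b \<in> B. c' b \<noteq> \<zero>} \<subseteq> A'" for A'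
    proof -
      have cR: "c' b \<in> carrier R" for b using A(3) by (auto simp: c'_def)
      have AA: "finite (A \<union> A')" "A \<union> A' \<subseteq> carrier P" using A A' BP by auto
      have "P.lincomb c' (A \<union> A') = P.lincomb c' A'"
        by (rule P.lincomb_mono_neutral[OF AA(1) _ AA(2) cR]) (use A A' in auto)
      moreover have "P.lincomb c' (A \<union> A') = P.lincomb c' A"
        by (rule P.lincomb_mono_neutral[OF AA(1) _ AA(2) cR]) (auto simp: c'_def)
      moreover have "P.lincomb c' A = P.lincomb c A"
        by (rule P.lincomb_cong) (use A BP in \<open>auto simp: c'_def\<close>)
      ultimately show ?thesis using A(4) by simp
    qed
    moreover have "c' \<in> B \<rightarrow> carrier R" using A(3) by (auto simp: c'_def)
    moreover have "finite {b \<in> B. c' b \<noteq> \<zero>}"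
      by (rule finite_subset[OF _ A(1)]) (auto simp: c'_def)
    ultimately show ?thesis by blast
  qed
  then have "\<exists>co. \<forall>x\<in>carrier P. co x \<in> B \<rightarrow> carrier R \<and> finite {b \<in> B. co x b \<noteq> \<zero>} \<and>
      (\<forall>A. finite A \<longrightarrow> A \<subseteq> B \<longrightarrow> {b \<in> B. co x b \<noteq> \<zero>} \<subseteq> A \<longrightarrow> x = P.lincomb (co x) A)"
    by (intro bchoice) blast
  then obtain co where co': "\<forall>x\<in>carrier P. co x \<in> B \<rightarrow> carrier R \<and> finite {b \<in> B. co x b \<noteq> \<zero>} \<and>
      (\<forall>A. finite A \<longrightarrow> A \<subseteq> B \<longrightarrow> {b \<in> B. co x b \<noteq> \<zero>} \<subseteq> A \<longrightarrow> x = P.lincomb (co x) A)"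
    by (elim exE)
  have co: "\<And>x. x \<in> carrier P \<Longrightarrow> co x \<in> B \<rightarrow> carrier R"
    "\<And>x. x \<in> carrier P \<Longrightarrow> finite {b \<in> B. co x b \<noteq> \<zero>}"
    "\<And>x A. x \<in> carrier P \<Longrightarrow> finite A \<Longrightarrow> A \<subseteq> B \<Longrightarrow> {b \<in> B. co x b \<noteq> \<zero>} \<subseteq> A \<Longrightarrow> x = P.lincomb (co x) A"
    using bspec[OF co'] by simp_all
  have coR: "co x b \<in> carrier R" if "x \<in> carrier P" "b \<in> B" for x b using co(1) that by blast
  have uniq: "co x b = c b"
    if x: "x \<in> carrier P" and A: "finite A" "A \<subseteq> B" and c: "c \<in> B \<rightarrow> carrier R" "\<And>b. b \<in> B - A \<Longrightarrow> c b = \<zero>"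
      "x = P.lincomb c A" and b: "b \<in> B" for x A c b
  proof (rule ccontr)
    assume ne: "co x b \<noteq> c b"
    let ?A = "A \<union> {b \<in> B. co x b \<noteq> \<zero>}"
    have fin: "finite ?A" "?A \<subseteq> B" using A co(2)[OF x] by auto
    have bA: "b \<in> ?A" using ne c(2) b by (cases "b \<in> A") auto
    have "x = P.lincomb (co x) ?A" using co(3)[OF x fin] by blast
    moreover have "P.lincomb c ?A = P.lincomb c A"
      by (rule P.lincomb_mono_neutral[OF fin(1)]) (use fin A c BP in auto)
    ultimately have "P.lincomb (co x) ?A = P.lincomb c ?A" using c(3) by simp
    moreover have "P.lincomb (\<lambda>b. co x b \<ominus> c b) ?A = P.lincomb (co x) ?A \<ominus>\<^bsub>P\<^esub> P.lincomb c ?A"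
      by (rule P.lincomb_diff) (use fin BP coR[OF x] c(1) in \<open>auto simp: Pi_def subset_iff\<close>)
    moreover have "P.lincomb c ?A \<in> carrier P" using fin BP c(1) by (intro P.lincomb_closed) auto
    ultimately have "P.lincomb (\<lambda>b. co x b \<ominus> c b) ?A = \<zero>\<^bsub>P\<^esub>" by (simp add: a_minus_def P.M.r_neg)
    then have "P.lin_dep B"
    proof (intro P.lin_dep_crit[OF fin _ bA])
      show "(\<lambda>b. co x b \<ominus> c b) \<in> ?A \<rightarrow> carrier R" using fin coR[OF x] c(1) by (auto simp: Pi_def)
      show "co x b \<ominus> c b \<noteq> \<zero>" using ne coR[OF x b] c(1) b by (auto simp: Pi_def)
    qed
    with indep show False by blast
  qed
  define f where "f x = (\<Oplus>\<^bsub>Y\<^esub>b\<in>{b \<in> B. co x b \<noteq> \<zero>}. co x b \<odot>\<^bsub>Y\<^esub> g b)" for x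
  have f: "f x = (\<Oplus>\<^bsub>Y\<^esub>b\<in>A. co x b \<odot>\<^bsub>Y\<^esub> g b)"
    if "x \<in> carrier P" "finite A" "A \<subseteq> B" "{b \<in> B. co x b \<noteq> \<zero>} \<subseteq> A" for x A
  proof -
    have "co x b \<odot>\<^bsub>Y\<^esub> g b = \<zero>\<^bsub>Y\<^esub>" if "b \<in> A - {b \<in> B. co x b \<noteq> \<zero>}" for b
      using that \<open>A \<subseteq> B\<close> gY[of b] by auto
    then show ?thesis unfolding f_def using that gY coR
      by (intro Y.M.add.finprod_mono_neutral_cong_left) auto
  qed
  have sm: "co x b \<odot>\<^bsub>Y\<^esub> g b \<in> carrier Y" if "x \<in> carrier P" "b \<in> B" for x b
    using coR[OF that] gY[OF that(2)] by simp
  have closed: "f x \<in> carrier Y" if "x \<in> carrier P" for x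
    unfolding f_def using sm[OF that] by (intro Y.finsum_closed) auto
  have co_add: "co (x \<oplus>\<^bsub>P\<^esub> y) b = co x b \<oplus> co y b" if xy: "x \<in> carrier P" "y \<in> carrier P" and b: "b \<in> B" for x y b
  proof -
    let ?A = "{b \<in> B. co x b \<noteq> \<zero>} \<union> {b \<in> B. co y b \<noteq> \<zero>}"
    have A: "finite ?A" "?A \<subseteq> B" using co(2) xy by auto
    have "x = P.lincomb (co x) ?A" "y = P.lincomb (co y) ?A" using co(3)[OF _ A] xy by blast+
    moreover have "P.lincomb (\<lambda>b. co x b \<oplus> co y b) ?A = P.lincomb (co x) ?A \<oplus>\<^bsub>P\<^esub> P.lincomb (co y) ?A"
      by (rule P.lincomb_sum) (use A BP coR[OF xy(1)] coR[OF xy(2)] in \<open>auto simp: Pi_def subset_iff\<close>)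
    ultimately have eq: "x \<oplus>\<^bsub>P\<^esub> y = P.lincomb (\<lambda>b. co x b \<oplus> co y b) ?A" by simp
    have cl: "x \<oplus>\<^bsub>P\<^esub> y \<in> carrier P" using xy by simp
    show ?thesis
      by (rule uniq[OF cl A _ _ eq b]) (use xy coR in auto)
  qed
  have co_smult: "co (r \<odot>\<^bsub>P\<^esub> x) b = r \<otimes> co x b" if x: "x \<in> carrier P" and r: "r \<in> carrier R" and b: "b \<in> B" for r x b
  proof -
    let ?A = "{b \<in> B. co x b \<noteq> \<zero>}"
    have A: "finite ?A" "?A \<subseteq> B" using co(2) x by auto
    have "x = P.lincomb (co x) ?A" using co(3)[OF _ A] x by blast
    moreover have "P.lincomb (\<lambda>b. r \<otimes> co x b) ?A = r \<odot>\<^bsub>P\<^esub> P.lincomb (co x) ?A"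
      by (rule P.lincomb_smult) (use A BP coR[OF x] r in \<open>auto simp: Pi_def\<close>)
    ultimately have eq: "r \<odot>\<^bsub>P\<^esub> x = P.lincomb (\<lambda>b. r \<otimes> co x b) ?A" by simp
    have cl: "r \<odot>\<^bsub>P\<^esub> x \<in> carrier P" using x r by simp
    show ?thesis
      by (rule uniq[OF cl A _ _ eq b]) (use x r coR in auto)
  qed
  have co_grade: "co x b \<in> rgrade R (j - i)" if x: "x \<in> mgrade P j" and b: "b \<in> B" "b \<in> mgrade P i" for x b i j
  proof -
    have xP: "x \<in> carrier P" using x P.mgrade_carrier by blast
    let ?A = "{b \<in> B. co x b \<noteq> \<zero>}"
    have A: "finite ?A" "?A \<subseteq> B" using co(2) xP by auto
    have "\<forall>b\<in>B. \<exists>i. b \<in> mgrade P i" using B by (auto simp: hbasis_def)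
    then obtain dg where dg: "\<And>b. b \<in> B \<Longrightarrow> b \<in> mgrade P (dg b)" by metis
    have "b \<noteq> \<zero>\<^bsub>P\<^esub>" using P.zero_nin_lin_indpt[OF BP indep] b one_neq_zero by auto
    then have dgb: "dg b = i"
      using P.gcomp_homogeneous[OF dg[OF b(1)], of i] P.gcomp_homogeneous[OF b(2), of i] by (auto split: if_splits)
    let ?c = "\<lambda>b. gcomp (regular_module R) (j - dg b) (co x b)"
    have "x = gcomp P j (P.lincomb (co x) ?A)"
      using P.gcomp_homogeneous[OF x, of j] co(3)[OF xP A] by simp
    also have "\<dots> = (\<Oplus>\<^bsub>P\<^esub>b\<in>?A. gcomp P j (co x b \<odot>\<^bsub>P\<^esub> b))"
      unfolding P.lincomb_def using BP coR[OF xP] by (intro P.gcomp_finsum) auto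
    also have "\<dots> = P.lincomb ?c ?A" unfolding P.lincomb_def
      using BP coR[OF xP] gcomp_smult_homogeneous[OF P dg] by (intro P.M.finsum_cong') auto
    finally have eq: "x = P.lincomb ?c ?A" .
    have "co x b = ?c b"
      by (rule uniq[OF xP A _ _ eq b(1)]) (use coR[OF xP] in auto)
    also have "\<dots> \<in> rgrade R (j - i)" using RM.gcomp_spec(1) coR[OF xP b(1)] dgb by simp
    finally show ?thesis .
  qed
  have "ghom R a P Y f"
  proof (rule ghomI)
    fix x y assume xy: "x \<in> carrier P" "y \<in> carrier P"
    let ?A = "{b \<in> B. co x b \<noteq> \<zero>} \<union> {b \<in> B. co y b \<noteq> \<zero>}"
    have A: "finite ?A" "?A \<subseteq> B" using co(2) xy by auto
    have "f (x \<oplus>\<^bsub>P\<^esub> y) = (\<Oplus>\<^bsub>Y\<^esub>b\<in>?A. co (x \<oplus>\<^bsub>P\<^esub> y) b \<odot>\<^bsub>Y\<^esub> g b)"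
      using xy A co_add[OF xy] by (intro f) auto
    also have "\<dots> = (\<Oplus>\<^bsub>Y\<^esub>b\<in>?A. co x b \<odot>\<^bsub>Y\<^esub> g b \<oplus>\<^bsub>Y\<^esub> co y b \<odot>\<^bsub>Y\<^esub> g b)"
      using xy A co_add[OF xy] coR gY sm by (intro Y.M.finsum_cong') (auto simp: Y.smult_l_distr)
    also have "\<dots> = (\<Oplus>\<^bsub>Y\<^esub>b\<in>?A. co x b \<odot>\<^bsub>Y\<^esub> g b) \<oplus>\<^bsub>Y\<^esub> (\<Oplus>\<^bsub>Y\<^esub>b\<in>?A. co y b \<odot>\<^bsub>Y\<^esub> g b)"
      using sm[OF xy(1)] sm[OF xy(2)] by (intro Y.M.finsum_addf) auto
    also have "\<dots> = f x \<oplus>\<^bsub>Y\<^esub> f y"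
      using f[OF xy(1) A] f[OF xy(2) A] by auto
    finally show "f (x \<oplus>\<^bsub>P\<^esub> y) = f x \<oplus>\<^bsub>Y\<^esub> f y" .
  next
    fix r x assume rx: "r \<in> carrier R" "x \<in> carrier P"
    let ?A = "{b \<in> B. co x b \<noteq> \<zero>}"
    have A: "finite ?A" "?A \<subseteq> B" using co(2) rx by auto
    have "f (r \<odot>\<^bsub>P\<^esub> x) = (\<Oplus>\<^bsub>Y\<^esub>b\<in>?A. co (r \<odot>\<^bsub>P\<^esub> x) b \<odot>\<^bsub>Y\<^esub> g b)"
      using rx A co_smult[OF rx(2,1)] by (intro f) auto
    also have "\<dots> = (\<Oplus>\<^bsub>Y\<^esub>b\<in>?A. r \<odot>\<^bsub>Y\<^esub> (co x b \<odot>\<^bsub>Y\<^esub> g b))"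
      using rx A co_smult[OF rx(2,1)] coR gY sm by (intro Y.M.finsum_cong') (auto simp: Y.smult_assoc1)
    also have "\<dots> = r \<odot>\<^bsub>Y\<^esub> f x"
      unfolding f_def using sm[OF rx(2)] A(1) by (intro Y.finsum_smult_ldistr[symmetric] rx) auto
    finally show "f (r \<odot>\<^bsub>P\<^esub> x) = r \<odot>\<^bsub>Y\<^esub> f x" .
  next
    fix x j assume x: "x \<in> mgrade P j"
    show "f x \<in> mgrade Y (j + a)" unfolding f_def
    proof (rule Y.mgrade_finsum)
      fix b assume b: "b \<in> {b \<in> B. co x b \<noteq> \<zero>}"
      then obtain i where i: "b \<in> mgrade P i" using B by (auto simp: hbasis_def)
      have "co x b \<in> rgrade R (j - i)" using co_grade[OF x _ i] b by blast
      from Y.mgrade_smult[OF this g[OF _ i]] b show "co x b \<odot>\<^bsub>Y\<^esub> g b \<in> mgrade Y (j + a)" by simp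
    qed
  qed (rule closed)
  moreover have "f b = g b" if b: "b \<in> B" for b
  proof -
    let ?c = "\<lambda>b'. if b' = b then \<one> else \<zero>"
    have bP: "b \<in> carrier P" using b BP by blast
    have co_b: "co b b' = ?c b'" if "b' \<in> B" for b'
      by (rule uniq[OF bP _ _ _ _ _ that, of "{b}"]) (use b bP in \<open>auto simp: P.lincomb_def\<close>)
    have "f b = (\<Oplus>\<^bsub>Y\<^esub>b'\<in>{b}. co b b' \<odot>\<^bsub>Y\<^esub> g b')"
      using b bP co_b by (intro f) (auto split: if_splits)
    then show ?thesis using co_b[OF b] gY[OF b] by simp
  qed
  ultimately show ?thesis by blast
qed

text \<open>Prescribe homogeneous preimages of the right degree on a homogeneous basis.\<close>

lemma projective_lift:
  assumes P: "graded_free R P" and Y: "graded_module R Y" and Z: "graded_module R Z"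
    and u: "ghom R a P Z u" and \<delta>: "ghom R 0 Y Z \<delta>"
    and im: "\<And>x. x \<in> carrier P \<Longrightarrow> u x \<in> \<delta> ` carrier Y"
  shows "\<exists>f. ghom R a P Y f \<and> (\<forall>x\<in>carrier P. \<delta> (f x) = u x)"
proof -
  obtain B where gP: "graded_module R P" and B: "hbasis P B" using P graded_free_iff by blast
  interpret P: graded_module R P by fact
  interpret Y: graded_module R Y by fact
  interpret Z: graded_module R Z by fact
  have BP: "B \<subseteq> carrier P" using B P.mgrade_carrier by (auto simp: hbasis_def)
  have indep: "P.lin_indpt B" and span: "P.span B = carrier P" using B by (auto simp: hbasis_def)
  have "\<forall>b\<in>B. \<exists>y. (\<forall>j. b \<in> mgrade P j \<longrightarrow> y \<in> mgrade Y (j + a)) \<and> \<delta> y = u b"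
  proof
    fix b assume b: "b \<in> B"
    obtain j where j: "b \<in> mgrade P j" using B b by (auto simp: hbasis_def)
    have "b \<noteq> \<zero>\<^bsub>P\<^esub>" using P.zero_nin_lin_indpt[OF BP indep] b one_neq_zero by auto
    then have uj: "i = j" if "b \<in> mgrade P i" for i
      using P.gcomp_homogeneous[OF that, of i] P.gcomp_homogeneous[OF j, of i] by (auto split: if_splits)
    obtain y where y: "y \<in> carrier Y" "\<delta> y = u b" using im[of b] b BP by force
    have "\<delta> (gcomp Y (j + a) y) = gcomp Z (j + a) (u b)"
      using gcomp_ghom[OF Y Z \<delta> y(1), of "j + a"] y(2) by simp
    also have "\<dots> = u b" using Z.gcomp_homogeneous[OF ghom_grade[OF u j]] by simp
    finally show "\<exists>y. (\<forall>j. b \<in> mgrade P j \<longrightarrow> y \<in> mgrade Y (j + a)) \<and> \<delta> y = u b"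
      using uj Y.gcomp_spec(1)[OF y(1)] by blast
  qed
  from bchoice[OF this] obtain g where g: "\<And>b j. b \<in> B \<Longrightarrow> b \<in> mgrade P j \<Longrightarrow> g b \<in> mgrade Y (j + a)" "\<And>b. b \<in> B \<Longrightarrow> \<delta> (g b) = u b"
    by blast
  obtain f where f: "ghom R a P Y f" "\<And>b. b \<in> B \<Longrightarrow> f b = g b"
    using free_extension[OF gP B Y, of g a] g(1) by blast
  have "\<delta> (f x) = u x" if "x \<in> carrier P" for x
    by (rule ghom_eq_on_span[OF gP Z ghom_comp[OF \<delta> f(1) refl] u BP span _ that]) (simp add: f(2) g(2))
  with f(1) show ?thesis by blast
qed

end

section \<open>Lifting along free resolutions\<close>

lemma abelian_group_uminus_zero:
  assumes "abelian_group G" shows "\<ominus>\<^bsub>G\<^esub> \<zero>\<^bsub>G\<^esub> = \<zero>\<^bsub>G\<^esub>"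
proof -
  interpret abelian_group G by fact
  show ?thesis using r_neg[OF zero_closed] by simp
qed

context connected_algebra
begin

text \<open>The recursion common to comparison maps, homotopies and maps to a cone: the map in step \<open>Suc n\<close> lifts
the difference of the map in step \<open>n\<close> after the differential and the correction \<open>t\<close>. This difference is a cycle,
hence a boundary by exactness.\<close>

lemma lift_sequence:
  fixes P :: "nat \<Rightarrow> ('r, 'p, 'y) graded_module_scheme" and Q :: "nat \<Rightarrow> ('r, 'q, 'z) graded_module_scheme"
  assumes P: "\<And>n. graded_free R (P n)" and Q: "\<And>n. graded_module R (Q n)"
    and dP: "\<And>n. ghom R 0 (P (Suc n)) (P n) (dP n)"
    and dPdP: "\<And>n x. x \<in> carrier (P (Suc (Suc n))) \<Longrightarrow> dP n (dP (Suc n) x) = \<zero>\<^bsub>P n\<^esub>"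
    and dQ: "\<And>n. ghom R 0 (Q (Suc n)) (Q n) (dQ n)"
    and exact: "\<And>n y. y \<in> carrier (Q (Suc n)) \<Longrightarrow> dQ n y = \<zero>\<^bsub>Q n\<^esub> \<Longrightarrow>
      y \<in> dQ (Suc n) ` carrier (Q (Suc (Suc n)))"
    and t: "\<And>n. ghom R a (P (Suc n)) (Q n) (t n)"
    and dt: "\<And>n x. x \<in> carrier (P (Suc (Suc n))) \<Longrightarrow> dQ n (t (Suc n) x) = \<ominus>\<^bsub>Q n\<^esub> t n (dP (Suc n) x)"
    and u0: "ghom R a (P 0) (Q 0) u0"
    and base: "\<And>x. x \<in> carrier (P (Suc 0)) \<Longrightarrow> u0 (dP 0 x) \<ominus>\<^bsub>Q 0\<^esub> t 0 x \<in> dQ 0 ` carrier (Q (Suc 0))"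
  shows "\<exists>u. u 0 = u0 \<and> (\<forall>n. ghom R a (P n) (Q n) (u n)) \<and>
    (\<forall>n. \<forall>x\<in>carrier (P (Suc n)). dQ n (u (Suc n) x) = u n (dP n x) \<ominus>\<^bsub>Q n\<^esub> t n x)"
proof -
  define good where "good n u \<longleftrightarrow> ghom R a (P n) (Q n) u \<and> (n = 0 \<longrightarrow> u = u0) \<and>
     (\<forall>x\<in>carrier (P (Suc n)). u (dP n x) \<ominus>\<^bsub>Q n\<^esub> t n x \<in> dQ n ` carrier (Q (Suc n)))" for n u
  have gP: "graded_module R (P n)" for n using P graded_free_iff by blast
  have "\<exists>u. \<forall>n. good n (u n) \<and>
      (\<forall>x\<in>carrier (P (Suc n)). dQ n (u (Suc n) x) = u n (dP n x) \<ominus>\<^bsub>Q n\<^esub> t n x)"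
  proof (rule dependent_nat_choice)
    show "\<exists>u. good 0 u" using u0 base by (auto simp: good_def)
  next
    fix u n assume u: "good n u"
    interpret Pn: graded_module R "P n" by (rule gP)
    interpret Qn: graded_module R "Q n" by (rule Q)
    interpret Qn': graded_module R "Q (Suc n)" by (rule Q)
    have gu: "ghom R a (P n) (Q n) u" using u by (simp add: good_def)
    have "\<exists>u'. ghom R a (P (Suc n)) (Q (Suc n)) u' \<and>
      (\<forall>x\<in>carrier (P (Suc n)). dQ n (u' x) = u (dP n x) \<ominus>\<^bsub>Q n\<^esub> t n x)"
      by (rule projective_lift[OF P Q Q _ dQ])
        (use u in \<open>auto simp: good_def intro!: ghom_pointwise_minus[OF Q _ t] ghom_comp[OF gu dP]\<close>)
    then obtain u' where u': "ghom R a (P (Suc n)) (Q (Suc n)) u'"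
      "\<And>x. x \<in> carrier (P (Suc n)) \<Longrightarrow> dQ n (u' x) = u (dP n x) \<ominus>\<^bsub>Q n\<^esub> t n x" by blast
    have "u' (dP (Suc n) x) \<ominus>\<^bsub>Q (Suc n)\<^esub> t (Suc n) x \<in> dQ (Suc n) ` carrier (Q (Suc (Suc n)))"
      if x: "x \<in> carrier (P (Suc (Suc n)))" for x
    proof (rule exact)
      have c: "dP (Suc n) x \<in> carrier (P (Suc n))" "u' (dP (Suc n) x) \<in> carrier (Q (Suc n))"
        "t (Suc n) x \<in> carrier (Q (Suc n))" "t n (dP (Suc n) x) \<in> carrier (Q n)"
        using x ghom_closed[OF dP] ghom_closed[OF u'(1)] ghom_closed[OF t] by auto
      then show "u' (dP (Suc n) x) \<ominus>\<^bsub>Q (Suc n)\<^esub> t (Suc n) x \<in> carrier (Q (Suc n))" by simp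
      have "dQ n (u' (dP (Suc n) x) \<ominus>\<^bsub>Q (Suc n)\<^esub> t (Suc n) x) =
          dQ n (u' (dP (Suc n) x)) \<ominus>\<^bsub>Q n\<^esub> dQ n (t (Suc n) x)"
        using c by (intro ghom_minus[OF dQ Qn'.module_axioms Qn.module_axioms])
      also have "\<dots> = (u (dP n (dP (Suc n) x)) \<ominus>\<^bsub>Q n\<^esub> t n (dP (Suc n) x)) \<ominus>\<^bsub>Q n\<^esub> (\<ominus>\<^bsub>Q n\<^esub> t n (dP (Suc n) x))"
        using u'(2)[OF c(1)] dt[OF x] by simp
      also have "\<dots> = \<zero>\<^bsub>Q n\<^esub>"
        using c(4) dPdP[OF x] ghom_zero[OF gu Pn.module_axioms Qn.module_axioms]
        by (simp add: a_minus_def Qn.M.l_neg)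
      finally show "dQ n (u' (dP (Suc n) x) \<ominus>\<^bsub>Q (Suc n)\<^esub> t (Suc n) x) = \<zero>\<^bsub>Q n\<^esub>" .
    qed
    then show "\<exists>u'. good (Suc n) u' \<and> (\<forall>x\<in>carrier (P (Suc n)). dQ n (u' x) = u (dP n x) \<ominus>\<^bsub>Q n\<^esub> t n x)"
      using u' by (intro exI[of _ u']) (auto simp: good_def)
  qed
  then obtain u where u: "\<And>n. good n (u n)"
    "\<And>n x. x \<in> carrier (P (Suc n)) \<Longrightarrow> dQ n (u (Suc n) x) = u n (dP n x) \<ominus>\<^bsub>Q n\<^esub> t n x" by blast
  have "u 0 = u0" using u(1)[of 0] by (simp add: good_def)
  moreover have "ghom R a (P n) (Q n) (u n)" for n using u(1)[of n] by (simp add: good_def)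
  ultimately show ?thesis using u(2) by blast
qed

text \<open>The homotopy is built by the recursion of lemma \<open>lift_sequence\<close>, since the part of \<open>w\<close> that it does not yet account for
is a cycle in each step.\<close>

lemma null_homotopy:
  fixes P :: "nat \<Rightarrow> ('r, 'p, 'y) graded_module_scheme" and Q :: "nat \<Rightarrow> ('r, 'q, 'z) graded_module_scheme"
  assumes P: "\<And>n. graded_free R (P n)" and Q: "\<And>n. graded_module R (Q n)"
    and dP: "\<And>n. ghom R 0 (P (Suc n)) (P n) (dP n)"
    and dPdP: "\<And>n x. x \<in> carrier (P (Suc (Suc n))) \<Longrightarrow> dP n (dP (Suc n) x) = \<zero>\<^bsub>P n\<^esub>"
    and dQ: "\<And>n. ghom R 0 (Q (Suc n)) (Q n) (dQ n)"
    and exact: "\<And>n y. y \<in> carrier (Q (Suc n)) \<Longrightarrow> dQ n y = \<zero>\<^bsub>Q n\<^esub> \<Longrightarrow>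
      y \<in> dQ (Suc n) ` carrier (Q (Suc (Suc n)))"
    and w: "\<And>n. ghom R a (P n) (Q n) (w n)"
    and dw: "\<And>n x. x \<in> carrier (P (Suc n)) \<Longrightarrow> dQ n (w (Suc n) x) = w n (dP n x)"
    and base: "\<And>x. x \<in> carrier (P 0) \<Longrightarrow> w 0 x \<in> dQ 0 ` carrier (Q (Suc 0))"
  shows "\<exists>s. (\<forall>n. ghom R a (P n) (Q (Suc n)) (s n)) \<and> (\<forall>x\<in>carrier (P 0). dQ 0 (s 0 x) = w 0 x) \<and>
    (\<forall>n. \<forall>x\<in>carrier (P (Suc n)). dQ (Suc n) (s (Suc n) x) = w (Suc n) x \<ominus>\<^bsub>Q (Suc n)\<^esub> s n (dP n x))"
proof -
  have gP: "graded_module R (P n)" for n using P graded_free_iff by blast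
  have mP: "module R (P n)" for n using gP[of n] graded_module.axioms(1) by blast
  have mQ: "module R (Q n)" for n using Q[of n] graded_module.axioms(1) by blast
  have agP: "abelian_group (P n)" for n using mP[of n] module.axioms(2) by blast
  have agQ: "abelian_group (Q n)" for n using mQ[of n] module.axioms(2) by blast
  obtain s0 where s0: "ghom R a (P 0) (Q (Suc 0)) s0" "\<And>x. x \<in> carrier (P 0) \<Longrightarrow> dQ 0 (s0 x) = w 0 x"
    using projective_lift[OF P Q Q w dQ base] by blast
  have "\<exists>u. u 0 = s0 \<and> (\<forall>n. ghom R a (P n) (Q (Suc n)) (u n)) \<and>
    (\<forall>n. \<forall>x\<in>carrier (P (Suc n)). dQ (Suc n) (u (Suc n) x) =
       u n (\<ominus>\<^bsub>P n\<^esub> dP n x) \<ominus>\<^bsub>Q (Suc n)\<^esub> (\<ominus>\<^bsub>Q (Suc n)\<^esub> w (Suc n) x))"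
  proof (rule lift_sequence[where P = P and Q = "\<lambda>n. Q (Suc n)" and dQ = "\<lambda>n. dQ (Suc n)" and dP = "\<lambda>n x. \<ominus>\<^bsub>P n\<^esub> dP n x"
        and t = "\<lambda>n x. \<ominus>\<^bsub>Q (Suc n)\<^esub> w (Suc n) x", OF P Q _ _ dQ exact _ _ s0(1)])
    show "ghom R 0 (P (Suc n)) (P n) (\<lambda>x. \<ominus>\<^bsub>P n\<^esub> dP n x)" for n
      by (rule ghom_pointwise_uminus[OF gP dP])
    show "\<ominus>\<^bsub>P n\<^esub> dP n (\<ominus>\<^bsub>P (Suc n)\<^esub> dP (Suc n) x) = \<zero>\<^bsub>P n\<^esub>" if "x \<in> carrier (P (Suc (Suc n)))" for n x
      using dPdP[OF that] ghom_uminus[OF dP mP mP, of "dP (Suc n) x" n] ghom_closed[OF dP that]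
        abelian_group.minus_minus[OF agP] abelian_group_uminus_zero[OF agP]
      by simp
    show "ghom R a (P (Suc n)) (Q (Suc n)) (\<lambda>x. \<ominus>\<^bsub>Q (Suc n)\<^esub> w (Suc n) x)" for n
      by (rule ghom_pointwise_uminus[OF Q w])
    show "dQ (Suc n) (\<ominus>\<^bsub>Q (Suc (Suc n))\<^esub> w (Suc (Suc n)) x) =
      \<ominus>\<^bsub>Q (Suc n)\<^esub> (\<ominus>\<^bsub>Q (Suc n)\<^esub> w (Suc n) (\<ominus>\<^bsub>P (Suc n)\<^esub> dP (Suc n) x))"
      if x: "x \<in> carrier (P (Suc (Suc n)))" for n x
      using ghom_uminus[OF dQ mQ mQ ghom_closed[OF w x]] dw[OF x]
        ghom_uminus[OF w mP mQ ghom_closed[OF dP x]] ghom_closed[OF w ghom_closed[OF dP x]]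
        abelian_group.minus_minus[OF agQ] abelian_group.a_inv_closed[OF agQ]
      by simp
    show "s0 (\<ominus>\<^bsub>P 0\<^esub> dP 0 x) \<ominus>\<^bsub>Q (Suc 0)\<^esub> (\<ominus>\<^bsub>Q (Suc 0)\<^esub> w (Suc 0) x) \<in> dQ (Suc 0) ` carrier (Q (Suc (Suc 0)))"
      if x: "x \<in> carrier (P (Suc 0))" for x
    proof (rule exact)
      interpret Q1: abelian_group "Q (Suc 0)" by (rule agQ)
      interpret Q0: abelian_group "Q 0" by (rule agQ)
      have c: "dP 0 x \<in> carrier (P 0)" "s0 (dP 0 x) \<in> carrier (Q (Suc 0))" "w (Suc 0) x \<in> carrier (Q (Suc 0))"
        "w 0 (dP 0 x) \<in> carrier (Q 0)"
        using x ghom_closed[OF dP x] ghom_closed[OF s0(1)] ghom_closed[OF w] by auto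
      have eq: "s0 (\<ominus>\<^bsub>P 0\<^esub> dP 0 x) \<ominus>\<^bsub>Q (Suc 0)\<^esub> (\<ominus>\<^bsub>Q (Suc 0)\<^esub> w (Suc 0) x) = w (Suc 0) x \<ominus>\<^bsub>Q (Suc 0)\<^esub> s0 (dP 0 x)"
        using c ghom_uminus[OF s0(1) mP mQ c(1)] by (simp add: a_minus_def Q1.a_comm)
      show "s0 (\<ominus>\<^bsub>P 0\<^esub> dP 0 x) \<ominus>\<^bsub>Q (Suc 0)\<^esub> (\<ominus>\<^bsub>Q (Suc 0)\<^esub> w (Suc 0) x) \<in> carrier (Q (Suc 0))"
        unfolding eq using c by simp
      show "dQ 0 (s0 (\<ominus>\<^bsub>P 0\<^esub> dP 0 x) \<ominus>\<^bsub>Q (Suc 0)\<^esub> (\<ominus>\<^bsub>Q (Suc 0)\<^esub> w (Suc 0) x)) = \<zero>\<^bsub>Q 0\<^esub>"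
        unfolding eq using c ghom_minus[OF dQ mQ mQ c(3,2)] dw[OF x] s0(2)[OF c(1)]
        by (simp add: a_minus_def Q0.r_neg)
    qed
  qed
  then obtain u where u: "u 0 = s0" "\<And>n. ghom R a (P n) (Q (Suc n)) (u n)"
    "\<And>n x. x \<in> carrier (P (Suc n)) \<Longrightarrow> dQ (Suc n) (u (Suc n) x) =
       u n (\<ominus>\<^bsub>P n\<^esub> dP n x) \<ominus>\<^bsub>Q (Suc n)\<^esub> (\<ominus>\<^bsub>Q (Suc n)\<^esub> w (Suc n) x)" by blast
  have "dQ (Suc n) (u (Suc n) x) = w (Suc n) x \<ominus>\<^bsub>Q (Suc n)\<^esub> u n (dP n x)" if x: "x \<in> carrier (P (Suc n))" for n x
  proof -
    interpret Q: abelian_group "Q (Suc n)" by (rule agQ)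
    have "dP n x \<in> carrier (P n)" "u n (dP n x) \<in> carrier (Q (Suc n))" "w (Suc n) x \<in> carrier (Q (Suc n))"
      using x ghom_closed[OF dP x] ghom_closed[OF u(2)] ghom_closed[OF w] by auto
    with u(3)[OF x] ghom_uminus[OF u(2) mP mQ, of "dP n x" n] show ?thesis
      by (simp add: a_minus_def Q.a_comm)
  qed
  with u s0(2) show ?thesis by (intro exI[of _ u]) auto
qed

lemma free_resolutionD:
  assumes "free_resolution R N F \<delta> \<epsilon>"
  shows "graded_free R (F n)" "graded_module R (F n)" "ghom R 0 (F 0) N \<epsilon>" "ghom R 0 (F (Suc n)) (F n) (\<delta> n)"
    "\<epsilon> ` carrier (F 0) = carrier N"
    "x \<in> carrier (F (Suc 0)) \<Longrightarrow> \<epsilon> (\<delta> 0 x) = \<zero>\<^bsub>N\<^esub>"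
    "y \<in> carrier (F (Suc (Suc n))) \<Longrightarrow> \<delta> n (\<delta> (Suc n) y) = \<zero>\<^bsub>F n\<^esub>"
    "x' \<in> carrier (F 0) \<Longrightarrow> \<epsilon> x' = \<zero>\<^bsub>N\<^esub> \<Longrightarrow> x' \<in> \<delta> 0 ` carrier (F (Suc 0))"
    "y' \<in> carrier (F (Suc n)) \<Longrightarrow> \<delta> n y' = \<zero>\<^bsub>F n\<^esub> \<Longrightarrow> y' \<in> \<delta> (Suc n) ` carrier (F (Suc (Suc n)))"
proof -
  have ex: "\<delta> 0 ` carrier (F (Suc 0)) = {x \<in> carrier (F 0). \<epsilon> x = \<zero>\<^bsub>N\<^esub>}"
    "\<And>i. \<delta> (Suc i) ` carrier (F (Suc (Suc i))) = {x \<in> carrier (F (Suc i)). \<delta> i x = \<zero>\<^bsub>F i\<^esub>}"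
    using assms by (simp_all add: free_resolution_def)
  show "x \<in> carrier (F (Suc 0)) \<Longrightarrow> \<epsilon> (\<delta> 0 x) = \<zero>\<^bsub>N\<^esub>"
    and "x' \<in> carrier (F 0) \<Longrightarrow> \<epsilon> x' = \<zero>\<^bsub>N\<^esub> \<Longrightarrow> x' \<in> \<delta> 0 ` carrier (F (Suc 0))"
    using ex(1) by blast+
  show "y \<in> carrier (F (Suc (Suc n))) \<Longrightarrow> \<delta> n (\<delta> (Suc n) y) = \<zero>\<^bsub>F n\<^esub>"
    and "y' \<in> carrier (F (Suc n)) \<Longrightarrow> \<delta> n y' = \<zero>\<^bsub>F n\<^esub> \<Longrightarrow> y' \<in> \<delta> (Suc n) ` carrier (F (Suc (Suc n)))"
    using ex(2)[of n] by blast+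
  show "graded_free R (F n)" "graded_module R (F n)" "ghom R 0 (F 0) N \<epsilon>" "ghom R 0 (F (Suc n)) (F n) (\<delta> n)"
    "\<epsilon> ` carrier (F 0) = carrier N"
    using assms by (auto simp: free_resolution_def ghom_def graded_free_def image_subset_iff)
qed

lemma comparison_map:
  assumes F: "\<And>n. graded_free R (F n)" "\<And>n. ghom R 0 (F (Suc n)) (F n) (\<delta> n)"
      "\<And>n x. x \<in> carrier (F (Suc (Suc n))) \<Longrightarrow> \<delta> n (\<delta> (Suc n) x) = \<zero>\<^bsub>F n\<^esub>"
    and G: "free_resolution R N G \<gamma> \<eta>" and N: "graded_module R N"
    and f: "ghom R a (F 0) N f" "\<And>x. x \<in> carrier (F (Suc 0)) \<Longrightarrow> f (\<delta> 0 x) = \<zero>\<^bsub>N\<^esub>"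
  shows "\<exists>u. (\<forall>n. ghom R a (F n) (G n) (u n)) \<and> (\<forall>x\<in>carrier (F 0). \<eta> (u 0 x) = f x) \<and>
    (\<forall>n. \<forall>x\<in>carrier (F (Suc n)). \<gamma> n (u (Suc n) x) = u n (\<delta> n x))"
proof -
  note G = free_resolutionD[OF G]
  have mG: "module R (G n)" for n using G(2)[of n] graded_module.axioms(1) by blast
  have agG: "abelian_group (G n)" for n using mG[of n] module.axioms(2) by blast
  obtain u0 where u0: "ghom R a (F 0) (G 0) u0" "\<And>x. x \<in> carrier (F 0) \<Longrightarrow> \<eta> (u0 x) = f x"
    using projective_lift[OF F(1) G(2) N f(1) G(3)] G(5) ghom_closed[OF f(1)] by blast
  have "\<exists>u. u 0 = u0 \<and> (\<forall>n. ghom R a (F n) (G n) (u n)) \<and>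
    (\<forall>n. \<forall>x\<in>carrier (F (Suc n)). \<gamma> n (u (Suc n) x) = u n (\<delta> n x) \<ominus>\<^bsub>G n\<^esub> \<zero>\<^bsub>G n\<^esub>)"
  proof (rule lift_sequence[where P = F and Q = G and dP = \<delta> and dQ = \<gamma> and t = "\<lambda>n x. \<zero>\<^bsub>G n\<^esub>", OF F(1) G(2) F(2) F(3) G(4) G(9) _ _ u0(1)])
    show "ghom R a (F (Suc n)) (G n) (\<lambda>x. \<zero>\<^bsub>G n\<^esub>)" for n by (rule ghom_const_zero[OF G(2)])
    show "\<gamma> n \<zero>\<^bsub>G (Suc n)\<^esub> = \<ominus>\<^bsub>G n\<^esub> \<zero>\<^bsub>G n\<^esub>" for n
      using ghom_zero[OF G(4) mG mG] abelian_group_uminus_zero[OF agG] by simp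
    show "u0 (\<delta> 0 x) \<ominus>\<^bsub>G 0\<^esub> \<zero>\<^bsub>G 0\<^esub> \<in> \<gamma> 0 ` carrier (G (Suc 0))" if x: "x \<in> carrier (F (Suc 0))" for x
    proof -
      interpret G0: abelian_group "G 0" by (rule agG)
      have "u0 (\<delta> 0 x) \<in> \<gamma> 0 ` carrier (G (Suc 0))"
        using x ghom_closed[OF u0(1)] ghom_closed[OF F(2)] u0(2) f(2) by (intro G(8)) auto
      moreover have "u0 (\<delta> 0 x) \<in> carrier (G 0)" using x ghom_closed[OF u0(1)] ghom_closed[OF F(2)] by auto
      ultimately show ?thesis by (simp add: a_minus_def abelian_group_uminus_zero[OF agG])
    qed
  qed
  then obtain u where u: "u 0 = u0" "\<And>n. ghom R a (F n) (G n) (u n)"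
    "\<And>n x. x \<in> carrier (F (Suc n)) \<Longrightarrow> \<gamma> n (u (Suc n) x) = u n (\<delta> n x) \<ominus>\<^bsub>G n\<^esub> \<zero>\<^bsub>G n\<^esub>" by blast
  have "\<gamma> n (u (Suc n) x) = u n (\<delta> n x)" if x: "x \<in> carrier (F (Suc n))" for n x
  proof -
    interpret Gn: abelian_group "G n" by (rule agG)
    have "u n (\<delta> n x) \<in> carrier (G n)" using x ghom_closed[OF u(2)] ghom_closed[OF F(2)] by auto
    then show ?thesis using u(3)[OF x] by (simp add: a_minus_def abelian_group_uminus_zero[OF agG])
  qed
  with u u0(2) show ?thesis by (intro exI[of _ u]) auto
qed

section \<open>The residue field\<close>

abbreviation rc :: "int \<Rightarrow> 'r \<Rightarrow> 'r" where "rc \<equiv> gcomp (regular_module R)"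

lemma scalar_grade [simp]: "scalar R c \<in> rgrade R 0" by (simp add: rgrade_0)

lemma scalar_carrier [simp]: "scalar R c \<in> carrier R" using RM.mgrade_carrier scalar_grade by blast

lemma scalar_zero [simp]: "scalar R 0 = \<zero>"
proof -
  have "scalar R 0 \<oplus> scalar R 0 = scalar R 0" using scalar_add[of 0 0] by simp
  then show ?thesis by (metis R.add.r_cancel_one scalar_carrier)
qed

lemma scalar_eq_iff [simp]: "scalar R a = scalar R b \<longleftrightarrow> a = b"
proof
  assume eq: "scalar R a = scalar R b"
  have "scalar R (a - b) \<oplus> scalar R b = scalar R b"
    using scalar_add[of "a - b" b] eq by simp
  then have 0: "scalar R (a - b) = \<zero>" by (metis R.add.r_cancel_one' R.add.r_cancel_one scalar_carrier)
  show "a = b"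
  proof (rule ccontr)
    assume "a \<noteq> b"
    then have "\<one> = scalar R (a - b) \<otimes> scalar R (inverse (a - b))"
      using scalar_mult[of "a - b" "inverse (a - b)"] scalar_one by simp
    with 0 one_neq_zero show False by simp
  qed
qed simp

text \<open>The augmentation \<open>R \<rightarrow> k\<close>: the component of degree \<open>0\<close>, read as a scalar.\<close>

definition aug :: "'r \<Rightarrow> 'k" where "aug r = (THE c. scalar R c = rc 0 r)"

lemma scalar_aug:
  assumes "r \<in> carrier R" shows "scalar R (aug r) = rc 0 r"
proof -
  have "rc 0 r \<in> range (scalar R)" using RM.gcomp_spec(1)[of r 0] assms rgrade_0 by simp
  then obtain c where "rc 0 r = scalar R c" by blast
  then show ?thesis unfolding aug_def by simp
qed

lemma aug_eqI: "r \<in> carrier R \<Longrightarrow> rc 0 r = scalar R c \<Longrightarrow> aug r = c"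
  using scalar_aug by (metis scalar_eq_iff)

lemma aug_scalar [simp]: "aug (scalar R c) = c"
  by (rule aug_eqI) (simp_all add: RM.gcomp_homogeneous[OF scalar_grade])

lemma aug_zero [simp]: "aug \<zero> = 0" using aug_scalar[of 0] by simp

lemma aug_one [simp]: "aug \<one> = 1" using aug_scalar[of 1] by (simp add: scalar_one)

lemma aug_homogeneous: "r \<in> rgrade R j \<Longrightarrow> j \<noteq> 0 \<Longrightarrow> aug r = 0"
  using RM.gcomp_homogeneous[of r j 0] RM.mgrade_carrier by (intro aug_eqI) auto

lemma aug_add:
  assumes "r \<in> carrier R" "s \<in> carrier R" shows "aug (r \<oplus> s) = aug r + aug s"
  using assms scalar_aug[of r] scalar_aug[of s]
  by (intro aug_eqI) (simp_all add: RM.gcomp_add scalar_add)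

lemma aug_mult:
  assumes r: "r \<in> carrier R" and s: "s \<in> carrier R" shows "aug (r \<otimes> s) = aug r * aug s"
  using r
proof (induction rule: RM.homogeneous_induct)
  case zero
  then show ?case using s by simp
next
  case (add x y j)
  have y: "y \<in> carrier R" using add RM.mgrade_carrier by blast
  have "ghom R j (regular_module R) (regular_module R) (\<lambda>s. y \<otimes> s)"
  proof (rule ghomI)
    show "y \<otimes> x \<in> mgrade (regular_module R) (i + j)" if "x \<in> mgrade (regular_module R) i" for x i
      using RM.mgrade_smult[OF add.hyps(2), of x i] that by (simp add: add.commute)
  qed (use y R.m_lcomm in \<open>auto simp: R.r_distr\<close>)
  from gcomp_ghom[OF regular regular this, of s "- j"] s
  have "rc 0 (y \<otimes> s) = y \<otimes> rc (- j) s" by simp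
  also have "\<dots> = scalar R (aug y * aug s)"
  proof (cases "j = 0")
    case True
    then have "y = scalar R (aug y)" using scalar_aug[OF y] RM.gcomp_homogeneous[OF add.hyps(2)] by simp
    then have "y \<otimes> rc 0 s = scalar R (aug y) \<otimes> scalar R (aug s)" using scalar_aug[OF s] by simp
    then show ?thesis using True by (simp add: scalar_mult)
  next
    case False
    have "y = \<zero> \<or> rc (- j) s = \<zero>"
      using rgrade_neg[of j] add.hyps(2) rgrade_neg[of "- j"] RM.gcomp_spec(1)[of s "- j"] s False
      by (cases "j < 0") auto
    then show ?thesis using aug_homogeneous[OF add.hyps(2) False] y s by auto
  qed
  finally have "aug (y \<otimes> s) = aug y * aug s" using y s by (intro aug_eqI) auto
  then show ?case using add y s by (simp add: R.l_distr aug_add algebra_simps)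
qed

lemma X_carrier: "i < e \<Longrightarrow> X i \<in> carrier R" using X_grade RM.mgrade_carrier by blast

lemma aug_X: "i < e \<Longrightarrow> aug (X i) = 0"
  using aug_homogeneous[OF X_grade] d_pos[of i] by auto

lemma \<mm>_ideal: "ideal \<mm> R"
  unfolding \<mm>_def by (rule R.genideal_ideal) (use X_carrier in auto)

lemma aug_uminus: "r \<in> carrier R \<Longrightarrow> aug (\<ominus> r) = - aug r"
  using aug_add[of r "\<ominus> r"] R.r_neg[of r] by (simp add: eq_neg_iff_add_eq_0 add.commute)

lemma aug_kernel_ideal: "ideal {r \<in> carrier R. aug r = 0} R"
proof (rule idealI)
  show "subgroup {r \<in> carrier R. aug r = 0} (add_monoid R)"
    by (rule R.add.subgroupI) (auto simp: aug_add aug_uminus aug_mult a_inv_def[symmetric] intro!: exI[of _ "\<zero>"])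
qed (auto simp: aug_mult R.ring_axioms)

text \<open>The ideal generated by the variables is the kernel of the augmentation, because the components of
nonzero degree of a ring element lie in it.\<close>

lemma in_\<mm>_iff: "r \<in> \<mm> \<longleftrightarrow> r \<in> carrier R \<and> aug r = 0"
proof
  assume "r \<in> \<mm>"
  moreover have "\<mm> \<subseteq> {r \<in> carrier R. aug r = 0}"
    unfolding \<mm>_def by (rule R.genideal_minimal[OF aug_kernel_ideal]) (use X_carrier aug_X in auto)
  ultimately show "r \<in> carrier R \<and> aug r = 0" by blast
next
  assume r: "r \<in> carrier R \<and> aug r = 0"
  interpret \<mm>: ideal \<mm> R by (rule \<mm>_ideal)
  have j: "rc j r \<in> \<mm>" for j
  proof -
    have "rc j r \<in> rgrade R j" using RM.gcomp_spec(1) r by blast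
    moreover have "rc 0 r = \<zero>" using scalar_aug[of r] r by simp
    ultimately show ?thesis
      using rgrade_pos[of j] rgrade_neg[of j] \<mm>.zero_closed by (cases j "0 :: int" rule: linorder_cases) auto
  qed
  have "(\<Oplus>j\<in>S. rc j r) \<in> \<mm>" if "finite S" for S using that
  proof (induction S rule: finite_induct)
    case (insert x F)
    then show ?case using j r by simp
  qed simp
  from this[OF RM.gcomp_spec(2)[of r]] RM.gcomp_spec(3)[of r] r show "r \<in> \<mm>" by simp
qed

abbreviation kk :: "('r, 'r set) graded_module" where "kk \<equiv> quot_graded_module (regular_module R) \<mm>"

text \<open>The element of the residue field \<open>R/\<mm>\<close>, as a coset, that is given by the scalar \<open>c\<close>.\<close>

definition kinj :: "'k \<Rightarrow> 'r set" where "kinj c = {s \<in> carrier R. aug s = c}"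

lemma kinj_eq_iff [simp]: "kinj a = kinj b \<longleftrightarrow> a = b"
  using aug_scalar scalar_carrier unfolding kinj_def by (metis (mono_tags, lifting) mem_Collect_eq)

lemma coset_kinj:
  assumes r: "r \<in> carrier R" shows "\<mm> +>\<^bsub>regular_module R\<^esub> r = kinj (aug r)"
proof -
  have "s \<in> (\<Union>h\<in>\<mm>. {h \<oplus> r})" if "s \<in> carrier R" "aug s = aug r" for s
  proof (rule UN_I)
    show "s \<ominus> r \<in> \<mm>" using that r by (auto simp: in_\<mm>_iff a_minus_def aug_add aug_uminus)
    show "s \<in> {s \<ominus> r \<oplus> r}" using that r by (simp add: a_minus_def R.a_assoc R.l_neg)
  qed
  moreover have "s \<in> carrier R \<and> aug s = aug r" if "s \<in> (\<Union>h\<in>\<mm>. {h \<oplus> r})" for s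
    using that r by (auto simp: in_\<mm>_iff aug_add)
  ultimately have "(\<Union>h\<in>\<mm>. {h \<oplus> r}) = kinj (aug r)" unfolding kinj_def by blast
  then show ?thesis by (simp add: a_r_coset_def')
qed

lemma kk_simps:
  "carrier kk = range kinj" "\<zero>\<^bsub>kk\<^esub> = kinj 0" "kinj a \<oplus>\<^bsub>kk\<^esub> kinj b = kinj (a + b)"
  "r \<in> carrier R \<Longrightarrow> r \<odot>\<^bsub>kk\<^esub> kinj a = kinj (aug r * a)"
  "mgrade kk j = (if j = 0 then range kinj else {kinj 0})"
proof -
  have sel: "carrier kk = a_rcosets\<^bsub>regular_module R\<^esub> \<mm>" "\<zero>\<^bsub>kk\<^esub> = \<mm>" "add kk = set_add (regular_module R)"
    "module.smult kk = (\<lambda>r X. \<Union>x\<in>X. \<mm> +>\<^bsub>regular_module R\<^esub> (r \<otimes> x))"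
    "mgrade kk = (\<lambda>j. (\<lambda>x. \<mm> +>\<^bsub>regular_module R\<^esub> x) ` rgrade R j)"
    by (simp_all add: quot_graded_module_def quot_module_def module.defs graded_module.defs)
  have "c \<in> aug ` carrier R" for c by (rule image_eqI[of _ _ "scalar R c"]) simp_all
  then have surj: "range kinj = kinj ` aug ` carrier R" by blast
  show "carrier kk = range kinj"
    unfolding sel A_RCOSETS_def' surj using coset_kinj by auto
  show "\<zero>\<^bsub>kk\<^esub> = kinj 0" by (auto simp: sel kinj_def in_\<mm>_iff)
  show "kinj a \<oplus>\<^bsub>kk\<^esub> kinj b = kinj (a + b)"
  proof -
    have "s \<in> (\<Union>h\<in>kinj a. \<Union>k\<in>kinj b. {h \<oplus> k})" if "s \<in> kinj (a + b)" for s
    proof (intro UN_I)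
      show "s \<ominus> scalar R b \<in> kinj a" using that by (auto simp: kinj_def a_minus_def aug_add aug_uminus)
      show "scalar R b \<in> kinj b" by (simp add: kinj_def)
      show "s \<in> {s \<ominus> scalar R b \<oplus> scalar R b}" using that by (simp add: kinj_def a_minus_def R.a_assoc R.l_neg)
    qed
    then show ?thesis by (auto simp: sel set_add_def' kinj_def aug_add)
  qed
  show "r \<odot>\<^bsub>kk\<^esub> kinj a = kinj (aug r * a)" if r: "r \<in> carrier R"
  proof -
    have "\<mm> +>\<^bsub>regular_module R\<^esub> (r \<otimes> x) = kinj (aug r * a)" if "x \<in> kinj a" for x
      using coset_kinj[of "r \<otimes> x"] that r by (simp add: kinj_def aug_mult)
    moreover have "scalar R a \<in> kinj a" by (simp add: kinj_def)
    ultimately show ?thesis by (auto simp: sel)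
  qed
  show "mgrade kk j = (if j = 0 then range kinj else {kinj 0})"
  proof -
    have "mgrade kk j = (\<lambda>r. kinj (aug r)) ` rgrade R j"
      unfolding sel using coset_kinj RM.mgrade_carrier by (intro image_cong) auto
    also have "\<dots> = (if j = 0 then range kinj else {kinj 0})"
    proof (cases "j = 0")
      case False
      have "(\<lambda>r. kinj (aug r)) ` rgrade R j = (\<lambda>r. kinj 0) ` rgrade R j"
        by (rule image_cong) (simp_all add: aug_homogeneous[OF _ False])
      also have "\<dots> = {kinj 0}" by (rule image_constant[OF RM.mgrade_zero])
      finally show ?thesis using False by simp
    qed (simp add: rgrade_0 image_image)
    finally show ?thesis .
  qed
qed

lemma kk_module: "module R kk"
proof (rule moduleI)
  show "abelian_group kk"
  proof (rule abelian_groupI)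
    show "\<exists>y\<in>carrier kk. y \<oplus>\<^bsub>kk\<^esub> x = \<zero>\<^bsub>kk\<^esub>" if x: "x \<in> carrier kk" for x
    proof -
      obtain a where "x = kinj a" using x kk_simps by auto
      then show ?thesis by (intro bexI[of _ "kinj (- a)"]) (auto simp: kk_simps)
    qed
  qed (auto simp: kk_simps ac_simps)
qed (auto simp: kk_simps R_cring aug_add aug_mult ring_distribs mult.assoc)

lemma kk_graded: "graded_module R kk"
proof (rule graded_moduleI[where p = "\<lambda>j x. if j = 0 then x else kinj 0"])
  interpret kk: module R kk by (rule kk_module)
  show "subgroup (mgrade kk j) (add_monoid kk)" for j
  proof -
    have "\<ominus>\<^bsub>kk\<^esub> kinj a = kinj (- a)" for a by (rule kk.M.minus_equality) (auto simp: kk_simps)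
    then show ?thesis by (intro kk.M.add.subgroupI) (auto simp: kk_simps split: if_splits)
  qed
  show "\<exists>S :: int set. finite S \<and> (\<forall>j. j \<notin> S \<longrightarrow> (if j = 0 then x else kinj 0) = \<zero>\<^bsub>kk\<^esub>) \<and>
      x = (\<Oplus>\<^bsub>kk\<^esub>j\<in>S. if j = 0 then x else kinj 0)" if "x \<in> carrier kk" for x
    using that by (intro exI[of _ "{0 :: int}"]) (auto simp: kk_simps)
  show "r \<odot>\<^bsub>kk\<^esub> x \<in> mgrade kk (i + j)" if "r \<in> rgrade R i" "x \<in> mgrade kk j" for r x i j
    using that(2) RM.mgrade_carrier[OF that(1)] aug_homogeneous[OF that(1)]
    by (auto simp: kk_simps split: if_splits)
qed (auto simp: kk_simps kk_module split: if_splits)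

text \<open>Homogeneous homomorphisms to the residue field, with scalars as values. The ring acts on scalars through the
augmentation, and a functional of degree \<open>a\<close> sees only the part of degree \<open>a\<close>.\<close>

definition kfun :: "('r, 'm, 'y) graded_module_scheme \<Rightarrow> int \<Rightarrow> ('m \<Rightarrow> 'k) \<Rightarrow> bool"
  where "kfun Y a f \<longleftrightarrow> (\<forall>x\<in>carrier Y. \<forall>y\<in>carrier Y. f (x \<oplus>\<^bsub>Y\<^esub> y) = f x + f y) \<and>
    (\<forall>r\<in>carrier R. \<forall>x\<in>carrier Y. f (r \<odot>\<^bsub>Y\<^esub> x) = aug r * f x) \<and>
    (\<forall>n. n \<noteq> a \<longrightarrow> (\<forall>x\<in>mgrade Y n. f x = 0))"

lemma kfunD:
  assumes "kfun Y a f"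
  shows kfun_add: "x \<in> carrier Y \<Longrightarrow> y \<in> carrier Y \<Longrightarrow> f (x \<oplus>\<^bsub>Y\<^esub> y) = f x + f y"
    and kfun_smult: "r \<in> carrier R \<Longrightarrow> x \<in> carrier Y \<Longrightarrow> f (r \<odot>\<^bsub>Y\<^esub> x) = aug r * f x"
    and kfun_grade: "x \<in> mgrade Y n \<Longrightarrow> n \<noteq> a \<Longrightarrow> f x = 0"
  using assms by (auto simp: kfun_def)

lemma kfun_X: "kfun Y a f \<Longrightarrow> i < e \<Longrightarrow> x \<in> carrier Y \<Longrightarrow> f (X i \<odot>\<^bsub>Y\<^esub> x) = 0"
  using kfun_smult[of Y a f "X i" x] by (simp add: X_carrier aug_X)

lemma kfun_zero:
  assumes "kfun Y a f" "module R Y" shows "f \<zero>\<^bsub>Y\<^esub> = 0"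
proof -
  interpret module R Y by fact
  have "f (\<zero> \<odot>\<^bsub>Y\<^esub> \<zero>\<^bsub>Y\<^esub>) = aug \<zero> * f \<zero>\<^bsub>Y\<^esub>" by (rule kfun_smult[OF assms(1)]) auto
  then show ?thesis by simp
qed

lemma kfun_uminus:
  assumes "kfun Y a f" "module R Y" "x \<in> carrier Y" shows "f (\<ominus>\<^bsub>Y\<^esub> x) = - f x"
proof -
  interpret module R Y by fact
  have "f (x \<oplus>\<^bsub>Y\<^esub> \<ominus>\<^bsub>Y\<^esub> x) = f x + f (\<ominus>\<^bsub>Y\<^esub> x)" by (rule kfun_add[OF assms(1)]) (use assms in auto)
  then show ?thesis using assms(3) kfun_zero[OF assms(1,2)] by (simp add: M.r_neg eq_neg_iff_add_eq_0 add.commute)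
qed

lemma kfun_minus:
  assumes "kfun Y a f" "module R Y" "x \<in> carrier Y" "y \<in> carrier Y" shows "f (x \<ominus>\<^bsub>Y\<^esub> y) = f x - f y"
proof -
  interpret module R Y by fact
  show ?thesis using assms by (simp add: a_minus_def kfun_add[OF assms(1)] kfun_uminus[OF assms(1,2)])
qed

lemma kfun_finsum:
  assumes "kfun Y a f" "module R Y" "\<And>i. i \<in> S \<Longrightarrow> g i \<in> carrier Y"
  shows "f (\<Oplus>\<^bsub>Y\<^esub>i\<in>S. g i) = (\<Sum>i\<in>S. f (g i))"
proof -
  interpret module R Y by fact
  show ?thesis using assms(3)
  proof (induction S rule: infinite_finite_induct)
    case (insert x F)
    then have "g \<in> F \<rightarrow> carrier Y" "g x \<in> carrier Y" "finsum Y g F \<in> carrier Y" by (auto intro: M.finsum_closed)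
    with insert show ?case by (simp add: kfun_add[OF assms(1)])
  qed (simp_all add: kfun_zero[OF assms(1,2)])
qed

lemma kfun_comp:
  assumes "kfun Y b f" "ghom R a Z Y g" "c = b - a"
  shows "kfun Z c (\<lambda>x. f (g x))"
proof -
  have "f (g x) = 0" if "n \<noteq> c" "x \<in> mgrade Z n" for n x
    using kfun_grade[OF assms(1) ghom_grade[OF assms(2) that(2)]] that(1) assms(3) by simp
  then show ?thesis using ghomD[OF assms(2)] kfunD[OF assms(1)] by (auto simp: kfun_def)
qed

lemma kfun_zero_fun: "kfun Y a (\<lambda>_. 0)" by (simp add: kfun_def)

lemma kfun_plus: "kfun Y a f \<Longrightarrow> kfun Y a g \<Longrightarrow> kfun Y a (\<lambda>x. f x + g x)"
  by (simp add: kfun_def ring_distribs algebra_simps)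

lemma kfun_scale: "kfun Y a f \<Longrightarrow> kfun Y a (\<lambda>x. c * f x)"
  by (simp add: kfun_def ring_distribs mult.left_commute)

lemma kfun_sum: "(\<And>i. i \<in> S \<Longrightarrow> kfun Y a (f i)) \<Longrightarrow> kfun Y a (\<lambda>x. \<Sum>i\<in>S. f i x)"
  by (induction S rule: infinite_finite_induct) (simp_all add: kfun_zero_fun kfun_plus)

lemma kfun_imp_ghom: "kfun Y a f \<Longrightarrow> ghom R (- a) Y kk (\<lambda>x. kinj (f x))"
  by (rule ghomI) (auto simp: kk_simps kfunD)

lemma ghom_imp_kfun:
  assumes g: "ghom R (- a) Y kk g" and Y: "graded_module R Y"
  obtains f where "kfun Y a f" "\<And>x. x \<in> carrier Y \<Longrightarrow> g x = kinj (f x)"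
proof -
  interpret Y: graded_module R Y by fact
  have "\<forall>x\<in>carrier Y. \<exists>c. g x = kinj c"
  proof
    fix x assume "x \<in> carrier Y"
    from ghom_closed[OF g this] have "g x \<in> range kinj" unfolding kk_simps(1) .
    then show "\<exists>c. g x = kinj c" by (elim rangeE exI)
  qed
  then obtain f where "\<forall>x\<in>carrier Y. g x = kinj (f x)" by (elim bchoice[THEN exE])
  then have f: "\<And>x. x \<in> carrier Y \<Longrightarrow> g x = kinj (f x)" by (rule bspec)
  have "kfun Y a f" unfolding kfun_def
  proof (intro conjI ballI allI impI)
    fix x y assume xy: "x \<in> carrier Y" "y \<in> carrier Y"
    then have "kinj (f (x \<oplus>\<^bsub>Y\<^esub> y)) = kinj (f x) \<oplus>\<^bsub>kk\<^esub> kinj (f y)" using ghom_add[OF g xy] f by simp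
    then show "f (x \<oplus>\<^bsub>Y\<^esub> y) = f x + f y" by (simp add: kk_simps)
  next
    fix r x assume rx: "r \<in> carrier R" "x \<in> carrier Y"
    then have "kinj (f (r \<odot>\<^bsub>Y\<^esub> x)) = r \<odot>\<^bsub>kk\<^esub> kinj (f x)" using ghom_smult[OF g rx] f by simp
    then show "f (r \<odot>\<^bsub>Y\<^esub> x) = aug r * f x" using rx by (simp add: kk_simps)
  next
    fix n x assume n: "n \<noteq> a" "x \<in> mgrade Y n"
    then show "f x = 0" using ghom_grade[OF g n(2)] f[OF Y.mgrade_carrier[OF n(2)]] by (simp add: kk_simps)
  qed
  with f that show thesis by blast
qed

section \<open>Cohomology with coefficients in the residue field\<close>

text \<open>Cocycles of \<open>Hom(F, k)\<close> with scalars as values.\<close>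

definition cocyc :: "(nat \<Rightarrow> ('r, 'f) graded_module) \<Rightarrow> (nat \<Rightarrow> 'f \<Rightarrow> 'f) \<Rightarrow> nat \<Rightarrow> int \<Rightarrow> ('f \<Rightarrow> 'k) \<Rightarrow> bool"
  where "cocyc F \<delta> n j f \<longleftrightarrow> kfun (F n) j f \<and> (\<forall>x\<in>carrier (F (Suc n)). f (\<delta> n x) = 0)"

fun cobd :: "(nat \<Rightarrow> ('r, 'f) graded_module) \<Rightarrow> (nat \<Rightarrow> 'f \<Rightarrow> 'f) \<Rightarrow> nat \<Rightarrow> int \<Rightarrow> ('f \<Rightarrow> 'k) \<Rightarrow> bool"
  where "cobd F \<delta> 0 j f \<longleftrightarrow> (\<forall>x\<in>carrier (F 0). f x = 0)"
  | "cobd F \<delta> (Suc m) j f \<longleftrightarrow> (\<exists>g. kfun (F m) j g \<and> (\<forall>x\<in>carrier (F (Suc m)). f x = g (\<delta> m x)))"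

lemma cocyc_plus: "cocyc F \<delta> n j f \<Longrightarrow> cocyc F \<delta> n j g \<Longrightarrow> cocyc F \<delta> n j (\<lambda>x. f x + g x)"
  by (auto simp: cocyc_def kfun_plus)

lemma cocyc_scale: "cocyc F \<delta> n j f \<Longrightarrow> cocyc F \<delta> n j (\<lambda>x. c * f x)"
  by (auto simp: cocyc_def kfun_scale)

lemma cocyc_zero: "cocyc F \<delta> n j (\<lambda>x. 0)"
  by (auto simp: cocyc_def kfun_zero_fun)

lemma cocyc_sum: "(\<And>i. i \<in> S \<Longrightarrow> cocyc F \<delta> n j (f i)) \<Longrightarrow> cocyc F \<delta> n j (\<lambda>x. \<Sum>i\<in>S. f i x)"
  by (auto simp: cocyc_def intro!: kfun_sum sum.neutral)

lemma cobd_zero: "cobd F \<delta> n j (\<lambda>x. 0)"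
  by (cases n) (auto intro: exI[of _ "\<lambda>_. 0"] kfun_zero_fun)

lemma cobd_plus:
  assumes "cobd F \<delta> n j f" "cobd F \<delta> n j g" shows "cobd F \<delta> n j (\<lambda>x. f x + g x)"
proof (cases n)
  case 0
  then show ?thesis using assms by simp
next
  case (Suc m)
  then obtain f' g' where "kfun (F m) j f'" "\<forall>x\<in>carrier (F (Suc m)). f x = f' (\<delta> m x)"
    "kfun (F m) j g'" "\<forall>x\<in>carrier (F (Suc m)). g x = g' (\<delta> m x)" using assms by auto
  then show ?thesis using Suc by (auto intro!: exI[of _ "\<lambda>x. f' x + g' x"] kfun_plus)
qed

lemma cobd_scale:
  assumes "cobd F \<delta> n j f" shows "cobd F \<delta> n j (\<lambda>x. c * f x)"
proof (cases n)
  case 0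
  then show ?thesis using assms by simp
next
  case (Suc m)
  then obtain f' where "kfun (F m) j f'" "\<forall>x\<in>carrier (F (Suc m)). f x = f' (\<delta> m x)" using assms by auto
  then show ?thesis using Suc by (auto intro!: exI[of _ "\<lambda>x. c * f' x"] kfun_scale)
qed

lemma cobd_cong:
  assumes "\<And>x. x \<in> carrier (F n) \<Longrightarrow> f x = g x" shows "cobd F \<delta> n j f \<longleftrightarrow> cobd F \<delta> n j g"
  by (cases n) (use assms in auto)

definition cocyc_module :: "(nat \<Rightarrow> ('r, 'f) graded_module) \<Rightarrow> (nat \<Rightarrow> 'f \<Rightarrow> 'f) \<Rightarrow> nat \<Rightarrow> int \<Rightarrow> ('k, 'f \<Rightarrow> 'k) module"
  where "cocyc_module F \<delta> n j = \<lparr>carrier = {f. cocyc F \<delta> n j f}, monoid.mult = undefined, one = undefined,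
    zero = (\<lambda>_. 0), add = (\<lambda>f g x. f x + g x), module.smult = (\<lambda>c f x. c * f x)\<rparr>"

lemma cocyc_module_vectorspace: "vectorspace (class_ring :: 'k ring) (cocyc_module F \<delta> n j)"
proof (rule vs_criteria[OF class_field])
  show "\<forall>v\<in>carrier (cocyc_module F \<delta> n j). \<exists>w\<in>carrier (cocyc_module F \<delta> n j).
      v \<oplus>\<^bsub>cocyc_module F \<delta> n j\<^esub> w = \<zero>\<^bsub>cocyc_module F \<delta> n j\<^esub>"
  proof
    fix v assume "v \<in> carrier (cocyc_module F \<delta> n j)"
    then show "\<exists>w\<in>carrier (cocyc_module F \<delta> n j). v \<oplus>\<^bsub>cocyc_module F \<delta> n j\<^esub> w = \<zero>\<^bsub>cocyc_module F \<delta> n j\<^esub>"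
      by (intro bexI[of _ "\<lambda>x. - 1 * v x"]) (auto simp: cocyc_module_def intro: cocyc_scale[of F \<delta> n j v "- 1", simplified])
  qed
qed (auto simp: cocyc_module_def cocyc_zero cocyc_plus cocyc_scale fun_eq_iff algebra_simps)

text \<open>Translates scalar valued functions to the extensional, coset valued ones of which Ext is made.\<close>

definition to_kk :: "'f set \<Rightarrow> ('f \<Rightarrow> 'k) \<Rightarrow> 'f \<Rightarrow> 'r set"
  where "to_kk A f = (\<lambda>x\<in>A. kinj (f x))"

lemma to_kk_eq_iff: "to_kk A f = to_kk A g \<longleftrightarrow> (\<forall>x\<in>A. f x = g x)"
  by (auto simp: to_kk_def fun_eq_iff restrict_def)

lemma hom_space_carrier:
  assumes "graded_module R Y"
  shows "carrier (hom_space R Y kk j) = to_kk (carrier Y) ` {f. kfun Y j f}"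
proof (intro equalityI subsetI)
  interpret Y: graded_module R Y by fact
  fix h assume h: "h \<in> carrier (hom_space R Y kk j)"
  then have "ghom R (- j) Y kk h" "h \<in> extensional (carrier Y)"
    by (auto simp: hom_space_def ghom_def image_subset_iff)
  from ghom_imp_kfun[OF this(1) assms] obtain f where "kfun Y j f" "\<And>x. x \<in> carrier Y \<Longrightarrow> h x = kinj (f x)" by blast
  moreover from this have "h = to_kk (carrier Y) f"
    using \<open>h \<in> extensional (carrier Y)\<close> unfolding to_kk_def by (auto simp: fun_eq_iff extensional_def)
  ultimately show "h \<in> to_kk (carrier Y) ` {f. kfun Y j f}" by blast
next
  interpret Y: graded_module R Y by fact
  fix h assume "h \<in> to_kk (carrier Y) ` {f. kfun Y j f}"
  then obtain f where f: "kfun Y j f" "h = to_kk (carrier Y) f" by blast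
  have "ghom R (- j) Y kk h"
    by (rule ghomI) (use kfunD[OF f(1)] in \<open>auto simp: f(2) to_kk_def kk_simps dest: Y.mgrade_carrier\<close>)
  then show "h \<in> carrier (hom_space R Y kk j)"
    by (auto simp: hom_space_def ghom_def image_subset_iff f(2) to_kk_def)
qed

lemma cocycles_eq:
  assumes F: "\<And>n. graded_module R (F n)" and \<delta>: "\<And>n. ghom R 0 (F (Suc n)) (F n) (\<delta> n)"
  shows "cocycles R F \<delta> kk n j = to_kk (carrier (F n)) ` {f. cocyc F \<delta> n j f}"
  unfolding cocycles_def hom_space_carrier[OF F] cocyc_def
  using ghom_closed[OF \<delta>, of _ n] by (auto simp: to_kk_def kk_simps image_iff)

lemma coboundaries_eq:
  assumes F: "\<And>n. graded_module R (F n)" and \<delta>: "\<And>n. ghom R 0 (F (Suc n)) (F n) (\<delta> n)"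
  shows "coboundaries R F \<delta> kk n j = to_kk (carrier (F n)) ` {f. cobd F \<delta> n j f}"
proof (cases n)
  case 0
  have "to_kk (carrier (F 0)) ` {f. cobd F \<delta> 0 j f} = {to_kk (carrier (F 0)) (\<lambda>_. 0)}"
    using to_kk_eq_iff by (auto intro!: image_eqI[of _ _ "\<lambda>_. 0"])
  then show ?thesis using 0 by (simp add: hom_space_def to_kk_def kk_simps)
next
  case (Suc m)
  have "coboundaries R F \<delta> kk (Suc m) j = (\<lambda>g. to_kk (carrier (F (Suc m))) (\<lambda>x. g (\<delta> m x))) ` {g. kfun (F m) j g}"
    unfolding coboundaries.simps hom_space_carrier[OF F] image_image
    by (intro image_cong refl) (use ghom_closed[OF \<delta>, of _ m] in \<open>auto simp: to_kk_def fun_eq_iff\<close>)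
  also have "\<dots> = to_kk (carrier (F (Suc m))) ` {f. cobd F \<delta> (Suc m) j f}"
  proof (intro equalityI subsetI)
    fix h assume "h \<in> (\<lambda>g. to_kk (carrier (F (Suc m))) (\<lambda>x. g (\<delta> m x))) ` {g. kfun (F m) j g}"
    then show "h \<in> to_kk (carrier (F (Suc m))) ` {f. cobd F \<delta> (Suc m) j f}" by auto
  next
    fix h assume "h \<in> to_kk (carrier (F (Suc m))) ` {f. cobd F \<delta> (Suc m) j f}"
    then obtain f g where "h = to_kk (carrier (F (Suc m))) f" "kfun (F m) j g" "\<forall>x\<in>carrier (F (Suc m)). f x = g (\<delta> m x)"
      by auto
    then show "h \<in> (\<lambda>g. to_kk (carrier (F (Suc m))) (\<lambda>x. g (\<delta> m x))) ` {g. kfun (F m) j g}"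
      using to_kk_eq_iff by (intro image_eqI[of _ _ g]) auto
  qed
  finally show ?thesis using Suc by simp
qed

text \<open>The Ext space of the definitions consists of cosets of restricted functions with cosets as
values. Here it is presented as the image of the space of scalar valued cocycles.\<close>

lemma cohomology_linear_quotient:
  fixes F :: "nat \<Rightarrow> ('r, 'f) graded_module"
  assumes F: "\<And>n. graded_module R (F n)" and \<delta>: "\<And>n. ghom R 0 (F (Suc n)) (F n) (\<delta> n)"
  defines "cls \<equiv> \<lambda>n j f. to_kk (carrier (F n)) ` {h. cobd F \<delta> n j (\<lambda>x. h x - f x)}"
  shows "linear_quotient (cocyc_module F \<delta> n j) (cohomology R F \<delta> kk n j) (cls n j)"
    and "cls n j f = \<zero>\<^bsub>cohomology R F \<delta> kk n j\<^esub> \<longleftrightarrow> cobd F \<delta> n j f"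
proof -
  define Hc where "Hc = (hom_space R (F n) kk j)\<lparr>carrier := cocycles R F \<delta> kk n j\<rparr>"
  let ?B = "coboundaries R F \<delta> kk n j" and ?t = "to_kk (carrier (F n))"
  have Hc_add: "?t f \<oplus>\<^bsub>Hc\<^esub> ?t g = ?t (\<lambda>x. f x + g x)" for f g
    by (auto simp: Hc_def hom_space_def to_kk_def fun_eq_iff kk_simps)
  have Hc_smult: "c \<odot>\<^bsub>Hc\<^esub> ?t f = ?t (\<lambda>x. c * f x)" for c f
    by (auto simp: Hc_def hom_space_def to_kk_def fun_eq_iff kk_simps)
  have diff_zero: "cobd F \<delta> n j (\<lambda>x. f x - f x)" for f using cobd_zero by simp
  have coset: "?B +>\<^bsub>Hc\<^esub> ?t f = cls n j f" for f
  proof (intro equalityI subsetI)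
    fix z assume "z \<in> ?B +>\<^bsub>Hc\<^esub> ?t f"
    then obtain b where "cobd F \<delta> n j b" "z = ?t (\<lambda>x. b x + f x)"
      by (auto simp: a_r_coset_def' coboundaries_eq[of F \<delta>, OF F \<delta>] Hc_add)
    then show "z \<in> cls n j f" unfolding cls_def by (intro image_eqI[of _ _ "\<lambda>x. b x + f x"]) auto
  next
    fix z assume "z \<in> cls n j f"
    then obtain h where h: "cobd F \<delta> n j (\<lambda>x. h x - f x)" "z = ?t h" unfolding cls_def by blast
    then have "z = ?t (\<lambda>x. h x - f x) \<oplus>\<^bsub>Hc\<^esub> ?t f" by (simp add: Hc_add)
    then show "z \<in> ?B +>\<^bsub>Hc\<^esub> ?t f" using h(1) by (auto simp: a_r_coset_def' coboundaries_eq[of F \<delta>, OF F \<delta>])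
  qed
  have W: "cohomology R F \<delta> kk n j = quot_module Hc ?B" by (simp add: cohomology_def Hc_def)
  have W_carrier: "carrier (quot_module Hc ?B) = cls n j ` {f. cocyc F \<delta> n j f}"
  proof -
    have "carrier (quot_module Hc ?B) = (\<lambda>z. ?B +>\<^bsub>Hc\<^esub> z) ` carrier Hc"
      by (auto simp: quot_module_def A_RCOSETS_def')
    also have "carrier Hc = ?t ` {f. cocyc F \<delta> n j f}"
      by (simp add: Hc_def cocycles_eq[of F \<delta>, OF F \<delta>])
    finally show ?thesis by (simp only: image_image coset)
  qed
  have W_zero: "\<zero>\<^bsub>quot_module Hc ?B\<^esub> = cls n j (\<lambda>_. 0)"
    by (simp add: quot_module_def cls_def coboundaries_eq[of F \<delta>, OF F \<delta>])
  have W_add: "cls n j f \<oplus>\<^bsub>quot_module Hc ?B\<^esub> cls n j g = cls n j (\<lambda>x. f x + g x)" for f g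
  proof (intro equalityI subsetI)
    fix z assume "z \<in> cls n j f \<oplus>\<^bsub>quot_module Hc ?B\<^esub> cls n j g"
    then obtain h h' where h: "cobd F \<delta> n j (\<lambda>x. h x - f x)" "cobd F \<delta> n j (\<lambda>x. h' x - g x)" "z = ?t (\<lambda>x. h x + h' x)"
      by (auto simp: quot_module_def set_add_def' cls_def Hc_add)
    have "cobd F \<delta> n j (\<lambda>x. h x + h' x - (f x + g x))"
      using cobd_plus[OF h(1,2)] by (simp add: algebra_simps)
    with h(3) show "z \<in> cls n j (\<lambda>x. f x + g x)" unfolding cls_def by blast
  next
    fix z assume "z \<in> cls n j (\<lambda>x. f x + g x)"
    then obtain h where h: "cobd F \<delta> n j (\<lambda>x. h x - (f x + g x))" "z = ?t h" unfolding cls_def by blast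
    have "?t (\<lambda>x. h x - g x) \<in> cls n j f" using h(1) unfolding cls_def by (auto simp: algebra_simps)
    moreover have "?t g \<in> cls n j g" using diff_zero unfolding cls_def by blast
    moreover have "z = ?t (\<lambda>x. h x - g x) \<oplus>\<^bsub>Hc\<^esub> ?t g" by (simp add: Hc_add h(2))
    ultimately show "z \<in> cls n j f \<oplus>\<^bsub>quot_module Hc ?B\<^esub> cls n j g" by (auto simp: quot_module_def set_add_def')
  qed
  have W_smult: "c \<odot>\<^bsub>quot_module Hc ?B\<^esub> cls n j f = cls n j (\<lambda>x. c * f x)" for c f
  proof -
    have "c \<odot>\<^bsub>quot_module Hc ?B\<^esub> cls n j f = (\<Union>h\<in>{h. cobd F \<delta> n j (\<lambda>x. h x - f x)}. cls n j (\<lambda>x. c * h x))"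
      unfolding cls_def[THEN meta_eq_to_obj_eq, THEN fun_cong, THEN fun_cong, THEN fun_cong, of n j f]
      by (simp add: quot_module_def Hc_smult coset)
    also have "\<dots> = cls n j (\<lambda>x. c * f x)"
    proof -
      have "cls n j (\<lambda>x. c * h x) = cls n j (\<lambda>x. c * f x)" if "cobd F \<delta> n j (\<lambda>x. h x - f x)" for h
      proof -
        have 1: "cobd F \<delta> n j (\<lambda>x. c * h x - c * f x)" using cobd_scale[OF that, of c] by (simp add: algebra_simps)
        have 2: "cobd F \<delta> n j (\<lambda>x. c * f x - c * h x)" using cobd_scale[OF that, of "- c"] by (simp add: algebra_simps)
        have "cobd F \<delta> n j (\<lambda>x. u x - c * h x) \<longleftrightarrow> cobd F \<delta> n j (\<lambda>x. u x - c * f x)" for u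
          using cobd_plus[OF _ 1, of "\<lambda>x. u x - c * h x"] cobd_plus[OF _ 2, of "\<lambda>x. u x - c * f x"]
          by (simp add: algebra_simps) blast
        then have "{u. cobd F \<delta> n j (\<lambda>x. u x - c * h x)} = {u. cobd F \<delta> n j (\<lambda>x. u x - c * f x)}" by blast
        then show ?thesis unfolding cls_def by (rule arg_cong)
      qed
      then have "(\<Union>h\<in>{h. cobd F \<delta> n j (\<lambda>x. h x - f x)}. cls n j (\<lambda>x. c * h x)) =
          (\<Union>h\<in>{h. cobd F \<delta> n j (\<lambda>x. h x - f x)}. cls n j (\<lambda>x. c * f x))" by simp
      also have "\<dots> = cls n j (\<lambda>x. c * f x)"
        by (rule UN_constant_eq[of f], rule CollectI, rule diff_zero) simp
      finally show ?thesis .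
    qed
    finally show ?thesis .
  qed
  show "cls n j f = \<zero>\<^bsub>cohomology R F \<delta> kk n j\<^esub> \<longleftrightarrow> cobd F \<delta> n j f"
  proof
    assume "cls n j f = \<zero>\<^bsub>cohomology R F \<delta> kk n j\<^esub>"
    moreover have "?t f \<in> cls n j f" using diff_zero unfolding cls_def by blast
    ultimately have "?t f \<in> cls n j (\<lambda>_. 0)" unfolding W W_zero by simp
    then obtain h where h: "cobd F \<delta> n j h" "?t f = ?t h" unfolding cls_def by auto
    from h(2) have "\<And>x. x \<in> carrier (F n) \<Longrightarrow> f x = h x" unfolding to_kk_eq_iff by (rule bspec)
    from cobd_cong[of F n f h, OF this] h(1) show "cobd F \<delta> n j f" by blast
  next
    assume f: "cobd F \<delta> n j f"
    have "cobd F \<delta> n j (\<lambda>x. u x - f x) \<longleftrightarrow> cobd F \<delta> n j u" for u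
      using cobd_plus[OF _ f, of "\<lambda>x. u x - f x"] cobd_plus[OF _ cobd_scale[OF f, of "- 1"], of u] by auto
    then show "cls n j f = \<zero>\<^bsub>cohomology R F \<delta> kk n j\<^esub>" unfolding W W_zero cls_def by simp
  qed
  show "linear_quotient (cocyc_module F \<delta> n j) (cohomology R F \<delta> kk n j) (cls n j)"
    unfolding W
    by (intro linear_quotient.intro linear_quotient_axioms.intro cocyc_module_vectorspace)
      (auto simp: cocyc_module_def W_carrier W_add W_smult W_zero)
qed

text \<open>Cocycles that represent a basis of the cohomology of \<open>Hom(F, k)\<close>, and the dual coordinates as functionals on
cocycles.\<close>

definition coh_basis :: "(nat \<Rightarrow> ('r, 'f) graded_module) \<Rightarrow> (nat \<Rightarrow> 'f \<Rightarrow> 'f) \<Rightarrow> nat \<Rightarrow> int \<Rightarrow> nat \<Rightarrow>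
    (nat \<Rightarrow> 'f \<Rightarrow> 'k) \<Rightarrow> (nat \<Rightarrow> ('f \<Rightarrow> 'k) \<Rightarrow> 'k) \<Rightarrow> bool"
  where "coh_basis F \<delta> n j D b \<kappa> \<longleftrightarrow> (\<forall>i<D. cocyc F \<delta> n j (b i) \<and> lin_functional (cocyc_module F \<delta> n j) (\<kappa> i)) \<and>
    (\<forall>i<D. \<forall>f. cocyc F \<delta> n j f \<longrightarrow> cobd F \<delta> n j f \<longrightarrow> \<kappa> i f = 0) \<and>
    (\<forall>i<D. \<forall>i'<D. \<kappa> i (b i') = of_bool (i = i')) \<and>
    (\<forall>f. cocyc F \<delta> n j f \<longrightarrow> (\<forall>i<D. \<kappa> i f = 0) \<longrightarrow> cobd F \<delta> n j f)"

text \<open>Coordinates on cohomology, composed with the quotient map, are functionals on cocycles with common kernel the coboundaries.\<close>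

lemma cohomology_dim:
  fixes F :: "nat \<Rightarrow> ('r, 'f) graded_module"
  assumes F: "\<And>n. graded_module R (F n)" and \<delta>: "\<And>n. ghom R 0 (F (Suc n)) (F n) (\<delta> n)"
    and lin: "\<And>i. i < m \<Longrightarrow> lin_functional (cocyc_module F \<delta> n j) (\<kappa> i)"
    and ker: "\<And>f. cocyc F \<delta> n j f \<Longrightarrow> (\<And>i. i < m \<Longrightarrow> \<kappa> i f = 0) \<Longrightarrow> cobd F \<delta> n j f"
  defines "D \<equiv> vectorspace.dim (class_ring :: 'k ring) (cohomology R F \<delta> kk n j)"
  shows "D \<le> m" "\<exists>b \<kappa>'. coh_basis F \<delta> n j D b \<kappa>'"
proof -
  let ?cls = "\<lambda>f. to_kk (carrier (F n)) ` {h. cobd F \<delta> n j (\<lambda>x. h x - f x)}"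
  interpret linear_quotient "cocyc_module F \<delta> n j" "cohomology R F \<delta> kk n j" ?cls
    by (rule cohomology_linear_quotient(1)[of F \<delta>, OF F \<delta>])
  note zero = cohomology_linear_quotient(2)[of F \<delta>, OF F \<delta>]
  have car: "f \<in> carrier (cocyc_module F \<delta> n j) \<longleftrightarrow> cocyc F \<delta> n j f" for f by (simp add: cocyc_module_def)
  have ker': "?cls f = \<zero>\<^bsub>cohomology R F \<delta> kk n j\<^esub>"
    if "f \<in> carrier (cocyc_module F \<delta> n j)" "\<And>i. i < m \<Longrightarrow> \<kappa> i f = 0" for f
    unfolding zero using ker that car by blast
  show "D \<le> m" unfolding D_def by (rule fin_dim_functionals(2)[of m \<kappa>]) (use lin ker' in blast)+
  show "\<exists>b \<kappa>'. coh_basis F \<delta> n j D b \<kappa>'"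
  proof (rule dual_basis[of m \<kappa>])
    fix b \<kappa>'
    assume "\<And>i. i < vectorspace.dim (class_ring :: 'k ring) (cohomology R F \<delta> kk n j) \<Longrightarrow> b i \<in> carrier (cocyc_module F \<delta> n j)"
      "\<And>i. i < vectorspace.dim (class_ring :: 'k ring) (cohomology R F \<delta> kk n j) \<Longrightarrow> lin_functional (cocyc_module F \<delta> n j) (\<kappa>' i)"
      "\<And>i x. i < vectorspace.dim (class_ring :: 'k ring) (cohomology R F \<delta> kk n j) \<Longrightarrow> x \<in> carrier (cocyc_module F \<delta> n j) \<Longrightarrow>
        ?cls x = \<zero>\<^bsub>cohomology R F \<delta> kk n j\<^esub> \<Longrightarrow> \<kappa>' i x = 0"
      "\<And>i i'. i < vectorspace.dim (class_ring :: 'k ring) (cohomology R F \<delta> kk n j) \<Longrightarrow>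
        i' < vectorspace.dim (class_ring :: 'k ring) (cohomology R F \<delta> kk n j) \<Longrightarrow> \<kappa>' i (b i') = of_bool (i = i')"
      "\<And>x. x \<in> carrier (cocyc_module F \<delta> n j) \<Longrightarrow>
        (\<And>i. i < vectorspace.dim (class_ring :: 'k ring) (cohomology R F \<delta> kk n j) \<Longrightarrow> \<kappa>' i x = 0) \<Longrightarrow> ?cls x = \<zero>\<^bsub>cohomology R F \<delta> kk n j\<^esub>"
    then show "\<exists>b \<kappa>'. coh_basis F \<delta> n j D b \<kappa>'"
      unfolding zero car D_def[symmetric] coh_basis_def by (intro exI[of _ b] exI[of _ \<kappa>']) simp
  qed (use lin ker' in blast)+
qed

end

section \<open>Degreewise finite modules and graded submodules\<close>

lemma finite_set_enum_functionals:
  assumes "finite K"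
  obtains N :: nat and \<kappa> where "K = \<kappa> ` {..<N}"
  using assms by (metis finite_conv_nat_seg_image lessThan_def)

lemma submod_simps [simp]:
  "carrier (submod L N) = N" "zero (submod L N) = zero L" "add (submod L N) = add L"
  "module.smult (submod L N) = module.smult L" "mgrade (submod L N) = (\<lambda>j. N \<inter> mgrade L j)"
  by (simp_all add: submod_def)

lemma submod_module:
  assumes "module R Y" "N \<subseteq> carrier Y" "\<zero>\<^bsub>Y\<^esub> \<in> N"
    and add: "\<And>x y. x \<in> N \<Longrightarrow> y \<in> N \<Longrightarrow> x \<oplus>\<^bsub>Y\<^esub> y \<in> N"
    and sm: "\<And>r x. r \<in> carrier R \<Longrightarrow> x \<in> N \<Longrightarrow> r \<odot>\<^bsub>Y\<^esub> x \<in> N"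
  shows "module R (submod Y N)"
proof -
  interpret Y: module R Y by fact
  have N: "x \<in> carrier Y" if "x \<in> N" for x using assms(2) that by blast
  show ?thesis
  proof (rule moduleI)
    show "abelian_group (submod Y N)"
    proof (rule abelian_groupI)
      fix x assume x: "x \<in> carrier (submod Y N)"
      then have "(\<ominus>\<^bsub>R\<^esub> \<one>\<^bsub>R\<^esub>) \<odot>\<^bsub>Y\<^esub> x \<in> N" using sm by simp
      moreover have "(\<ominus>\<^bsub>R\<^esub> \<one>\<^bsub>R\<^esub>) \<odot>\<^bsub>Y\<^esub> x \<oplus>\<^bsub>Y\<^esub> x = \<zero>\<^bsub>Y\<^esub>"
        using x N by (simp add: Y.smult_l_minus Y.M.l_neg)
      ultimately show "\<exists>y\<in>carrier (submod Y N). y \<oplus>\<^bsub>submod Y N\<^esub> x = \<zero>\<^bsub>submod Y N\<^esub>" by auto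
    qed (use assms N in \<open>auto simp: Y.M.a_ac\<close>)
  qed (use assms N in \<open>auto simp: Y.smult_l_distr Y.smult_r_distr Y.smult_assoc1 Y.R.cring_axioms\<close>)
qed

lemma finsum_submod:
  assumes "abelian_monoid Y" "abelian_monoid (submod Y N)" "N \<subseteq> carrier Y" "\<And>i. i \<in> S \<Longrightarrow> f i \<in> N"
  shows "finsum (submod Y N) f S = finsum Y f S"
proof -
  interpret Y: abelian_monoid Y by fact
  interpret Z: abelian_monoid "submod Y N" by fact
  show ?thesis using assms(4)
  proof (induction S rule: infinite_finite_induct)
    case (insert x F)
    then have "f \<in> F \<rightarrow> carrier Y" "f x \<in> carrier Y" "f \<in> F \<rightarrow> carrier (submod Y N)" "f x \<in> carrier (submod Y N)"
      using assms(3) by auto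
    with insert show ?case by simp
  qed (simp_all)
qed

context connected_algebra
begin

text \<open>The projections of the ambient module to its homogeneous parts restrict to the submodule.\<close>

lemma submod_graded:
  assumes Q: "graded_module R Q" and sub: "N \<subseteq> carrier Q" "\<zero>\<^bsub>Q\<^esub> \<in> N"
    and add: "\<And>x y. x \<in> N \<Longrightarrow> y \<in> N \<Longrightarrow> x \<oplus>\<^bsub>Q\<^esub> y \<in> N"
    and sm: "\<And>r x. r \<in> carrier R \<Longrightarrow> x \<in> N \<Longrightarrow> r \<odot>\<^bsub>Q\<^esub> x \<in> N"
    and comp: "\<And>x j. x \<in> N \<Longrightarrow> gcomp Q j x \<in> N"
  shows "graded_module R (submod Q N)"
proof -
  interpret Q: graded_module R Q by fact
  have mN: "module R (submod Q N)"
    by (rule submod_module[OF Q.module_axioms]) (use sub add sm in auto)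
  interpret N: module R "submod Q N" by (rule mN)
  have neg: "\<ominus>\<^bsub>submod Q N\<^esub> x = \<ominus>\<^bsub>Q\<^esub> x" if x: "x \<in> N" for x
  proof (rule N.M.minus_equality)
    have "\<ominus>\<^bsub>Q\<^esub> x = (\<ominus> \<one>) \<odot>\<^bsub>Q\<^esub> x" using x sub by (simp add: subsetD Q.smult_l_minus)
    then show "\<ominus>\<^bsub>Q\<^esub> x \<in> carrier (submod Q N)" using sm[OF _ x, of "\<ominus> \<one>"] by simp
  qed (use x sub in \<open>auto simp: Q.M.l_neg subsetD\<close>)
  show ?thesis
  proof (rule graded_moduleI[OF mN, where p = "gcomp Q"])
    show "subgroup (mgrade (submod Q N) j) (add_monoid (submod Q N))" for j
    proof -
      have "\<ominus>\<^bsub>submod Q N\<^esub> x \<in> mgrade (submod Q N) j" if x: "x \<in> mgrade (submod Q N) j" for x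
      proof -
        have "x \<in> carrier (submod Q N)" "x \<in> mgrade Q j" using x by auto
        then show ?thesis using N.M.a_inv_closed[of x] neg[of x] Q.mgrade_uminus[of x j] by simp
      qed
      then show ?thesis
        using sub by (intro N.M.add.subgroupI) (auto simp: Q.mgrade_add add intro!: exI[of _ "\<zero>\<^bsub>Q\<^esub>"])
    qed
    show "r \<odot>\<^bsub>submod Q N\<^esub> x \<in> mgrade (submod Q N) (i + j)"
      if "r \<in> rgrade R i" "x \<in> mgrade (submod Q N) j" for r x i j
      using that Q.mgrade_smult RM.mgrade_carrier[OF that(1)] by (auto intro: sm)
    show "\<exists>S. finite S \<and> (\<forall>j. j \<notin> S \<longrightarrow> gcomp Q j x = \<zero>\<^bsub>submod Q N\<^esub>) \<and> x = (\<Oplus>\<^bsub>submod Q N\<^esub>j\<in>S. gcomp Q j x)"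
      if x: "x \<in> carrier (submod Q N)" for x
    proof (intro exI conjI allI impI)
      let ?S = "{j. gcomp Q j x \<noteq> \<zero>\<^bsub>Q\<^esub>}"
      have xQ: "x \<in> carrier Q" using x sub by auto
      show "finite ?S" using Q.gcomp_spec(2)[OF xQ] .
      have "finsum (submod Q N) (\<lambda>j. gcomp Q j x) ?S = finsum Q (\<lambda>j. gcomp Q j x) ?S"
        by (rule finsum_submod[OF Q.M.abelian_monoid_axioms N.M.abelian_monoid_axioms]) (use comp x sub in auto)
      then show "x = (\<Oplus>\<^bsub>submod Q N\<^esub>j\<in>?S. gcomp Q j x)" using Q.gcomp_spec(3)[OF xQ] by simp
    qed simp
  qed (use comp sub Q.gcomp_spec(1) Q.gcomp_add Q.gcomp_homogeneous in \<open>auto simp: subsetD\<close>)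
qed

lemma kernel_graded:
  assumes Q: "graded_module R Q" and Y: "graded_module R Y" and f: "ghom R 0 Q Y f"
  shows "graded_module R (submod Q {x \<in> carrier Q. f x = \<zero>\<^bsub>Y\<^esub>})"
proof -
  interpret Q: graded_module R Q by fact
  interpret Y: graded_module R Y by fact
  note f0 = ghom_zero[OF f Q.module_axioms Y.module_axioms]
  have "f (gcomp Q j x) = \<zero>\<^bsub>Y\<^esub>" if "x \<in> carrier Q" "f x = \<zero>\<^bsub>Y\<^esub>" for x j
    using gcomp_ghom[OF Q Y f, of x j] that by simp
  then show ?thesis by (intro submod_graded[OF Q]) (auto simp: f0 ghomD[OF f])
qed

lemma graded_part_vectorspace:
  assumes "graded_module R Y" shows "vectorspace (class_ring :: 'k ring) (graded_part R Y j)"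
proof -
  interpret Y: graded_module R Y by fact
  have sm: "scalar R c \<odot>\<^bsub>Y\<^esub> x \<in> mgrade Y j" if "x \<in> mgrade Y j" for c x
    using Y.mgrade_smult[OF scalar_grade that] by simp
  show ?thesis
  proof (rule vs_criteria[OF class_field])
    show "\<forall>v\<in>carrier (graded_part R Y j). \<exists>w\<in>carrier (graded_part R Y j). v \<oplus>\<^bsub>graded_part R Y j\<^esub> w = \<zero>\<^bsub>graded_part R Y j\<^esub>"
    proof
      fix v assume "v \<in> carrier (graded_part R Y j)"
      then have "v \<in> mgrade Y j" by (simp add: graded_part_def)
      then show "\<exists>w\<in>carrier (graded_part R Y j). v \<oplus>\<^bsub>graded_part R Y j\<^esub> w = \<zero>\<^bsub>graded_part R Y j\<^esub>"
        by (intro bexI[of _ "\<ominus>\<^bsub>Y\<^esub> v"]) (simp_all add: graded_part_def Y.mgrade_uminus Y.mgrade_carrier Y.M.r_neg)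
    qed
  qed (auto simp: graded_part_def sm Y.mgrade_add Y.mgrade_carrier Y.M.a_ac scalar_mult scalar_one scalar_add
      Y.smult_assoc1 Y.smult_l_distr Y.smult_r_distr)
qed

text \<open>Bounded below with finite dimensional homogeneous parts. Unlike finite generation this passes
to graded submodules for trivial reasons, so resolutions can be built without a Noetherian hypothesis.\<close>

definition locfin :: "int \<Rightarrow> ('r, 'm, 'y) graded_module_scheme \<Rightarrow> bool"
  where "locfin lo Y \<longleftrightarrow> (\<forall>j<lo. mgrade Y j \<subseteq> {\<zero>\<^bsub>Y\<^esub>}) \<and> (\<forall>j. fin_graded_part R Y j)"

text \<open>Expansion in a dual system: the difference of \<open>x\<close> and its expansion is killed by all functionals
of the system, hence by the separating ones.\<close>

lemma fin_graded_part_generators: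
  assumes Y: "graded_module R Y" and "fin_graded_part R Y j"
  shows "\<exists>(N::nat) b. (\<forall>i<N. b i \<in> mgrade Y j) \<and> (\<forall>x\<in>mgrade Y j. \<exists>c. x = (\<Oplus>\<^bsub>Y\<^esub>i\<in>{..<N}. scalar R (c i) \<odot>\<^bsub>Y\<^esub> b i))"
proof -
  interpret Y: graded_module R Y by fact
  let ?H = "graded_part R Y j"
  have H: "carrier ?H = mgrade Y j" "add ?H = add Y" "\<And>c x. c \<odot>\<^bsub>?H\<^esub> x = scalar R c \<odot>\<^bsub>Y\<^esub> x" "\<zero>\<^bsub>?H\<^esub> = \<zero>\<^bsub>Y\<^esub>"
    by (simp_all add: graded_part_def)
  obtain K where "finite K \<and> (\<forall>\<kappa>\<in>K. lin_functional ?H \<kappa>) \<and>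
      (\<forall>x\<in>mgrade Y j. (\<forall>\<kappa>\<in>K. \<kappa> x = 0) \<longrightarrow> x = \<zero>\<^bsub>Y\<^esub>)"
    using assms(2) unfolding fin_graded_part_def by (elim exE)
  then have K: "finite K" "\<And>\<kappa>. \<kappa> \<in> K \<Longrightarrow> lin_functional ?H \<kappa>"
    "\<And>x. x \<in> mgrade Y j \<Longrightarrow> (\<And>\<kappa>. \<kappa> \<in> K \<Longrightarrow> \<kappa> x = 0) \<Longrightarrow> x = \<zero>\<^bsub>Y\<^esub>"
    by simp_all
  obtain M :: nat and \<kappa> where \<kappa>: "K = \<kappa> ` {..<M}" using finite_set_enum_functionals[OF K(1)] .
  have sm: "scalar R c \<odot>\<^bsub>Y\<^esub> x \<in> mgrade Y j" if "x \<in> mgrade Y j" for c x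
    using Y.mgrade_smult[OF scalar_grade that] by simp
  have "\<exists>(m::nat) v \<pi>. (\<forall>s<m. v s \<in> mgrade Y j \<and> lin_functional ?H (\<pi> s) \<and>
       (\<forall>x\<in>carrier ?H. (\<forall>i<M. \<kappa> i x = 0) \<longrightarrow> \<pi> s x = 0)) \<and>
     (\<forall>s<m. \<forall>t<m. \<pi> s (v t) = of_bool (s = t)) \<and>
     (\<forall>z\<in>mgrade Y j. (\<forall>s<m. \<pi> s z = 0) \<longrightarrow> (\<forall>i<M. \<kappa> i z = 0))"
    by (rule dual_system_on_subspace[OF graded_part_vectorspace[OF Y]])
      (use K(2) \<kappa> sm in \<open>auto simp: H Y.mgrade_add\<close>)
  then obtain m :: nat and v \<pi> where
    v: "\<forall>s<m. v s \<in> mgrade Y j \<and> lin_functional ?H (\<pi> s) \<and> (\<forall>x\<in>carrier ?H. (\<forall>i<M. \<kappa> i x = 0) \<longrightarrow> \<pi> s x = 0)"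
    and dual: "\<forall>s<m. \<forall>t<m. \<pi> s (v t) = of_bool (s = t)"
    and ker: "\<forall>z\<in>mgrade Y j. (\<forall>s<m. \<pi> s z = 0) \<longrightarrow> (\<forall>i<M. \<kappa> i z = 0)"
    by (elim exE conjE)
  have "x = (\<Oplus>\<^bsub>Y\<^esub>i\<in>{..<m}. scalar R (\<pi> i x) \<odot>\<^bsub>Y\<^esub> v i)" if x: "x \<in> mgrade Y j" for x
  proof -
    let ?s = "\<lambda>S. \<Oplus>\<^bsub>Y\<^esub>i\<in>S. scalar R (\<pi> i x) \<odot>\<^bsub>Y\<^esub> v i"
    have vj: "scalar R (\<pi> i x) \<odot>\<^bsub>Y\<^esub> v i \<in> mgrade Y j" if "i < m" for i using sm v that by blast
    have sj: "?s {..<m} \<in> mgrade Y j" using vj by (intro Y.mgrade_finsum) auto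
    have pi_sum: "\<pi> s (?s S) = (\<Sum>i\<in>S. \<pi> i x * \<pi> s (v i))" if s: "s < m" and S: "finite S" "S \<subseteq> {..<m}" for s S
      using S
    proof (induction S rule: finite_induct)
      case empty
      have "\<pi> s \<zero>\<^bsub>?H\<^esub> = 0" by (rule lin_functional_zero[OF _ graded_part_vectorspace[OF Y]]) (use v s in simp)
      then show ?case by (simp add: H)
    next
      case (insert i F)
      have i: "i < m" using insert by auto
      have F: "?s F \<in> mgrade Y j" using insert vj by (intro Y.mgrade_finsum) auto
      have lin: "lin_functional ?H (\<pi> s)" using v s by blast
      have "?s (insert i F) = scalar R (\<pi> i x) \<odot>\<^bsub>Y\<^esub> v i \<oplus>\<^bsub>Y\<^esub> ?s F"
        using insert vj Y.mgrade_carrier by (intro Y.M.finsum_insert) auto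
      then have "\<pi> s (?s (insert i F)) = \<pi> s (scalar R (\<pi> i x) \<odot>\<^bsub>Y\<^esub> v i) + \<pi> s (?s F)"
        using lin_functionalD(1)[OF lin, of "scalar R (\<pi> i x) \<odot>\<^bsub>Y\<^esub> v i" "?s F"] vj[OF i] F by (simp add: H)
      moreover have "\<pi> s (scalar R (\<pi> i x) \<odot>\<^bsub>Y\<^esub> v i) = \<pi> i x * \<pi> s (v i)"
        using lin_functionalD(2)[OF lin, of "v i" "\<pi> i x"] v i by (simp add: H)
      ultimately show ?case using insert by simp
    qed
    let ?d = "?s {..<m} \<oplus>\<^bsub>Y\<^esub> scalar R (- 1) \<odot>\<^bsub>Y\<^esub> x"
    have d: "?d \<in> mgrade Y j" using sj x sm Y.mgrade_add by blast
    have "\<pi> s ?d = 0" if s: "s < m" for s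
    proof -
      have lin: "lin_functional ?H (\<pi> s)" using v s by blast
      have "\<pi> s ?d = \<pi> s (?s {..<m}) + \<pi> s (scalar R (- 1) \<odot>\<^bsub>Y\<^esub> x)"
        using lin_functionalD(1)[OF lin, of "?s {..<m}" "scalar R (- 1) \<odot>\<^bsub>Y\<^esub> x"] sj sm[OF x] by (simp add: H)
      also have "\<pi> s (scalar R (- 1) \<odot>\<^bsub>Y\<^esub> x) = - \<pi> s x"
        using lin_functionalD(2)[OF lin, of x "- 1"] x by (simp add: H)
      also have "\<pi> s (?s {..<m}) = (\<Sum>i<m. \<pi> i x * \<pi> s (v i))" using pi_sum[OF s] by simp
      also have "\<dots> = (\<Sum>i<m. if s = i then \<pi> i x else 0)" using dual s by (intro sum.cong) auto
      also have "\<dots> = \<pi> s x" using s by simp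
      finally show ?thesis by simp
    qed
    then have "\<kappa> i ?d = 0" if "i < M" for i using ker d that by blast
    then have "?d = \<zero>\<^bsub>Y\<^esub>" using K(3)[OF d] \<kappa> by auto
    moreover have "scalar R (- 1) \<odot>\<^bsub>Y\<^esub> x = \<ominus>\<^bsub>Y\<^esub> x"
    proof -
      have "scalar R (- 1) = \<ominus> \<one>"
        by (rule R.minus_equality[symmetric]) (use scalar_add[of "- 1" 1] scalar_one scalar_zero in auto)
      then show ?thesis using Y.mgrade_carrier[OF x] by (simp add: Y.smult_l_minus)
    qed
    ultimately have "?s {..<m} \<oplus>\<^bsub>Y\<^esub> \<ominus>\<^bsub>Y\<^esub> x = \<zero>\<^bsub>Y\<^esub>" by simp
    then have "\<ominus>\<^bsub>Y\<^esub> (\<ominus>\<^bsub>Y\<^esub> x) = ?s {..<m}"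
      using Y.mgrade_carrier[OF x] Y.mgrade_carrier[OF sj] by (intro Y.M.minus_equality) auto
    then show ?thesis using Y.mgrade_carrier[OF x] by simp
  qed
  then show ?thesis using v by (intro exI[of _ m] exI[of _ v] conjI ballI exI) auto
qed

section \<open>Free modules on a set of natural numbers\<close>

text \<open>The free module on generators \<open>i \<in> I\<close> of degrees \<open>dg i\<close>, in the type that the chosen resolutions
have.\<close>

definition free_mod :: "nat set \<Rightarrow> (nat \<Rightarrow> int) \<Rightarrow> ('r, nat \<Rightarrow> 'r) graded_module"
  where "free_mod I dg =
    (let C = {f. (\<forall>i. f i \<in> carrier R) \<and> finite {i. f i \<noteq> \<zero>} \<and> (\<forall>i. i \<notin> I \<longrightarrow> f i = \<zero>)} in
    \<lparr>carrier = C, monoid.mult = undefined, one = undefined, zero = (\<lambda>_. \<zero>), add = (\<lambda>f g i. f i \<oplus> g i),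
     module.smult = (\<lambda>r f i. r \<otimes> f i), mgrade = (\<lambda>j. {f \<in> C. \<forall>i. f i \<in> rgrade R (j - dg i)})\<rparr>)"

lemma free_mod_simps:
  "f \<in> carrier (free_mod I dg) \<longleftrightarrow> (\<forall>i. f i \<in> carrier R) \<and> finite {i. f i \<noteq> \<zero>} \<and> (\<forall>i. i \<notin> I \<longrightarrow> f i = \<zero>)"
  "\<zero>\<^bsub>free_mod I dg\<^esub> = (\<lambda>_. \<zero>)" "f \<oplus>\<^bsub>free_mod I dg\<^esub> g = (\<lambda>i. f i \<oplus> g i)"
  "r \<odot>\<^bsub>free_mod I dg\<^esub> f = (\<lambda>i. r \<otimes> f i)"
  "f \<in> mgrade (free_mod I dg) j \<longleftrightarrow> f \<in> carrier (free_mod I dg) \<and> (\<forall>i. f i \<in> rgrade R (j - dg i))"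
  by (simp_all add: free_mod_def Let_def)

lemma free_mod_module: "module R (free_mod I dg)"
proof (rule moduleI[OF R_cring])
  have cl: "(\<lambda>i. f i \<oplus> g i) \<in> carrier (free_mod I dg)" if "f \<in> carrier (free_mod I dg)" "g \<in> carrier (free_mod I dg)" for f g
  proof -
    have "finite ({i. f i \<noteq> \<zero>} \<union> {i. g i \<noteq> \<zero>})" using that by (simp add: free_mod_simps)
    then have "finite {i. f i \<oplus> g i \<noteq> \<zero>}" by (rule rev_finite_subset) auto
    then show ?thesis using that by (auto simp: free_mod_simps)
  qed
  show smc: "r \<odot>\<^bsub>free_mod I dg\<^esub> f \<in> carrier (free_mod I dg)" if "r \<in> carrier R" "f \<in> carrier (free_mod I dg)" for r f
  proof -
    have "finite {i. f i \<noteq> \<zero>}" using that by (simp add: free_mod_simps)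
    then have "finite {i. r \<otimes> f i \<noteq> \<zero>}" by (rule rev_finite_subset) (use that in auto)
    then show ?thesis using that by (auto simp: free_mod_simps)
  qed
  show "abelian_group (free_mod I dg)"
  proof (rule abelian_groupI)
    fix f assume f: "f \<in> carrier (free_mod I dg)"
    have "(\<ominus> \<one>) \<odot>\<^bsub>free_mod I dg\<^esub> f \<in> carrier (free_mod I dg)" using smc[OF _ f] by simp
    moreover have "(\<ominus> \<one>) \<odot>\<^bsub>free_mod I dg\<^esub> f \<oplus>\<^bsub>free_mod I dg\<^esub> f = \<zero>\<^bsub>free_mod I dg\<^esub>"
      using f by (auto simp: free_mod_simps R.l_minus R.l_neg)
    ultimately show "\<exists>g\<in>carrier (free_mod I dg). g \<oplus>\<^bsub>free_mod I dg\<^esub> f = \<zero>\<^bsub>free_mod I dg\<^esub>" by blast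
  next
    show "\<zero>\<^bsub>free_mod I dg\<^esub> \<in> carrier (free_mod I dg)" by (simp add: free_mod_simps)
  next
    fix f g assume "f \<in> carrier (free_mod I dg)" "g \<in> carrier (free_mod I dg)"
    then show "f \<oplus>\<^bsub>free_mod I dg\<^esub> g \<in> carrier (free_mod I dg)" using cl by (simp only: free_mod_simps(3))
  qed (auto simp: free_mod_simps R.a_ac)
qed (auto simp: free_mod_simps R.l_distr R.r_distr R.m_assoc)

lemma free_mod_eval_finsum:
  assumes "\<And>a. a \<in> S \<Longrightarrow> g a \<in> carrier (free_mod I dg)"
  shows "finsum (free_mod I dg) g S i = (\<Oplus>a\<in>S. g a i)"
proof -
  interpret F: module R "free_mod I dg" by (rule free_mod_module)
  show ?thesis using assms
  proof (induction S rule: infinite_finite_induct)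
    case (insert x S)
    then have "g \<in> S \<rightarrow> carrier (free_mod I dg)" "g x \<in> carrier (free_mod I dg)" by auto
    moreover have "(\<lambda>a. g a i) \<in> S \<rightarrow> carrier R" "g x i \<in> carrier R" using insert.prems by (auto simp: free_mod_simps(1))
    ultimately show ?case using insert by (simp add: free_mod_simps(3))
  qed (simp_all add: free_mod_simps(2))
qed

lemma free_mod_graded: "graded_module R (free_mod I dg)"
proof -
  interpret F: module R "free_mod I dg" by (rule free_mod_module)
  let ?F = "free_mod I dg" and ?p = "\<lambda>j f i. rc (j - dg i) (f i)"
  have comp: "?p j f \<in> mgrade ?F j" if f: "f \<in> carrier ?F" for f j
  proof -
    have "finite {i. f i \<noteq> \<zero>}" using f by (simp add: free_mod_simps)
    then have "finite {i. ?p j f i \<noteq> \<zero>}" by (rule rev_finite_subset) auto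
    then show ?thesis using f RM.gcomp_spec(1) by (simp add: free_mod_simps)
  qed
  have neg: "(\<ominus>\<^bsub>?F\<^esub> f) i = \<ominus> f i" if f: "f \<in> carrier ?F" for f i
  proof -
    have "(\<ominus>\<^bsub>?F\<^esub> f \<oplus>\<^bsub>?F\<^esub> f) i = \<zero>" using f by (simp add: F.M.l_neg free_mod_simps(2))
    then have "(\<ominus>\<^bsub>?F\<^esub> f) i \<oplus> f i = \<zero>" by (simp add: free_mod_simps(3))
    moreover have "(\<ominus>\<^bsub>?F\<^esub> f) i \<in> carrier R" "f i \<in> carrier R" using F.M.a_inv_closed[OF f] f by (simp_all add: free_mod_simps(1))
    ultimately show ?thesis by (metis R.minus_equality)
  qed
  show ?thesis
  proof (rule graded_moduleI[OF free_mod_module, where p = ?p])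
    show "subgroup (mgrade ?F j) (add_monoid ?F)" for j
    proof (rule F.M.add.subgroupI)
      show "mgrade ?F j \<subseteq> carrier ?F" by (auto simp: free_mod_simps(5))
      have "\<zero>\<^bsub>?F\<^esub> \<in> mgrade ?F j" using F.M.zero_closed by (auto simp: free_mod_simps(2,5))
      then show "mgrade ?F j \<noteq> {}" by blast
      show "\<ominus>\<^bsub>?F\<^esub> f \<in> mgrade ?F j" if "f \<in> mgrade ?F j" for f
        using that neg F.M.a_inv_closed RM.mgrade_uminus by (auto simp: free_mod_simps(5))
      show "f \<oplus>\<^bsub>?F\<^esub> g \<in> mgrade ?F j" if "f \<in> mgrade ?F j" "g \<in> mgrade ?F j" for f g
      proof -
        have "f \<oplus>\<^bsub>?F\<^esub> g \<in> carrier ?F" using that by (intro F.M.a_closed) (auto simp only: free_mod_simps(5))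
        then show ?thesis using that RM.mgrade_add by (simp add: free_mod_simps(3,5))
      qed
    qed
    show "r \<odot>\<^bsub>?F\<^esub> f \<in> mgrade ?F (i + j)" if r: "r \<in> rgrade R i" and f: "f \<in> mgrade ?F j" for r f i j
    proof -
      have "r \<odot>\<^bsub>?F\<^esub> f \<in> carrier ?F" using RM.mgrade_carrier[OF r] f by (intro F.smult_closed) (simp_all only: free_mod_simps(5))
      moreover have "r \<otimes> f l \<in> rgrade R (i + j - dg l)" for l
        using RM.mgrade_smult[OF r, of "f l" "j - dg l"] f by (simp add: free_mod_simps(5) algebra_simps)
      ultimately show ?thesis by (simp add: free_mod_simps(4,5))
    qed
    show "?p j f \<in> mgrade ?F j" if "f \<in> carrier ?F" for f j by (rule comp[OF that])
    show "?p j (f \<oplus>\<^bsub>?F\<^esub> g) = ?p j f \<oplus>\<^bsub>?F\<^esub> ?p j g" if "f \<in> carrier ?F" "g \<in> carrier ?F" for f g j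
      using that by (simp add: free_mod_simps RM.gcomp_add)
    show "?p j f = (if j = i then f else \<zero>\<^bsub>?F\<^esub>)" if "f \<in> mgrade ?F i" for f i j
    proof -
      have "f l \<in> rgrade R (i - dg l)" for l using that by (simp add: free_mod_simps(5))
      from RM.gcomp_homogeneous[OF this] have "rc (j - dg l) (f l) = (if j = i then f l else \<zero>)" for l by simp
      then show ?thesis by (simp add: free_mod_simps(2))
    qed
    show "\<exists>S. finite S \<and> (\<forall>j. j \<notin> S \<longrightarrow> ?p j f = \<zero>\<^bsub>?F\<^esub>) \<and> f = (\<Oplus>\<^bsub>?F\<^esub>j\<in>S. ?p j f)" if f: "f \<in> carrier ?F" for f
    proof -
      have fi: "f i \<in> carrier R" for i using f by (simp add: free_mod_simps)
      let ?S = "\<Union>i\<in>{i. f i \<noteq> \<zero>}. (\<lambda>j. j + dg i) ` {j. rc j (f i) \<noteq> \<zero>}"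
      have fin: "finite ?S" using f RM.gcomp_spec(2)[OF fi] by (auto simp: free_mod_simps)
      have out: "rc (j - dg i) (f i) = \<zero>" if "j \<notin> ?S" for i j
      proof (cases "f i = \<zero>")
        case False
        show ?thesis
        proof (rule ccontr)
          assume "rc (j - dg i) (f i) \<noteq> \<zero>"
          then have "j - dg i + dg i \<in> (\<lambda>j. j + dg i) ` {j. rc j (f i) \<noteq> \<zero>}" by (intro imageI CollectI)
          then have "j \<in> ?S" using False by (intro UN_I[of i]) simp_all
          with that show False by blast
        qed
      qed simp
      have "(\<Oplus>\<^bsub>?F\<^esub>j\<in>?S. ?p j f) i = f i" for i
      proof -
        have "(\<Oplus>\<^bsub>?F\<^esub>j\<in>?S. ?p j f) i = (\<Oplus>j\<in>?S. rc (j - dg i) (f i))"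
          using comp[OF f] by (intro free_mod_eval_finsum) (simp add: free_mod_simps(5))
        also have "\<dots> = (\<Oplus>j\<in>(\<lambda>j. j - dg i) ` ?S. rc j (f i))"
          using fi by (subst R.finsum_reindex) (auto simp: inj_on_def)
        also have "\<dots> = f i"
        proof (rule RM.gcomp_sum[symmetric, simplified finsum_regular_module])
          show "rc j (f i) = \<zero>" if "j \<notin> (\<lambda>j. j - dg i) ` ?S" for j
          proof -
            have "j + dg i \<notin> ?S"
            proof
              assume "j + dg i \<in> ?S"
              then have "j + dg i - dg i \<in> (\<lambda>j. j - dg i) ` ?S" by (rule imageI)
              with that show False by simp
            qed
            from out[OF this, of i] show ?thesis by simp
          qed
        qed (use fin fi in auto)
        finally show ?thesis .
      qed
      then have "f = (\<Oplus>\<^bsub>?F\<^esub>j\<in>?S. ?p j f)" by auto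
      moreover have "?p j f = \<zero>\<^bsub>?F\<^esub>" if "j \<notin> ?S" for j
        using out[OF that] by (auto simp: free_mod_simps(2))
      ultimately show ?thesis using fin by blast
    qed
  qed
qed

definition std_gen :: "nat \<Rightarrow> nat \<Rightarrow> 'r" where "std_gen i = (\<lambda>l. if l = i then \<one> else \<zero>)"

lemma std_gen_inj: "inj std_gen"
  using one_neq_zero by (auto simp: inj_def std_gen_def fun_eq_iff split: if_splits)

lemma one_grade: "\<one> \<in> rgrade R 0" using scalar_grade[of 1] scalar_one by simp

lemma std_gen_grade: "i \<in> I \<Longrightarrow> std_gen i \<in> mgrade (free_mod I dg) (dg i)"
  using one_grade by (auto simp: free_mod_simps std_gen_def)

lemma std_gen_carrier: "i \<in> I \<Longrightarrow> std_gen i \<in> carrier (free_mod I dg)"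
  using std_gen_grade free_mod_simps(5) by blast

lemma free_mod_expansion:
  assumes f: "f \<in> carrier (free_mod I dg)" and S: "finite S" "{i. f i \<noteq> \<zero>} \<subseteq> S" "S \<subseteq> I"
  shows "f = (\<Oplus>\<^bsub>free_mod I dg\<^esub>i\<in>S. f i \<odot>\<^bsub>free_mod I dg\<^esub> std_gen i)"
proof
  interpret F: graded_module R "free_mod I dg" by (rule free_mod_graded)
  fix l
  have fi: "f i \<in> carrier R" for i using f by (simp add: free_mod_simps)
  have "(\<Oplus>\<^bsub>free_mod I dg\<^esub>i\<in>S. f i \<odot>\<^bsub>free_mod I dg\<^esub> std_gen i) l = (\<Oplus>i\<in>S. (f i \<odot>\<^bsub>free_mod I dg\<^esub> std_gen i) l)"
    using fi S std_gen_carrier by (intro free_mod_eval_finsum F.smult_closed) auto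
  also have "\<dots> = (\<Oplus>i\<in>S. if l = i then f i else \<zero>)"
    using fi by (intro R.finsum_cong') (auto simp: free_mod_simps(4) std_gen_def)
  also have "\<dots> = f l"
  proof (cases "l \<in> S")
    case True
    then show ?thesis using fi S by (intro R.finsum_singleton) auto
  next
    case False
    then have "(\<Oplus>i\<in>S. if l = i then f i else \<zero>) = (\<Oplus>i\<in>S. \<zero>)" using fi by (intro R.finsum_cong') auto
    moreover have "f l = \<zero>" using False S by auto
    ultimately show ?thesis by simp
  qed
  finally show "f l = (\<Oplus>\<^bsub>free_mod I dg\<^esub>i\<in>S. f i \<odot>\<^bsub>free_mod I dg\<^esub> std_gen i) l" by simp
qed

lemma free_mod_free: "hbasis (free_mod I dg) (std_gen ` I)"
proof -
  interpret F: graded_module R "free_mod I dg" by (rule free_mod_graded)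
  let ?F = "free_mod I dg"
  have uc: "std_gen i \<in> carrier ?F" if "i \<in> I" for i using std_gen_grade[OF that] F.mgrade_carrier by blast
  have lc: "F.lincomb a (std_gen ` S) = (\<lambda>i. if i \<in> S then a (std_gen i) else \<zero>)"
    if "finite S" "S \<subseteq> I" "a \<in> std_gen ` S \<rightarrow> carrier R" for a S
  proof -
    let ?f = "\<lambda>i. if i \<in> S then a (std_gen i) else \<zero>"
    have f: "?f \<in> carrier ?F" using that by (auto simp: free_mod_simps)
    have aR: "a (std_gen i) \<in> carrier R" if "i \<in> S" for i using \<open>a \<in> std_gen ` S \<rightarrow> carrier R\<close> that by blast
    have sm: "a (std_gen i) \<odot>\<^bsub>?F\<^esub> std_gen i \<in> carrier ?F" if "i \<in> S" for i
      using aR[OF that] uc[of i] that \<open>S \<subseteq> I\<close> by (intro F.smult_closed) auto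
    have "F.lincomb a (std_gen ` S) = (\<Oplus>\<^bsub>?F\<^esub>i\<in>S. a (std_gen i) \<odot>\<^bsub>?F\<^esub> std_gen i)"
      unfolding F.lincomb_def using sm inj_on_subset[OF std_gen_inj subset_UNIV, of S] by (subst F.M.finsum_reindex) auto
    also have "\<dots> = (\<Oplus>\<^bsub>?F\<^esub>i\<in>S. ?f i \<odot>\<^bsub>?F\<^esub> std_gen i)"
      using sm by (intro F.M.finsum_cong') auto
    also have "\<dots> = ?f" by (rule free_mod_expansion[OF f that(1) _ that(2), symmetric]) auto
    finally show ?thesis .
  qed
  have "\<not> F.lin_dep (std_gen ` I)"
  proof
    assume "F.lin_dep (std_gen ` I)"
    then obtain A a v where A: "finite A" "A \<subseteq> std_gen ` I" "a \<in> A \<rightarrow> carrier R" "F.lincomb a A = \<zero>\<^bsub>?F\<^esub>" "v \<in> A" "a v \<noteq> \<zero>"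
      unfolding F.lin_dep_def by blast
    obtain S where S: "S \<subseteq> I" "finite S" "A = std_gen ` S"
      using finite_subset_image[OF A(1,2)] by blast
    from A(5) obtain i where i: "v = std_gen i" "i \<in> S" unfolding S(3) by (rule imageE)
    have eq1: "F.lincomb a (std_gen ` S) = (\<lambda>_. \<zero>)" using A(4) unfolding S(3) free_mod_simps(2) .
    have eq2: "F.lincomb a (std_gen ` S) = (\<lambda>i. if i \<in> S then a (std_gen i) else \<zero>)"
      by (rule lc[OF S(2,1)]) (use A(3) in \<open>simp only: S(3)\<close>)
    from fun_cong[OF trans[OF eq2[symmetric] eq1], of i] show False using i A(6) by simp
  qed
  moreover have "F.span (std_gen ` I) = carrier ?F"
  proof
    show "F.span (std_gen ` I) \<subseteq> carrier ?F" by (rule F.span_is_subset2) (use uc in auto)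
    show "carrier ?F \<subseteq> F.span (std_gen ` I)"
    proof
      fix f assume f: "f \<in> carrier ?F"
      let ?S = "{i. f i \<noteq> \<zero>}"
      have S: "finite ?S" "?S \<subseteq> I" using f by (auto simp: free_mod_simps)
      define a where "a = (\<lambda>u. f (inv_into UNIV std_gen u))"
      have a: "a (std_gen i) = f i" for i by (simp add: a_def inv_f_f[OF std_gen_inj])
      have "f i \<in> carrier R" for i using f by (simp add: free_mod_simps)
      then have aR: "a \<in> std_gen ` ?S \<rightarrow> carrier R" unfolding Pi_def using a by auto
      have "F.lincomb a (std_gen ` ?S) = f" unfolding lc[OF S aR] by (auto simp: a)
      then show "f \<in> F.span (std_gen ` I)" unfolding F.span_def using S aR
        by (intro CollectI exI[of _ a] exI[of _ "std_gen ` ?S"] conjI image_mono) auto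
    qed
  qed
  moreover have "std_gen ` I \<subseteq> (\<Union>j. mgrade ?F j)" using std_gen_grade by blast
  ultimately show ?thesis by (simp add: hbasis_def)
qed

lemma free_mod_graded_free: "graded_free R (free_mod I dg)"
  using free_mod_graded free_mod_free graded_free_iff by blast

text \<open>In each degree only the finitely many generators of smaller or equal degree contribute.\<close>

lemma free_mod_locfin:
  assumes lo: "\<And>i. i \<in> I \<Longrightarrow> lo \<le> dg i" and fin: "\<And>j. finite {i \<in> I. dg i \<le> j}"
  shows "locfin lo (free_mod I dg)"
  unfolding locfin_def
proof (intro conjI allI impI)
  let ?F = "free_mod I dg"
  fix j assume "j < lo"
  show "mgrade ?F j \<subseteq> {\<zero>\<^bsub>?F\<^esub>}"
  proof
    fix f assume f: "f \<in> mgrade ?F j"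
    have "f i = \<zero>" for i
    proof (cases "i \<in> I")
      case True
      then show ?thesis using f lo[OF True] \<open>j < lo\<close> rgrade_neg[of "j - dg i"] by (auto simp: free_mod_simps)
    qed (use f in \<open>auto simp: free_mod_simps\<close>)
    then show "f \<in> {\<zero>\<^bsub>?F\<^esub>}" by (auto simp: free_mod_simps(2))
  qed
next
  let ?F = "free_mod I dg"
  fix j
  have "\<forall>i. \<exists>K. finite K \<and> (\<forall>\<kappa>\<in>K. lin_functional (graded_part R (regular_module R) (j - dg i)) \<kappa>) \<and>
    (\<forall>x\<in>rgrade R (j - dg i). (\<forall>\<kappa>\<in>K. \<kappa> x = 0) \<longrightarrow> x = \<zero>)"
    using rgrade_fin unfolding fin_graded_part_def by simp
  from choice[OF this] obtain K where "\<forall>i. finite (K i) \<and>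
      (\<forall>\<kappa>\<in>K i. lin_functional (graded_part R (regular_module R) (j - dg i)) \<kappa>) \<and>
      (\<forall>x\<in>rgrade R (j - dg i). (\<forall>\<kappa>\<in>K i. \<kappa> x = 0) \<longrightarrow> x = \<zero>)" by (elim exE)
  then have K: "\<And>i. finite (K i)"
    "\<And>i \<kappa>. \<kappa> \<in> K i \<Longrightarrow> lin_functional (graded_part R (regular_module R) (j - dg i)) \<kappa>"
    "\<And>i x. x \<in> rgrade R (j - dg i) \<Longrightarrow> (\<And>\<kappa>. \<kappa> \<in> K i \<Longrightarrow> \<kappa> x = 0) \<Longrightarrow> x = \<zero>"
    by simp_all
  let ?K = "\<Union>i\<in>{i \<in> I. dg i \<le> j}. (\<lambda>\<kappa> f. \<kappa> (f i)) ` K i"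
  show "fin_graded_part R ?F j" unfolding fin_graded_part_def
  proof (intro exI[of _ ?K] conjI ballI impI)
    show "finite ?K" using fin K(1) by auto
    fix \<kappa> assume "\<kappa> \<in> ?K"
    then obtain i \<kappa>' where \<kappa>: "\<kappa> = (\<lambda>f. \<kappa>' (f i))" "\<kappa>' \<in> K i" by blast
    show "lin_functional (graded_part R ?F j) \<kappa>"
      using K(2)[OF \<kappa>(2)] unfolding lin_functional_def graded_part_def \<kappa>(1)
      by (simp add: free_mod_simps(3,4,5))
  next
    fix f assume f: "f \<in> mgrade ?F j" "\<forall>\<kappa>\<in>?K. \<kappa> f = 0"
    have "f i = \<zero>" for i
    proof (cases "i \<in> I \<and> dg i \<le> j")
      case True
      show ?thesis
      proof (rule K(3)[of _ i])
        show "f i \<in> rgrade R (j - dg i)" using f(1) by (simp add: free_mod_simps(5))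
        show "\<kappa> (f i) = 0" if "\<kappa> \<in> K i" for \<kappa>
        proof -
          have "(\<lambda>f. \<kappa> (f i)) \<in> ?K" using True that by (intro UN_I[of i] image_eqI[of _ _ \<kappa>]) auto
          from bspec[OF f(2) this] show ?thesis .
        qed
      qed
    next
      case False
      have "f i \<in> rgrade R (j - dg i)" "i \<notin> I \<Longrightarrow> f i = \<zero>" using f(1) by (simp_all add: free_mod_simps(1,5))
      then show ?thesis using False rgrade_neg[of "j - dg i"] by force
    qed
    then show "f = \<zero>\<^bsub>?F\<^esub>" by (auto simp: free_mod_simps(2))
  qed
qed

lemma kfun_free_mod_eqI:
  assumes "kfun (free_mod I dg) j f" "\<And>i. i \<in> I \<Longrightarrow> dg i = j \<Longrightarrow> f (std_gen i) = 0" "x \<in> carrier (free_mod I dg)"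
  shows "f x = 0"
proof -
  interpret F: graded_module R "free_mod I dg" by (rule free_mod_graded)
  let ?S = "{i. x i \<noteq> \<zero>}"
  have S: "finite ?S" "?S \<subseteq> I" and xi: "\<And>i. x i \<in> carrier R" using assms(3) by (auto simp: free_mod_simps)
  have u: "std_gen i \<in> carrier (free_mod I dg)" if "i \<in> I" for i using std_gen_grade[OF that] F.mgrade_carrier by blast
  have "f x = f (\<Oplus>\<^bsub>free_mod I dg\<^esub>i\<in>?S. x i \<odot>\<^bsub>free_mod I dg\<^esub> std_gen i)"
    using free_mod_expansion[OF assms(3) S(1) _ S(2)] by simp
  also have "\<dots> = (\<Sum>i\<in>?S. f (x i \<odot>\<^bsub>free_mod I dg\<^esub> std_gen i))"
    using S xi u by (intro kfun_finsum[OF assms(1) F.module_axioms]) auto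
  also have "\<dots> = 0"
  proof (rule sum.neutral, rule ballI)
    fix i assume "i \<in> ?S"
    then have i: "i \<in> I" using S by blast
    have "f (std_gen i) = 0"
      using assms(2)[OF i] kfun_grade[OF assms(1) std_gen_grade[OF i]] by blast
    then show "f (x i \<odot>\<^bsub>free_mod I dg\<^esub> std_gen i) = 0" using kfun_smult[OF assms(1) xi u[OF i]] by simp
  qed
  finally show ?thesis .
qed

section \<open>Existence of resolutions and finiteness of Betti numbers\<close>

text \<open>The functionals to \<open>k\<close> of each degree form a finite dimensional space, which is zero below \<open>lo\<close>. This is
the finiteness that Betti numbers inherit.\<close>

definition kfun_fin :: "int \<Rightarrow> ('r, 'm, 'y) graded_module_scheme \<Rightarrow> bool"
  where "kfun_fin lo F \<longleftrightarrow> (\<forall>j. \<exists>C. finite C \<and> C \<subseteq> carrier F \<and> (j < lo \<longrightarrow> C = {}) \<and>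
    (\<forall>f x. kfun F j f \<longrightarrow> (\<forall>c\<in>C. f c = 0) \<longrightarrow> x \<in> carrier F \<longrightarrow> f x = 0))"

lemma std_gen_degree: "std_gen i \<in> mgrade (free_mod I dg) j \<Longrightarrow> j = dg i"
proof -
  assume "std_gen i \<in> mgrade (free_mod I dg) j"
  then have "\<one> \<in> rgrade R (j - dg i)" by (auto simp: free_mod_simps(5) std_gen_def dest: spec[of _ i])
  from RM.gcomp_homogeneous[OF this, of 0] RM.gcomp_homogeneous[OF one_grade, of 0] one_neq_zero
  show "j = dg i" by (auto split: if_splits)
qed

text \<open>Take vector space generators of all homogeneous parts as module generators. A cover by these is far from minimal, but
there are finitely many in each degree, and none below \<open>lo\<close>.\<close>

lemma locfin_cover:
  fixes Y :: "('r, 'm, 'y) graded_module_scheme"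
  assumes Y: "graded_module R Y" and lf: "locfin lo Y"
  shows "\<exists>(F :: ('r, nat \<Rightarrow> 'r) graded_module) \<epsilon>. graded_free R F \<and> locfin lo F \<and> kfun_fin lo F \<and>
    ghom R 0 F Y \<epsilon> \<and> \<epsilon> ` carrier F = carrier Y"
proof -
  interpret Y: graded_module R Y by fact
  have "\<forall>j. \<exists>(N::nat) b. (\<forall>i<N. b i \<in> mgrade Y j) \<and>
      (\<forall>x\<in>mgrade Y j. \<exists>c. x = (\<Oplus>\<^bsub>Y\<^esub>i\<in>{..<N}. scalar R (c i) \<odot>\<^bsub>Y\<^esub> b i))"
    using fin_graded_part_generators[OF Y] lf unfolding locfin_def by blast
  from choice[OF this] obtain N :: "int \<Rightarrow> nat" where "\<forall>j. \<exists>b. (\<forall>i<N j. b i \<in> mgrade Y j) \<and>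
      (\<forall>x\<in>mgrade Y j. \<exists>c. x = (\<Oplus>\<^bsub>Y\<^esub>i\<in>{..<N j}. scalar R (c i) \<odot>\<^bsub>Y\<^esub> b i))" by (elim exE)
  from choice[OF this] obtain b where "\<forall>j. (\<forall>i<N j. b j i \<in> mgrade Y j) \<and>
      (\<forall>x\<in>mgrade Y j. \<exists>c. x = (\<Oplus>\<^bsub>Y\<^esub>i\<in>{..<N j}. scalar R (c i) \<odot>\<^bsub>Y\<^esub> b j i))" by (elim exE)
  then have b: "\<And>j i. i < N j \<Longrightarrow> b j i \<in> mgrade Y j"
    "\<And>j x. x \<in> mgrade Y j \<Longrightarrow> \<exists>c. x = (\<Oplus>\<^bsub>Y\<^esub>i\<in>{..<N j}. scalar R (c i) \<odot>\<^bsub>Y\<^esub> b j i)" by simp_all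
  define dg where "dg c = lo + int (fst (prod_decode c))" for c
  define gen where "gen c = b (dg c) (snd (prod_decode c))" for c
  define I where "I = {c. snd (prod_decode c) < N (dg c)}"
  let ?F = "free_mod I dg"
  interpret F: graded_module R ?F by (rule free_mod_graded)
  have fin: "finite {i \<in> I. dg i \<le> j}" for j
  proof (rule finite_subset)
    show "{i \<in> I. dg i \<le> j} \<subseteq> prod_encode ` (SIGMA a:{..nat (j - lo)}. {..<N (lo + int a)})"
    proof
      fix i assume "i \<in> {i \<in> I. dg i \<le> j}"
      then show "i \<in> prod_encode ` (SIGMA a:{..nat (j - lo)}. {..<N (lo + int a)})"
        by (intro image_eqI[of _ _ "prod_decode i"]) (auto simp: I_def dg_def mem_Times_iff mem_Sigma_iff[of "fst (prod_decode i)" "snd (prod_decode i)", simplified])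
    qed
  qed auto
  have lo: "lo \<le> dg i" for i by (simp add: dg_def)
  define g where "g u = gen (inv_into UNIV std_gen u)" for u
  have g: "g (std_gen i) = gen i" for i by (simp add: g_def inv_f_f[OF std_gen_inj])
  have "\<exists>\<epsilon>. ghom R 0 ?F Y \<epsilon> \<and> (\<forall>u\<in>std_gen ` I. \<epsilon> u = g u)"
  proof (rule free_extension[OF free_mod_graded free_mod_free Y])
    fix u j assume "u \<in> std_gen ` I" "u \<in> mgrade ?F j"
    then obtain i where i: "i \<in> I" "u = std_gen i" "j = dg i" using std_gen_degree by blast
    then show "g u \<in> mgrade Y (j + 0)" using b(1) by (simp add: g gen_def I_def)
  qed
  then obtain \<epsilon> where \<epsilon>: "ghom R 0 ?F Y \<epsilon>" "\<And>i. i \<in> I \<Longrightarrow> \<epsilon> (std_gen i) = gen i" using g by auto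
  note \<epsilon>0 = ghom_zero[OF \<epsilon>(1) F.module_axioms Y.module_axioms]
  have homog: "y \<in> \<epsilon> ` carrier ?F" if y: "y \<in> mgrade Y j" for y j
  proof (cases "j < lo")
    case True
    then have "y = \<zero>\<^bsub>Y\<^esub>" using lf y unfolding locfin_def by blast
    then show ?thesis using \<epsilon>0 by (intro image_eqI[of _ _ "\<zero>\<^bsub>?F\<^esub>"]) simp_all
  next
    case False
    obtain c where c: "y = (\<Oplus>\<^bsub>Y\<^esub>i\<in>{..<N j}. scalar R (c i) \<odot>\<^bsub>Y\<^esub> b j i)" using b(2)[OF y] by blast
    define h where "h i = prod_encode (nat (j - lo), i)" for i
    have dh: "dg (h i) = j" for i using False by (simp add: dg_def h_def)
    have hI: "h i \<in> I" if "i < N j" for i using that dh[of i] by (simp add: I_def) (simp add: h_def)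
    have gh: "gen (h i) = b j i" for i using dh[of i] by (simp add: gen_def) (simp add: h_def)
    have cl: "scalar R (c i) \<odot>\<^bsub>?F\<^esub> std_gen (h i) \<in> carrier ?F" if "i < N j" for i
      using std_gen_carrier[OF hI[OF that]] by simp
    have "\<epsilon> (\<Oplus>\<^bsub>?F\<^esub>i\<in>{..<N j}. scalar R (c i) \<odot>\<^bsub>?F\<^esub> std_gen (h i)) =
        (\<Oplus>\<^bsub>Y\<^esub>i\<in>{..<N j}. \<epsilon> (scalar R (c i) \<odot>\<^bsub>?F\<^esub> std_gen (h i)))"
      using cl by (intro ghom_finsum[OF \<epsilon>(1) F.module_axioms Y.module_axioms]) auto
    also have "\<dots> = y" unfolding c
    proof (rule Y.M.finsum_cong')
      show "\<epsilon> (scalar R (c i) \<odot>\<^bsub>?F\<^esub> std_gen (h i)) = scalar R (c i) \<odot>\<^bsub>Y\<^esub> b j i" if "i \<in> {..<N j}" for i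
        using that ghom_smult[OF \<epsilon>(1) scalar_carrier std_gen_carrier[OF hI]] \<epsilon>(2)[OF hI] gh by simp
      show "(\<lambda>i. scalar R (c i) \<odot>\<^bsub>Y\<^esub> b j i) \<in> {..<N j} \<rightarrow> carrier Y"
        using b(1) Y.mgrade_carrier by (intro Pi_I Y.smult_closed) auto
    qed simp
    finally have "\<epsilon> (\<Oplus>\<^bsub>?F\<^esub>i\<in>{..<N j}. scalar R (c i) \<odot>\<^bsub>?F\<^esub> std_gen (h i)) = y" .
    moreover have "(\<Oplus>\<^bsub>?F\<^esub>i\<in>{..<N j}. scalar R (c i) \<odot>\<^bsub>?F\<^esub> std_gen (h i)) \<in> carrier ?F"
      using cl by (intro F.M.finsum_closed) auto
    ultimately show ?thesis by (rule image_eqI[OF sym])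
  qed
  have "y \<in> \<epsilon> ` carrier ?F" if "y \<in> carrier Y" for y
    using that
  proof (induction rule: Y.homogeneous_induct)
    case zero
    show ?case by (rule homog[OF Y.mgrade_zero])
  next
    case (add x y j)
    obtain x' where x': "x = \<epsilon> x'" "x' \<in> carrier ?F" using add.IH by (elim imageE)
    obtain y' where y': "y = \<epsilon> y'" "y' \<in> carrier ?F" using homog[OF add.hyps(2)] by (elim imageE)
    show ?case using ghom_add[OF \<epsilon>(1) y'(2) x'(2)] x' y' by (intro image_eqI[of _ _ "y' \<oplus>\<^bsub>?F\<^esub> x'"]) auto
  qed
  then have surj: "\<epsilon> ` carrier ?F = carrier Y" using ghom_closed[OF \<epsilon>(1)] by blast
  have "kfun_fin lo ?F" unfolding kfun_fin_def
  proof (intro allI)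
    fix j
    show "\<exists>C. finite C \<and> C \<subseteq> carrier ?F \<and> (j < lo \<longrightarrow> C = {}) \<and>
      (\<forall>f x. kfun ?F j f \<longrightarrow> (\<forall>c\<in>C. f c = 0) \<longrightarrow> x \<in> carrier ?F \<longrightarrow> f x = 0)"
    proof -
      let ?C = "std_gen ` {i \<in> I. dg i = j}"
      have 1: "finite ?C"
        by (rule finite_imageI, rule finite_subset[OF _ fin[of j]]) auto
      have 2: "?C \<subseteq> carrier ?F" using std_gen_carrier by blast
      have "{i \<in> I. dg i = j} = {}" if "j < lo"
      proof -
        have "\<not> (i \<in> I \<and> dg i = j)" for i using lo[of i] that by linarith
        then show ?thesis by blast
      qed
      then have 3: "j < lo \<longrightarrow> ?C = {}" by (metis image_empty)
      have 4: "f x = 0" if "kfun ?F j f" "\<forall>c\<in>?C. f c = 0" "x \<in> carrier ?F" for f x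
      proof (rule kfun_free_mod_eqI[OF that(1) _ that(3)])
        fix i assume "i \<in> I" "dg i = j"
        then have "std_gen i \<in> ?C" by (intro imageI CollectI conjI)
        with that(2) show "f (std_gen i) = 0" by (rule bspec)
      qed
      show ?thesis
        by (rule exI[of _ ?C], intro conjI allI impI) (rule 1, rule 2, rule 3[rule_format], assumption, rule 4)
    qed
  qed
  then show ?thesis
    using free_mod_graded_free free_mod_locfin[OF lo fin] \<epsilon>(1) surj by blast
qed

lemma locfin_submod:
  assumes "locfin lo Y" shows "locfin lo (submod Y N)"
  unfolding locfin_def
proof (intro conjI allI impI)
  show "mgrade (submod Y N) j \<subseteq> {\<zero>\<^bsub>submod Y N\<^esub>}" if "j < lo" for j
    using assms that by (auto simp: locfin_def)
  fix j
  obtain K where K: "finite K \<and> (\<forall>\<kappa>\<in>K. lin_functional (graded_part R Y j) \<kappa>) \<and>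
    (\<forall>x\<in>mgrade Y j. (\<forall>\<kappa>\<in>K. \<kappa> x = 0) \<longrightarrow> x = \<zero>\<^bsub>Y\<^esub>)"
    using assms unfolding locfin_def fin_graded_part_def by meson
  have "lin_functional (graded_part R (submod Y N) j) \<kappa>" if "\<kappa> \<in> K" for \<kappa>
    using K that by (auto simp: lin_functional_def graded_part_def)
  with K show "fin_graded_part R (submod Y N) j"
    unfolding fin_graded_part_def by (intro exI[of _ K]) auto
qed

text \<open>Cover the module, then the kernel of the cover, and so on: kernels stay bounded below and
degreewise finite.\<close>

lemma locfin_resolution:
  fixes Y :: "('r, 'm, 'y) graded_module_scheme"
  assumes Y: "graded_module R Y" and lf: "locfin lo Y"
  shows "\<exists>(F :: nat \<Rightarrow> ('r, nat \<Rightarrow> 'r) graded_module) \<delta> \<epsilon>. free_resolution R Y F \<delta> \<epsilon> \<and> (\<forall>n. kfun_fin lo (F n))"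
proof -
  obtain F0 :: "('r, nat \<Rightarrow> 'r) graded_module" and \<epsilon> where F0: "graded_free R F0" "locfin lo F0" "kfun_fin lo F0"
    "ghom R 0 F0 Y \<epsilon>" "\<epsilon> ` carrier F0 = carrier Y"
    using locfin_cover[OF Y lf] by blast
  define K0 where "K0 = submod F0 {x \<in> carrier F0. \<epsilon> x = \<zero>\<^bsub>Y\<^esub>}"
  have grF: "graded_module R F" if "graded_free R F" for F :: "('r, nat \<Rightarrow> 'r) graded_module"
    using that by (simp add: graded_free_def)
  define good :: "nat \<Rightarrow> ('r, nat \<Rightarrow> 'r) graded_module \<times> ('r, nat \<Rightarrow> 'r) graded_module \<times> ((nat \<Rightarrow> 'r) \<Rightarrow> (nat \<Rightarrow> 'r)) \<Rightarrow> bool"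
    where "good n s \<longleftrightarrow> (case s of (F, K, \<delta>) \<Rightarrow> graded_free R F \<and> kfun_fin lo F \<and> graded_module R K \<and> locfin lo K \<and>
      K = submod F (carrier K) \<and> carrier K \<subseteq> carrier F \<and> (n = 0 \<longrightarrow> F = F0 \<and> K = K0))" for n s
  define nxt :: "('r, nat \<Rightarrow> 'r) graded_module \<times> ('r, nat \<Rightarrow> 'r) graded_module \<times> ((nat \<Rightarrow> 'r) \<Rightarrow> (nat \<Rightarrow> 'r)) \<Rightarrow>
      ('r, nat \<Rightarrow> 'r) graded_module \<times> ('r, nat \<Rightarrow> 'r) graded_module \<times> ((nat \<Rightarrow> 'r) \<Rightarrow> (nat \<Rightarrow> 'r)) \<Rightarrow> bool"
    where "nxt s s' \<longleftrightarrow> (case s of (F, K, \<delta>) \<Rightarrow> case s' of (F', K', \<delta>') \<Rightarrow> ghom R 0 F' K \<delta>' \<and>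
      \<delta>' ` carrier F' = carrier K \<and> carrier K' = {x \<in> carrier F'. \<delta>' x = \<zero>\<^bsub>K\<^esub>})" for s s'
  have "\<exists>f. \<forall>n. good n (f n) \<and> nxt (f n) (f (Suc n))"
  proof (rule dependent_nat_choice)
    have "good 0 (F0, K0, undefined)"
      unfolding good_def using F0 kernel_graded[OF grF[OF F0(1)] Y F0(4)] locfin_submod[OF F0(2)] by (simp add: K0_def)
    then show "\<exists>s. good 0 s" by blast
  next
    fix s n assume s: "good n s"
    obtain F K \<delta> where sF: "s = (F, K, \<delta>)" by (cases s)
    have K: "graded_module R K" "locfin lo K" using s by (auto simp: good_def sF)
    obtain F' :: "('r, nat \<Rightarrow> 'r) graded_module" and \<delta>' where F': "graded_free R F'" "locfin lo F'" "kfun_fin lo F'"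
      "ghom R 0 F' K \<delta>'" "\<delta>' ` carrier F' = carrier K"
      using locfin_cover[OF K] by blast
    let ?K' = "submod F' {x \<in> carrier F'. \<delta>' x = \<zero>\<^bsub>K\<^esub>}"
    have "good (Suc n) (F', ?K', \<delta>')"
      unfolding good_def using F' kernel_graded[OF grF[OF F'(1)] K(1) F'(4)] locfin_submod[OF F'(2)] by simp
    moreover have "nxt s (F', ?K', \<delta>')" using F' by (simp add: nxt_def sF)
    ultimately show "\<exists>s'. good (Suc n) s' \<and> nxt s s'" by blast
  qed
  then obtain f where f: "\<And>n. good n (f n)" "\<And>n. nxt (f n) (f (Suc n))" by blast
  define F where "F n = fst (f n)" for n
  define K where "K n = fst (snd (f n))" for n
  define \<delta> where "\<delta> n = snd (snd (f (Suc n)))" for n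
  have fn: "f n = (F n, K n, snd (snd (f n)))" for n by (simp add: F_def K_def)
  have good: "graded_free R (F n)" "kfun_fin lo (F n)" "K n = submod (F n) (carrier (K n))" "carrier (K n) \<subseteq> carrier (F n)" for n
    using f(1)[of n] by (simp_all add: good_def F_def K_def split: prod.splits)
  have zero: "F 0 = F0" "K 0 = K0" using f(1)[of 0] by (simp_all add: good_def F_def K_def split: prod.splits)
  have nxt: "ghom R 0 (F (Suc n)) (K n) (\<delta> n)" "\<delta> n ` carrier (F (Suc n)) = carrier (K n)"
    "carrier (K (Suc n)) = {x \<in> carrier (F (Suc n)). \<delta> n x = \<zero>\<^bsub>K n\<^esub>}" for n
    using f(2)[of n] by (simp_all add: nxt_def F_def K_def \<delta>_def split: prod.splits)
  have sel: "\<zero>\<^bsub>K n\<^esub> = \<zero>\<^bsub>F n\<^esub>" "add (K n) = add (F n)" "module.smult (K n) = module.smult (F n)"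
    "mgrade (K n) j = carrier (K n) \<inter> mgrade (F n) j" for n j
    by (subst good(3), simp)+
  have \<delta>: "ghom R 0 (F (Suc n)) (F n) (\<delta> n)" for n
    by (rule ghomI) (use ghomD[OF nxt(1)[of n]] good(4)[of n] in \<open>auto simp: sel\<close>)
  have "free_resolution R Y F \<delta> \<epsilon>"
    unfolding free_resolution_def
  proof (intro conjI allI)
    show "\<epsilon> \<in> module_hom R (F 0) Y" "\<epsilon> ` mgrade (F 0) j \<subseteq> mgrade Y j" for j
      using F0(4) by (auto simp: ghom_def zero)
    show "\<delta> i \<in> module_hom R (F (Suc i)) (F i)" "\<delta> i ` mgrade (F (Suc i)) j \<subseteq> mgrade (F i) j" for i j
      using \<delta>[of i] by (auto simp: ghom_def)
    show "\<epsilon> ` carrier (F 0) = carrier Y" using F0(5) zero by simp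
    show "\<delta> 0 ` carrier (F 1) = {x \<in> carrier (F 0). \<epsilon> x = \<zero>\<^bsub>Y\<^esub>}"
      using nxt(2)[of 0] by (simp add: zero K0_def)
    show "\<delta> (Suc i) ` carrier (F (Suc (Suc i))) = {x \<in> carrier (F (Suc i)). \<delta> i x = \<zero>\<^bsub>F i\<^esub>}" for i
      using nxt(2)[of "Suc i"] nxt(3)[of i] by (simp add: sel)
  qed (rule good(1))
  then show ?thesis using good(2) by blast
qed

lemma locfin_kk: "locfin 0 kk"
  unfolding locfin_def
proof (intro conjI allI impI)
  show "mgrade kk j \<subseteq> {\<zero>\<^bsub>kk\<^esub>}" if "j < 0" for j using that by (simp add: kk_simps)
  fix j
  have inv: "inv_into UNIV kinj (kinj a) = a" for a by (simp add: inv_f_f inj_def)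
  show "fin_graded_part R kk j" unfolding fin_graded_part_def
  proof (intro exI[of _ "{inv_into UNIV kinj}"] conjI ballI impI)
    fix \<kappa> assume "\<kappa> \<in> {inv_into UNIV kinj}"
    then show "lin_functional (graded_part R kk j) \<kappa>"
      by (auto simp: lin_functional_def graded_part_def kk_simps inv split: if_splits)
  next
    fix x assume "x \<in> mgrade kk j" "\<forall>\<kappa>\<in>{inv_into UNIV kinj}. \<kappa> x = 0"
    then show "x = \<zero>\<^bsub>kk\<^esub>" by (auto simp: kk_simps inv split: if_splits)
  qed simp
qed

text \<open>A resolution with the right finiteness exists, but it need not be \<open>F\<close>. Let \<open>E\<close> be such a resolution. The
composite of comparison maps from \<open>F\<close> to \<open>E\<close> and back is homotopic to the identity. Hence a cocycle on \<open>F\<close>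
that vanishes on the images of the finitely many elements of \<open>E\<close> that detect functionals is a coboundary, and evaluation
at these images gives finitely many functionals on cocycles that detect coboundaries.\<close>

lemma cohomology_finite:
  fixes F :: "nat \<Rightarrow> ('r, 'f) graded_module"
  assumes Y: "graded_module R Y" and lf: "locfin lo Y" and F: "free_resolution R Y F \<delta> \<epsilon>"
  defines "D \<equiv> \<lambda>n j. vectorspace.dim (class_ring :: 'k ring) (cohomology R F \<delta> kk n j)"
  shows "\<exists>b \<kappa>. coh_basis F \<delta> n j (D n j) b \<kappa>" "j < lo \<Longrightarrow> D n j = 0"
proof -
  obtain E :: "nat \<Rightarrow> ('r, nat \<Rightarrow> 'r) graded_module" and \<delta>' \<epsilon>' where
    E: "free_resolution R Y E \<delta>' \<epsilon>'" and fin: "\<And>n. kfun_fin lo (E n)"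
    using locfin_resolution[OF Y lf] by blast
  note Fr = free_resolutionD[OF F] and Er = free_resolutionD[OF E]
  have mF: "module R (F n)" for n using Fr(2)[of n] graded_module.axioms(1) by blast
  have mY: "module R Y" using Y graded_module.axioms(1) by blast
  obtain \<alpha> where \<alpha>: "\<And>n. ghom R 0 (F n) (E n) (\<alpha> n)" "\<And>x. x \<in> carrier (F 0) \<Longrightarrow> \<epsilon>' (\<alpha> 0 x) = \<epsilon> x"
    "\<And>n x. x \<in> carrier (F (Suc n)) \<Longrightarrow> \<delta>' n (\<alpha> (Suc n) x) = \<alpha> n (\<delta> n x)"
    using comparison_map[where F = F and G = E, OF Fr(1) Fr(4) Fr(7) E Y Fr(3) Fr(6)] by blast
  obtain \<gamma> where \<gamma>: "\<And>n. ghom R 0 (E n) (F n) (\<gamma> n)" "\<And>x. x \<in> carrier (E 0) \<Longrightarrow> \<epsilon> (\<gamma> 0 x) = \<epsilon>' x"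
    "\<And>n x. x \<in> carrier (E (Suc n)) \<Longrightarrow> \<delta> n (\<gamma> (Suc n) x) = \<gamma> n (\<delta>' n x)"
    using comparison_map[where F = E and G = F, OF Er(1) Er(4) Er(7) F Y Er(3) Er(6)] by blast
  define w where "w n x = \<gamma> n (\<alpha> n x) \<ominus>\<^bsub>F n\<^esub> x" for n x
  have w: "ghom R 0 (F n) (F n) (w n)" for n
    unfolding w_def by (intro ghom_pointwise_minus[OF Fr(2)] ghom_comp[OF \<gamma>(1) \<alpha>(1)] ghom_id) simp
  have "\<exists>s. (\<forall>n. ghom R 0 (F n) (F (Suc n)) (s n)) \<and> (\<forall>x\<in>carrier (F 0). \<delta> 0 (s 0 x) = w 0 x) \<and>
    (\<forall>n. \<forall>x\<in>carrier (F (Suc n)). \<delta> (Suc n) (s (Suc n) x) = w (Suc n) x \<ominus>\<^bsub>F (Suc n)\<^esub> s n (\<delta> n x))"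
  proof (rule null_homotopy[where P = F and Q = F and dP = \<delta> and dQ = \<delta>, OF Fr(1) Fr(2) Fr(4) Fr(7) Fr(4) Fr(9) w])
    fix n x assume x: "x \<in> carrier (F (Suc n))"
    have "\<delta> n (w (Suc n) x) = \<delta> n (\<gamma> (Suc n) (\<alpha> (Suc n) x)) \<ominus>\<^bsub>F n\<^esub> \<delta> n x"
      unfolding w_def using x ghom_closed[OF \<gamma>(1)] ghom_closed[OF \<alpha>(1)] by (intro ghom_minus[OF Fr(4) mF mF]) auto
    then show "\<delta> n (w (Suc n) x) = w n (\<delta> n x)"
      using x \<gamma>(3)[OF ghom_closed[OF \<alpha>(1) x]] \<alpha>(3)[OF x] by (simp add: w_def)
  next
    fix x assume x: "x \<in> carrier (F 0)"
    interpret Y: module R Y by (rule mY)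
    have c: "\<gamma> 0 (\<alpha> 0 x) \<in> carrier (F 0)" using x ghom_closed[OF \<gamma>(1)] ghom_closed[OF \<alpha>(1)] by blast
    have "\<epsilon> (w 0 x) = \<epsilon> x \<ominus>\<^bsub>Y\<^esub> \<epsilon> x"
      unfolding w_def using ghom_minus[OF Fr(3) mF mY c x] \<gamma>(2)[OF ghom_closed[OF \<alpha>(1) x]] \<alpha>(2)[OF x] by simp
    also have "\<dots> = \<zero>\<^bsub>Y\<^esub>" using ghom_closed[OF Fr(3) x] by (simp add: a_minus_def Y.M.r_neg)
    finally show "w 0 x \<in> \<delta> 0 ` carrier (F (Suc 0))" using Fr(8)[OF ghom_closed[OF w x]] by blast
  qed
  then obtain s where s: "\<And>n. ghom R 0 (F n) (F (Suc n)) (s n)" "\<And>x. x \<in> carrier (F 0) \<Longrightarrow> \<delta> 0 (s 0 x) = w 0 x"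
    "\<And>n x. x \<in> carrier (F (Suc n)) \<Longrightarrow> \<delta> (Suc n) (s (Suc n) x) = w (Suc n) x \<ominus>\<^bsub>F (Suc n)\<^esub> s n (\<delta> n x)" by blast
  obtain C where "finite C \<and> C \<subseteq> carrier (E n) \<and> (j < lo \<longrightarrow> C = {}) \<and>
    (\<forall>f x. kfun (E n) j f \<longrightarrow> (\<forall>c\<in>C. f c = 0) \<longrightarrow> x \<in> carrier (E n) \<longrightarrow> f x = 0)"
    using fin[of n, unfolded kfun_fin_def, THEN spec, of j] by (elim exE)
  then have C: "finite C" "j < lo \<Longrightarrow> C = {}"
    "\<And>f x. kfun (E n) j f \<Longrightarrow> (\<And>c. c \<in> C \<Longrightarrow> f c = 0) \<Longrightarrow> x \<in> carrier (E n) \<Longrightarrow> f x = 0"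
    by simp_all
  obtain m :: nat and c where c: "C = c ` {..<m}" using finite_set_enum_functionals[OF C(1)] .
  define \<kappa> :: "nat \<Rightarrow> ('f \<Rightarrow> 'k) \<Rightarrow> 'k" where "\<kappa> i z = z (\<gamma> n (c i))" for i z
  have lin: "lin_functional (cocyc_module F \<delta> n j) (\<kappa> i)" for i
    by (simp add: lin_functional_def cocyc_module_def \<kappa>_def)
  have ker: "cobd F \<delta> n j z" if z: "cocyc F \<delta> n j z" and 0: "\<And>i. i < m \<Longrightarrow> \<kappa> i z = 0" for z
  proof -
    have kz: "kfun (F n) j z" and z\<delta>: "\<And>x. x \<in> carrier (F (Suc n)) \<Longrightarrow> z (\<delta> n x) = 0" using z by (auto simp: cocyc_def)
    have "z (\<gamma> n y) = 0" if "y \<in> carrier (E n)" for y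
    proof (rule C(3)[OF _ _ that])
      show "kfun (E n) j (\<lambda>y. z (\<gamma> n y))" by (rule kfun_comp[OF kz \<gamma>(1)]) simp
      show "z (\<gamma> n c') = 0" if "c' \<in> C" for c' using 0 that unfolding c \<kappa>_def by blast
    qed
    then have zw: "z (w n x) = - z x" if "x \<in> carrier (F n)" for x
      unfolding w_def using that kfun_minus[OF kz mF ghom_closed[OF \<gamma>(1) ghom_closed[OF \<alpha>(1)]], of x x] ghom_closed[OF \<alpha>(1)] by simp
    show ?thesis
    proof (cases n)
      case n: 0
      have "z x = 0" if "x \<in> carrier (F 0)" for x
        using z\<delta>[of "s 0 x"] zw[of x] s(2)[OF that] ghom_closed[OF s(1) that] that n by simp
      then show ?thesis using n by simp
    next
      case n: (Suc l)
      have "z x = - 1 * z (s l (\<delta> l x))" if x: "x \<in> carrier (F n)" for x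
      proof -
        have x': "x \<in> carrier (F (Suc l))" using x n by simp
        have cl: "w (Suc l) x \<in> carrier (F (Suc l))" "s l (\<delta> l x) \<in> carrier (F (Suc l))"
          using ghom_closed[OF w x'] ghom_closed[OF s(1) ghom_closed[OF Fr(4) x']] by auto
        have "0 = z (w (Suc l) x \<ominus>\<^bsub>F (Suc l)\<^esub> s l (\<delta> l x))"
          using z\<delta>[of "s n x"] s(3)[OF x'] ghom_closed[OF s(1) x] n by simp
        also have "\<dots> = z (w (Suc l) x) - z (s l (\<delta> l x))"
          using kfun_minus[OF kz[unfolded n] mF cl] .
        finally show ?thesis using zw[OF x] n by simp
      qed
      moreover have "kfun (F l) j (\<lambda>x. - 1 * z (s l x))"
        by (rule kfun_scale, rule kfun_comp[OF kz[unfolded n] s(1)]) simp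
      ultimately show ?thesis unfolding n cobd.simps by (intro exI[of _ "\<lambda>x. - 1 * z (s l x)"]) (simp add: n)
    qed
  qed
  note dims = cohomology_dim[where F = F and \<delta> = \<delta> and n = n and j = j and m = m and \<kappa> = \<kappa>, OF Fr(2) Fr(4) lin ker]
  show "\<exists>b \<kappa>. coh_basis F \<delta> n j (D n j) b \<kappa>" using dims(2) unfolding D_def by blast
  show "D n j = 0" if "j < lo"
  proof -
    have "m = 0" using C(2)[OF that] c by auto
    then show ?thesis using dims(1) unfolding D_def by blast
  qed
qed

lemma betti_basis:
  assumes Y: "graded_module R Y" and lf: "locfin lo Y" and ch: "chosen_resolution R Y = (F, \<delta>)"
  shows "\<exists>\<epsilon>. free_resolution R Y F \<delta> \<epsilon>"
    and "\<exists>b \<kappa>. coh_basis F \<delta> n j (betti R \<mm> Y n j) b \<kappa>"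
    and "j < lo \<Longrightarrow> betti R \<mm> Y n j = 0"
proof -
  have "\<exists>p. case p of (F, \<delta>) \<Rightarrow> \<exists>\<epsilon>. free_resolution R Y (F :: nat \<Rightarrow> ('r, nat \<Rightarrow> 'r) graded_module) \<delta> \<epsilon>"
    using locfin_resolution[OF Y lf] by auto
  from someI_ex[OF this] ch show res: "\<exists>\<epsilon>. free_resolution R Y F \<delta> \<epsilon>" unfolding chosen_resolution_def by simp
  have bt: "betti R \<mm> Y n j = vectorspace.dim (class_ring :: 'k ring) (cohomology R F \<delta> kk n j)"
    by (simp add: betti_def Ext_def ch)
  from res obtain \<epsilon> where "free_resolution R Y F \<delta> \<epsilon>" by blast
  from cohomology_finite[OF Y lf this] show "\<exists>b \<kappa>. coh_basis F \<delta> n j (betti R \<mm> Y n j) b \<kappa>"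
    and "j < lo \<Longrightarrow> betti R \<mm> Y n j = 0" unfolding bt by blast+
qed

section \<open>Maps to and from the cone of the variables\<close>

lemma ghom_aug: "ghom R 0 (regular_module R) kk (\<lambda>r. kinj (aug r))"
proof (rule ghomI)
  show "kinj (aug x) \<in> mgrade kk (j + 0)" if "x \<in> mgrade (regular_module R) j" for x j
    using that aug_homogeneous[of x j] by (cases "j = 0") (auto simp: kk_simps)
qed (auto simp: kk_simps aug_add aug_mult)

text \<open>Since \<open>G 0\<close> is free, \<open>G 0 \<rightarrow> k\<close> factors through \<open>R \<rightarrow> k\<close>; boundaries are then sent into the
kernel \<open>\<mm>\<close> of \<open>R \<rightarrow> k\<close>.\<close>

lemma augmentation_lift:
  assumes G: "free_resolution R kk G \<gamma> \<eta>"
  obtains \<theta> where "ghom R 0 (G 0) (regular_module R) \<theta>" "\<And>x. x \<in> carrier (G 0) \<Longrightarrow> \<eta> x = kinj (aug (\<theta> x))"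
    "\<And>x. x \<in> carrier (G (Suc 0)) \<Longrightarrow> \<theta> (\<gamma> 0 x) \<in> \<mm>"
proof -
  note Gr = free_resolutionD[OF G]
  have onto: "y \<in> (\<lambda>r. kinj (aug r)) ` carrier (regular_module R)" if y: "y \<in> carrier kk" for y
  proof -
    from y obtain a where "y = kinj a" unfolding kk_simps(1) by (rule rangeE)
    then show ?thesis by (intro image_eqI[of _ _ "scalar R a"]) simp_all
  qed
  have "\<exists>\<theta>. ghom R 0 (G 0) (regular_module R) \<theta> \<and> (\<forall>x\<in>carrier (G 0). kinj (aug (\<theta> x)) = \<eta> x)"
    by (rule projective_lift[OF Gr(1) regular kk_graded Gr(3) ghom_aug]) (rule onto[OF ghom_closed[OF Gr(3)]])
  then obtain \<theta> where \<theta>: "ghom R 0 (G 0) (regular_module R) \<theta>" "\<And>x. x \<in> carrier (G 0) \<Longrightarrow> kinj (aug (\<theta> x)) = \<eta> x" by blast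
  have "\<theta> (\<gamma> 0 x) \<in> \<mm>" if x: "x \<in> carrier (G (Suc 0))" for x
  proof -
    have c: "\<gamma> 0 x \<in> carrier (G 0)" using ghom_closed[OF Gr(4) x] .
    have "kinj (aug (\<theta> (\<gamma> 0 x))) = kinj 0" using \<theta>(2)[OF c] Gr(6)[OF x] by (simp add: kk_simps)
    then show ?thesis using ghom_closed[OF \<theta>(1) c] by (simp add: in_\<mm>_iff)
  qed
  then show thesis using that \<theta> by metis
qed

text \<open>The equations of a chain map from \<open>G\<close> to the cone of the variables on \<open>F\<close>: \<open>\<phi>\<close> is its
component in \<open>F\<close>, and \<open>\<phi>'\<close> its components in the \<open>e\<close> shifted copies of \<open>F\<close>, where the differential
has the opposite sign.\<close>

definition lift_sys :: "(nat \<Rightarrow> ('r, 'g) graded_module) \<Rightarrow> (nat \<Rightarrow> 'g \<Rightarrow> 'g) \<Rightarrow> (nat \<Rightarrow> ('r, 'f) graded_module) \<Rightarrow>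
    (nat \<Rightarrow> 'f \<Rightarrow> 'f) \<Rightarrow> int \<Rightarrow> (nat \<Rightarrow> 'g \<Rightarrow> 'f) \<Rightarrow> (nat \<Rightarrow> nat \<Rightarrow> 'g \<Rightarrow> 'f) \<Rightarrow> bool"
  where "lift_sys G \<gamma> F \<delta> a \<phi> \<phi>' \<longleftrightarrow> (\<forall>n. ghom R a (G n) (F n) (\<phi> n)) \<and>
    (\<forall>i<e. \<forall>n. ghom R (a - int (d i)) (G (Suc n)) (F n) (\<phi>' i n)) \<and>
    (\<forall>i<e. \<forall>n. \<forall>x\<in>carrier (G (Suc (Suc n))). \<delta> n (\<phi>' i (Suc n) x) = \<ominus>\<^bsub>F n\<^esub> \<phi>' i n (\<gamma> (Suc n) x)) \<and>
    (\<forall>n. \<forall>x\<in>carrier (G (Suc n)). \<delta> n (\<phi> (Suc n) x) = \<phi> n (\<gamma> n x) \<ominus>\<^bsub>F n\<^esub> (\<Oplus>\<^bsub>F n\<^esub>i\<in>{..<e}. X i \<odot>\<^bsub>F n\<^esub> \<phi>' i n x))"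

text \<open>The equations of a chain map from the cone of the variables on \<open>F\<close> to \<open>G\<close>: a chain map \<open>\<psi>\<close> and, for each variable, a null
homotopy \<open>\<psi>'\<close> of its multiple.\<close>

definition proj_sys :: "(nat \<Rightarrow> ('r, 'f) graded_module) \<Rightarrow> (nat \<Rightarrow> 'f \<Rightarrow> 'f) \<Rightarrow> (nat \<Rightarrow> ('r, 'g) graded_module) \<Rightarrow>
    (nat \<Rightarrow> 'g \<Rightarrow> 'g) \<Rightarrow> int \<Rightarrow> (nat \<Rightarrow> 'f \<Rightarrow> 'g) \<Rightarrow> (nat \<Rightarrow> nat \<Rightarrow> 'f \<Rightarrow> 'g) \<Rightarrow> bool"
  where "proj_sys F \<delta> G \<gamma> a \<psi> \<psi>' \<longleftrightarrow> (\<forall>n. ghom R (- a) (F n) (G n) (\<psi> n)) \<and>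
    (\<forall>i<e. \<forall>n. ghom R (int (d i) - a) (F n) (G (Suc n)) (\<psi>' i n)) \<and>
    (\<forall>n. \<forall>x\<in>carrier (F (Suc n)). \<gamma> n (\<psi> (Suc n) x) = \<psi> n (\<delta> n x)) \<and>
    (\<forall>i<e. \<forall>x\<in>carrier (F 0). \<gamma> 0 (\<psi>' i 0 x) = X i \<odot>\<^bsub>G 0\<^esub> \<psi> 0 x) \<and>
    (\<forall>i<e. \<forall>n. \<forall>x\<in>carrier (F (Suc n)). \<gamma> (Suc n) (\<psi>' i (Suc n) x) = X i \<odot>\<^bsub>G (Suc n)\<^esub> \<psi> (Suc n) x \<ominus>\<^bsub>G (Suc n)\<^esub> \<psi>' i n (\<delta> n x))"

text \<open>On boundaries \<open>\<gamma> y\<close> in \<open>G 0\<close> the element \<open>r = \<theta> (\<gamma> y)\<close> lies in \<open>\<mm>\<close>, so that \<open>r v = \<Sum> x\<^sub>i (r l\<^sub>i)\<close> with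
\<open>r l\<^sub>i \<in> \<mm>L \<subseteq> M\<close>. The maps \<open>y \<mapsto> r l\<^sub>i\<close> from \<open>G 1\<close> to \<open>M\<close> vanish on boundaries and lift to chain maps \<open>\<phi>'\<close> from
the truncated and shifted resolution. With them in place, the lifts \<open>\<phi>\<close> are built step by step.\<close>

lemma lifting_maps:
  assumes L: "graded_module R L" and N: "graded_module R (submod L M)" and M: "M \<subseteq> carrier L"
    and mL: "\<And>r x. r \<in> \<mm> \<Longrightarrow> x \<in> carrier L \<Longrightarrow> r \<odot>\<^bsub>L\<^esub> x \<in> M"
    and F: "free_resolution R (submod L M) F \<delta> \<epsilon>" and G: "free_resolution R kk G \<gamma> \<eta>"
    and \<theta>: "ghom R 0 (G 0) (regular_module R) \<theta>" "\<And>x. x \<in> carrier (G (Suc 0)) \<Longrightarrow> \<theta> (\<gamma> 0 x) \<in> \<mm>"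
    and v: "v \<in> mgrade (submod L M) a" "v = (\<Oplus>\<^bsub>L\<^esub>i\<in>{..<e}. X i \<odot>\<^bsub>L\<^esub> l i)"
    and l: "\<And>i. i < e \<Longrightarrow> l i \<in> mgrade L (a - int (d i))"
  shows "\<exists>\<phi> \<phi>'. lift_sys G \<gamma> F \<delta> a \<phi> \<phi>' \<and> (\<forall>x\<in>carrier (G 0). \<epsilon> (\<phi> 0 x) = \<theta> x \<odot>\<^bsub>L\<^esub> v)"
proof -
  interpret L: graded_module R L by fact
  interpret N: graded_module R "submod L M" by fact
  note Fr = free_resolutionD[OF F] and Gr = free_resolutionD[OF G]
  have mF: "module R (F n)" and mG: "module R (G n)" for n
    using Fr(2)[of n] Gr(2)[of n] graded_module.axioms(1) by blast+
  have lL: "l i \<in> carrier L" if "i < e" for i using l[OF that] L.mgrade_carrier by blast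
  have vN: "v \<in> carrier (submod L M)" using v(1) N.mgrade_carrier by blast
  have \<theta>R: "\<theta> x \<in> carrier R" if "x \<in> carrier (G 0)" for x using ghom_closed[OF \<theta>(1) that] by simp
  have \<theta>add: "\<theta> (x \<oplus>\<^bsub>G 0\<^esub> y) = \<theta> x \<oplus> \<theta> y" if "x \<in> carrier (G 0)" "y \<in> carrier (G 0)" for x y
    using ghom_add[OF \<theta>(1) that] by simp
  have \<theta>sm: "\<theta> (r \<odot>\<^bsub>G 0\<^esub> x) = r \<otimes> \<theta> x" if "r \<in> carrier R" "x \<in> carrier (G 0)" for x r
    using ghom_smult[OF \<theta>(1) that] by simp
  have \<theta>gr: "\<theta> x \<in> rgrade R j" if "x \<in> mgrade (G 0) j" for x j
    using ghom_grade[OF \<theta>(1) that] by simp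
  have \<gamma>c: "\<gamma> n x \<in> carrier (G n)" if "x \<in> carrier (G (Suc n))" for n x using ghom_closed[OF Gr(4) that] .
  have G0gr: "x \<in> carrier (G n)" if "x \<in> mgrade (G n) j" for n x j
    using graded_module.mgrade_carrier[OF Gr(2) that] .
  have ex: "\<exists>u. (\<forall>n. ghom R (a - int (d i)) (G (Suc n)) (F n) (u n)) \<and>
      (\<forall>x\<in>carrier (G (Suc 0)). \<epsilon> (u 0 x) = \<theta> (\<gamma> 0 x) \<odot>\<^bsub>L\<^esub> l i) \<and>
      (\<forall>n. \<forall>x\<in>carrier (G (Suc (Suc n))). \<delta> n (u (Suc n) x) = \<ominus>\<^bsub>F n\<^esub> u n (\<gamma> (Suc n) x))" if i: "i < e" for i
  proof -
    let ?f = "\<lambda>x. \<theta> (\<gamma> 0 x) \<odot>\<^bsub>L\<^esub> l i"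
    have f: "ghom R (a - int (d i)) (G (Suc 0)) (submod L M) ?f"
    proof (rule ghomI)
      show "?f x \<in> carrier (submod L M)" if "x \<in> carrier (G (Suc 0))" for x using mL \<theta>(2)[OF that] lL[OF i] by simp
      show "?f x \<in> mgrade (submod L M) (j + (a - int (d i)))" if x: "x \<in> mgrade (G (Suc 0)) j" for x j
        using L.mgrade_smult[OF \<theta>gr l[OF i], of "\<gamma> 0 x" j] ghom_grade[OF Gr(4) x] mL[OF \<theta>(2)[OF G0gr[OF x]] lL[OF i]] by simp
      show "?f (x \<oplus>\<^bsub>G (Suc 0)\<^esub> y) = ?f x \<oplus>\<^bsub>submod L M\<^esub> ?f y" if "x \<in> carrier (G (Suc 0))" "y \<in> carrier (G (Suc 0))" for x y
        using that ghom_add[OF Gr(4)] \<gamma>c \<theta>add \<theta>R lL[OF i] by (simp add: L.smult_l_distr)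
      show "?f (r \<odot>\<^bsub>G (Suc 0)\<^esub> x) = r \<odot>\<^bsub>submod L M\<^esub> ?f x" if "r \<in> carrier R" "x \<in> carrier (G (Suc 0))" for r x
        using that ghom_smult[OF Gr(4)] \<gamma>c \<theta>sm \<theta>R lL[OF i] by (simp add: L.smult_assoc1)
    qed
    have "\<exists>u. (\<forall>n. ghom R (a - int (d i)) (G (Suc n)) (F n) (u n)) \<and> (\<forall>x\<in>carrier (G (Suc 0)). \<epsilon> (u 0 x) = ?f x) \<and>
      (\<forall>n. \<forall>x\<in>carrier (G (Suc (Suc n))). \<delta> n (u (Suc n) x) = u n (\<ominus>\<^bsub>G (Suc n)\<^esub> \<gamma> (Suc n) x))"
    proof (rule comparison_map[where F = "\<lambda>n. G (Suc n)" and \<delta> = "\<lambda>n x. \<ominus>\<^bsub>G (Suc n)\<^esub> \<gamma> (Suc n) x" and G = F and \<gamma> = \<delta> and \<eta> = \<epsilon>,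
          OF Gr(1) _ _ F N f])
      show "ghom R 0 (G (Suc (Suc n))) (G (Suc n)) (\<lambda>x. \<ominus>\<^bsub>G (Suc n)\<^esub> \<gamma> (Suc n) x)" for n
        by (rule ghom_pointwise_uminus[OF Gr(2) Gr(4)])
      show "\<ominus>\<^bsub>G (Suc n)\<^esub> \<gamma> (Suc n) (\<ominus>\<^bsub>G (Suc (Suc n))\<^esub> \<gamma> (Suc (Suc n)) x) = \<zero>\<^bsub>G (Suc n)\<^esub>"
        if x: "x \<in> carrier (G (Suc (Suc (Suc n))))" for n x
        using ghom_uminus[OF Gr(4) mG mG \<gamma>c[OF x]] Gr(7)[OF x] abelian_group_uminus_zero[OF module.axioms(2)[OF mG]] by simp
      show "\<theta> (\<gamma> 0 (\<ominus>\<^bsub>G (Suc 0)\<^esub> \<gamma> (Suc 0) x)) \<odot>\<^bsub>L\<^esub> l i = \<zero>\<^bsub>submod L M\<^esub>" if x: "x \<in> carrier (G (Suc (Suc 0)))" for x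
        using ghom_uminus[OF Gr(4) mG mG \<gamma>c[OF x]] Gr(7)[OF x] abelian_group_uminus_zero[OF module.axioms(2)[OF mG]]
          ghom_zero[OF \<theta>(1) mG RM.module_axioms] lL[OF i] by simp
    qed
    then obtain u where u: "\<And>n. ghom R (a - int (d i)) (G (Suc n)) (F n) (u n)" "\<And>x. x \<in> carrier (G (Suc 0)) \<Longrightarrow> \<epsilon> (u 0 x) = ?f x"
      "\<And>n x. x \<in> carrier (G (Suc (Suc n))) \<Longrightarrow> \<delta> n (u (Suc n) x) = u n (\<ominus>\<^bsub>G (Suc n)\<^esub> \<gamma> (Suc n) x)" by blast
    have "\<delta> n (u (Suc n) x) = \<ominus>\<^bsub>F n\<^esub> u n (\<gamma> (Suc n) x)" if "x \<in> carrier (G (Suc (Suc n)))" for n x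
      using u(3)[OF that] ghom_uminus[OF u(1) mG mF \<gamma>c[OF that]] by simp
    with u(1,2) show ?thesis by blast
  qed
  have "\<forall>i. \<exists>u. i < e \<longrightarrow> (\<forall>n. ghom R (a - int (d i)) (G (Suc n)) (F n) (u n)) \<and>
      (\<forall>x\<in>carrier (G (Suc 0)). \<epsilon> (u 0 x) = \<theta> (\<gamma> 0 x) \<odot>\<^bsub>L\<^esub> l i) \<and>
      (\<forall>n. \<forall>x\<in>carrier (G (Suc (Suc n))). \<delta> n (u (Suc n) x) = \<ominus>\<^bsub>F n\<^esub> u n (\<gamma> (Suc n) x))"
    using ex by blast
  from choice[OF this] obtain \<phi>' where \<phi>'_all: "\<forall>i. i < e \<longrightarrow> (\<forall>n. ghom R (a - int (d i)) (G (Suc n)) (F n) (\<phi>' i n)) \<and>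
      (\<forall>x\<in>carrier (G (Suc 0)). \<epsilon> (\<phi>' i 0 x) = \<theta> (\<gamma> 0 x) \<odot>\<^bsub>L\<^esub> l i) \<and>
      (\<forall>n. \<forall>x\<in>carrier (G (Suc (Suc n))). \<delta> n (\<phi>' i (Suc n) x) = \<ominus>\<^bsub>F n\<^esub> \<phi>' i n (\<gamma> (Suc n) x))" by (elim exE)
  then have \<phi>': "\<And>i n. i < e \<Longrightarrow> ghom R (a - int (d i)) (G (Suc n)) (F n) (\<phi>' i n)"
    "\<And>i x. i < e \<Longrightarrow> x \<in> carrier (G (Suc 0)) \<Longrightarrow> \<epsilon> (\<phi>' i 0 x) = \<theta> (\<gamma> 0 x) \<odot>\<^bsub>L\<^esub> l i"
    "\<And>i n x. i < e \<Longrightarrow> x \<in> carrier (G (Suc (Suc n))) \<Longrightarrow> \<delta> n (\<phi>' i (Suc n) x) = \<ominus>\<^bsub>F n\<^esub> \<phi>' i n (\<gamma> (Suc n) x)"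
    by simp_all
  have "ghom R a (G 0) (submod L M) (\<lambda>x. \<theta> x \<odot>\<^bsub>L\<^esub> v)"
  proof (rule ghomI)
    show "\<theta> x \<odot>\<^bsub>L\<^esub> v \<in> carrier (submod L M)" if "x \<in> carrier (G 0)" for x using N.smult_closed[OF \<theta>R[OF that] vN] by simp
    show "\<theta> x \<odot>\<^bsub>L\<^esub> v \<in> mgrade (submod L M) (j + a)" if "x \<in> mgrade (G 0) j" for x j
      using N.mgrade_smult[OF \<theta>gr[OF that] v(1)] by simp
    show "\<theta> (x \<oplus>\<^bsub>G 0\<^esub> y) \<odot>\<^bsub>L\<^esub> v = \<theta> x \<odot>\<^bsub>L\<^esub> v \<oplus>\<^bsub>submod L M\<^esub> \<theta> y \<odot>\<^bsub>L\<^esub> v" if "x \<in> carrier (G 0)" "y \<in> carrier (G 0)" for x y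
      using N.smult_l_distr[OF \<theta>R[OF that(1)] \<theta>R[OF that(2)] vN] \<theta>add[OF that] by simp
    show "\<theta> (r \<odot>\<^bsub>G 0\<^esub> x) \<odot>\<^bsub>L\<^esub> v = r \<odot>\<^bsub>submod L M\<^esub> (\<theta> x \<odot>\<^bsub>L\<^esub> v)" if "r \<in> carrier R" "x \<in> carrier (G 0)" for r x
      using N.smult_assoc1[OF that(1) \<theta>R[OF that(2)] vN] \<theta>sm[OF that] by simp
  qed
  from projective_lift[OF Gr(1) Fr(2) N this Fr(3)] Fr(5) ghom_closed[OF this]
  obtain u0 where u0: "ghom R a (G 0) (F 0) u0" "\<And>x. x \<in> carrier (G 0) \<Longrightarrow> \<epsilon> (u0 x) = \<theta> x \<odot>\<^bsub>L\<^esub> v" by blast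
  let ?t = "\<lambda>n x. \<Oplus>\<^bsub>F n\<^esub>i\<in>{..<e}. X i \<odot>\<^bsub>F n\<^esub> \<phi>' i n x"
  have t: "ghom R a (G (Suc n)) (F n) (?t n)" for n
  proof (rule ghom_pointwise_finsum[OF Fr(2) finite_lessThan])
    fix i assume "i \<in> {..<e}"
    then have i: "i < e" by simp
    show "ghom R a (G (Suc n)) (F n) (\<lambda>x. X i \<odot>\<^bsub>F n\<^esub> \<phi>' i n x)"
      by (rule ghom_smult_homogeneous[OF Fr(2) X_grade[OF i] X_carrier[OF i] \<phi>'(1)[OF i]]) simp
  qed
  have c\<phi>': "\<phi>' i n x \<in> carrier (F n)" if "i < e" "x \<in> carrier (G (Suc n))" for i n x
    using ghom_closed[OF \<phi>'(1)[OF that(1)] that(2)] .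
  have Xc: "X i \<odot>\<^bsub>F n\<^esub> y \<in> carrier (F n)" if "i < e" "y \<in> carrier (F n)" for i n y
    using module.smult_closed[OF mF X_carrier[OF that(1)] that(2)] .
  have "\<exists>u. u 0 = u0 \<and> (\<forall>n. ghom R a (G n) (F n) (u n)) \<and>
    (\<forall>n. \<forall>x\<in>carrier (G (Suc n)). \<delta> n (u (Suc n) x) = u n (\<gamma> n x) \<ominus>\<^bsub>F n\<^esub> ?t n x)"
  proof (rule lift_sequence[where P = G and Q = F and dP = \<gamma> and dQ = \<delta> and t = ?t, OF Gr(1) Fr(2) Gr(4) Gr(7) Fr(4) Fr(9) t _ u0(1)])
    fix n x assume x: "x \<in> carrier (G (Suc (Suc n)))"
    interpret Fn: module R "F n" by (rule mF)
    have "\<delta> n (?t (Suc n) x) = (\<Oplus>\<^bsub>F n\<^esub>i\<in>{..<e}. \<delta> n (X i \<odot>\<^bsub>F (Suc n)\<^esub> \<phi>' i (Suc n) x))"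
      using c\<phi>' Xc x by (intro ghom_finsum[OF Fr(4) mF mF]) auto
    also have "\<dots> = (\<Oplus>\<^bsub>F n\<^esub>i\<in>{..<e}. (\<ominus> \<one>) \<odot>\<^bsub>F n\<^esub> (X i \<odot>\<^bsub>F n\<^esub> \<phi>' i n (\<gamma> (Suc n) x)))"
    proof (rule Fn.M.finsum_cong')
      fix i assume i: "i \<in> {..<e}"
      then show "\<delta> n (X i \<odot>\<^bsub>F (Suc n)\<^esub> \<phi>' i (Suc n) x) = (\<ominus> \<one>) \<odot>\<^bsub>F n\<^esub> (X i \<odot>\<^bsub>F n\<^esub> \<phi>' i n (\<gamma> (Suc n) x))"
        using ghom_smult[OF Fr(4) X_carrier c\<phi>'[OF _ x], of i i] \<phi>'(3)[OF _ x] c\<phi>'[OF _ \<gamma>c[OF x]] Xc X_carrier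
        by (simp add: Fn.smult_l_minus Fn.smult_r_minus)
    qed (use Xc c\<phi>' \<gamma>c[OF x] in auto)
    also have "\<dots> = (\<ominus> \<one>) \<odot>\<^bsub>F n\<^esub> ?t n (\<gamma> (Suc n) x)"
      using Xc c\<phi>' \<gamma>c[OF x] by (intro Fn.finsum_smult_ldistr[symmetric]) auto
    also have "\<dots> = \<ominus>\<^bsub>F n\<^esub> ?t n (\<gamma> (Suc n) x)"
      using ghom_closed[OF t \<gamma>c[OF x]] by (simp add: Fn.smult_l_minus)
    finally show "\<delta> n (?t (Suc n) x) = \<ominus>\<^bsub>F n\<^esub> ?t n (\<gamma> (Suc n) x)" .
  next
    fix x assume x: "x \<in> carrier (G (Suc 0))"
    let ?r = "\<theta> (\<gamma> 0 x)"
    have r: "?r \<in> carrier R" using \<theta>R[OF \<gamma>c[OF x]] .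
    have rl: "?r \<odot>\<^bsub>L\<^esub> l i \<in> M" if "i < e" for i using mL[OF \<theta>(2)[OF x] lL[OF that]] .
    have Xrl: "X i \<odot>\<^bsub>L\<^esub> (?r \<odot>\<^bsub>L\<^esub> l i) \<in> M" if "i < e" for i
      using N.smult_closed[OF X_carrier[OF that], of "?r \<odot>\<^bsub>L\<^esub> l i"] rl[OF that] by simp
    have c: "u0 (\<gamma> 0 x) \<in> carrier (F 0)" "?t 0 x \<in> carrier (F 0)"
      using ghom_closed[OF u0(1) \<gamma>c[OF x]] ghom_closed[OF t x] by auto
    interpret F0: module R "F 0" by (rule mF)
    have "\<epsilon> (?t 0 x) = (\<Oplus>\<^bsub>submod L M\<^esub>i\<in>{..<e}. \<epsilon> (X i \<odot>\<^bsub>F 0\<^esub> \<phi>' i 0 x))"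
      using c\<phi>' Xc x by (intro ghom_finsum[OF Fr(3) mF N.module_axioms]) auto
    also have "\<dots> = (\<Oplus>\<^bsub>submod L M\<^esub>i\<in>{..<e}. X i \<odot>\<^bsub>L\<^esub> (?r \<odot>\<^bsub>L\<^esub> l i))"
    proof (rule N.M.finsum_cong')
      fix i assume "i \<in> {..<e}"
      then show "\<epsilon> (X i \<odot>\<^bsub>F 0\<^esub> \<phi>' i 0 x) = X i \<odot>\<^bsub>L\<^esub> (?r \<odot>\<^bsub>L\<^esub> l i)"
        using ghom_smult[OF Fr(3) X_carrier c\<phi>'[OF _ x], of i i] \<phi>'(2)[OF _ x] by simp
    qed (use Xrl in auto)
    also have "\<dots> = (\<Oplus>\<^bsub>L\<^esub>i\<in>{..<e}. X i \<odot>\<^bsub>L\<^esub> (?r \<odot>\<^bsub>L\<^esub> l i))"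
      by (rule finsum_submod[OF L.M.abelian_monoid_axioms N.M.abelian_monoid_axioms M]) (use Xrl in auto)
    also have "\<dots> = (\<Oplus>\<^bsub>L\<^esub>i\<in>{..<e}. ?r \<odot>\<^bsub>L\<^esub> (X i \<odot>\<^bsub>L\<^esub> l i))"
    proof (rule L.M.finsum_cong')
      fix i assume "i \<in> {..<e}"
      then show "X i \<odot>\<^bsub>L\<^esub> (?r \<odot>\<^bsub>L\<^esub> l i) = ?r \<odot>\<^bsub>L\<^esub> (X i \<odot>\<^bsub>L\<^esub> l i)"
        using L.smult_assoc1[OF X_carrier r lL, of i i] L.smult_assoc1[OF r X_carrier lL, of i i] R.m_comm[OF r X_carrier, of i] by simp
    qed (use lL r X_carrier in auto)
    also have "\<dots> = ?r \<odot>\<^bsub>L\<^esub> v" unfolding v(2)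
      using lL r X_carrier by (intro L.finsum_smult_ldistr[symmetric]) auto
    finally have "\<epsilon> (u0 (\<gamma> 0 x) \<ominus>\<^bsub>F 0\<^esub> ?t 0 x) = \<zero>\<^bsub>submod L M\<^esub>"
      using ghom_minus[OF Fr(3) mF N.module_axioms c] u0(2)[OF \<gamma>c[OF x]] N.smult_closed[OF r vN]
        N.M.r_neg[of "?r \<odot>\<^bsub>L\<^esub> v"] by (simp add: a_minus_def)
    then show "u0 (\<gamma> 0 x) \<ominus>\<^bsub>F 0\<^esub> ?t 0 x \<in> \<delta> 0 ` carrier (F (Suc 0))"
      using c by (intro Fr(8)) auto
  qed
  then obtain \<phi> where "\<phi> 0 = u0" "\<And>n. ghom R a (G n) (F n) (\<phi> n)"
    "\<And>n x. x \<in> carrier (G (Suc n)) \<Longrightarrow> \<delta> n (\<phi> (Suc n) x) = \<phi> n (\<gamma> n x) \<ominus>\<^bsub>F n\<^esub> ?t n x" by blast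
  then show ?thesis using \<phi>'(1,3) u0(2) unfolding lift_sys_def by (intro exI[of _ \<phi>] exI[of _ \<phi>']) auto
qed

text \<open>A functional to \<open>k\<close> lifts to a chain map between resolutions; its multiple by a variable lifts
the zero map to \<open>k\<close>, hence is null homotopic.\<close>

lemma projection_maps:
  assumes N: "graded_module R N"
    and F: "free_resolution R N F \<delta> \<epsilon>" and G: "free_resolution R kk G \<gamma> \<eta>" and \<pi>: "kfun N a \<pi>"
  shows "\<exists>\<psi> \<psi>'. proj_sys F \<delta> G \<gamma> a \<psi> \<psi>' \<and> (\<forall>x\<in>carrier (F 0). \<eta> (\<psi> 0 x) = kinj (\<pi> (\<epsilon> x)))"
proof -
  interpret N: graded_module R N by fact
  note Fr = free_resolutionD[OF F] and Gr = free_resolutionD[OF G]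
  have mF: "module R (F n)" and mG: "module R (G n)" for n
    using Fr(2)[of n] Gr(2)[of n] graded_module.axioms(1) by blast+
  have f: "ghom R (- a) (F 0) kk (\<lambda>x. kinj (\<pi> (\<epsilon> x)))"
    by (rule kfun_imp_ghom, rule kfun_comp[OF \<pi> Fr(3)]) simp
  have "\<exists>u. (\<forall>n. ghom R (- a) (F n) (G n) (u n)) \<and> (\<forall>x\<in>carrier (F 0). \<eta> (u 0 x) = kinj (\<pi> (\<epsilon> x))) \<and>
    (\<forall>n. \<forall>x\<in>carrier (F (Suc n)). \<gamma> n (u (Suc n) x) = u n (\<delta> n x))"
    by (rule comparison_map[where F = F and G = G, OF Fr(1) Fr(4) Fr(7) G kk_graded f])
      (simp_all add: Fr(6) kfun_zero[OF \<pi> N.module_axioms] kk_simps)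
  then obtain \<psi> where \<psi>: "\<And>n. ghom R (- a) (F n) (G n) (\<psi> n)" "\<And>x. x \<in> carrier (F 0) \<Longrightarrow> \<eta> (\<psi> 0 x) = kinj (\<pi> (\<epsilon> x))"
    "\<And>n x. x \<in> carrier (F (Suc n)) \<Longrightarrow> \<gamma> n (\<psi> (Suc n) x) = \<psi> n (\<delta> n x)" by blast
  have "\<exists>s. (\<forall>n. ghom R (int (d i) - a) (F n) (G (Suc n)) (s n)) \<and> (\<forall>x\<in>carrier (F 0). \<gamma> 0 (s 0 x) = X i \<odot>\<^bsub>G 0\<^esub> \<psi> 0 x) \<and>
    (\<forall>n. \<forall>x\<in>carrier (F (Suc n)). \<gamma> (Suc n) (s (Suc n) x) = X i \<odot>\<^bsub>G (Suc n)\<^esub> \<psi> (Suc n) x \<ominus>\<^bsub>G (Suc n)\<^esub> s n (\<delta> n x))"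
    if i: "i < e" for i
  proof (rule null_homotopy[where P = F and Q = G and dP = \<delta> and dQ = \<gamma> and w = "\<lambda>n x. X i \<odot>\<^bsub>G n\<^esub> \<psi> n x",
        OF Fr(1) Gr(2) Fr(4) Fr(7) Gr(4) Gr(9)])
    show "ghom R (int (d i) - a) (F n) (G n) (\<lambda>x. X i \<odot>\<^bsub>G n\<^esub> \<psi> n x)" for n
      by (rule ghom_smult_homogeneous[OF Gr(2) X_grade[OF i] X_carrier[OF i] \<psi>(1)]) simp
    show "\<gamma> n (X i \<odot>\<^bsub>G (Suc n)\<^esub> \<psi> (Suc n) x) = X i \<odot>\<^bsub>G n\<^esub> \<psi> n (\<delta> n x)" if "x \<in> carrier (F (Suc n))" for n x
      using ghom_smult[OF Gr(4) X_carrier[OF i] ghom_closed[OF \<psi>(1) that]] \<psi>(3)[OF that] by simp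
    show "X i \<odot>\<^bsub>G 0\<^esub> \<psi> 0 x \<in> \<gamma> 0 ` carrier (G (Suc 0))" if x: "x \<in> carrier (F 0)" for x
    proof (rule Gr(8))
      show "X i \<odot>\<^bsub>G 0\<^esub> \<psi> 0 x \<in> carrier (G 0)" using module.smult_closed[OF mG X_carrier[OF i] ghom_closed[OF \<psi>(1) x]] .
      show "\<eta> (X i \<odot>\<^bsub>G 0\<^esub> \<psi> 0 x) = \<zero>\<^bsub>kk\<^esub>"
        using ghom_smult[OF Gr(3) X_carrier[OF i] ghom_closed[OF \<psi>(1) x]] \<psi>(2)[OF x] X_carrier[OF i] aug_X[OF i]
        by (simp add: kk_simps)
    qed
  qed
  then have "\<forall>i. \<exists>s. i < e \<longrightarrow> (\<forall>n. ghom R (int (d i) - a) (F n) (G (Suc n)) (s n)) \<and> (\<forall>x\<in>carrier (F 0). \<gamma> 0 (s 0 x) = X i \<odot>\<^bsub>G 0\<^esub> \<psi> 0 x) \<and>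
    (\<forall>n. \<forall>x\<in>carrier (F (Suc n)). \<gamma> (Suc n) (s (Suc n) x) = X i \<odot>\<^bsub>G (Suc n)\<^esub> \<psi> (Suc n) x \<ominus>\<^bsub>G (Suc n)\<^esub> s n (\<delta> n x))"
    by blast
  from choice[OF this] obtain \<psi>' where "\<forall>i. i < e \<longrightarrow> (\<forall>n. ghom R (int (d i) - a) (F n) (G (Suc n)) (\<psi>' i n)) \<and> (\<forall>x\<in>carrier (F 0). \<gamma> 0 (\<psi>' i 0 x) = X i \<odot>\<^bsub>G 0\<^esub> \<psi> 0 x) \<and>
    (\<forall>n. \<forall>x\<in>carrier (F (Suc n)). \<gamma> (Suc n) (\<psi>' i (Suc n) x) = X i \<odot>\<^bsub>G (Suc n)\<^esub> \<psi> (Suc n) x \<ominus>\<^bsub>G (Suc n)\<^esub> \<psi>' i n (\<delta> n x))"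
    by (elim exE)
  with \<psi> show ?thesis unfolding proj_sys_def by (intro exI[of _ \<psi>] exI[of _ \<psi>'] conjI) simp_all
qed

lemma lift_sysD:
  assumes "lift_sys G \<gamma> F \<delta> a \<phi> \<phi>'"
  shows "ghom R a (G n) (F n) (\<phi> n)"
    "i < e \<Longrightarrow> ghom R (a - int (d i)) (G (Suc n)) (F n) (\<phi>' i n)"
    "i < e \<Longrightarrow> x \<in> carrier (G (Suc (Suc n))) \<Longrightarrow> \<delta> n (\<phi>' i (Suc n) x) = \<ominus>\<^bsub>F n\<^esub> \<phi>' i n (\<gamma> (Suc n) x)"
    "y \<in> carrier (G (Suc n)) \<Longrightarrow> \<delta> n (\<phi> (Suc n) y) = \<phi> n (\<gamma> n y) \<ominus>\<^bsub>F n\<^esub> (\<Oplus>\<^bsub>F n\<^esub>i\<in>{..<e}. X i \<odot>\<^bsub>F n\<^esub> \<phi>' i n y)"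
  using assms unfolding lift_sys_def by blast+

lemma proj_sysD:
  assumes "proj_sys F \<delta> G \<gamma> a \<psi> \<psi>'"
  shows "ghom R (- a) (F n) (G n) (\<psi> n)"
    "i < e \<Longrightarrow> ghom R (int (d i) - a) (F n) (G (Suc n)) (\<psi>' i n)"
    "x \<in> carrier (F (Suc n)) \<Longrightarrow> \<gamma> n (\<psi> (Suc n) x) = \<psi> n (\<delta> n x)"
    "i < e \<Longrightarrow> y \<in> carrier (F 0) \<Longrightarrow> \<gamma> 0 (\<psi>' i 0 y) = X i \<odot>\<^bsub>G 0\<^esub> \<psi> 0 y"
    "i < e \<Longrightarrow> x \<in> carrier (F (Suc n)) \<Longrightarrow>
      \<gamma> (Suc n) (\<psi>' i (Suc n) x) = X i \<odot>\<^bsub>G (Suc n)\<^esub> \<psi> (Suc n) x \<ominus>\<^bsub>G (Suc n)\<^esub> \<psi>' i n (\<delta> n x)"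
  using assms unfolding proj_sys_def by blast+

text \<open>The composite of the chain map into the cone with the one out of it.\<close>

definition composite :: "(nat \<Rightarrow> ('r, 'g) graded_module) \<Rightarrow> (nat \<Rightarrow> 'g \<Rightarrow> 'f) \<Rightarrow> (nat \<Rightarrow> nat \<Rightarrow> 'g \<Rightarrow> 'f) \<Rightarrow>
    (nat \<Rightarrow> 'f \<Rightarrow> 'g) \<Rightarrow> (nat \<Rightarrow> nat \<Rightarrow> 'f \<Rightarrow> 'g) \<Rightarrow> nat \<Rightarrow> 'g \<Rightarrow> 'g"
  where "composite G \<phi> \<phi>' \<psi> \<psi>' n x = \<psi> n (\<phi> n x) \<oplus>\<^bsub>G n\<^esub>
    (case n of 0 \<Rightarrow> \<zero>\<^bsub>G n\<^esub> | Suc m \<Rightarrow> \<Oplus>\<^bsub>G n\<^esub>i\<in>{..<e}. \<psi>' i m (\<phi>' i m x))"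

text \<open>The composite is a chain map from \<open>G\<close> to \<open>G\<close>. It induces on \<open>k\<close> the same map as the identity, respectively zero, so the
difference is null homotopic.\<close>

lemma retraction_homotopy:
  assumes F: "free_resolution R N F \<delta> \<epsilon>" and G: "free_resolution R kk G \<gamma> \<eta>"
    and lift: "lift_sys G \<gamma> F \<delta> a \<phi> \<phi>'" and proj: "proj_sys F \<delta> G \<gamma> b \<psi> \<psi>'"
    and base: "\<And>x. x \<in> carrier (G 0) \<Longrightarrow> \<eta> (\<psi> 0 (\<phi> 0 x)) = (if same then \<eta> x else \<zero>\<^bsub>kk\<^esub>)" and same: "same \<Longrightarrow> a = b"
  defines "idc \<equiv> \<lambda>n x. if same then x else \<zero>\<^bsub>G n\<^esub>"
  shows "\<exists>s. (\<forall>n. ghom R (a - b) (G n) (G (Suc n)) (s n)) \<and>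
    (\<forall>x\<in>carrier (G 0). \<gamma> 0 (s 0 x) = composite G \<phi> \<phi>' \<psi> \<psi>' 0 x \<ominus>\<^bsub>G 0\<^esub> idc 0 x) \<and>
    (\<forall>n. \<forall>x\<in>carrier (G (Suc n)). \<gamma> (Suc n) (s (Suc n) x) =
      (composite G \<phi> \<phi>' \<psi> \<psi>' (Suc n) x \<ominus>\<^bsub>G (Suc n)\<^esub> idc (Suc n) x) \<ominus>\<^bsub>G (Suc n)\<^esub> s n (\<gamma> n x))"
proof -
  note Fr = free_resolutionD[OF F] and Gr = free_resolutionD[OF G]
  note li = lift_sysD[OF lift] and pr = proj_sysD[OF proj]
  have mF: "module R (F n)" and mG: "module R (G n)" for n
    using Fr(2)[of n] Gr(2)[of n] graded_module.axioms(1) by blast+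
  define T where "T n x = (case n of 0 \<Rightarrow> \<zero>\<^bsub>G n\<^esub> | Suc m \<Rightarrow> \<Oplus>\<^bsub>G n\<^esub>i\<in>{..<e}. \<psi>' i m (\<phi>' i m x))" for n x
  let ?C = "composite G \<phi> \<phi>' \<psi> \<psi>'"
  have C: "?C n x = \<psi> n (\<phi> n x) \<oplus>\<^bsub>G n\<^esub> T n x" for n x by (simp add: composite_def T_def)
  have T: "ghom R (a - b) (G n) (G n) (T n)" for n
  proof (cases n)
    case 0
    then show ?thesis using ghom_const_zero[OF Gr(2)] by (simp add: T_def[abs_def])
  next
    case (Suc m)
    have "ghom R (a - b) (G n) (G n) (\<lambda>x. \<Oplus>\<^bsub>G n\<^esub>i\<in>{..<e}. \<psi>' i m (\<phi>' i m x))"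
      by (rule ghom_pointwise_finsum[OF Gr(2)]) (auto simp: Suc intro!: ghom_comp[OF pr(2) li(2)])
    then show ?thesis by (simp add: T_def[abs_def] Suc)
  qed
  have \<psi>\<phi>: "ghom R (a - b) (G n) (G n) (\<lambda>x. \<psi> n (\<phi> n x))" for n by (rule ghom_comp[OF pr(1) li(1)]) simp
  have idc: "ghom R (a - b) (G n) (G n) (idc n)" for n
    using same ghom_id[of R "G n"] ghom_const_zero[OF Gr(2)[of n]] by (cases same) (auto simp: idc_def)
  have w: "ghom R (a - b) (G n) (G n) (\<lambda>x. ?C n x \<ominus>\<^bsub>G n\<^esub> idc n x)" for n
    unfolding C by (intro ghom_pointwise_minus ghom_pointwise_add Gr(2) \<psi>\<phi> T idc)
  have key: "(\<Oplus>\<^bsub>G n\<^esub>i\<in>{..<e}. \<gamma> n (\<psi>' i n (\<phi>' i n x))) = (\<Oplus>\<^bsub>G n\<^esub>i\<in>{..<e}. X i \<odot>\<^bsub>G n\<^esub> \<psi> n (\<phi>' i n x)) \<oplus>\<^bsub>G n\<^esub> T n (\<gamma> n x)"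
    if x: "x \<in> carrier (G (Suc n))" for n x
  proof -
    interpret Gn: module R "G n" by (rule mG)
    have c1: "\<phi>' i n x \<in> carrier (F n)" if "i < e" for i using ghom_closed[OF li(2)[OF that] x] .
    have c2: "X i \<odot>\<^bsub>G n\<^esub> \<psi> n (\<phi>' i n x) \<in> carrier (G n)" if "i < e" for i
      using Gn.smult_closed[OF X_carrier[OF that] ghom_closed[OF pr(1) c1[OF that]]] .
    show ?thesis
    proof (cases n)
      case n: 0
      have "(\<Oplus>\<^bsub>G n\<^esub>i\<in>{..<e}. \<gamma> n (\<psi>' i n (\<phi>' i n x))) = (\<Oplus>\<^bsub>G n\<^esub>i\<in>{..<e}. X i \<odot>\<^bsub>G n\<^esub> \<psi> n (\<phi>' i n x))"
        using c1 c2 pr(4) n by (intro Gn.M.finsum_cong') auto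
      moreover have "(\<Oplus>\<^bsub>G n\<^esub>i\<in>{..<e}. X i \<odot>\<^bsub>G n\<^esub> \<psi> n (\<phi>' i n x)) \<in> carrier (G n)"
        using c2 by (intro Gn.M.finsum_closed) auto
      moreover have "T n (\<gamma> n x) = \<zero>\<^bsub>G n\<^esub>" using n by (simp add: T_def)
      ultimately show ?thesis by simp
    next
      case n: (Suc m)
      have x': "x \<in> carrier (G (Suc (Suc m)))" using x n by simp
      have \<gamma>x: "\<gamma> (Suc m) x \<in> carrier (G (Suc m))" using ghom_closed[OF Gr(4) x'] .
      have c3: "\<psi>' i m (\<phi>' i m (\<gamma> n x)) \<in> carrier (G n)" if "i < e" for i
        using ghom_closed[OF pr(2)[OF that] ghom_closed[OF li(2)[OF that] \<gamma>x]] n by simp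
      have "\<gamma> n (\<psi>' i n (\<phi>' i n x)) = X i \<odot>\<^bsub>G n\<^esub> \<psi> n (\<phi>' i n x) \<oplus>\<^bsub>G n\<^esub> \<psi>' i m (\<phi>' i m (\<gamma> n x))" if i: "i < e" for i
      proof -
        have c4: "\<phi>' i m (\<gamma> (Suc m) x) \<in> carrier (F m)" using ghom_closed[OF li(2)[OF i] \<gamma>x] .
        have "\<gamma> n (\<psi>' i n (\<phi>' i n x)) = X i \<odot>\<^bsub>G n\<^esub> \<psi> n (\<phi>' i n x) \<ominus>\<^bsub>G n\<^esub> \<psi>' i m (\<delta> m (\<phi>' i n x))"
          using pr(5)[OF i, of "\<phi>' i n x" m] c1[OF i] n by simp
        also have "\<delta> m (\<phi>' i n x) = \<ominus>\<^bsub>F m\<^esub> \<phi>' i m (\<gamma> n x)" using li(3)[OF i x'] n by simp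
        also have "\<psi>' i m (\<ominus>\<^bsub>F m\<^esub> \<phi>' i m (\<gamma> n x)) = \<ominus>\<^bsub>G n\<^esub> \<psi>' i m (\<phi>' i m (\<gamma> n x))"
          using ghom_uminus[OF pr(2)[OF i] mF mG c4] n by simp
        finally show ?thesis using c3[OF i] by (simp add: a_minus_def)
      qed
      then have "(\<Oplus>\<^bsub>G n\<^esub>i\<in>{..<e}. \<gamma> n (\<psi>' i n (\<phi>' i n x))) =
          (\<Oplus>\<^bsub>G n\<^esub>i\<in>{..<e}. X i \<odot>\<^bsub>G n\<^esub> \<psi> n (\<phi>' i n x) \<oplus>\<^bsub>G n\<^esub> \<psi>' i m (\<phi>' i m (\<gamma> n x)))"
        using c2 c3 by (intro Gn.M.finsum_cong') auto
      also have "\<dots> = (\<Oplus>\<^bsub>G n\<^esub>i\<in>{..<e}. X i \<odot>\<^bsub>G n\<^esub> \<psi> n (\<phi>' i n x)) \<oplus>\<^bsub>G n\<^esub> (\<Oplus>\<^bsub>G n\<^esub>i\<in>{..<e}. \<psi>' i m (\<phi>' i m (\<gamma> n x)))"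
        using c2 c3 by (intro Gn.M.finsum_addf) auto
      finally show ?thesis by (simp add: T_def n)
    qed
  qed
  show ?thesis
  proof (rule null_homotopy[where P = G and Q = G and dP = \<gamma> and dQ = \<gamma> and w = "\<lambda>n x. ?C n x \<ominus>\<^bsub>G n\<^esub> idc n x",
        OF Gr(1) Gr(2) Gr(4) Gr(7) Gr(4) Gr(9) w])
    fix n x assume x: "x \<in> carrier (G (Suc n))"
    interpret Gn: module R "G n" by (rule mG)
    interpret Gn': module R "G (Suc n)" by (rule mG)
    have \<gamma>x: "\<gamma> n x \<in> carrier (G n)" using ghom_closed[OF Gr(4) x] .
    have c1: "\<phi>' i n x \<in> carrier (F n)" if "i < e" for i using ghom_closed[OF li(2)[OF that] x] .
    have c2: "X i \<odot>\<^bsub>G n\<^esub> \<psi> n (\<phi>' i n x) \<in> carrier (G n)" "X i \<odot>\<^bsub>F n\<^esub> \<phi>' i n x \<in> carrier (F n)" if "i < e" for i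
      using Gn.smult_closed[OF X_carrier[OF that] ghom_closed[OF pr(1) c1[OF that]]]
        module.smult_closed[OF mF X_carrier[OF that] c1[OF that]] .
    let ?S = "\<Oplus>\<^bsub>G n\<^esub>i\<in>{..<e}. X i \<odot>\<^bsub>G n\<^esub> \<psi> n (\<phi>' i n x)"
    let ?U = "\<Oplus>\<^bsub>F n\<^esub>i\<in>{..<e}. X i \<odot>\<^bsub>F n\<^esub> \<phi>' i n x"
    have S: "?S \<in> carrier (G n)" using c2 by (intro Gn.M.finsum_closed) auto
    have U: "?U \<in> carrier (F n)" using c2 module.axioms(2)[OF mF[of n]] by (intro abelian_monoid.finsum_closed[OF abelian_group.axioms(1)]) auto
    have "\<psi> n ?U = (\<Oplus>\<^bsub>G n\<^esub>i\<in>{..<e}. \<psi> n (X i \<odot>\<^bsub>F n\<^esub> \<phi>' i n x))"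
      using c2 by (intro ghom_finsum[OF pr(1) mF mG]) auto
    also have "\<dots> = ?S"
      using c1 c2 ghom_smult[OF pr(1) X_carrier] by (intro Gn.M.finsum_cong') auto
    finally have \<psi>U: "\<psi> n ?U = ?S" .
    have "\<gamma> n (\<psi> (Suc n) (\<phi> (Suc n) x)) = \<psi> n (\<phi> n (\<gamma> n x) \<ominus>\<^bsub>F n\<^esub> ?U)"
      using pr(3)[OF ghom_closed[OF li(1) x]] li(4)[OF x] by simp
    also have "\<dots> = \<psi> n (\<phi> n (\<gamma> n x)) \<ominus>\<^bsub>G n\<^esub> ?S"
      using ghom_minus[OF pr(1) mF mG ghom_closed[OF li(1) \<gamma>x] U] \<psi>U by simp
    finally have 1: "\<gamma> n (\<psi> (Suc n) (\<phi> (Suc n) x)) = \<psi> n (\<phi> n (\<gamma> n x)) \<ominus>\<^bsub>G n\<^esub> ?S" .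
    have "\<gamma> n (T (Suc n) x) = (\<Oplus>\<^bsub>G n\<^esub>i\<in>{..<e}. \<gamma> n (\<psi>' i n (\<phi>' i n x)))"
      unfolding T_def using c1 ghom_closed[OF pr(2)] by (simp, intro ghom_finsum[OF Gr(4) mG mG]) auto
    then have 2: "\<gamma> n (T (Suc n) x) = ?S \<oplus>\<^bsub>G n\<^esub> T n (\<gamma> n x)" using key[OF x] by simp
    have 3: "\<gamma> n (idc (Suc n) x) = idc n (\<gamma> n x)" using ghom_zero[OF Gr(4) mG mG] by (simp add: idc_def)
    have c: "\<psi> (Suc n) (\<phi> (Suc n) x) \<in> carrier (G (Suc n))" "T (Suc n) x \<in> carrier (G (Suc n))" "idc (Suc n) x \<in> carrier (G (Suc n))"
      "\<psi> n (\<phi> n (\<gamma> n x)) \<in> carrier (G n)" "T n (\<gamma> n x) \<in> carrier (G n)" "idc n (\<gamma> n x) \<in> carrier (G n)"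
      using ghom_closed[OF \<psi>\<phi>] ghom_closed[OF T] ghom_closed[OF idc] x \<gamma>x by auto
    have "\<gamma> n (?C (Suc n) x \<ominus>\<^bsub>G (Suc n)\<^esub> idc (Suc n) x) =
        (\<gamma> n (\<psi> (Suc n) (\<phi> (Suc n) x)) \<oplus>\<^bsub>G n\<^esub> \<gamma> n (T (Suc n) x)) \<ominus>\<^bsub>G n\<^esub> \<gamma> n (idc (Suc n) x)"
      unfolding C using c ghom_minus[OF Gr(4) mG mG, of "\<psi> (Suc n) (\<phi> (Suc n) x) \<oplus>\<^bsub>G (Suc n)\<^esub> T (Suc n) x" n "idc (Suc n) x"]
        ghom_add[OF Gr(4) c(1,2)] by simp
    also have "\<dots> = ?C n (\<gamma> n x) \<ominus>\<^bsub>G n\<^esub> idc n (\<gamma> n x)"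
      unfolding 1 2 3 C using c S
      by (simp add: a_minus_def Gn.M.a_ac Gn.M.r_neg Gn.M.r_neg1 Gn.M.r_neg2)
    finally show "\<gamma> n (?C (Suc n) x \<ominus>\<^bsub>G (Suc n)\<^esub> idc (Suc n) x) = ?C n (\<gamma> n x) \<ominus>\<^bsub>G n\<^esub> idc n (\<gamma> n x)" .
  next
    fix x assume x: "x \<in> carrier (G 0)"
    interpret G0: module R "G 0" by (rule mG)
    interpret kk: module R kk by (rule kk_module)
    have c: "\<psi> 0 (\<phi> 0 x) \<in> carrier (G 0)" "idc 0 x \<in> carrier (G 0)" using ghom_closed[OF \<psi>\<phi> x] ghom_closed[OF idc x] by auto
    have C0: "?C 0 x = \<psi> 0 (\<phi> 0 x)" unfolding C T_def using c by simp
    have "\<eta> (?C 0 x \<ominus>\<^bsub>G 0\<^esub> idc 0 x) = \<eta> (\<psi> 0 (\<phi> 0 x)) \<ominus>\<^bsub>kk\<^esub> \<eta> (idc 0 x)"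
      unfolding C0 by (rule ghom_minus[OF Gr(3) mG kk_module c])
    also have "\<eta> (idc 0 x) = \<eta> (\<psi> 0 (\<phi> 0 x))" using base[OF x] ghom_zero[OF Gr(3) mG kk_module] by (simp add: idc_def)
    finally have "\<eta> (?C 0 x \<ominus>\<^bsub>G 0\<^esub> idc 0 x) = \<zero>\<^bsub>kk\<^esub>"
      using kk.M.r_neg[OF ghom_closed[OF Gr(3) c(1)]] by (simp only: a_minus_def)
    then show "?C 0 x \<ominus>\<^bsub>G 0\<^esub> idc 0 x \<in> \<gamma> 0 ` carrier (G (Suc 0))" using ghom_closed[OF w x] by (intro Gr(8))
  qed
qed

lemma lin_functional_sum:
  assumes "lin_functional (cocyc_module F \<delta> n j) \<kappa>" "finite S" "\<And>s. s \<in> S \<Longrightarrow> cocyc F \<delta> n j (f s)"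
  shows "\<kappa> (\<lambda>x. \<Sum>s\<in>S. c s * f s x) = (\<Sum>s\<in>S. c s * \<kappa> (f s))"
  using assms(2,3)
proof (induction S rule: finite_induct)
  case empty
  show ?case using lin_functional_zero[OF assms(1) cocyc_module_vectorspace] by (simp add: cocyc_module_def)
next
  case (insert s S)
  have "cocyc F \<delta> n j (\<lambda>x. \<Sum>s\<in>S. c s * f s x)" by (rule cocyc_sum, rule cocyc_scale) (use insert in auto)
  moreover have "cocyc F \<delta> n j (\<lambda>x. c s * f s x)" by (rule cocyc_scale) (use insert in auto)
  ultimately have "\<kappa> (\<lambda>x. c s * f s x + (\<Sum>s\<in>S. c s * f s x)) = \<kappa> (\<lambda>x. c s * f s x) + \<kappa> (\<lambda>x. \<Sum>s\<in>S. c s * f s x)"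
    using lin_functionalD(1)[OF assms(1)] by (simp add: cocyc_module_def)
  moreover have "\<kappa> (\<lambda>x. c s * f s x) = c s * \<kappa> (f s)"
    using lin_functionalD(2)[OF assms(1), of "f s" "c s"] insert by (simp add: cocyc_module_def)
  ultimately show ?case using insert by simp
qed

section \<open>Counting dimensions in a retract\<close>

lemma coh_basisD:
  assumes "coh_basis F \<delta> n j D b \<kappa>"
  shows "i < D \<Longrightarrow> cocyc F \<delta> n j (b i)" "i < D \<Longrightarrow> lin_functional (cocyc_module F \<delta> n j) (\<kappa> i)"
    "i < D \<Longrightarrow> cocyc F \<delta> n j f \<Longrightarrow> cobd F \<delta> n j f \<Longrightarrow> \<kappa> i f = 0"
    "i < D \<Longrightarrow> i' < D \<Longrightarrow> \<kappa> i (b i') = of_bool (i = i')"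
    "cocyc F \<delta> n j f \<Longrightarrow> (\<And>i. i < D \<Longrightarrow> \<kappa> i f = 0) \<Longrightarrow> cobd F \<delta> n j f"
  using assms unfolding coh_basis_def by blast+

lemma cocyc_pullback:
  assumes proj: "proj_sys F \<delta> G \<gamma> a \<psi> \<psi>'" and F: "free_resolution R N F \<delta> \<epsilon>" and G: "free_resolution R kk G \<gamma> \<eta>"
  shows "cocyc G \<gamma> n (j - a) f \<Longrightarrow> cocyc F \<delta> n j (\<lambda>x. f (\<psi> n x))"
    and "cocyc G \<gamma> (Suc m) (j - a) f \<Longrightarrow> i < e \<Longrightarrow> cocyc F \<delta> m (j - int (d i)) (\<lambda>x. f (\<psi>' i m x))"
proof -
  note Fr = free_resolutionD[OF F] and Gr = free_resolutionD[OF G] and pr = proj_sysD[OF proj]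
  have mG: "module R (G n)" for n using Gr(2)[of n] graded_module.axioms(1) by blast
  show "cocyc F \<delta> n j (\<lambda>x. f (\<psi> n x))" if f: "cocyc G \<gamma> n (j - a) f" for n
    unfolding cocyc_def
  proof (intro conjI ballI)
    show "kfun (F n) j (\<lambda>x. f (\<psi> n x))" using f by (intro kfun_comp[OF _ pr(1)]) (auto simp: cocyc_def)
    show "f (\<psi> n (\<delta> n x)) = 0" if "x \<in> carrier (F (Suc n))" for x
      using f ghom_closed[OF pr(1) that] pr(3)[OF that] by (auto simp: cocyc_def)
  qed
  show "cocyc F \<delta> m (j - int (d i)) (\<lambda>x. f (\<psi>' i m x))" if f: "cocyc G \<gamma> (Suc m) (j - a) f" and i: "i < e"
    unfolding cocyc_def
  proof (intro conjI ballI)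
    have kf: "kfun (G (Suc m)) (j - a) f" using f by (simp add: cocyc_def)
    show "kfun (F m) (j - int (d i)) (\<lambda>x. f (\<psi>' i m x))" by (rule kfun_comp[OF kf pr(2)[OF i]]) simp
    fix x assume x: "x \<in> carrier (F (Suc m))"
    have c: "X i \<odot>\<^bsub>G (Suc m)\<^esub> \<psi> (Suc m) x \<in> carrier (G (Suc m))" "\<psi>' i m (\<delta> m x) \<in> carrier (G (Suc m))"
      using module.smult_closed[OF mG X_carrier[OF i] ghom_closed[OF pr(1) x]] ghom_closed[OF pr(2)[OF i] ghom_closed[OF Fr(4) x]] by auto
    have "0 = f (\<gamma> (Suc m) (\<psi>' i (Suc m) x))" using f ghom_closed[OF pr(2)[OF i] x] by (simp add: cocyc_def)
    also have "\<dots> = f (X i \<odot>\<^bsub>G (Suc m)\<^esub> \<psi> (Suc m) x) - f (\<psi>' i m (\<delta> m x))"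
      unfolding pr(5)[OF i x] by (rule kfun_minus[OF kf mG c])
    also have "f (X i \<odot>\<^bsub>G (Suc m)\<^esub> \<psi> (Suc m) x) = 0" by (rule kfun_X[OF kf i ghom_closed[OF pr(1) x]])
    finally show "f (\<psi>' i m (\<delta> m x)) = 0" by simp
  qed
qed

lemma cobd_pullback:
  assumes lift: "lift_sys G \<gamma> F \<delta> a \<phi> \<phi>'" and F: "free_resolution R N F \<delta> \<epsilon>" and G: "free_resolution R kk G \<gamma> \<eta>"
  shows "cobd F \<delta> n j f \<Longrightarrow> cobd G \<gamma> n (j - a) (\<lambda>x. f (\<phi> n x))"
    and "cobd F \<delta> m (j - int (d i)) f \<Longrightarrow> i < e \<Longrightarrow> cobd G \<gamma> (Suc m) (j - a) (\<lambda>x. f (\<phi>' i m x))"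
proof -
  note Fr = free_resolutionD[OF F] and Gr = free_resolutionD[OF G] and li = lift_sysD[OF lift]
  have mF: "module R (F n)" for n using Fr(2)[of n] graded_module.axioms(1) by blast
  show "cobd G \<gamma> n (j - a) (\<lambda>x. f (\<phi> n x))" if f: "cobd F \<delta> n j f"
  proof (cases n)
    case 0
    then show ?thesis using f ghom_closed[OF li(1)] by simp
  next
    case n: (Suc m)
    then obtain h where h: "kfun (F m) j h" "\<And>x. x \<in> carrier (F (Suc m)) \<Longrightarrow> f x = h (\<delta> m x)" using f by auto
    have "f (\<phi> (Suc m) x) = h (\<phi> m (\<gamma> m x))" if x: "x \<in> carrier (G (Suc m))" for x
    proof -
      let ?U = "\<Oplus>\<^bsub>F m\<^esub>i\<in>{..<e}. X i \<odot>\<^bsub>F m\<^esub> \<phi>' i m x"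
      interpret Fm: module R "F m" by (rule mF)
      have c1: "\<phi>' i m x \<in> carrier (F m)" if "i < e" for i using ghom_closed[OF li(2)[OF that] x] .
      have c2: "X i \<odot>\<^bsub>F m\<^esub> \<phi>' i m x \<in> carrier (F m)" if "i < e" for i using Fm.smult_closed[OF X_carrier[OF that] c1[OF that]] .
      have "h ?U = (\<Sum>i<e. h (X i \<odot>\<^bsub>F m\<^esub> \<phi>' i m x))" using c2 by (intro kfun_finsum[OF h(1) mF]) auto
      also have "\<dots> = 0" using kfun_X[OF h(1)] c1 by simp
      finally have U: "h ?U = 0" .
      have "f (\<phi> (Suc m) x) = h (\<phi> m (\<gamma> m x) \<ominus>\<^bsub>F m\<^esub> ?U)"
        using h(2)[OF ghom_closed[OF li(1) x]] li(4)[OF x] by simp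
      also have "\<dots> = h (\<phi> m (\<gamma> m x)) - h ?U"
        using c2 by (intro kfun_minus[OF h(1) mF ghom_closed[OF li(1) ghom_closed[OF Gr(4) x]]] Fm.M.finsum_closed) auto
      finally show ?thesis using U by simp
    qed
    moreover have "kfun (G m) (j - a) (\<lambda>x. h (\<phi> m x))" by (rule kfun_comp[OF h(1) li(1) refl])
    ultimately show ?thesis unfolding n cobd.simps by (intro exI[of _ "\<lambda>x. h (\<phi> m x)"]) simp
  qed
  show "cobd G \<gamma> (Suc m) (j - a) (\<lambda>x. f (\<phi>' i m x))" if f: "cobd F \<delta> m (j - int (d i)) f" and i: "i < e"
  proof (cases m)
    case 0
    have "f (\<phi>' i m x) = 0" if "x \<in> carrier (G (Suc m))" for x
      using f ghom_closed[OF li(2)[OF i] that] 0 by simp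
    then show ?thesis unfolding cobd.simps by (intro exI[of _ "\<lambda>_. 0"]) (simp add: kfun_zero_fun)
  next
    case m: (Suc l)
    then obtain h where h: "kfun (F l) (j - int (d i)) h" "\<And>x. x \<in> carrier (F (Suc l)) \<Longrightarrow> f x = h (\<delta> l x)" using f by auto
    have "f (\<phi>' i m x) = - 1 * h (\<phi>' i l (\<gamma> m x))" if x: "x \<in> carrier (G (Suc m))" for x
    proof -
      have x': "x \<in> carrier (G (Suc (Suc l)))" using x m by simp
      have "f (\<phi>' i m x) = h (\<ominus>\<^bsub>F l\<^esub> \<phi>' i l (\<gamma> m x))"
        using h(2)[of "\<phi>' i m x"] ghom_closed[OF li(2)[OF i] x] li(3)[OF i x'] m by simp
      then show ?thesis
        using kfun_uminus[OF h(1) mF ghom_closed[OF li(2)[OF i] ghom_closed[OF Gr(4) x']]] m by simp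
    qed
    moreover have "kfun (G (Suc l)) (j - a) (\<lambda>x. - 1 * h (\<phi>' i l x))"
      by (rule kfun_scale, rule kfun_comp[OF h(1) li(2)[OF i]]) simp
    ultimately show ?thesis unfolding cobd.simps by (intro exI[of _ "\<lambda>x. - 1 * h (\<phi>' i l x)"]) (simp add: m)
  qed
qed

text \<open>Applied to a cocycle the homotopy turns the difference of the composite and the identity, respectively
zero, into a coboundary.\<close>

lemma cobd_composite:
  assumes F: "free_resolution R N F \<delta> \<epsilon>" and G: "free_resolution R kk G \<gamma> \<eta>"
    and lift: "lift_sys G \<gamma> F \<delta> a \<phi> \<phi>'" and proj: "proj_sys F \<delta> G \<gamma> b \<psi> \<psi>'"
    and base: "\<And>x. x \<in> carrier (G 0) \<Longrightarrow> \<eta> (\<psi> 0 (\<phi> 0 x)) = (if same then \<eta> x else \<zero>\<^bsub>kk\<^esub>)" and same: "same \<Longrightarrow> a = b"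
    and f: "cocyc G \<gamma> n (j - b) f"
  shows "cobd G \<gamma> n (j - a) (\<lambda>x. f (\<psi> n (\<phi> n x)) + (case n of 0 \<Rightarrow> 0 | Suc m \<Rightarrow> \<Sum>i<e. f (\<psi>' i m (\<phi>' i m x))) - (if same then f x else 0))"
proof -
  note Fr = free_resolutionD[OF F] and Gr = free_resolutionD[OF G]
  note li = lift_sysD[OF lift] and pr = proj_sysD[OF proj]
  have mG: "module R (G n)" for n using Gr(2)[of n] graded_module.axioms(1) by blast
  have kf: "kfun (G n) (j - b) f" and f\<gamma>: "\<And>x. x \<in> carrier (G (Suc n)) \<Longrightarrow> f (\<gamma> n x) = 0" using f by (auto simp: cocyc_def)
  let ?idc = "\<lambda>n x. if same then x else \<zero>\<^bsub>G n\<^esub>"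
  let ?C = "composite G \<phi> \<phi>' \<psi> \<psi>'"
  obtain s where s: "\<And>n. ghom R (a - b) (G n) (G (Suc n)) (s n)"
    "\<And>x. x \<in> carrier (G 0) \<Longrightarrow> \<gamma> 0 (s 0 x) = ?C 0 x \<ominus>\<^bsub>G 0\<^esub> ?idc 0 x"
    "\<And>n x. x \<in> carrier (G (Suc n)) \<Longrightarrow> \<gamma> (Suc n) (s (Suc n) x) = (?C (Suc n) x \<ominus>\<^bsub>G (Suc n)\<^esub> ?idc (Suc n) x) \<ominus>\<^bsub>G (Suc n)\<^esub> s n (\<gamma> n x)"
    using retraction_homotopy[OF F G lift proj base same] by blast
  interpret Gn: module R "G n" by (rule mG)
  have c1: "\<psi> n (\<phi> n x) \<in> carrier (G n)" if "x \<in> carrier (G n)" for x using ghom_closed[OF pr(1) ghom_closed[OF li(1) that]] .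
  have Cc: "?C n x \<in> carrier (G n)" "f (?C n x) = f (\<psi> n (\<phi> n x)) + (case n of 0 \<Rightarrow> 0 | Suc m \<Rightarrow> \<Sum>i<e. f (\<psi>' i m (\<phi>' i m x)))"
    if x: "x \<in> carrier (G n)" for x
  proof -
    let ?T = "case n of 0 \<Rightarrow> \<zero>\<^bsub>G n\<^esub> | Suc m \<Rightarrow> \<Oplus>\<^bsub>G n\<^esub>i\<in>{..<e}. \<psi>' i m (\<phi>' i m x)"
    have T: "?T \<in> carrier (G n) \<and> f ?T = (case n of 0 \<Rightarrow> 0 | Suc m \<Rightarrow> \<Sum>i<e. f (\<psi>' i m (\<phi>' i m x)))"
    proof (cases n)
      case 0
      then show ?thesis using kfun_zero[OF kf mG] Gn.M.zero_closed by simp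
    next
      case (Suc m)
      have c: "\<psi>' i m (\<phi>' i m x) \<in> carrier (G n)" if "i < e" for i
        using ghom_closed[OF pr(2)[OF that] ghom_closed[OF li(2)[OF that]], of x m] x Suc by simp
      have "(\<Oplus>\<^bsub>G n\<^esub>i\<in>{..<e}. \<psi>' i m (\<phi>' i m x)) \<in> carrier (G n)" using c by (intro Gn.M.finsum_closed) auto
      moreover have "f (\<Oplus>\<^bsub>G n\<^esub>i\<in>{..<e}. \<psi>' i m (\<phi>' i m x)) = (\<Sum>i<e. f (\<psi>' i m (\<phi>' i m x)))"
        using c by (intro kfun_finsum[OF kf mG]) auto
      ultimately show ?thesis using Suc by simp
    qed
    show "?C n x \<in> carrier (G n)" unfolding composite_def using c1[OF x] T by simp
    show "f (?C n x) = f (\<psi> n (\<phi> n x)) + (case n of 0 \<Rightarrow> 0 | Suc m \<Rightarrow> \<Sum>i<e. f (\<psi>' i m (\<phi>' i m x)))"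
      unfolding composite_def using kfun_add[OF kf c1[OF x]] T by simp
  qed
  have idc: "?idc n x \<in> carrier (G n)" "f (?idc n x) = (if same then f x else 0)" if "x \<in> carrier (G n)" for x
    using that kfun_zero[OF kf mG] by auto
  have W: "f (?C n x \<ominus>\<^bsub>G n\<^esub> ?idc n x) = f (\<psi> n (\<phi> n x)) + (case n of 0 \<Rightarrow> 0 | Suc m \<Rightarrow> \<Sum>i<e. f (\<psi>' i m (\<phi>' i m x))) - (if same then f x else 0)"
    if x: "x \<in> carrier (G n)" for x
    using kfun_minus[OF kf mG Cc(1)[OF x] idc(1)[OF x]] Cc(2)[OF x] idc(2)[OF x] by simp
  have "cobd G \<gamma> n (j - a) (\<lambda>x. f (?C n x \<ominus>\<^bsub>G n\<^esub> ?idc n x))"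
  proof (cases n)
    case n: 0
    have "f (?C 0 x \<ominus>\<^bsub>G 0\<^esub> ?idc 0 x) = 0" if x: "x \<in> carrier (G 0)" for x
      using f\<gamma>[of "s 0 x"] s(2)[OF x] ghom_closed[OF s(1) x] n by simp
    then show ?thesis unfolding n cobd.simps by blast
  next
    case n: (Suc m)
    have "f (?C n x \<ominus>\<^bsub>G n\<^esub> ?idc n x) = f (s m (\<gamma> m x))" if x: "x \<in> carrier (G n)" for x
    proof -
      have x': "x \<in> carrier (G (Suc m))" using x n by simp
      have c: "?C n x \<ominus>\<^bsub>G n\<^esub> ?idc n x \<in> carrier (G n)" by (intro Gn.M.minus_closed Cc(1) idc(1) x)
      have c': "s m (\<gamma> m x) \<in> carrier (G n)" using ghom_closed[OF s(1) ghom_closed[OF Gr(4) x']] n by simp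
      have "0 = f (\<gamma> n (s n x))" using f\<gamma>[OF ghom_closed[OF s(1) x]] by simp
      also have "\<gamma> n (s n x) = (?C n x \<ominus>\<^bsub>G n\<^esub> ?idc n x) \<ominus>\<^bsub>G n\<^esub> s m (\<gamma> m x)" using s(3)[OF x'] n by simp
      also have "f \<dots> = f (?C n x \<ominus>\<^bsub>G n\<^esub> ?idc n x) - f (s m (\<gamma> m x))" by (rule kfun_minus[OF kf mG c c'])
      finally show ?thesis by simp
    qed
    moreover have "kfun (G m) (j - a) (\<lambda>x. f (s m x))" by (rule kfun_comp[OF kf[unfolded n] s(1)]) simp
    ultimately have "\<exists>g. kfun (G m) (j - a) g \<and> (\<forall>x\<in>carrier (G n). f (?C n x \<ominus>\<^bsub>G n\<^esub> ?idc n x) = g (\<gamma> m x))"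
      by (intro exI[of _ "\<lambda>x. f (s m x)"] conjI ballI)
    then show ?thesis unfolding n cobd.simps .
  qed
  then show ?thesis by (subst cobd_cong[OF W[symmetric]])
qed

lemma cobd_sum:
  assumes "finite S" "\<And>s. s \<in> S \<Longrightarrow> cobd F \<delta> n j (f s)" shows "cobd F \<delta> n j (\<lambda>x. \<Sum>s\<in>S. f s x)"
  using assms by (induction S rule: finite_induct) (auto simp: cobd_zero intro: cobd_plus)

text \<open>A linear combination of basis cocycles of the copies of \<open>G\<close>, indexed by \<open>P\<close>, gives cocycles on \<open>F\<close> by pulling it back
along the maps out of the cones. If the dimensions violated the inequality, some nontrivial combination would give
only coboundaries on \<open>F\<close>. Pulling these back along the map into the cone for an index \<open>p\<^sub>0\<close> recovers,
up to coboundaries, the part of the combination that belongs to \<open>p\<^sub>0\<close>, so this part is a coboundary and its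
coefficients vanish.\<close>

theorem retract_dim_inequality:
  assumes P: "finite P" and F: "free_resolution R N F \<delta> \<epsilon>" and G: "free_resolution R kk G \<gamma> \<eta>"
    and lift: "\<And>p. p \<in> P \<Longrightarrow> lift_sys G \<gamma> F \<delta> (a p) (\<phi> p) (\<phi>' p)"
    and proj: "\<And>p. p \<in> P \<Longrightarrow> proj_sys F \<delta> G \<gamma> (a p) (\<psi> p) (\<psi>' p)"
    and base: "\<And>p q x. p \<in> P \<Longrightarrow> q \<in> P \<Longrightarrow> x \<in> carrier (G 0) \<Longrightarrow>
      \<eta> (\<psi> p 0 (\<phi> q 0 x)) = (if p = q then \<eta> x else \<zero>\<^bsub>kk\<^esub>)"
    and A: "\<And>p. p \<in> P \<Longrightarrow> coh_basis G \<gamma> n (j - a p) (\<alpha> p) (bA p) (\<kappa>A p)"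
    and B0: "coh_basis F \<delta> n j \<beta>0 b0 \<kappa>0"
    and B: "\<And>i m. i < e \<Longrightarrow> n = Suc m \<Longrightarrow> coh_basis F \<delta> m (j - int (d i)) (\<beta> i) (b' i) (\<kappa>' i)"
  shows "(\<Sum>p\<in>P. \<alpha> p) \<le> \<beta>0 + (if n = 0 then 0 else \<Sum>i<e. \<beta> i)"
proof (rule ccontr)
  assume no: "\<not> ?thesis"
  define E where "E = (if n = 0 then {} else {..<e})"
  define m where "m = n - 1"
  have En: "i < e" "n = Suc m" if "i \<in> E" for i using that by (auto simp: E_def m_def split: if_splits)
  define Q where "Q = (SIGMA p:P. {..<\<alpha> p})"
  define Y where "Y = (SIGMA t:insert 0 (Suc ` E). {..<(case t of 0 \<Rightarrow> \<beta>0 | Suc i \<Rightarrow> \<beta> i)})"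
  have fin: "finite Q" "finite Y" "finite E" using P by (auto simp: Q_def Y_def E_def)
  have "card Y = \<beta>0 + (\<Sum>i\<in>E. \<beta> i)"
    using fin(3) by (simp add: Y_def sum.reindex)
  moreover have "(\<Sum>i\<in>E. \<beta> i) = (if n = 0 then 0 else \<Sum>i<e. \<beta> i)" by (simp add: E_def)
  moreover have "card Q = (\<Sum>p\<in>P. \<alpha> p)" using P by (simp add: Q_def)
  ultimately have card: "card Y < card Q" using no by simp
  \<comment> \<open>The equations say that the pulled back cocycles have zero coordinates; index 0 stands for the unshifted copy of F.\<close>
  define M where "M y q = (case y of (t, r) \<Rightarrow> case q of (p, s) \<Rightarrow> case t of
      0 \<Rightarrow> \<kappa>0 r (\<lambda>x. bA p s (\<psi> p n x)) | Suc i \<Rightarrow> \<kappa>' i r (\<lambda>x. bA p s (\<psi>' p i m x)))" for y q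
  obtain c where c: "\<exists>q\<in>Q. c q \<noteq> 0" "\<And>y. y \<in> Y \<Longrightarrow> (\<Sum>q\<in>Q. c q * M y q) = 0"
    using homogeneous_system_solution[OF fin(2,1) card, of M] by blast
  have cA: "cocyc G \<gamma> n (j - a (fst q)) (bA (fst q) (snd q))" if "q \<in> Q" for q
    using coh_basisD(1)[OF A] that by (auto simp: Q_def)
  define Z0 where "Z0 x = (\<Sum>q\<in>Q. c q * bA (fst q) (snd q) (\<psi> (fst q) n x))" for x
  define Z where "Z i x = (\<Sum>q\<in>Q. c q * bA (fst q) (snd q) (\<psi>' (fst q) i m x))" for i x
  have cy0: "cocyc F \<delta> n j (\<lambda>x. bA (fst q) (snd q) (\<psi> (fst q) n x))" if "q \<in> Q" for q
    using that by (intro cocyc_pullback(1)[OF proj F G cA]) (auto simp: Q_def)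
  have cyi: "cocyc F \<delta> m (j - int (d i)) (\<lambda>x. bA (fst q) (snd q) (\<psi>' (fst q) i m x))" if "q \<in> Q" "i \<in> E" for q i
  proof -
    have p: "fst q \<in> P" using that(1) by (auto simp: Q_def)
    have "cocyc G \<gamma> (Suc m) (j - a (fst q)) (bA (fst q) (snd q))" using cA[OF that(1)] En(2)[OF that(2)] by simp
    from cocyc_pullback(2)[OF proj[OF p] F G this En(1)[OF that(2)]] show ?thesis .
  qed
  have Z0: "cobd F \<delta> n j Z0"
  proof (rule coh_basisD(5)[OF B0])
    show "cocyc F \<delta> n j Z0" unfolding Z0_def[abs_def] by (intro cocyc_sum cocyc_scale cy0)
    fix r assume r: "r < \<beta>0"
    have "\<kappa>0 r Z0 = (\<Sum>q\<in>Q. c q * M (0, r) q)"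
      unfolding Z0_def[abs_def] using lin_functional_sum[where c = c, OF coh_basisD(2)[OF B0 r] fin(1) cy0]
      by (simp add: M_def case_prod_beta)
    also have "\<dots> = 0" by (rule c(2)) (use r in \<open>auto simp: Y_def\<close>)
    finally show "\<kappa>0 r Z0 = 0" .
  qed
  have Z: "cobd F \<delta> m (j - int (d i)) (Z i)" if i: "i \<in> E" for i
  proof (rule coh_basisD(5)[OF B[OF En[OF i]]])
    show "cocyc F \<delta> m (j - int (d i)) (Z i)" unfolding Z_def[abs_def] by (intro cocyc_sum cocyc_scale cyi i)
    fix r assume r: "r < \<beta> i"
    have "\<kappa>' i r (Z i) = (\<Sum>q\<in>Q. c q * M (Suc i, r) q)"
      unfolding Z_def[abs_def] using lin_functional_sum[where c = c, OF coh_basisD(2)[OF B[OF En[OF i]] r] fin(1) cyi[OF _ i]]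
      by (simp add: M_def case_prod_beta)
    also have "\<dots> = 0" by (rule c(2)) (use r i in \<open>auto simp: Y_def\<close>)
    finally show "\<kappa>' i r (Z i) = 0" .
  qed
  obtain p0 s0 where q0: "p0 \<in> P" "s0 < \<alpha> p0" "c (p0, s0) \<noteq> 0" using c(1) by (auto simp: Q_def)
  let ?W = "\<lambda>q x. bA (fst q) (snd q) (\<psi> (fst q) n (\<phi> p0 n x)) +
      (case n of 0 \<Rightarrow> 0 | Suc m \<Rightarrow> \<Sum>i<e. bA (fst q) (snd q) (\<psi>' (fst q) i m (\<phi>' p0 i m x))) - (if fst q = p0 then bA (fst q) (snd q) x else 0)"
  have 1: "cobd G \<gamma> n (j - a p0) (?W q)" if q: "q \<in> Q" for q
  proof -
    have "fst q \<in> P" using q by (auto simp: Q_def)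
    then show ?thesis
      by (intro cobd_composite[OF F G lift[OF q0(1)] proj _ _ cA[OF q]] base q0(1)) auto
  qed
  define g where "g x = (\<Sum>s<\<alpha> p0. c (p0, s) * bA p0 s x)" for x
  have g_alt: "g x = (\<Sum>q\<in>Q. c q * (if fst q = p0 then bA (fst q) (snd q) x else 0))" for x
  proof -
    have "(\<Sum>q\<in>Q. c q * (if fst q = p0 then bA (fst q) (snd q) x else 0)) =
        (\<Sum>p\<in>P. \<Sum>s<\<alpha> p. c (p, s) * (if p = p0 then bA p s x else 0))"
      unfolding Q_def using P by (subst sum.Sigma) (auto simp: case_prod_beta)
    also have "\<dots> = (\<Sum>p\<in>P. if p = p0 then \<Sum>s<\<alpha> p. c (p, s) * bA p s x else 0)" by (intro sum.cong) auto
    also have "\<dots> = g x" using P q0(1) by (simp add: g_def)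
    finally show ?thesis by simp
  qed
  have 2: "cobd G \<gamma> n (j - a p0) (\<lambda>x. (\<Sum>q\<in>Q. c q * ?W q x))"
    by (intro cobd_sum cobd_scale 1 fin)
  have 3: "cobd G \<gamma> n (j - a p0) (\<lambda>x. Z0 (\<phi> p0 n x))"
    by (rule cobd_pullback(1)[OF lift[OF q0(1)] F G Z0])
  have 4: "cobd G \<gamma> n (j - a p0) (\<lambda>x. \<Sum>i\<in>E. Z i (\<phi>' p0 i m x))"
  proof (rule cobd_sum[OF fin(3)])
    fix i assume i: "i \<in> E"
    show "cobd G \<gamma> n (j - a p0) (\<lambda>x. Z i (\<phi>' p0 i m x))"
      using cobd_pullback(2)[OF lift[OF q0(1)] F G Z[OF i] En(1)[OF i]] En(2)[OF i] by simp
  qed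
  have "g x = Z0 (\<phi> p0 n x) + (\<Sum>i\<in>E. Z i (\<phi>' p0 i m x)) + (- 1) * (\<Sum>q\<in>Q. c q * ?W q x)" for x
  proof -
    have "(\<Sum>q\<in>Q. c q * (case n of 0 \<Rightarrow> 0 | Suc m \<Rightarrow> \<Sum>i<e. bA (fst q) (snd q) (\<psi>' (fst q) i m (\<phi>' p0 i m x)))) =
        (\<Sum>i\<in>E. Z i (\<phi>' p0 i m x))"
    proof (cases n)
      case (Suc k)
      have "(\<Sum>q\<in>Q. \<Sum>i<e. c q * bA (fst q) (snd q) (\<psi>' (fst q) i k (\<phi>' p0 i k x))) =
          (\<Sum>i<e. \<Sum>q\<in>Q. c q * bA (fst q) (snd q) (\<psi>' (fst q) i k (\<phi>' p0 i k x)))" by (rule sum.swap)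
      then show ?thesis by (simp add: Suc E_def m_def Z_def sum_distrib_left)
    qed (simp add: E_def)
    then show ?thesis
      by (simp add: g_alt Z0_def ring_distribs sum.distrib sum_subtractf)
  qed
  then have "cobd G \<gamma> n (j - a p0) g"
    using cobd_plus[OF cobd_plus[OF 3 4] cobd_scale[OF 2, of "- 1"]] by presburger
  moreover have "cocyc G \<gamma> n (j - a p0) g"
    unfolding g_def[abs_def] using coh_basisD(1)[OF A[OF q0(1)]] by (intro cocyc_sum cocyc_scale) auto
  ultimately have "\<kappa>A p0 s0 g = 0" using coh_basisD(3)[OF A[OF q0(1)] q0(2)] by blast
  moreover have "\<kappa>A p0 s0 g = (\<Sum>s<\<alpha> p0. c (p0, s) * \<kappa>A p0 s0 (bA p0 s))"
    unfolding g_def[abs_def]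
    using coh_basisD(1)[OF A[OF q0(1)]] by (intro lin_functional_sum[OF coh_basisD(2)[OF A[OF q0(1)] q0(2)]]) auto
  moreover have "\<dots> = (\<Sum>s<\<alpha> p0. if s0 = s then c (p0, s) else 0)"
    using coh_basisD(4)[OF A[OF q0(1)] q0(2)] by (intro sum.cong) auto
  ultimately show False using q0(2,3) by simp
qed

end

section \<open>Quotients and finitely generated modules\<close>

text \<open>Coordinates on the quotient give the separating functionals. The two structures may be graded over different
algebras, so that this also applies to a ring and its quotient.\<close>

lemma fin_graded_part_quotient:
  fixes S :: "('s, 'k::field, 'x) graded_algebra_scheme" and R :: "('r, 'k, 'y) graded_algebra_scheme"
  assumes q: "linear_quotient (graded_part S Z i) (graded_part R Y j) q" and fin: "fin_graded_part S Z i"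
  shows "fin_graded_part R Y j"
    and "\<exists>(N::nat) \<kappa>. (\<forall>i<N. lin_functional (graded_part R Y j) (\<kappa> i)) \<and>
      (\<forall>x\<in>mgrade Y j. (\<forall>i<N. \<kappa> i x = 0) \<longrightarrow> x = \<zero>\<^bsub>Y\<^esub>)"
proof -
  interpret linear_quotient "graded_part S Z i" "graded_part R Y j" q by fact
  have c: "carrier (graded_part S Z i) = mgrade Z i" "carrier (graded_part R Y j) = mgrade Y j"
    "\<zero>\<^bsub>graded_part R Y j\<^esub> = \<zero>\<^bsub>Y\<^esub>" "\<zero>\<^bsub>graded_part S Z i\<^esub> = \<zero>\<^bsub>Z\<^esub>"
    by (simp_all add: graded_part_def)
  obtain K where "finite K \<and> (\<forall>\<kappa>\<in>K. lin_functional (graded_part S Z i) \<kappa>) \<and>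
      (\<forall>x\<in>mgrade Z i. (\<forall>\<kappa>\<in>K. \<kappa> x = 0) \<longrightarrow> x = \<zero>\<^bsub>Z\<^esub>)"
    using fin unfolding fin_graded_part_def by (elim exE)
  then have K: "finite K" "\<And>\<kappa>. \<kappa> \<in> K \<Longrightarrow> lin_functional (graded_part S Z i) \<kappa>"
    "\<And>x. x \<in> mgrade Z i \<Longrightarrow> (\<And>\<kappa>. \<kappa> \<in> K \<Longrightarrow> \<kappa> x = 0) \<Longrightarrow> x = \<zero>\<^bsub>Z\<^esub>" by simp_all
  obtain N :: nat and \<kappa> where \<kappa>: "K = \<kappa> ` {..<N}" using finite_set_enum_functionals[OF K(1)] .
  have fd: "vectorspace.fin_dim class_ring (graded_part R Y j)"
  proof (rule fin_dim_functionals(1)[of N \<kappa>])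
    show "lin_functional (graded_part S Z i) (\<kappa> n)" if "n < N" for n using K(2) \<kappa> that by simp
    fix x assume x: "x \<in> carrier (graded_part S Z i)" "\<And>n. n < N \<Longrightarrow> \<kappa> n x = 0"
    have "x = \<zero>\<^bsub>Z\<^esub>" by (rule K(3)) (use x \<kappa> c in auto)
    then show "q x = \<zero>\<^bsub>graded_part R Y j\<^esub>" using q_zero c by simp
  qed
  obtain b \<mu> where "(\<forall>i<vectorspace.dim (class_ring :: 'k ring) (graded_part R Y j). b i \<in> carrier (graded_part R Y j) \<and> lin_functional (graded_part R Y j) (\<mu> i)) \<and>
    (\<forall>i<vectorspace.dim (class_ring :: 'k ring) (graded_part R Y j). \<forall>i'<vectorspace.dim (class_ring :: 'k ring) (graded_part R Y j). \<mu> i (b i') = of_bool (i = i')) \<and>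
    (\<forall>w\<in>carrier (graded_part R Y j). (\<forall>i<vectorspace.dim (class_ring :: 'k ring) (graded_part R Y j). \<mu> i w = 0) \<longrightarrow> w = \<zero>\<^bsub>graded_part R Y j\<^esub>)"
    using coordinates[OF vectorspace_W fd] by (elim exE)
  then have \<mu>: "\<forall>i<vectorspace.dim (class_ring :: 'k ring) (graded_part R Y j). lin_functional (graded_part R Y j) (\<mu> i)"
    "\<forall>w\<in>mgrade Y j. (\<forall>i<vectorspace.dim (class_ring :: 'k ring) (graded_part R Y j). \<mu> i w = 0) \<longrightarrow> w = \<zero>\<^bsub>Y\<^esub>"
    unfolding c by simp_all
  show "\<exists>(N::nat) \<kappa>. (\<forall>i<N. lin_functional (graded_part R Y j) (\<kappa> i)) \<and>
      (\<forall>x\<in>mgrade Y j. (\<forall>i<N. \<kappa> i x = 0) \<longrightarrow> x = \<zero>\<^bsub>Y\<^esub>)"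
    by (intro exI conjI) (rule \<mu>)+
  show "fin_graded_part R Y j" unfolding fin_graded_part_def
    by (rule exI[of _ "\<mu> ` {..<vectorspace.dim (class_ring :: 'k ring) (graded_part R Y j)}"]) (use \<mu> in simp)
qed

lemma quot_graded_module_sel:
  "carrier (quot_graded_module Y N) = a_rcosets\<^bsub>Y\<^esub> N" "\<zero>\<^bsub>quot_graded_module Y N\<^esub> = N"
  "add (quot_graded_module Y N) = set_add Y"
  "module.smult (quot_graded_module Y N) = (\<lambda>r X. \<Union>x\<in>X. N +>\<^bsub>Y\<^esub> (r \<odot>\<^bsub>Y\<^esub> x))"
  "mgrade (quot_graded_module Y N) = (\<lambda>j. (\<lambda>x. N +>\<^bsub>Y\<^esub> x) ` mgrade Y j)"
  by (simp_all add: quot_graded_module_def quot_module_def module.defs graded_module.defs)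

lemma quot_graded_module_coset:
  assumes Y: "module R Y" and N: "LinearCombinations.submodule R N Y"
    and x: "x \<in> carrier Y" and y: "y \<in> carrier Y"
  shows "(N +>\<^bsub>Y\<^esub> x) \<oplus>\<^bsub>quot_graded_module Y N\<^esub> (N +>\<^bsub>Y\<^esub> y) = N +>\<^bsub>Y\<^esub> (x \<oplus>\<^bsub>Y\<^esub> y)"
    and "r \<in> carrier R \<Longrightarrow> r \<odot>\<^bsub>quot_graded_module Y N\<^esub> (N +>\<^bsub>Y\<^esub> x) = N +>\<^bsub>Y\<^esub> (r \<odot>\<^bsub>Y\<^esub> x)"
    and "N +>\<^bsub>Y\<^esub> x = N \<longleftrightarrow> x \<in> N"
proof -
  interpret Y: module R Y by fact
  interpret N: LinearCombinations.submodule R N Y by fact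
  note sub = subsetD[OF N.subset]
  have neg: "\<ominus>\<^bsub>Y\<^esub> n \<in> N" if n: "n \<in> N" for n
    using N.smult_closed[of "\<ominus>\<^bsub>R\<^esub> \<one>\<^bsub>R\<^esub>" n] n by (simp add: sub Y.smult_l_minus)
  have "N \<noteq> {}" using N.zero_closed by blast
  then have sg: "subgroup N (add_monoid Y)"
    by (intro Y.M.add.subgroupI) (use N.subset neg in \<open>auto simp: a_inv_def[symmetric]\<close>)
  interpret S: abelian_subgroup N Y
    by (rule abelian_subgroupI3[OF additive_subgroup.intro[OF sg] Y.M.abelian_group_axioms])
  show "(N +>\<^bsub>Y\<^esub> x) \<oplus>\<^bsub>quot_graded_module Y N\<^esub> (N +>\<^bsub>Y\<^esub> y) = N +>\<^bsub>Y\<^esub> (x \<oplus>\<^bsub>Y\<^esub> y)"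
    unfolding quot_graded_module_sel by (rule S.a_rcos_sum[OF x y])
  show "N +>\<^bsub>Y\<^esub> x = N \<longleftrightarrow> x \<in> N"
    using Y.M.a_coset_join1[OF _ x sg] Y.M.a_coset_join2[OF x sg] by blast
  show "r \<odot>\<^bsub>quot_graded_module Y N\<^esub> (N +>\<^bsub>Y\<^esub> x) = N +>\<^bsub>Y\<^esub> (r \<odot>\<^bsub>Y\<^esub> x)" if r: "r \<in> carrier R"
  proof -
    have "N +>\<^bsub>Y\<^esub> (r \<odot>\<^bsub>Y\<^esub> z) = N +>\<^bsub>Y\<^esub> (r \<odot>\<^bsub>Y\<^esub> x)" if z: "z \<in> N +>\<^bsub>Y\<^esub> x" for z
    proof -
      obtain n where n: "n \<in> N" "z = n \<oplus>\<^bsub>Y\<^esub> x" using z unfolding a_r_coset_def' by (elim UN_E singletonE)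
      have "r \<odot>\<^bsub>Y\<^esub> z = r \<odot>\<^bsub>Y\<^esub> n \<oplus>\<^bsub>Y\<^esub> r \<odot>\<^bsub>Y\<^esub> x" using n r x by (simp add: sub Y.smult_r_distr)
      moreover have "r \<odot>\<^bsub>Y\<^esub> n \<in> N" using n r by simp
      ultimately have "r \<odot>\<^bsub>Y\<^esub> z \<in> N +>\<^bsub>Y\<^esub> (r \<odot>\<^bsub>Y\<^esub> x)" using Y.M.a_rcosI[OF _ N.subset Y.smult_closed[OF r x], of "r \<odot>\<^bsub>Y\<^esub> n"] by simp
      from Y.M.a_repr_independence[OF this Y.smult_closed[OF r x] sg] show ?thesis by (rule sym)
    qed
    then have "(\<Union>z\<in>N +>\<^bsub>Y\<^esub> x. N +>\<^bsub>Y\<^esub> (r \<odot>\<^bsub>Y\<^esub> z)) = (\<Union>z\<in>N +>\<^bsub>Y\<^esub> x. N +>\<^bsub>Y\<^esub> (r \<odot>\<^bsub>Y\<^esub> x))"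
      by (rule SUP_cong[OF refl])
    also have "\<dots> = N +>\<^bsub>Y\<^esub> (r \<odot>\<^bsub>Y\<^esub> x)" by (rule cSUP_const) (use S.a_rcos_self[OF x] in blast)
    finally show ?thesis unfolding quot_graded_module_sel .
  qed
qed

context connected_algebra
begin

lemma graded_quotient_linear:
  assumes Y: "graded_module R Y" and N: "LinearCombinations.submodule R N Y"
  shows "linear_quotient (graded_part R Y j) (graded_part R (quot_graded_module Y N) j) (\<lambda>x. N +>\<^bsub>Y\<^esub> x)"
proof -
  interpret Y: graded_module R Y by fact
  interpret V: vectorspace "class_ring :: 'k ring" "graded_part R Y j" by (rule graded_part_vectorspace[OF Y])
  note c = quot_graded_module_coset[OF Y.module_axioms N]
  have H: "x \<in> carrier Y" if "x \<in> carrier (graded_part R Y j)" for x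
    using that Y.mgrade_carrier by (simp add: graded_part_def)
  have W: "carrier (graded_part R (quot_graded_module Y N) j) = (\<lambda>x. N +>\<^bsub>Y\<^esub> x) ` carrier (graded_part R Y j)"
    by (simp add: graded_part_def quot_graded_module_sel)
  show ?thesis
  proof (unfold_locales, goal_cases)
    case (1 x)
    then show ?case unfolding W by (rule imageI)
  next
    case (2 w)
    then show ?case unfolding W by (elim imageE) (rule bexI, rule sym)
  next
    case (3 x y)
    show ?case using c(1)[OF H[OF 3(1)] H[OF 3(2)]] by (simp only: graded_part_def partial_object.simps monoid.simps ring.simps module.simps)
  next
    case (4 x c)
    show ?case using c(2)[OF H[OF 4] H[OF 4] scalar_carrier, of c] by (simp only: graded_part_def partial_object.simps monoid.simps ring.simps module.simps)
  next
    case 5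
    have "N +>\<^bsub>Y\<^esub> \<zero>\<^bsub>Y\<^esub> = N"
      using c(3)[OF Y.M.zero_closed Y.M.zero_closed] LinearCombinations.submodule.zero_closed[OF N] by (rule iffD2)
    then show ?case by (simp only: graded_part_def quot_graded_module_sel partial_object.simps monoid.simps ring.simps module.simps)
  qed
qed

lemma locfin_image:
  assumes F: "graded_module R F" and Y: "graded_module R Y" and \<epsilon>: "ghom R 0 F Y \<epsilon>"
    and surj: "carrier Y \<subseteq> \<epsilon> ` carrier F" and lf: "locfin lo F"
  shows "locfin lo Y"
proof -
  interpret F: graded_module R F by fact
  interpret Y: graded_module R Y by fact
  note \<epsilon>0 = ghom_zero[OF \<epsilon> F.module_axioms Y.module_axioms]
  have onto: "\<exists>x\<in>mgrade F j. \<epsilon> x = y" if y: "y \<in> mgrade Y j" for y j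
  proof -
    obtain x where x: "y = \<epsilon> x" "x \<in> carrier F" using surj Y.mgrade_carrier[OF y] by auto
    have "\<epsilon> (gcomp F j x) = y" using gcomp_ghom[OF F Y \<epsilon> x(2), of j] Y.gcomp_homogeneous[OF y, of j] x(1) by simp
    then show ?thesis using F.gcomp_spec(1)[OF x(2)] by blast
  qed
  show ?thesis unfolding locfin_def
  proof (intro conjI allI impI)
    show "mgrade Y j \<subseteq> {\<zero>\<^bsub>Y\<^esub>}" if j: "j < lo" for j
    proof
      fix y assume "y \<in> mgrade Y j"
      then obtain x where x: "x \<in> mgrade F j" "\<epsilon> x = y" using onto by blast
      then have "x = \<zero>\<^bsub>F\<^esub>" using lf j unfolding locfin_def by blast
      then show "y \<in> {\<zero>\<^bsub>Y\<^esub>}" using x \<epsilon>0 by simp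
    qed
    fix j
    interpret V: vectorspace "class_ring :: 'k ring" "graded_part R F j" by (rule graded_part_vectorspace[OF F])
    have "linear_quotient (graded_part R F j) (graded_part R Y j) \<epsilon>"
      by unfold_locales (use onto ghom_grade[OF \<epsilon>, where j = j] in \<open>auto simp: graded_part_def \<epsilon>0 ghomD[OF \<epsilon>] F.mgrade_carrier\<close>)
    then show "fin_graded_part R Y j" by (rule fin_graded_part_quotient) (use lf in \<open>simp add: locfin_def\<close>)
  qed
qed

text \<open>The homogeneous components of the generators still generate, and they are finitely many.\<close>

lemma locfin_finitely_generated:
  assumes L: "graded_module R L" and fg: "finitely_generated R L"
  obtains lo where "locfin lo L"
proof -
  interpret L: graded_module R L by fact
  obtain A where A: "finite A" "A \<subseteq> carrier L" "L.span A = carrier L" using fg unfolding finitely_generated_def by (elim exE conjE)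
  let ?P = "SIGMA x:A. {j. gcomp L j x \<noteq> \<zero>\<^bsub>L\<^esub>}"
  have "finite ?P" using A L.gcomp_spec(2) by (intro finite_SigmaI) auto
  then obtain N :: nat and h where h: "?P = h ` {..<N}" by (metis finite_conv_nat_seg_image lessThan_def)
  define dg where "dg i = snd (h i)" for i
  define g where "g u = (let i = inv_into UNIV std_gen u in gcomp L (dg i) (fst (h i)))" for u
  have g: "g (std_gen i) = gcomp L (dg i) (fst (h i))" for i by (simp add: g_def inv_f_f[OF std_gen_inj])
  have hA: "fst (h i) \<in> A" if "i < N" for i
  proof -
    have "h i \<in> ?P" unfolding h using that by simp
    then show ?thesis by (simp add: mem_Sigma_iff[of "fst (h i)" "snd (h i)", simplified])
  qed
  let ?F = "free_mod {..<N} dg"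
  interpret F: graded_module R ?F by (rule free_mod_graded)
  have "\<exists>\<epsilon>. ghom R 0 ?F L \<epsilon> \<and> (\<forall>u\<in>std_gen ` {..<N}. \<epsilon> u = g u)"
  proof (rule free_extension[OF free_mod_graded free_mod_free L])
    fix u j assume u: "u \<in> std_gen ` {..<N}" "u \<in> mgrade ?F j"
    then obtain i where i: "i < N" "u = std_gen i" by auto
    have "j = dg i" using std_gen_degree u(2) i(2) by blast
    then show "g u \<in> mgrade L (j + 0)" using i g L.gcomp_spec(1)[OF subsetD[OF A(2) hA[OF i(1)]]] by simp
  qed
  then obtain \<epsilon> where \<epsilon>: "ghom R 0 ?F L \<epsilon>" "\<And>i. i < N \<Longrightarrow> \<epsilon> (std_gen i) = gcomp L (dg i) (fst (h i))" using g by auto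
  note \<epsilon>0 = ghom_zero[OF \<epsilon>(1) F.module_axioms L.module_axioms]
  have im: "LinearCombinations.submodule R (\<epsilon> ` carrier ?F) L"
  proof (rule LinearCombinations.submodule.intro[OF L.module_axioms])
    show "\<zero>\<^bsub>L\<^esub> \<in> \<epsilon> ` carrier ?F" using \<epsilon>0 F.M.zero_closed by (metis image_eqI)
    show "v \<oplus>\<^bsub>L\<^esub> w \<in> \<epsilon> ` carrier ?F" if "v \<in> \<epsilon> ` carrier ?F" "w \<in> \<epsilon> ` carrier ?F" for v w
      using that ghom_add[OF \<epsilon>(1), symmetric] F.M.a_closed by (elim imageE) simp
    show "c \<odot>\<^bsub>L\<^esub> v \<in> \<epsilon> ` carrier ?F" if "c \<in> carrier R" "v \<in> \<epsilon> ` carrier ?F" for c v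
      using that ghom_smult[OF \<epsilon>(1), symmetric] F.smult_closed by (elim imageE) simp
  qed (use ghom_closed[OF \<epsilon>(1)] in auto)
  interpret Im: LinearCombinations.submodule R "\<epsilon> ` carrier ?F" L by (rule im)
  have "A \<subseteq> \<epsilon> ` carrier ?F"
  proof
    fix x assume x: "x \<in> A"
    let ?S = "{j. gcomp L j x \<noteq> \<zero>\<^bsub>L\<^esub>}"
    have c: "gcomp L j x \<in> \<epsilon> ` carrier ?F" if j: "j \<in> ?S" for j
    proof -
      have "(x, j) \<in> h ` {..<N}" unfolding h[symmetric] using x j by simp
      then obtain i where i: "(x, j) = h i" "i \<in> {..<N}" by (rule imageE)
      have "\<epsilon> (std_gen i) = gcomp L (dg i) (fst (h i))" by (rule \<epsilon>(2)) (use i(2) in simp)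
      also have "\<dots> = gcomp L j x" by (simp only: dg_def i(1)[symmetric] fst_conv snd_conv)
      finally have "\<epsilon> (std_gen i) = gcomp L j x" .
      from image_eqI[where f = \<epsilon> and x = "std_gen i", OF this[symmetric] std_gen_carrier[OF i(2)]] show ?thesis .
    qed
    have xL: "x \<in> carrier L" using A(2) x by (rule subsetD)
    note fin = L.gcomp_spec(2)[OF xL]
    have "(\<Oplus>\<^bsub>L\<^esub>j\<in>S. gcomp L j x) \<in> \<epsilon> ` carrier ?F" if "finite S" "S \<subseteq> ?S" for S
      using that
    proof (induction S rule: finite_induct)
      case (insert j S)
      have jS: "j \<in> ?S" "S \<subseteq> ?S" using insert.prems by simp_all
      have "(\<Oplus>\<^bsub>L\<^esub>j\<in>insert j S. gcomp L j x) = gcomp L j x \<oplus>\<^bsub>L\<^esub> (\<Oplus>\<^bsub>L\<^esub>j\<in>S. gcomp L j x)"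
        by (rule L.M.finsum_insert) (use insert.hyps xL in auto)
      then show ?case using Im.m_closed[OF c[OF jS(1)] insert.IH[OF jS(2)]] by simp
    qed (simp add: Im.zero_closed)
    from this[OF fin subset_refl] show "x \<in> \<epsilon> ` carrier ?F" using L.gcomp_spec(3)[OF xL] by simp
  qed
  then have surj: "carrier L \<subseteq> \<epsilon> ` carrier ?F" using L.span_is_subset[OF _ im] A(3) by blast
  have fin: "finite {i \<in> {..<N}. dg i \<le> j}" for j by simp
  have lo: "Min (insert 0 (dg ` {..<N})) \<le> dg i" if "i \<in> {..<N}" for i using that by (intro Min_le) auto
  show thesis by (rule that, rule locfin_image[OF free_mod_graded L \<epsilon>(1) surj free_mod_locfin[OF lo fin]])
qed

text \<open>The combinations of the variables form an ideal.\<close>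

lemma maximal_ideal_combination:
  assumes "r \<in> \<mm>"
  shows "\<exists>c. (\<forall>i<e. c i \<in> carrier R) \<and> r = (\<Oplus>i\<in>{..<e}. X i \<otimes> c i)"
proof -
  let ?D = "{r. \<exists>c. (\<forall>i<e. c i \<in> carrier R) \<and> r = (\<Oplus>i\<in>{..<e}. X i \<otimes> c i)}"
  have D: "(\<Oplus>i\<in>{..<e}. X i \<otimes> c i) \<in> ?D" if "\<And>i. i < e \<Longrightarrow> c i \<in> carrier R" for c using that by blast
  have mult: "a \<otimes> r \<in> ?D" if a: "a \<in> carrier R" and r: "r \<in> ?D" for a r
  proof -
    obtain c where c: "\<forall>i<e. c i \<in> carrier R" "r = (\<Oplus>i\<in>{..<e}. X i \<otimes> c i)" using r by (elim CollectE exE conjE)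
    have "a \<otimes> r = (\<Oplus>i\<in>{..<e}. a \<otimes> (X i \<otimes> c i))" unfolding c(2) using a c X_carrier by (intro R.finsum_rdistr) auto
    also have "\<dots> = (\<Oplus>i\<in>{..<e}. X i \<otimes> (a \<otimes> c i))" using a c X_carrier by (intro R.finsum_cong') (auto simp: R.m_lcomm)
    finally have eq: "a \<otimes> r = (\<Oplus>i\<in>{..<e}. X i \<otimes> (a \<otimes> c i))" .
    show ?thesis unfolding eq by (rule D) (use a c(1) in simp)
  qed
  have add: "r \<oplus> s \<in> ?D" if r: "r \<in> ?D" and s: "s \<in> ?D" for r s
  proof -
    obtain c where c: "\<forall>i<e. c i \<in> carrier R" "r = (\<Oplus>i\<in>{..<e}. X i \<otimes> c i)" using r by (elim CollectE exE conjE)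
    obtain c' where c': "\<forall>i<e. c' i \<in> carrier R" "s = (\<Oplus>i\<in>{..<e}. X i \<otimes> c' i)" using s by (elim CollectE exE conjE)
    have "r \<oplus> s = (\<Oplus>i\<in>{..<e}. X i \<otimes> c i \<oplus> X i \<otimes> c' i)" unfolding c(2) c'(2) using c c' X_carrier by (subst R.finsum_addf) auto
    also have "\<dots> = (\<Oplus>i\<in>{..<e}. X i \<otimes> (c i \<oplus> c' i))" using c c' X_carrier by (intro R.finsum_cong') (auto simp: R.r_distr)
    finally have eq: "r \<oplus> s = (\<Oplus>i\<in>{..<e}. X i \<otimes> (c i \<oplus> c' i))" .
    show ?thesis unfolding eq by (rule D) (use c(1) c'(1) in simp)
  qed
  have carr: "r \<in> carrier R" if r: "r \<in> ?D" for r
  proof -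
    obtain c where c: "\<forall>i<e. c i \<in> carrier R" "r = (\<Oplus>i\<in>{..<e}. X i \<otimes> c i)" using r by (elim CollectE exE conjE)
    show ?thesis unfolding c(2) using c(1) X_carrier by (intro R.finsum_closed) auto
  qed
  have zero: "\<zero> \<in> ?D"
  proof -
    have "(\<Oplus>i\<in>{..<e}. X i \<otimes> \<zero>) = (\<Oplus>i\<in>{..<e}. \<zero>)" using X_carrier by (intro R.finsum_cong') auto
    also have "\<dots> = \<zero>" by simp
    finally have eq: "(\<Oplus>i\<in>{..<e}. X i \<otimes> \<zero>) = \<zero>" .
    show ?thesis by (subst eq[symmetric], rule D) simp
  qed
  have "ideal ?D R"
  proof (rule idealI[OF R.ring_axioms])
    show "subgroup ?D (add_monoid R)"
    proof (rule R.add.subgroupI)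
      show "?D \<subseteq> carrier R" using carr by (rule subsetI)
      show "?D \<noteq> {}" using zero by (rule ex_in_conv[THEN iffD1, OF exI])
      show "\<ominus> a \<in> ?D" if "a \<in> ?D" for a
      proof -
        have "\<ominus> a = (\<ominus> \<one>) \<otimes> a" using carr[OF that] by (simp add: R.l_minus)
        then show ?thesis using mult[OF _ that, of "\<ominus> \<one>"] by simp
      qed
      show "a \<oplus> b \<in> ?D" if "a \<in> ?D" "b \<in> ?D" for a b using that by (rule add)
    qed
    show "a \<otimes> x \<in> ?D" if "a \<in> ?D" "x \<in> carrier R" for a x
      unfolding R.m_comm[OF carr[OF that(1)] that(2)] by (rule mult[OF that(2,1)])
    show "x \<otimes> a \<in> ?D" if "a \<in> ?D" "x \<in> carrier R" for a x by (rule mult[OF that(2,1)])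
  qed
  moreover have "X ` {..<e} \<subseteq> ?D"
  proof
    fix x assume "x \<in> X ` {..<e}"
    then obtain k where k: "k < e" "x = X k" by auto
    have "(\<Oplus>i\<in>{..<e}. X i \<otimes> (if i = k then \<one> else \<zero>)) = (\<Oplus>i\<in>{..<e}. if k = i then X i else \<zero>)"
      using X_carrier by (intro R.finsum_cong') auto
    also have "\<dots> = x" using k X_carrier by (subst R.finsum_singleton[of k]) auto
    finally have eq: "x = (\<Oplus>i\<in>{..<e}. X i \<otimes> (if i = k then \<one> else \<zero>))" by (rule sym)
    show "x \<in> ?D" unfolding eq by (rule D) simp
  qed
  ultimately have "\<mm> \<subseteq> ?D" unfolding \<mm>_def by (rule R.genideal_minimal)
  then have "r \<in> ?D" using assms by (rule subsetD)
  then show ?thesis by (rule CollectD)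
qed

section \<open>Multiples of the maximal ideal\<close>

lemma gcomp_X:
  assumes L: "graded_module R L" and i: "i < e" and x: "x \<in> carrier L"
  shows "gcomp L j (X i \<odot>\<^bsub>L\<^esub> x) = X i \<odot>\<^bsub>L\<^esub> gcomp L (j - int (d i)) x"
  using gcomp_ghom[OF L L ghom_smult_homogeneous[OF L X_grade[OF i] X_carrier[OF i] ghom_id refl] x, of "j - int (d i)"]
  by simp

text \<open>Elements of \<open>\<mm>N\<close> are combinations of the variables with exactly one coefficient in \<open>N\<close> for each
variable; this is what makes the number of variables enter the inequality.\<close>

lemma ideal_times_eq:
  assumes L: "graded_module R L" and N: "LinearCombinations.submodule R N L"
  shows "ideal_times R \<mm> L N = {(\<Oplus>\<^bsub>L\<^esub>i\<in>{..<e}. X i \<odot>\<^bsub>L\<^esub> l i) | l. \<forall>i<e. l i \<in> N}" (is "_ = ?D")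
    and "LinearCombinations.submodule R (ideal_times R \<mm> L N) L"
    and "r \<in> \<mm> \<Longrightarrow> x \<in> N \<Longrightarrow> r \<odot>\<^bsub>L\<^esub> x \<in> ideal_times R \<mm> L N"
    and "ideal_times R \<mm> L N \<subseteq> N"
proof -
  interpret L: graded_module R L by fact
  interpret N: LinearCombinations.submodule R N L by fact
  note sub = subsetD[OF N.subset]
  let ?G = "{r \<odot>\<^bsub>L\<^esub> x | r x. r \<in> \<mm> \<and> x \<in> N}"
  have mR: "r \<in> carrier R" if "r \<in> \<mm>" for r using that by (simp add: in_\<mm>_iff)
  have Xm: "X i \<in> \<mm>" if "i < e" for i using that by (simp add: in_\<mm>_iff X_carrier aug_X)
  have G: "?G \<subseteq> carrier L" using mR sub by auto
  have T: "ideal_times R \<mm> L N = L.span ?G" by (simp add: ideal_times_def)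
  show T1: "LinearCombinations.submodule R (ideal_times R \<mm> L N) L" unfolding T by (rule L.span_is_submodule[OF G])
  interpret T: LinearCombinations.submodule R "ideal_times R \<mm> L N" L by (rule T1)
  have T2: "r \<odot>\<^bsub>L\<^esub> x \<in> ideal_times R \<mm> L N" if "r \<in> \<mm>" "x \<in> N" for r x
    unfolding T by (rule subsetD[OF L.in_own_span[OF G]]) (use that in blast)
  then show "r \<in> \<mm> \<Longrightarrow> x \<in> N \<Longrightarrow> r \<odot>\<^bsub>L\<^esub> x \<in> ideal_times R \<mm> L N" by blast
  show "ideal_times R \<mm> L N \<subseteq> N" unfolding T by (rule L.span_is_subset[OF _ N]) (use mR in auto)
  have DI: "(\<Oplus>\<^bsub>L\<^esub>i\<in>{..<e}. X i \<odot>\<^bsub>L\<^esub> l i) \<in> ?D" if "\<And>i. i < e \<Longrightarrow> l i \<in> N" for l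
    using that by (intro CollectI exI[of _ l] conjI allI impI refl)
  have DE: "\<exists>l. (\<forall>i<e. l i \<in> N) \<and> x = (\<Oplus>\<^bsub>L\<^esub>i\<in>{..<e}. X i \<odot>\<^bsub>L\<^esub> l i)" if "x \<in> ?D" for x
    using that by (elim CollectE exE conjE) (intro exI conjI)
  have Dc: "?D \<subseteq> carrier L"
  proof
    fix x assume "x \<in> ?D"
    from DE[OF this] obtain l where l: "\<forall>i<e. l i \<in> N" "x = (\<Oplus>\<^bsub>L\<^esub>i\<in>{..<e}. X i \<odot>\<^bsub>L\<^esub> l i)" by (elim exE conjE)
    show "x \<in> carrier L" unfolding l(2) using l(1) X_carrier sub by (intro L.M.finsum_closed) auto
  qed
  have "LinearCombinations.submodule R ?D L"
  proof (rule LinearCombinations.submodule.intro[OF L.module_axioms Dc])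
    show "v \<oplus>\<^bsub>L\<^esub> w \<in> ?D" if v: "v \<in> ?D" and w: "w \<in> ?D" for v w
    proof -
      obtain l where l: "\<forall>i<e. l i \<in> N" "v = (\<Oplus>\<^bsub>L\<^esub>i\<in>{..<e}. X i \<odot>\<^bsub>L\<^esub> l i)" using DE[OF v] by (elim exE conjE)
      obtain l' where l': "\<forall>i<e. l' i \<in> N" "w = (\<Oplus>\<^bsub>L\<^esub>i\<in>{..<e}. X i \<odot>\<^bsub>L\<^esub> l' i)" using DE[OF w] by (elim exE conjE)
      have "v \<oplus>\<^bsub>L\<^esub> w = (\<Oplus>\<^bsub>L\<^esub>i\<in>{..<e}. X i \<odot>\<^bsub>L\<^esub> l i \<oplus>\<^bsub>L\<^esub> X i \<odot>\<^bsub>L\<^esub> l' i)"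
        unfolding l(2) l'(2) using l l' X_carrier sub by (subst L.M.finsum_addf) auto
      also have "\<dots> = (\<Oplus>\<^bsub>L\<^esub>i\<in>{..<e}. X i \<odot>\<^bsub>L\<^esub> (l i \<oplus>\<^bsub>L\<^esub> l' i))"
        using l l' X_carrier sub by (intro L.M.finsum_cong') (auto simp: L.smult_r_distr)
      finally have eq: "v \<oplus>\<^bsub>L\<^esub> w = (\<Oplus>\<^bsub>L\<^esub>i\<in>{..<e}. X i \<odot>\<^bsub>L\<^esub> (l i \<oplus>\<^bsub>L\<^esub> l' i))" .
      show ?thesis unfolding eq by (rule DI) (use l(1) l'(1) in simp)
    qed
    show "c \<odot>\<^bsub>L\<^esub> v \<in> ?D" if c: "c \<in> carrier R" and v: "v \<in> ?D" for c v
    proof -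
      obtain l where l: "\<forall>i<e. l i \<in> N" "v = (\<Oplus>\<^bsub>L\<^esub>i\<in>{..<e}. X i \<odot>\<^bsub>L\<^esub> l i)" using DE[OF v] by (elim exE conjE)
      have "c \<odot>\<^bsub>L\<^esub> v = (\<Oplus>\<^bsub>L\<^esub>i\<in>{..<e}. c \<odot>\<^bsub>L\<^esub> (X i \<odot>\<^bsub>L\<^esub> l i))"
        unfolding l(2) using l c X_carrier sub by (intro L.finsum_smult) auto
      also have "\<dots> = (\<Oplus>\<^bsub>L\<^esub>i\<in>{..<e}. X i \<odot>\<^bsub>L\<^esub> (c \<odot>\<^bsub>L\<^esub> l i))"
        using l c X_carrier sub by (intro L.M.finsum_cong') (auto simp: L.smult_assoc1[symmetric] R.m_comm)
      finally have eq: "c \<odot>\<^bsub>L\<^esub> v = (\<Oplus>\<^bsub>L\<^esub>i\<in>{..<e}. X i \<odot>\<^bsub>L\<^esub> (c \<odot>\<^bsub>L\<^esub> l i))" .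
      show ?thesis unfolding eq by (rule DI) (use l(1) c in simp)
    qed
    have "(\<Oplus>\<^bsub>L\<^esub>i\<in>{..<e}. X i \<odot>\<^bsub>L\<^esub> \<zero>\<^bsub>L\<^esub>) = (\<Oplus>\<^bsub>L\<^esub>i\<in>{..<e}. \<zero>\<^bsub>L\<^esub>)" using X_carrier by (intro L.M.finsum_cong') auto
    then have eq: "\<zero>\<^bsub>L\<^esub> = (\<Oplus>\<^bsub>L\<^esub>i\<in>{..<e}. X i \<odot>\<^bsub>L\<^esub> \<zero>\<^bsub>L\<^esub>)" by simp
    show "\<zero>\<^bsub>L\<^esub> \<in> ?D" by (subst eq, rule DI) simp
  qed
  moreover have "?G \<subseteq> ?D"
  proof
    fix y assume "y \<in> ?G"
    then obtain r x where y: "y = r \<odot>\<^bsub>L\<^esub> x" "r \<in> \<mm>" "x \<in> N" by (elim CollectE exE conjE)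
    obtain c where c: "\<forall>i<e. c i \<in> carrier R" "r = (\<Oplus>i\<in>{..<e}. X i \<otimes> c i)" using maximal_ideal_combination[OF y(2)] by (elim exE conjE)
    have "y = (\<Oplus>\<^bsub>L\<^esub>i\<in>{..<e}. (X i \<otimes> c i) \<odot>\<^bsub>L\<^esub> x)"
      unfolding y(1) c(2) using c y X_carrier sub by (intro L.finsum_smult_r) auto
    also have "\<dots> = (\<Oplus>\<^bsub>L\<^esub>i\<in>{..<e}. X i \<odot>\<^bsub>L\<^esub> (c i \<odot>\<^bsub>L\<^esub> x))"
      using c y X_carrier sub by (intro L.M.finsum_cong') (auto simp: L.smult_assoc1)
    finally have eq: "y = (\<Oplus>\<^bsub>L\<^esub>i\<in>{..<e}. X i \<odot>\<^bsub>L\<^esub> (c i \<odot>\<^bsub>L\<^esub> x))" .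
    show "y \<in> ?D" unfolding eq by (rule DI) (use c(1) y(3) in simp)
  qed
  ultimately have 1: "ideal_times R \<mm> L N \<subseteq> ?D" unfolding T by (intro L.span_is_subset)
  have "?D \<subseteq> ideal_times R \<mm> L N"
  proof
    fix y assume "y \<in> ?D"
    from DE[OF this] obtain l where l: "\<forall>i<e. l i \<in> N" "y = (\<Oplus>\<^bsub>L\<^esub>i\<in>{..<e}. X i \<odot>\<^bsub>L\<^esub> l i)" by (elim exE conjE)
    have "(\<Oplus>\<^bsub>L\<^esub>i\<in>S. X i \<odot>\<^bsub>L\<^esub> l i) \<in> ideal_times R \<mm> L N" if "finite S" "S \<subseteq> {..<e}" for S
      using that
    proof (induction S rule: finite_induct)
      case (insert j S)
      have j: "j < e" "S \<subseteq> {..<e}" using insert.prems by simp_all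
      have "(\<Oplus>\<^bsub>L\<^esub>i\<in>insert j S. X i \<odot>\<^bsub>L\<^esub> l i) = X j \<odot>\<^bsub>L\<^esub> l j \<oplus>\<^bsub>L\<^esub> (\<Oplus>\<^bsub>L\<^esub>i\<in>S. X i \<odot>\<^bsub>L\<^esub> l i)"
        using insert.hyps j l(1) X_carrier sub by (intro L.M.finsum_insert) auto
      moreover have "X j \<odot>\<^bsub>L\<^esub> l j \<in> ideal_times R \<mm> L N" by (rule T2) (use Xm j l(1) in auto)
      ultimately show ?case using T.m_closed[OF _ insert.IH[OF j(2)]] by simp
    qed simp
    then show "y \<in> ideal_times R \<mm> L N" unfolding l(2) by simp
  qed
  with 1 show "ideal_times R \<mm> L N = ?D" by (rule subset_antisym)
qed

text \<open>Take the homogeneous components of the coefficients.\<close>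

lemma ideal_times_graded:
  assumes L: "graded_module R L" and N: "LinearCombinations.submodule R N L"
    and comp: "\<And>x j. x \<in> N \<Longrightarrow> gcomp L j x \<in> N"
  shows "x \<in> ideal_times R \<mm> L N \<Longrightarrow> gcomp L j x \<in> ideal_times R \<mm> L N"
    and "x \<in> ideal_times R \<mm> L N \<Longrightarrow> x \<in> mgrade L j \<Longrightarrow>
      \<exists>l. (\<forall>i<e. l i \<in> N \<inter> mgrade L (j - int (d i))) \<and> x = (\<Oplus>\<^bsub>L\<^esub>i\<in>{..<e}. X i \<odot>\<^bsub>L\<^esub> l i)"
proof -
  interpret L: graded_module R L by fact
  interpret N: LinearCombinations.submodule R N L by fact
  note sub = subsetD[OF N.subset]
  have *: "\<exists>l. (\<forall>i<e. l i \<in> N \<inter> mgrade L (j - int (d i))) \<and> gcomp L j x = (\<Oplus>\<^bsub>L\<^esub>i\<in>{..<e}. X i \<odot>\<^bsub>L\<^esub> l i)"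
    if x: "x \<in> ideal_times R \<mm> L N" for x
  proof -
    obtain l where l: "\<forall>i<e. l i \<in> N" "x = (\<Oplus>\<^bsub>L\<^esub>i\<in>{..<e}. X i \<odot>\<^bsub>L\<^esub> l i)"
      using x unfolding ideal_times_eq(1)[OF L N] by (elim CollectE exE conjE)
    have "gcomp L j x = (\<Oplus>\<^bsub>L\<^esub>i\<in>{..<e}. gcomp L j (X i \<odot>\<^bsub>L\<^esub> l i))"
      unfolding l(2) using l X_carrier sub by (intro L.gcomp_finsum) auto
    also have "\<dots> = (\<Oplus>\<^bsub>L\<^esub>i\<in>{..<e}. X i \<odot>\<^bsub>L\<^esub> gcomp L (j - int (d i)) (l i))"
      using l X_carrier sub by (intro L.M.finsum_cong') (auto simp: gcomp_X[OF L])
    finally show ?thesis using l comp sub L.gcomp_spec(1)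
      by (intro exI[of _ "\<lambda>i. gcomp L (j - int (d i)) (l i)"]) auto
  qed
  show "gcomp L j x \<in> ideal_times R \<mm> L N" if x: "x \<in> ideal_times R \<mm> L N"
  proof -
    obtain l where l: "\<forall>i<e. l i \<in> N \<inter> mgrade L (j - int (d i))" "gcomp L j x = (\<Oplus>\<^bsub>L\<^esub>i\<in>{..<e}. X i \<odot>\<^bsub>L\<^esub> l i)"
      using *[OF x] by (elim exE conjE)
    show ?thesis unfolding ideal_times_eq(1)[OF L N] l(2) using l(1) by (intro CollectI exI[of _ l]) simp
  qed
  show "\<exists>l. (\<forall>i<e. l i \<in> N \<inter> mgrade L (j - int (d i))) \<and> x = (\<Oplus>\<^bsub>L\<^esub>i\<in>{..<e}. X i \<odot>\<^bsub>L\<^esub> l i)"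
    if "x \<in> ideal_times R \<mm> L N" "x \<in> mgrade L j"
    using *[OF that(1)] L.gcomp_homogeneous[OF that(2), of j] by simp
qed

lemma gcomp_submod:
  assumes L: "graded_module R L" and N: "graded_module R (submod L N)" and sub: "N \<subseteq> carrier L" and x: "x \<in> N"
  shows "gcomp (submod L N) j x = gcomp L j x"
proof -
  have "ghom R 0 (submod L N) L (\<lambda>x. x)" by (rule ghomI) (use sub in auto)
  from gcomp_ghom[OF N L this, of x j] x show ?thesis by simp
qed

text \<open>A ring element differs from its augmentation by an element of \<open>\<mm>\<close>, so a functional on one homogeneous part is
\<open>R\<close>-linear as soon as it ignores multiples of \<open>\<mm>\<close>.\<close>

lemma kfun_of_functional:
  assumes Y: "graded_module R Y" and lin: "lin_functional (graded_part R Y a) \<pi>"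
    and van: "\<And>r x. r \<in> \<mm> \<Longrightarrow> x \<in> carrier Y \<Longrightarrow> \<pi> (gcomp Y a (r \<odot>\<^bsub>Y\<^esub> x)) = 0"
  shows "kfun Y a (\<lambda>x. \<pi> (gcomp Y a x))"
proof -
  interpret Y: graded_module R Y by fact
  have add: "\<pi> (gcomp Y a (x \<oplus>\<^bsub>Y\<^esub> y)) = \<pi> (gcomp Y a x) + \<pi> (gcomp Y a y)"
    if "x \<in> carrier Y" "y \<in> carrier Y" for x y
    using lin_functionalD(1)[OF lin, of "gcomp Y a x" "gcomp Y a y"] that
    by (simp add: graded_part_def Y.gcomp_add Y.gcomp_spec(1))
  have sc: "\<pi> (gcomp Y a (scalar R c \<odot>\<^bsub>Y\<^esub> x)) = c * \<pi> (gcomp Y a x)" if x: "x \<in> carrier Y" for c x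
  proof -
    have "gcomp Y a (scalar R c \<odot>\<^bsub>Y\<^esub> x) = scalar R c \<odot>\<^bsub>Y\<^esub> gcomp Y a x"
      using gcomp_ghom[OF Y Y ghom_smult_homogeneous[OF Y scalar_grade scalar_carrier ghom_id refl] x, of a] by simp
    then show ?thesis
      using lin_functionalD(2)[OF lin, of "gcomp Y a x" c] x by (simp add: graded_part_def Y.gcomp_spec(1))
  qed
  have sm: "\<pi> (gcomp Y a (r \<odot>\<^bsub>Y\<^esub> x)) = aug r * \<pi> (gcomp Y a x)" if r: "r \<in> carrier R" and x: "x \<in> carrier Y" for r x
  proof -
    let ?r = "r \<ominus> scalar R (aug r)"
    have m: "?r \<in> \<mm>" using r by (simp add: in_\<mm>_iff a_minus_def aug_add aug_uminus)
    have rR: "?r \<in> carrier R" using r by simp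
    have "r = scalar R (aug r) \<oplus> ?r" using r by (simp add: a_minus_def R.a_lcomm R.r_neg)
    then have "r \<odot>\<^bsub>Y\<^esub> x = (scalar R (aug r) \<oplus> ?r) \<odot>\<^bsub>Y\<^esub> x" by (rule arg_cong)
    also have "\<dots> = scalar R (aug r) \<odot>\<^bsub>Y\<^esub> x \<oplus>\<^bsub>Y\<^esub> ?r \<odot>\<^bsub>Y\<^esub> x" by (rule Y.smult_l_distr[OF scalar_carrier rR x])
    finally have "r \<odot>\<^bsub>Y\<^esub> x = scalar R (aug r) \<odot>\<^bsub>Y\<^esub> x \<oplus>\<^bsub>Y\<^esub> ?r \<odot>\<^bsub>Y\<^esub> x" .
    then show ?thesis using add[of "scalar R (aug r) \<odot>\<^bsub>Y\<^esub> x" "?r \<odot>\<^bsub>Y\<^esub> x"] sc[OF x] van[OF m x] r x by simp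
  qed
  have "\<pi> \<zero>\<^bsub>Y\<^esub> = 0"
    using lin_functional_zero[OF lin graded_part_vectorspace[OF Y]] by (simp add: graded_part_def)
  then show ?thesis unfolding kfun_def using add sm by (auto simp: Y.gcomp_homogeneous)
qed

end

section \<open>Coefficients of products of series\<close>

lemma fls_X_power_times_nth: "fls_nth (fls_X ^ k * f) j = fls_nth f (j - int k)" for f :: "int fls"
proof (induction k arbitrary: j)
  case (Suc k)
  have "fls_nth (fls_X ^ Suc k * f) j = fls_nth (fls_X * (fls_X ^ k * f)) j" by (simp add: mult.assoc)
  also have "\<dots> = fls_nth (fls_X ^ k * f) (j - 1)" by (simp only: fls_X_times_conv_shift fls_shift_nth) simp
  finally show ?case using Suc.IH[of "j - 1"] by (simp add: algebra_simps)
qed simp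

lemma fls_times_nth_finite:
  fixes f g :: "int fls"
  obtains A where "finite A" "fls_nth (f * g) j = (\<Sum>a\<in>A. fls_nth f a * fls_nth g (j - a))"
proof
  let ?g = "fls_subdegree g" and ?f = "fls_subdegree f"
  have "fls_nth (f * g) j = (\<Sum>i=?f + ?g..j. fls_nth f (i - ?g) * fls_nth g (?g + j - i))" by (rule fls_times_nth)
  also have "\<dots> = (\<Sum>a\<in>(\<lambda>i. i - ?g) ` {?f + ?g..j}. fls_nth f a * fls_nth g (j - a))"
    by (subst sum.reindex) (auto simp: inj_on_def algebra_simps intro!: sum.cong)
  finally show "fls_nth (f * g) j = (\<Sum>a\<in>(\<lambda>i. i - ?g) ` {?f + ?g..j}. fls_nth f a * fls_nth g (j - a))" .
qed simp

text \<open>All coefficients are nonnegative, so on multiplying out the product the terms with at most one factor \<open>t\<close> from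
it give a lower bound.\<close>

lemma poly_product_lower_bound:
  fixes B :: "int fls fps" and e :: nat
  assumes nn: "\<And>n j. 0 \<le> fls_nth (fps_nth B n) j"
  shows "fls_nth (fps_nth B n) j + (if n = 0 then 0 else \<Sum>i<e. fls_nth (fps_nth B (n - 1)) (j - int (d i)))
    \<le> fls_nth (fps_nth (B * (\<Prod>i<e. 1 + fps_const (fls_X ^ d i) * fps_X)) n) j"
proof (induction e arbitrary: n j)
  case (Suc e)
  let ?B = "B * (\<Prod>i<e. 1 + fps_const (fls_X ^ d i) * fps_X)"
  have ge: "fls_nth (fps_nth B n) j \<le> fls_nth (fps_nth ?B n) j" for n j
  proof -
    have "0 \<le> (if n = 0 then 0 else \<Sum>i<e. fls_nth (fps_nth B (n - 1)) (j - int (d i)))" using nn by (simp add: sum_nonneg)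
    then show ?thesis using Suc.IH[of n j] by linarith
  qed
  have "B * (\<Prod>i<Suc e. 1 + fps_const (fls_X ^ d i) * fps_X) = ?B + fps_const (fls_X ^ d e) * ?B * fps_X"
    by (simp add: algebra_simps)
  then have "fls_nth (fps_nth (B * (\<Prod>i<Suc e. 1 + fps_const (fls_X ^ d i) * fps_X)) n) j =
      fls_nth (fps_nth ?B n) j + (if n = 0 then 0 else fls_nth (fps_nth ?B (n - 1)) (j - int (d e)))"
    by (simp add: fls_X_power_times_nth)
  then show ?case using Suc.IH[of n j] ge[of "n - 1" "j - int (d e)"] by (simp split: if_splits)
qed simp

section \<open>The inequality over a connected algebra\<close>

context connected_algebra
begin

text \<open>Functionals on the part of degree \<open>a\<close> of \<open>M\<close> with common kernel \<open>\<mm>M\<close> exist because \<open>M / \<mm>M\<close> is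
finite dimensional in each degree. The dual system that they give on \<open>\<mm>L\<close> has at least \<open>dim V\<^sub>a\<close> members, since the
functionals in it have common kernel \<open>\<mm>M\<close> on \<open>\<mm>L\<close>.\<close>

lemma tight_coordinates:
  fixes L :: "('r, 'm) graded_module"
  assumes L: "graded_module R L" and lf: "locfin lo L"
    and M: "LinearCombinations.submodule R M L" "graded_module R (submod L M)"
    and mL: "ideal_times R \<mm> L (carrier L) \<subseteq> M"
  defines "V \<equiv> quot_graded_module (submod L (ideal_times R \<mm> L (carrier L))) (ideal_times R \<mm> L M)"
  shows "\<exists>(m::nat) v \<pi>. vectorspace.dim (class_ring :: 'k ring) (graded_part R V a) \<le> m \<and>
      (\<forall>s<m. v s \<in> ideal_times R \<mm> L (carrier L) \<inter> mgrade L a \<and> kfun (submod L M) a (\<pi> s)) \<and>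
      (\<forall>s<m. \<forall>t<m. \<pi> s (v t) = of_bool (s = t))"
    and "a < lo \<Longrightarrow> vectorspace.dim (class_ring :: 'k ring) (graded_part R V a) = 0"
proof -
  interpret L: graded_module R L by fact
  interpret N: graded_module R "submod L M" by fact
  interpret M: LinearCombinations.submodule R M L by fact
  let ?TL = "ideal_times R \<mm> L (carrier L)" and ?TM = "ideal_times R \<mm> L M"
  have LL: "LinearCombinations.submodule R (carrier L) L"
    by (rule LinearCombinations.submodule.intro[OF L.module_axioms]) auto
  have compM: "gcomp L j x \<in> M" if "x \<in> M" for x j
    using N.gcomp_spec(1)[of x j] gcomp_submod[OF L M(2) M.subset that, of j] that by simp
  note tL = ideal_times_eq(2,3)[OF L LL] and tM = ideal_times_eq(2,3,4)[OF L M(1)]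
  interpret TL: LinearCombinations.submodule R ?TL L by (rule tL(1))
  interpret TM: LinearCombinations.submodule R ?TM L by (rule tM(1))
  have TM_TL: "?TM \<subseteq> ?TL"
  proof
    fix x assume "x \<in> ?TM"
    then obtain l where l: "\<forall>i<e. l i \<in> M" "x = (\<Oplus>\<^bsub>L\<^esub>i\<in>{..<e}. X i \<odot>\<^bsub>L\<^esub> l i)"
      unfolding ideal_times_eq(1)[OF L M(1)] by (elim CollectE exE conjE)
    show "x \<in> ?TL" unfolding ideal_times_eq(1)[OF L LL] l(2)
      using l(1) M.subset by (intro CollectI exI[of _ l] conjI refl allI impI) auto
  qed
  have gTL: "graded_module R (submod L ?TL)"
  proof (rule submod_graded[OF L TL.subset TL.zero_closed])
    show "gcomp L j x \<in> ?TL" if x: "x \<in> ?TL" for x j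
      by (rule ideal_times_graded(1)[OF L LL _ x]) (rule L.gcomp_carrier)
  qed (rule TL.m_closed TL.smult_closed; assumption)+
  have subM: "LinearCombinations.submodule R ?TM (submod L M)"
    using tM(3) by (intro LinearCombinations.submodule.intro[OF N.module_axioms]) (auto simp: TM.zero_closed)
  have subTL: "LinearCombinations.submodule R ?TM (submod L ?TL)"
    using TM_TL by (intro LinearCombinations.submodule.intro[OF graded_module.axioms(1)[OF gTL]]) (auto simp: TM.zero_closed)
  let ?H = "graded_part R (submod L M) a" and ?W = "graded_part R (quot_graded_module (submod L M) ?TM) a"
  let ?q = "\<lambda>x. ?TM +>\<^bsub>submod L M\<^esub> x"
  have lin: "linear_quotient ?H ?W ?q" by (rule graded_quotient_linear[OF M(2) subM])
  interpret q: linear_quotient ?H ?W ?q by (rule lin)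
  have Hsel: "carrier ?H = M \<inter> mgrade L a" "add ?H = add L" "\<And>c x. c \<odot>\<^bsub>?H\<^esub> x = scalar R c \<odot>\<^bsub>L\<^esub> x"
    by (simp_all add: graded_part_def)
  have qz: "?q x = \<zero>\<^bsub>?W\<^esub> \<longleftrightarrow> x \<in> ?TM" if "x \<in> M" for x
  proof -
    have "\<zero>\<^bsub>?W\<^esub> = ?TM" by (simp add: graded_part_def quot_graded_module_sel)
    moreover have "?q x = ?TM \<longleftrightarrow> x \<in> ?TM"
      by (rule quot_graded_module_coset(3)[OF N.module_axioms subM]) (use that in simp_all)
    ultimately show ?thesis by (simp only:)
  qed
  have finM: "fin_graded_part R (submod L M) a" using locfin_submod[OF lf, of M] unfolding locfin_def by blast
  from fin_graded_part_quotient(2)[OF lin finM] obtain N :: nat and \<kappa> where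
    "(\<forall>i<N. lin_functional ?W (\<kappa> i)) \<and>
      (\<forall>x\<in>mgrade (quot_graded_module (submod L M) ?TM) a. (\<forall>i<N. \<kappa> i x = 0) \<longrightarrow> x = \<zero>\<^bsub>quot_graded_module (submod L M) ?TM\<^esub>)"
    by (elim exE)
  then have \<kappa>: "\<And>i. i < N \<Longrightarrow> lin_functional ?W (\<kappa> i)"
    and \<kappa>inj: "\<And>w. w \<in> carrier ?W \<Longrightarrow> (\<And>i. i < N \<Longrightarrow> \<kappa> i w = 0) \<Longrightarrow> w = \<zero>\<^bsub>?W\<^esub>"
    by (simp_all add: graded_part_def)
  define \<mu> where "\<mu> i x = \<kappa> i (?q x)" for i x
  have \<mu>: "lin_functional ?H (\<mu> i)" if "i < N" for i
    unfolding lin_functional_def \<mu>_def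
    using lin_functionalD[OF \<kappa>[OF that]] q.q_closed q.q_add q.q_smult by simp
  have \<mu>0: "\<mu> i x = 0" if "i < N" "x \<in> ?TM \<inter> mgrade L a" for i x
  proof -
    have "?q x = \<zero>\<^bsub>?W\<^esub>" using qz[of x] that(2) tM(3) by blast
    then show ?thesis unfolding \<mu>_def using lin_functional_zero[OF \<kappa>[OF that(1)] q.vectorspace_W] by simp
  qed
  have \<mu>inj: "x \<in> ?TM" if x: "x \<in> M \<inter> mgrade L a" and "\<And>i. i < N \<Longrightarrow> \<mu> i x = 0" for x
  proof -
    have "?q x = \<zero>\<^bsub>?W\<^esub>" by (rule \<kappa>inj[OF q.q_closed]) (use that in \<open>simp_all add: \<mu>_def graded_part_def\<close>)
    then show ?thesis using qz[of x] x by blast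
  qed
  have "\<exists>(m::nat) v \<pi>. (\<forall>s<m. v s \<in> ?TL \<inter> mgrade L a \<and> lin_functional ?H (\<pi> s) \<and>
       (\<forall>x\<in>carrier ?H. (\<forall>i<N. \<mu> i x = 0) \<longrightarrow> \<pi> s x = 0)) \<and>
     (\<forall>s<m. \<forall>t<m. \<pi> s (v t) = of_bool (s = t)) \<and>
     (\<forall>z\<in>?TL \<inter> mgrade L a. (\<forall>s<m. \<pi> s z = 0) \<longrightarrow> (\<forall>i<N. \<mu> i z = 0))"
  proof (rule dual_system_on_subspace[OF graded_part_vectorspace[OF M(2)]])
    show "?TL \<inter> mgrade L a \<subseteq> carrier ?H" unfolding Hsel using mL by (rule Int_mono) simp
    show "x \<oplus>\<^bsub>?H\<^esub> y \<in> ?TL \<inter> mgrade L a" if "x \<in> ?TL \<inter> mgrade L a" "y \<in> ?TL \<inter> mgrade L a" for x y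
      unfolding Hsel using that TL.m_closed L.mgrade_add by simp
    show "c \<odot>\<^bsub>?H\<^esub> x \<in> ?TL \<inter> mgrade L a" if "x \<in> ?TL \<inter> mgrade L a" for c x
      unfolding Hsel using that TL.smult_closed[OF scalar_carrier, of x c] L.mgrade_smult[OF scalar_grade, of x a c] by simp
  qed (rule \<mu>)
  then obtain m :: nat and v \<pi> where
    v: "\<forall>s<m. v s \<in> ?TL \<inter> mgrade L a \<and> lin_functional ?H (\<pi> s) \<and> (\<forall>x\<in>carrier ?H. (\<forall>i<N. \<mu> i x = 0) \<longrightarrow> \<pi> s x = 0)"
    and dual: "\<forall>s<m. \<forall>t<m. \<pi> s (v t) = of_bool (s = t)"
    and ker: "\<forall>z\<in>?TL \<inter> mgrade L a. (\<forall>s<m. \<pi> s z = 0) \<longrightarrow> (\<forall>i<N. \<mu> i z = 0)"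
    by (elim exE conjE)
  have \<pi>lin: "lin_functional ?H (\<pi> s)" and vs: "v s \<in> ?TL \<inter> mgrade L a" if "s < m" for s using v that by simp_all
  have \<pi>0: "\<pi> s x = 0" if s: "s < m" and x: "x \<in> ?TM \<inter> mgrade L a" for s x
  proof -
    have "x \<in> carrier ?H" using x tM(3) unfolding Hsel by (elim IntE) (intro IntI, rule subsetD)
    moreover have "\<forall>i<N. \<mu> i x = 0" using \<mu>0 x by simp
    ultimately show ?thesis using v s by simp
  qed
  let ?H2 = "graded_part R (submod L ?TL) a"
  have lin2: "linear_quotient ?H2 (graded_part R V a) (\<lambda>x. ?TM +>\<^bsub>submod L ?TL\<^esub> x)"
    unfolding V_def by (rule graded_quotient_linear[OF gTL subTL])
  interpret q2: linear_quotient ?H2 "graded_part R V a" "\<lambda>x. ?TM +>\<^bsub>submod L ?TL\<^esub> x" by (rule lin2)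
  have H2sel: "carrier ?H2 = ?TL \<inter> mgrade L a" "add ?H2 = add L" "\<And>c x. c \<odot>\<^bsub>?H2\<^esub> x = scalar R c \<odot>\<^bsub>L\<^esub> x"
    by (simp_all add: graded_part_def)
  have q2z: "?TM +>\<^bsub>submod L ?TL\<^esub> x = \<zero>\<^bsub>graded_part R V a\<^esub>" if "x \<in> ?TM" for x
  proof -
    have "\<zero>\<^bsub>graded_part R V a\<^esub> = ?TM" by (simp add: V_def graded_part_def quot_graded_module_sel)
    moreover have "?TM +>\<^bsub>submod L ?TL\<^esub> x = ?TM \<longleftrightarrow> x \<in> ?TM"
      by (rule quot_graded_module_coset(3)[OF graded_module.axioms(1)[OF gTL] subTL]) (use that TM_TL in auto)
    ultimately show ?thesis using that by (simp only:)
  qed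
  have le: "vectorspace.dim (class_ring :: 'k ring) (graded_part R V a) \<le> m"
  proof (rule q2.fin_dim_functionals(2)[of m \<pi>])
    show "lin_functional ?H2 (\<pi> s)" if "s < m" for s
    proof -
      have "x \<in> carrier ?H" if "x \<in> carrier ?H2" for x using that mL unfolding Hsel H2sel by (elim IntE) (intro IntI, rule subsetD)
      then show ?thesis using lin_functionalD[OF \<pi>lin[OF that]] unfolding lin_functional_def Hsel(2,3) H2sel(2,3) by simp
    qed
    show "?TM +>\<^bsub>submod L ?TL\<^esub> x = \<zero>\<^bsub>graded_part R V a\<^esub>"
      if x: "x \<in> carrier ?H2" and z: "\<And>s. s < m \<Longrightarrow> \<pi> s x = 0" for x
    proof (rule q2z, rule \<mu>inj)
      show "x \<in> M \<inter> mgrade L a" using x mL unfolding H2sel by (elim IntE) (intro IntI, rule subsetD)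
      show "\<mu> i x = 0" if "i < N" for i using ker x z that unfolding H2sel by simp
    qed
  qed
  have kf: "kfun (submod L M) a (\<lambda>x. \<pi> s (gcomp (submod L M) a x))" if s: "s < m" for s
  proof (rule kfun_of_functional[OF M(2) \<pi>lin[OF s]])
    fix r x assume r: "r \<in> \<mm>" and x: "x \<in> carrier (submod L M)"
    have rx: "r \<odot>\<^bsub>L\<^esub> x \<in> ?TM" using tM(2)[OF r, of x] x by simp
    have g: "gcomp L a (r \<odot>\<^bsub>L\<^esub> x) \<in> ?TM \<inter> mgrade L a"
    proof
      show "gcomp L a (r \<odot>\<^bsub>L\<^esub> x) \<in> ?TM" by (rule ideal_times_graded(1)[OF L M(1) compM rx])
      show "gcomp L a (r \<odot>\<^bsub>L\<^esub> x) \<in> mgrade L a" by (rule L.gcomp_spec(1)) (rule subsetD[OF TM.subset rx])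
    qed
    have "gcomp (submod L M) a (r \<odot>\<^bsub>submod L M\<^esub> x) = gcomp L a (r \<odot>\<^bsub>L\<^esub> x)"
      using gcomp_submod[OF L M(2) M.subset subsetD[OF tM(3) rx], of a] by simp
    then show "\<pi> s (gcomp (submod L M) a (r \<odot>\<^bsub>submod L M\<^esub> x)) = 0" using \<pi>0[OF s g] by simp
  qed
  show "\<exists>(m::nat) v \<pi>. vectorspace.dim (class_ring :: 'k ring) (graded_part R V a) \<le> m \<and>
      (\<forall>s<m. v s \<in> ?TL \<inter> mgrade L a \<and> kfun (submod L M) a (\<pi> s)) \<and>
      (\<forall>s<m. \<forall>t<m. \<pi> s (v t) = of_bool (s = t))"
  proof (intro exI conjI allI impI)
    show "vectorspace.dim (class_ring :: 'k ring) (graded_part R V a) \<le> m" by (rule le)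
    fix s assume s: "s < m"
    show "v s \<in> ?TL \<inter> mgrade L a" by (rule vs[OF s])
    show "kfun (submod L M) a (\<lambda>x. \<pi> s (gcomp (submod L M) a x))" by (rule kf[OF s])
    fix t assume t: "t < m"
    have "v t \<in> mgrade (submod L M) a" using vs[OF t] mL by auto
    then have "gcomp (submod L M) a (v t) = v t" using N.gcomp_homogeneous[of "v t" a a] by simp
    then show "\<pi> s (gcomp (submod L M) a (v t)) = of_bool (s = t)" using dual s t by simp
  qed
  show "vectorspace.dim (class_ring :: 'k ring) (graded_part R V a) = 0" if "a < lo"
  proof -
    have "vectorspace.dim (class_ring :: 'k ring) (graded_part R V a) \<le> 0"
    proof (rule q2.fin_dim_functionals(2)[of 0])
      fix x assume "x \<in> carrier ?H2"
      then have "x \<in> mgrade L a" unfolding H2sel by (rule IntD2)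
      moreover have "mgrade L a \<subseteq> {\<zero>\<^bsub>L\<^esub>}" using lf that unfolding locfin_def by simp
      ultimately have "x \<in> {\<zero>\<^bsub>L\<^esub>}" by (rule rev_subsetD)
      then show "?TM +>\<^bsub>submod L ?TL\<^esub> x = \<zero>\<^bsub>graded_part R V a\<^esub>" using q2z[OF TM.zero_closed] by simp
    qed simp
    then show ?thesis by simp
  qed
qed

text \<open>The retract for the dual systems in all degrees \<open>a \<in> A\<close> at once. Members of different degrees
pair to zero because the functionals are homogeneous.\<close>

theorem tight_betti_inequality:
  fixes L :: "('r, 'm) graded_module"
  assumes L: "graded_module R L" and lf: "locfin lo L"
    and M: "LinearCombinations.submodule R M L" "graded_module R (submod L M)"
    and mL: "ideal_times R \<mm> L (carrier L) \<subseteq> M" and A: "finite A"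
  defines "V \<equiv> quot_graded_module (submod L (ideal_times R \<mm> L (carrier L))) (ideal_times R \<mm> L M)"
  shows "(\<Sum>a\<in>A. vectorspace.dim (class_ring :: 'k ring) (graded_part R V a) * betti R \<mm> kk n (j - a))
    \<le> betti R \<mm> (submod L M) n j + (if n = 0 then 0 else \<Sum>i<e. betti R \<mm> (submod L M) (n - 1) (j - int (d i)))"
proof -
  interpret L: graded_module R L by fact
  interpret M: LinearCombinations.submodule R M L by fact
  let ?TL = "ideal_times R \<mm> L (carrier L)"
  have LL: "LinearCombinations.submodule R (carrier L) L"
    by (rule LinearCombinations.submodule.intro[OF L.module_axioms]) auto
  have "\<forall>a. \<exists>(m::nat) v \<pi>. vectorspace.dim (class_ring :: 'k ring) (graded_part R V a) \<le> m \<and>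
      (\<forall>s<m. v s \<in> ?TL \<inter> mgrade L a \<and> kfun (submod L M) a (\<pi> s)) \<and> (\<forall>s<m. \<forall>t<m. \<pi> s (v t) = of_bool (s = t))"
    unfolding V_def by (intro allI tight_coordinates(1)[OF L lf M mL])
  from choice[OF this] obtain m :: "int \<Rightarrow> nat" where "\<forall>a. \<exists>v \<pi>. vectorspace.dim (class_ring :: 'k ring) (graded_part R V a) \<le> m a \<and>
      (\<forall>s<m a. v s \<in> ?TL \<inter> mgrade L a \<and> kfun (submod L M) a (\<pi> s)) \<and> (\<forall>s<m a. \<forall>t<m a. \<pi> s (v t) = of_bool (s = t))"
    by (elim exE)
  from choice[OF this] obtain v where "\<forall>a. \<exists>\<pi>. vectorspace.dim (class_ring :: 'k ring) (graded_part R V a) \<le> m a \<and>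
      (\<forall>s<m a. v a s \<in> ?TL \<inter> mgrade L a \<and> kfun (submod L M) a (\<pi> s)) \<and> (\<forall>s<m a. \<forall>t<m a. \<pi> s (v a t) = of_bool (s = t))"
    by (elim exE)
  from choice[OF this] obtain \<pi> where "\<forall>a. vectorspace.dim (class_ring :: 'k ring) (graded_part R V a) \<le> m a \<and>
      (\<forall>s<m a. v a s \<in> ?TL \<inter> mgrade L a \<and> kfun (submod L M) a (\<pi> a s)) \<and> (\<forall>s<m a. \<forall>t<m a. \<pi> a s (v a t) = of_bool (s = t))"
    by (elim exE)
  then have dim: "\<And>a. vectorspace.dim (class_ring :: 'k ring) (graded_part R V a) \<le> m a"
    and v: "\<And>a s. s < m a \<Longrightarrow> v a s \<in> ?TL \<and> v a s \<in> mgrade L a"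
    and \<pi>: "\<And>a s. s < m a \<Longrightarrow> kfun (submod L M) a (\<pi> a s)"
    and dual: "\<And>a s t. s < m a \<Longrightarrow> t < m a \<Longrightarrow> \<pi> a s (v a t) = of_bool (s = t)"
    by simp_all
  have vM: "v a s \<in> M \<and> v a s \<in> mgrade (submod L M) a" if "s < m a" for a s using v[OF that] mL by auto
  obtain F \<delta> where F: "chosen_resolution R (submod L M) = (F, \<delta>)" by (rule prod.exhaust)
  obtain G \<gamma> where G: "chosen_resolution R kk = (G, \<gamma>)" by (rule prod.exhaust)
  note bF = betti_basis[OF M(2) locfin_submod[OF lf] F] and bG = betti_basis[OF kk_graded locfin_kk G]
  obtain \<epsilon> where \<epsilon>: "free_resolution R (submod L M) F \<delta> \<epsilon>" using bF(1) by (elim exE)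
  obtain \<eta> where \<eta>: "free_resolution R kk G \<gamma> \<eta>" using bG(1) by (elim exE)
  note Gr = free_resolutionD[OF \<eta>] and Fr = free_resolutionD[OF \<epsilon>]
  obtain \<theta> where \<theta>: "ghom R 0 (G 0) (regular_module R) \<theta>" "\<And>x. x \<in> carrier (G 0) \<Longrightarrow> \<eta> x = kinj (aug (\<theta> x))"
    "\<And>x. x \<in> carrier (G (Suc 0)) \<Longrightarrow> \<theta> (\<gamma> 0 x) \<in> \<mm>"
  proof (rule augmentation_lift[OF \<eta>])
    fix \<theta> assume a: "ghom R 0 (G 0) (regular_module R) \<theta>" "\<And>x. x \<in> carrier (G 0) \<Longrightarrow> \<eta> x = kinj (aug (\<theta> x))"
      "\<And>x. x \<in> carrier (G (Suc 0)) \<Longrightarrow> \<theta> (\<gamma> 0 x) \<in> \<mm>"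
    show thesis by (rule that[OF a])
  qed
  have mLM: "r \<odot>\<^bsub>L\<^esub> x \<in> M" if "r \<in> \<mm>" "x \<in> carrier L" for r x
    using ideal_times_eq(3)[OF L LL that] mL by (rule rev_subsetD)
  \<comment> \<open>One copy of the resolution of the residue field for each member of the dual systems.\<close>
  define P where "P = (SIGMA a:A. {..<m a})"
  have P: "finite P" unfolding P_def using A by simp
  have Pm: "snd p < m (fst p)" if "p \<in> P" for p using that by (auto simp: P_def)
  have "\<forall>p\<in>P. \<exists>\<phi> \<phi>'. lift_sys G \<gamma> F \<delta> (fst p) \<phi> \<phi>' \<and> (\<forall>x\<in>carrier (G 0). \<epsilon> (\<phi> 0 x) = \<theta> x \<odot>\<^bsub>L\<^esub> v (fst p) (snd p))"
  proof
    fix p assume p: "p \<in> P"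
    let ?v = "v (fst p) (snd p)"
    obtain l where l: "\<forall>i<e. l i \<in> carrier L \<inter> mgrade L (fst p - int (d i))" "?v = (\<Oplus>\<^bsub>L\<^esub>i\<in>{..<e}. X i \<odot>\<^bsub>L\<^esub> l i)"
      using ideal_times_graded(2)[OF L LL L.gcomp_carrier, of ?v "fst p"] v[OF Pm[OF p]] by (elim meta_impE conjE exE) auto
    show "\<exists>\<phi> \<phi>'. lift_sys G \<gamma> F \<delta> (fst p) \<phi> \<phi>' \<and> (\<forall>x\<in>carrier (G 0). \<epsilon> (\<phi> 0 x) = \<theta> x \<odot>\<^bsub>L\<^esub> ?v)"
      by (rule lifting_maps[where F = F and \<delta> = \<delta> and \<epsilon> = \<epsilon> and G = G and \<gamma> = \<gamma> and \<eta> = \<eta> and \<theta> = \<theta> and l = l and v = ?v and a = "fst p",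
            OF L M(2) M.subset mLM \<epsilon> \<eta> \<theta>(1,3) _ l(2)]) (use l(1) vM[OF Pm[OF p]] in simp_all)
  qed
  from bchoice[OF this] obtain \<phi> where "\<forall>p\<in>P. \<exists>\<phi>'. lift_sys G \<gamma> F \<delta> (fst p) (\<phi> p) \<phi>' \<and> (\<forall>x\<in>carrier (G 0). \<epsilon> (\<phi> p 0 x) = \<theta> x \<odot>\<^bsub>L\<^esub> v (fst p) (snd p))"
    by (elim exE)
  from bchoice[OF this] obtain \<phi>' where "\<forall>p\<in>P. lift_sys G \<gamma> F \<delta> (fst p) (\<phi> p) (\<phi>' p) \<and> (\<forall>x\<in>carrier (G 0). \<epsilon> (\<phi> p 0 x) = \<theta> x \<odot>\<^bsub>L\<^esub> v (fst p) (snd p))"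
    by (elim exE)
  then have \<phi>: "\<And>p. p \<in> P \<Longrightarrow> lift_sys G \<gamma> F \<delta> (fst p) (\<phi> p) (\<phi>' p)"
    "\<And>p x. p \<in> P \<Longrightarrow> x \<in> carrier (G 0) \<Longrightarrow> \<epsilon> (\<phi> p 0 x) = \<theta> x \<odot>\<^bsub>L\<^esub> v (fst p) (snd p)" by simp_all
  have "\<forall>p\<in>P. \<exists>\<psi> \<psi>'. proj_sys F \<delta> G \<gamma> (fst p) \<psi> \<psi>' \<and> (\<forall>x\<in>carrier (F 0). \<eta> (\<psi> 0 x) = kinj (\<pi> (fst p) (snd p) (\<epsilon> x)))"
    by (intro ballI projection_maps[OF M(2) \<epsilon> \<eta>] \<pi> Pm)
  from bchoice[OF this] obtain \<psi> where "\<forall>p\<in>P. \<exists>\<psi>'. proj_sys F \<delta> G \<gamma> (fst p) (\<psi> p) \<psi>' \<and> (\<forall>x\<in>carrier (F 0). \<eta> (\<psi> p 0 x) = kinj (\<pi> (fst p) (snd p) (\<epsilon> x)))"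
    by (elim exE)
  from bchoice[OF this] obtain \<psi>' where "\<forall>p\<in>P. proj_sys F \<delta> G \<gamma> (fst p) (\<psi> p) (\<psi>' p) \<and> (\<forall>x\<in>carrier (F 0). \<eta> (\<psi> p 0 x) = kinj (\<pi> (fst p) (snd p) (\<epsilon> x)))"
    by (elim exE)
  then have \<psi>: "\<And>p. p \<in> P \<Longrightarrow> proj_sys F \<delta> G \<gamma> (fst p) (\<psi> p) (\<psi>' p)"
    "\<And>p x. p \<in> P \<Longrightarrow> x \<in> carrier (F 0) \<Longrightarrow> \<eta> (\<psi> p 0 x) = kinj (\<pi> (fst p) (snd p) (\<epsilon> x))" by simp_all
  have pair: "\<pi> (fst p) (snd p) (v (fst q) (snd q)) = of_bool (p = q)" if p: "p \<in> P" and q: "q \<in> P" for p q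
  proof (cases "fst p = fst q")
    case True
    then show ?thesis using dual[of "snd p" "fst p" "snd q"] Pm[OF p] Pm[OF q] by (simp add: prod_eq_iff)
  next
    case False
    then have "fst q \<noteq> fst p" "p \<noteq> q" by auto
    then show ?thesis using kfun_grade[OF \<pi>[OF Pm[OF p]] conjunct2[OF vM[OF Pm[OF q]]]] by simp
  qed
  have base: "\<eta> (\<psi> p 0 (\<phi> q 0 x)) = (if p = q then \<eta> x else \<zero>\<^bsub>kk\<^esub>)"
    if p: "p \<in> P" and q: "q \<in> P" and x: "x \<in> carrier (G 0)" for p q x
  proof -
    have c: "\<phi> q 0 x \<in> carrier (F 0)" by (rule ghom_closed[OF lift_sysD(1)[OF \<phi>(1)[OF q]] x])
    have "\<eta> (\<psi> p 0 (\<phi> q 0 x)) = kinj (\<pi> (fst p) (snd p) (\<theta> x \<odot>\<^bsub>L\<^esub> v (fst q) (snd q)))"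
      using \<psi>(2)[OF p c] \<phi>(2)[OF q x] by simp
    also have "\<pi> (fst p) (snd p) (\<theta> x \<odot>\<^bsub>L\<^esub> v (fst q) (snd q)) = aug (\<theta> x) * \<pi> (fst p) (snd p) (v (fst q) (snd q))"
      using kfun_smult[OF \<pi>[OF Pm[OF p]], of "\<theta> x" "v (fst q) (snd q)"] ghom_closed[OF \<theta>(1) x] vM[OF Pm[OF q]] by simp
    finally show ?thesis using pair[OF p q] \<theta>(2)[OF x] by (simp add: kk_simps)
  qed
  have "\<forall>i. \<exists>b \<kappa>. coh_basis G \<gamma> n i (betti R \<mm> kk n i) b \<kappa>" by (intro allI bG(2))
  from choice[OF this] obtain bA where "\<forall>i. \<exists>\<kappa>. coh_basis G \<gamma> n i (betti R \<mm> kk n i) (bA i) \<kappa>" by (elim exE)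
  from choice[OF this] obtain \<kappa>A where A': "\<forall>i. coh_basis G \<gamma> n i (betti R \<mm> kk n i) (bA i) (\<kappa>A i)" by (elim exE)
  obtain b0 \<kappa>0 where B0: "coh_basis F \<delta> n j (betti R \<mm> (submod L M) n j) b0 \<kappa>0" using bF(2)[of n j] by (elim exE)
  have "\<forall>i. \<exists>b \<kappa>. coh_basis F \<delta> (n - 1) (j - int (d i)) (betti R \<mm> (submod L M) (n - 1) (j - int (d i))) b \<kappa>"
    by (intro allI bF(2))
  from choice[OF this] obtain b' where "\<forall>i. \<exists>\<kappa>. coh_basis F \<delta> (n - 1) (j - int (d i)) (betti R \<mm> (submod L M) (n - 1) (j - int (d i))) (b' i) \<kappa>"
    by (elim exE)
  from choice[OF this] obtain \<kappa>' where B: "\<forall>i. coh_basis F \<delta> (n - 1) (j - int (d i)) (betti R \<mm> (submod L M) (n - 1) (j - int (d i))) (b' i) (\<kappa>' i)"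
    by (elim exE)
  have "(\<Sum>p\<in>P. betti R \<mm> kk n (j - fst p)) \<le> betti R \<mm> (submod L M) n j +
      (if n = 0 then 0 else \<Sum>i<e. betti R \<mm> (submod L M) (n - 1) (j - int (d i)))"
    by (rule retract_dim_inequality[where a = fst and bA = "\<lambda>p. bA (j - fst p)" and \<kappa>A = "\<lambda>p. \<kappa>A (j - fst p)" and b' = b' and \<kappa>' = \<kappa>',
          OF P \<epsilon> \<eta> \<phi>(1) \<psi>(1) base _ B0])
      (use A' B in simp_all)
  moreover have "(\<Sum>p\<in>P. betti R \<mm> kk n (j - fst p)) = (\<Sum>a\<in>A. m a * betti R \<mm> kk n (j - a))"
    unfolding P_def using A by (subst sum.Sigma[symmetric, of A _ "\<lambda>a s. betti R \<mm> kk n (j - a)", unfolded case_prod_beta]) simp_all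
  moreover have "(\<Sum>a\<in>A. vectorspace.dim (class_ring :: 'k ring) (graded_part R V a) * betti R \<mm> kk n (j - a))
      \<le> (\<Sum>a\<in>A. m a * betti R \<mm> kk n (j - a))"
    by (intro sum_mono mult_right_mono dim) simp
  ultimately show ?thesis by linarith
qed

theorem tight_embedding_series_inequality:
  fixes L :: "('r, 'm) graded_module"
  assumes tight: "tight_embedding R \<mm> M L"
    and V: "V = quot_graded_module (submod L (ideal_times R \<mm> L (carrier L))) (ideal_times R \<mm> L M)"
  shows "fps_const (hilbert_series R V) * poincare_series R \<mm> kk
    \<preceq> poincare_series R \<mm> (submod L M) * (\<Prod>i<e. 1 + fps_const (fls_X ^ d i) * fps_X)"
proof -
  have L: "graded_module R L" and fg: "finitely_generated R L" and M: "LinearCombinations.submodule R M L" "graded_module R (submod L M)"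
    and mL: "ideal_times R \<mm> L (carrier L) \<subseteq> M"
    using tight unfolding tight_embedding_def graded_submodule_def by simp_all
  obtain lo where lf: "locfin lo L" using locfin_finitely_generated[OF L fg] .
  obtain F \<delta> where F: "chosen_resolution R (submod L M) = (F, \<delta>)" by (rule prod.exhaust)
  obtain G \<gamma> where G: "chosen_resolution R kk = (G, \<gamma>)" by (rule prod.exhaust)
  have PM: "fls_nth (fps_nth (poincare_series R \<mm> (submod L M)) n) j = int (betti R \<mm> (submod L M) n j)" for n j
    unfolding poincare_series_def fps_nth_Abs_fps
    by (rule nth_Abs_fls_lower_bound[of lo]) (use betti_basis(3)[OF M(2) locfin_submod[OF lf] F] in simp)
  have Pk: "fls_nth (fps_nth (poincare_series R \<mm> kk) n) j = int (betti R \<mm> kk n j)" for n j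
    unfolding poincare_series_def fps_nth_Abs_fps
    by (rule nth_Abs_fls_lower_bound[of 0]) (use betti_basis(3)[OF kk_graded locfin_kk G] in simp)
  have H: "fls_nth (hilbert_series R V) a = int (vectorspace.dim (class_ring :: 'k ring) (graded_part R V a))" for a
    unfolding hilbert_series_def
    by (rule nth_Abs_fls_lower_bound[of lo]) (use tight_coordinates(2)[OF L lf M mL] V in simp)
  show ?thesis unfolding coeffwise_le_def
  proof (intro allI)
    fix n j
    let ?P = "poincare_series R \<mm> (submod L M)"
    obtain A where A: "finite A" "fls_nth (hilbert_series R V * fps_nth (poincare_series R \<mm> kk) n) j =
        (\<Sum>a\<in>A. fls_nth (hilbert_series R V) a * fls_nth (fps_nth (poincare_series R \<mm> kk) n) (j - a))"
      by (rule fls_times_nth_finite)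
    have "fls_nth (fps_nth (fps_const (hilbert_series R V) * poincare_series R \<mm> kk) n) j =
        int (\<Sum>a\<in>A. vectorspace.dim (class_ring :: 'k ring) (graded_part R V a) * betti R \<mm> kk n (j - a))"
      using A(2) by (simp add: H Pk)
    also have "\<dots> \<le> int (betti R \<mm> (submod L M) n j + (if n = 0 then 0 else \<Sum>i<e. betti R \<mm> (submod L M) (n - 1) (j - int (d i))))"
      unfolding V by (rule of_nat_mono[OF tight_betti_inequality[OF L lf M mL A(1)]])
    also have "\<dots> = fls_nth (fps_nth ?P n) j + (if n = 0 then 0 else \<Sum>i<e. fls_nth (fps_nth ?P (n - 1)) (j - int (d i)))"
      by (simp add: PM)
    also have "\<dots> \<le> fls_nth (fps_nth (?P * (\<Prod>i<e. 1 + fps_const (fls_X ^ d i) * fps_X)) n) j"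
      by (rule poly_product_lower_bound) (simp add: PM)
    finally show "fls_nth (fps_nth (fps_const (hilbert_series R V) * poincare_series R \<mm> kk) n) j \<le>
      fls_nth (fps_nth (?P * (\<Prod>i<e. 1 + fps_const (fls_X ^ d i) * fps_X)) n) j" .
  qed
qed

end

section \<open>Quotients of connected algebras\<close>

lemma quot_algebra_sel:
  "carrier (quot_algebra S I) = carrier (S Quot I)" "monoid.mult (quot_algebra S I) = monoid.mult (S Quot I)"
  "one (quot_algebra S I) = one (S Quot I)" "zero (quot_algebra S I) = zero (S Quot I)"
  "add (quot_algebra S I) = add (S Quot I)" "rgrade (quot_algebra S I) = (\<lambda>j. (\<lambda>p. I +>\<^bsub>S\<^esub> p) ` rgrade S j)"
  "scalar (quot_algebra S I) = (\<lambda>c. I +>\<^bsub>S\<^esub> scalar S c)"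
  by (simp_all add: quot_algebra_def ring.defs graded_algebra.defs)

lemma cring_same_operations:
  fixes A :: "('a, 'x) ring_scheme" and B :: "('a, 'y) ring_scheme"
  assumes "cring A" "carrier B = carrier A" "monoid.mult B = monoid.mult A" "one B = one A" "zero B = zero A" "add B = add A"
  shows "cring B"
proof -
  interpret cring A by fact
  show ?thesis
  proof (rule cringI)
    show "abelian_group B"
    proof (rule abelian_groupI)
      show "\<exists>y\<in>carrier B. y \<oplus>\<^bsub>B\<^esub> x = \<zero>\<^bsub>B\<^esub>" if "x \<in> carrier B" for x
        using that l_neg[of x] by (intro bexI[of _ "\<ominus>\<^bsub>A\<^esub> x"]) (simp_all add: assms)
    qed (simp_all add: assms a_ac)
    show "comm_monoid B"
      by (rule comm_monoidI) (simp_all add: assms m_ac)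
  qed (simp add: assms l_distr)
qed

context connected_algebra
begin

lemma gcomp_mult_homogeneous:
  assumes "y \<in> rgrade R i" "x \<in> carrier R"
  shows "rc j (y \<otimes> x) = y \<otimes> rc (j - i) x"
proof -
  have yc: "y \<in> carrier R" using RM.mgrade_carrier[of y i] assms(1) by simp
  have g: "ghom R i (regular_module R) (regular_module R) (\<lambda>x. y \<otimes> x)"
    using ghom_smult_homogeneous[OF regular assms(1) yc ghom_id, of i] by simp
  show ?thesis using gcomp_ghom[OF regular regular g, of x "j - i"] assms(2) by simp
qed

text \<open>The elements whose components all lie in \<open>I\<close> form an ideal, which contains the homogeneous
generators.\<close>

lemma homogeneous_ideal_stable:
  assumes "homogeneous_ideal I R" "x \<in> I"
  shows "rc j x \<in> I"
proof -
  obtain H where H: "H \<subseteq> (\<Union>j. rgrade R j)" "I = genideal R H"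
    using assms(1) unfolding homogeneous_ideal_def by (elim exE conjE)
  have Hc: "H \<subseteq> carrier R" using H(1) RM.mgrade_carrier by auto
  interpret I: ideal I R unfolding H(2) by (rule R.genideal_ideal[OF Hc])
  let ?J = "{x \<in> carrier R. \<forall>j. rc j x \<in> I}"
  have mult: "\<forall>j. rc j (a \<otimes> x) \<in> I" if a: "a \<in> carrier R" and x: "x \<in> ?J" for a x
  proof -
    show ?thesis using a
    proof (induction rule: RM.homogeneous_induct)
      case zero
      show ?case using x RM.gcomp_zero I.zero_closed by simp
    next
      case (add b y i)
      have c: "y \<in> carrier R" "b \<in> carrier R" "x \<in> carrier R" using add.hyps RM.mgrade_carrier[of y i] x by simp_all
      have "rc j ((y \<oplus> b) \<otimes> x) = y \<otimes> rc (j - i) x \<oplus> rc j (b \<otimes> x)" for j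
        using c add.hyps RM.gcomp_add[of "y \<otimes> x" "b \<otimes> x" j] gcomp_mult_homogeneous[of y i x j] by (simp add: R.l_distr)
      then show ?case using add.IH x c I.I_l_closed by (simp add: I.a_closed)
    qed
  qed
  have "ideal ?J R"
  proof (rule idealI[OF R.ring_axioms])
    show "subgroup ?J (add_monoid R)"
    proof (rule R.add.subgroupI)
      have "\<zero> \<in> ?J" using RM.gcomp_zero by (simp add: I.zero_closed)
      then show "?J \<noteq> {}" by blast
      show "\<ominus> a \<in> ?J" if "a \<in> ?J" for a
        using mult[of "\<ominus> \<one>" a] that by (simp add: R.l_minus)
      show "a \<oplus> b \<in> ?J" if "a \<in> ?J" "b \<in> ?J" for a b
        using that RM.gcomp_add[of a b] by (simp add: I.a_closed)
    qed simp
    show "x \<otimes> a \<in> ?J" if "a \<in> ?J" "x \<in> carrier R" for a x using mult[OF that(2,1)] that by simp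
    then show "a \<otimes> x \<in> ?J" if "a \<in> ?J" "x \<in> carrier R" for a x using that R.m_comm[of a x] by simp
  qed
  moreover have "H \<subseteq> ?J"
  proof
    fix h assume h: "h \<in> H"
    then obtain i where i: "h \<in> rgrade R i" using H(1) by auto
    have "h \<in> I" using h R.genideal_self[OF Hc] H(2) by auto
    then show "h \<in> ?J" using h Hc RM.gcomp_homogeneous[of h i] i I.zero_closed by auto
  qed
  ultimately have "I \<subseteq> ?J" unfolding H(2) by (rule R.genideal_minimal)
  then show ?thesis using assms(2) by blast
qed

text \<open>The projections to homogeneous components pass to the quotient because \<open>I\<close> is stable under
them, and everything else is inherited along the quotient map.\<close>

theorem quotient_connected_algebra:
  assumes I: "ideal I R" and stable: "\<And>x j. x \<in> I \<Longrightarrow> rc j x \<in> I" and proper: "I \<noteq> carrier R"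
  shows "connected_algebra (quot_algebra R I) e d (\<lambda>i. I +> X i) (genideal (quot_algebra R I) ((\<lambda>i. I +> X i) ` {..<e}))"
proof -
  interpret I: ideal I R by fact
  let ?Q = "quot_algebra R I" and ?q = "\<lambda>x. I +> x"
  have cr: "cring ?Q"
    by (rule cring_same_operations[OF I.quotient_is_cring[OF R_cring]]) (simp_all add: quot_algebra_sel)
  interpret Q: cring ?Q by (rule cr)
  have car: "carrier ?Q = ?q ` carrier R" by (auto simp: quot_algebra_sel FactRing_def A_RCOSETS_def')
  have hom: "?q \<in> Ring.ring_hom R ?Q"
    using I.rcos_ring_hom by (simp add: Ring.ring_hom_def quot_algebra_sel)
  have q: "?q x \<in> carrier ?Q" "?q (x \<oplus> y) = ?q x \<oplus>\<^bsub>?Q\<^esub> ?q y" "?q (x \<otimes> y) = ?q x \<otimes>\<^bsub>?Q\<^esub> ?q y" "?q \<one> = \<one>\<^bsub>?Q\<^esub>"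
    if "x \<in> carrier R" "y \<in> carrier R" for x y
    using Ring.ring_hom_closed[OF hom] Ring.ring_hom_add[OF hom] Ring.ring_hom_mult[OF hom] Ring.ring_hom_one[OF hom] that by simp_all
  have hr: "ring_hom_ring R ?Q ?q" by (rule ring_hom_ringI2[OF R.ring_axioms Q.ring_axioms hom])
  have eq: "?q x = ?q y \<longleftrightarrow> x \<ominus> y \<in> I" if "x \<in> carrier R" "y \<in> carrier R" for x y
    using R.quotient_eq_iff_same_a_r_cos[OF I that] by (rule sym)
  have q0: "\<zero>\<^bsub>?Q\<^esub> = ?q \<zero>"
    by (simp add: quot_algebra_sel FactRing_def R.a_coset_add_zero[OF I.a_subset])
  have gr: "rgrade ?Q j = ?q ` rgrade R j" for j by (simp add: quot_algebra_sel)
  have rg: "x \<in> carrier R" if "x \<in> rgrade R j" for x j using RM.mgrade_carrier[of x j] that by simp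
  have rcc: "rc j x \<in> carrier R" "rc j x \<in> rgrade R j" if "x \<in> carrier R" for x j
    using RM.gcomp_spec(1)[of x j] rg that by simp_all
  define rep where "rep Y = (SOME x. x \<in> carrier R \<and> ?q x = Y)" for Y
  have rep: "rep Y \<in> carrier R \<and> ?q (rep Y) = Y" if Y: "Y \<in> carrier ?Q" for Y
  proof -
    obtain x where "Y = ?q x" "x \<in> carrier R" using Y unfolding car by (elim imageE)
    then have "\<exists>x. x \<in> carrier R \<and> ?q x = Y" by (intro exI[of _ x]) simp
    then show ?thesis unfolding rep_def by (rule someI_ex)
  qed
  define p where "p j Y = ?q (rc j (rep Y))" for j Y
  have pq: "p j (?q x) = ?q (rc j x)" if x: "x \<in> carrier R" for x j
  proof -
    \<comment> \<open>The value does not depend on the representative: two of them differ by an element of the ideal.\<close>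
    let ?y = "rep (?q x)"
    have y: "?y \<in> carrier R" "?q ?y = ?q x" using rep[OF q(1)[OF x x]] by simp_all
    have "?y \<ominus> x \<in> I" using eq[OF y(1) x] y(2) by blast
    from stable[OF this, of j] have "rc j (?y \<ominus> x) \<in> I" .
    moreover have "rc j (?y \<ominus> x) = rc j ?y \<ominus> rc j x"
    proof -
      have "ghom R 0 (regular_module R) (regular_module R) (\<lambda>x. \<ominus>\<^bsub>regular_module R\<^esub> x)"
        by (rule ghom_pointwise_uminus[OF regular ghom_id])
      from gcomp_ghom[OF regular regular this, of x j] have "rc j (\<ominus> x) = \<ominus> rc j x" using x by simp
      then show ?thesis using RM.gcomp_add[of ?y "\<ominus> x" j] x y by (simp add: a_minus_def)
    qed
    ultimately show ?thesis unfolding p_def using eq[OF rcc(1)[OF y(1)] rcc(1)[OF x]] by simp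
  qed
  have sumq: "(\<Oplus>\<^bsub>?Q\<^esub>j\<in>S. ?q (f j)) = ?q (\<Oplus>j\<in>S. f j)" if "\<And>j. j \<in> S \<Longrightarrow> f j \<in> carrier R" for S and f :: "int \<Rightarrow> 'r"
    using that
  proof (induction S rule: infinite_finite_induct)
    case (insert i S)
    have "(\<Oplus>\<^bsub>?Q\<^esub>j\<in>insert i S. ?q (f j)) = ?q (f i) \<oplus>\<^bsub>?Q\<^esub> (\<Oplus>\<^bsub>?Q\<^esub>j\<in>S. ?q (f j))"
      using insert q(1) by (intro Q.finsum_insert) auto
    also have "\<dots> = ?q (f i \<oplus> (\<Oplus>j\<in>S. f j))" using insert q(2)[of "f i" "\<Oplus>j\<in>S. f j"] by (simp add: R.finsum_closed)
    also have "f i \<oplus> (\<Oplus>j\<in>S. f j) = (\<Oplus>j\<in>insert i S. f j)" using insert by (intro R.finsum_insert[symmetric]) auto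
    finally show ?case .
  qed (simp_all add: q0 Q.finsum_infinite R.finsum_infinite)
  have modQ: "module ?Q (regular_module ?Q)"
  proof (rule moduleI[OF cr])
    show "abelian_group (regular_module ?Q)"
    proof (rule abelian_groupI)
      show "\<exists>y\<in>carrier (regular_module ?Q). y \<oplus>\<^bsub>regular_module ?Q\<^esub> x = \<zero>\<^bsub>regular_module ?Q\<^esub>"
        if "x \<in> carrier (regular_module ?Q)" for x
        using that Q.l_neg[of x] by (intro bexI[of _ "\<ominus>\<^bsub>?Q\<^esub> x"]) simp_all
    qed (simp_all add: Q.a_ac)
  qed (simp_all add: Q.l_distr Q.r_distr Q.m_assoc)
  interpret QM: module ?Q "regular_module ?Q" by (rule modQ)
  have "graded_module ?Q (regular_module ?Q)"
  proof (rule graded_moduleI[where p = p, OF modQ])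
    fix j
    show "subgroup (mgrade (regular_module ?Q) j) (add_monoid (regular_module ?Q))"
    proof (rule QM.M.add.subgroupI)
      show "mgrade (regular_module ?Q) j \<subseteq> carrier (regular_module ?Q)" using rg q(1) by (auto simp: gr)
      have "?q \<zero> \<in> mgrade (regular_module ?Q) j" using RM.mgrade_zero[of j] by (simp add: gr)
      then show "mgrade (regular_module ?Q) j \<noteq> {}" by (rule ex_in_conv[THEN iffD1, OF exI])
    next
      fix Y assume "Y \<in> mgrade (regular_module ?Q) j"
      then obtain x where x: "Y = ?q x" "x \<in> rgrade R j" by (auto simp: gr)
      have "\<ominus>\<^bsub>?Q\<^esub> ?q x = ?q (\<ominus> x)"
        using q(1)[of x x] q(1)[of "\<ominus> x" x] q(2)[of "\<ominus> x" x] rg[OF x(2)] by (intro Q.minus_equality) (simp_all add: q0 R.l_neg)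
      moreover have "\<ominus> x \<in> rgrade R j" using RM.mgrade_uminus[of x j] x(2) by simp
      ultimately show "\<ominus>\<^bsub>regular_module ?Q\<^esub> Y \<in> mgrade (regular_module ?Q) j" unfolding x(1) by (simp add: gr)
    next
      fix Y Z assume "Y \<in> mgrade (regular_module ?Q) j" "Z \<in> mgrade (regular_module ?Q) j"
      then obtain x z where x: "Y = ?q x" "x \<in> rgrade R j" "Z = ?q z" "z \<in> rgrade R j" by (auto simp: gr)
      have "?q (x \<oplus> z) \<in> ?q ` rgrade R j" using RM.mgrade_add[of x j z] x by (intro imageI) simp
      then show "Y \<oplus>\<^bsub>regular_module ?Q\<^esub> Z \<in> mgrade (regular_module ?Q) j" using x q(2)[OF rg rg] by (simp add: gr)
    qed
  next
    fix r x i j assume "r \<in> rgrade ?Q i" "x \<in> mgrade (regular_module ?Q) j"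
    then obtain s y where s: "r = ?q s" "s \<in> rgrade R i" "x = ?q y" "y \<in> rgrade R j" by (auto simp: gr)
    have "?q (s \<otimes> y) \<in> ?q ` rgrade R (i + j)" using RM.mgrade_smult[of s i y j] s by (intro imageI) simp
    then show "r \<odot>\<^bsub>regular_module ?Q\<^esub> x \<in> mgrade (regular_module ?Q) (i + j)" using s q(3)[OF rg rg] by (simp add: gr)
  next
    fix x j assume "x \<in> carrier (regular_module ?Q)"
    then show "p j x \<in> mgrade (regular_module ?Q) j" using rep rcc(2) by (simp add: p_def gr)
  next
    fix x y j assume "x \<in> carrier (regular_module ?Q)" "y \<in> carrier (regular_module ?Q)"
    then obtain a b where a: "x = ?q a" "a \<in> carrier R" "y = ?q b" "b \<in> carrier R" by (auto simp: car)
    show "p j (x \<oplus>\<^bsub>regular_module ?Q\<^esub> y) = p j x \<oplus>\<^bsub>regular_module ?Q\<^esub> p j y"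
      using a q(2)[of a b] pq[of "a \<oplus> b" j] RM.gcomp_add[of a b j] q(2)[OF rcc(1) rcc(1), of a b j j] by (simp add: pq)
  next
    fix x i j assume "x \<in> mgrade (regular_module ?Q) i"
    then obtain a where a: "x = ?q a" "a \<in> rgrade R i" by (auto simp: gr)
    show "p j x = (if j = i then x else \<zero>\<^bsub>regular_module ?Q\<^esub>)"
      using a pq[OF rg[OF a(2)], of j] RM.gcomp_homogeneous[of a i j] by (simp add: q0)
  next
    fix x assume "x \<in> carrier (regular_module ?Q)"
    then obtain a where a: "x = ?q a" "a \<in> carrier R" by (auto simp: car)
    let ?S = "{j. rc j a \<noteq> \<zero>}"
    have S: "finite ?S" "a = (\<Oplus>j\<in>?S. rc j a)" using RM.gcomp_spec(2,3)[of a] a(2) by simp_all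
    have "x = (\<Oplus>\<^bsub>?Q\<^esub>j\<in>?S. p j x)"
    proof -
      have "(\<Oplus>\<^bsub>?Q\<^esub>j\<in>?S. p j x) = (\<Oplus>\<^bsub>?Q\<^esub>j\<in>?S. ?q (rc j a))" unfolding a(1) by (simp only: pq[OF a(2)])
      also have "\<dots> = ?q (\<Oplus>j\<in>?S. rc j a)" by (rule sumq) (rule rcc(1)[OF a(2)])
      also have "\<dots> = x" unfolding a(1) by (simp only: S(2)[symmetric])
      finally show ?thesis by (rule sym)
    qed
    moreover have "p j x = \<zero>\<^bsub>?Q\<^esub>" if "j \<notin> ?S" for j
    proof -
      have "rc j a = \<zero>" using that by simp
      then show ?thesis unfolding a(1) pq[OF a(2)] q0 by (rule arg_cong)
    qed
    ultimately show "\<exists>S. finite S \<and> (\<forall>j. j \<notin> S \<longrightarrow> p j x = \<zero>\<^bsub>regular_module ?Q\<^esub>) \<and> x = (\<Oplus>\<^bsub>regular_module ?Q\<^esub>j\<in>S. p j x)"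
      unfolding regular_module_simps finsum_regular_module using S(1) by (intro exI[of _ ?S] conjI allI impI)
  qed
  note gQ = this
  show ?thesis
  proof (rule connected_algebra.intro[OF cr gQ])
    show "\<one>\<^bsub>?Q\<^esub> \<noteq> \<zero>\<^bsub>?Q\<^esub>"
    proof
      assume "\<one>\<^bsub>?Q\<^esub> = \<zero>\<^bsub>?Q\<^esub>"
      then have "?q \<one> = ?q \<zero>" unfolding q0 q(4)[OF R.one_closed R.one_closed] .
      then have "\<one> \<ominus> \<zero> \<in> I" using eq[OF R.one_closed R.zero_closed] by (rule iffD1[rotated])
      moreover have "\<one> \<ominus> \<zero> = \<one>" by (simp add: a_minus_def)
      ultimately have "\<one> \<in> I" by (simp only:)
      then show False using I.one_imp_carrier proper by blast
    qed
    show "scalar ?Q (a + b) = scalar ?Q a \<oplus>\<^bsub>?Q\<^esub> scalar ?Q b" for a b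
      unfolding quot_algebra_sel(7) scalar_add by (rule q(2)[OF scalar_carrier scalar_carrier])
    show "scalar ?Q (a * b) = scalar ?Q a \<otimes>\<^bsub>?Q\<^esub> scalar ?Q b" for a b
      unfolding quot_algebra_sel(7) scalar_mult by (rule q(3)[OF scalar_carrier scalar_carrier])
    show "scalar ?Q 1 = \<one>\<^bsub>?Q\<^esub>" unfolding quot_algebra_sel(7) scalar_one by (rule q(4)[OF R.one_closed R.one_closed])
    show "rgrade ?Q 0 = range (scalar ?Q)" by (simp add: quot_algebra_sel(6,7) rgrade_0 image_image)
    show "rgrade ?Q j \<subseteq> {\<zero>\<^bsub>?Q\<^esub>}" if "j < 0" for j unfolding gr q0 by (rule image_subsetI) (use rgrade_neg[OF that] in \<open>auto intro: arg_cong\<close>)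
    show "?q (X i) \<in> rgrade ?Q (int (d i))" if "i < e" for i using X_grade[OF that] by (simp add: gr)
    show "1 \<le> d i" if "i < e" for i by (rule d_pos[OF that])
    show "fin_graded_part ?Q (regular_module ?Q) j" for j
    proof (rule fin_graded_part_quotient(1)[where S = R and Z = "regular_module R" and i = j and q = ?q])
      interpret V: vectorspace "class_ring :: 'k ring" "graded_part R (regular_module R) j"
        by (rule graded_part_vectorspace[OF regular])
      have H: "x \<in> carrier R" if "x \<in> carrier (graded_part R (regular_module R) j)" for x
        using that rg by (simp add: graded_part_def)
      have W: "carrier (graded_part ?Q (regular_module ?Q) j) = ?q ` carrier (graded_part R (regular_module R) j)"
        by (simp add: graded_part_def gr)
      show "linear_quotient (graded_part R (regular_module R) j) (graded_part ?Q (regular_module ?Q) j) ?q"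
      proof (unfold_locales, goal_cases)
        case (1 x)
        then show ?case unfolding W by (rule imageI)
      next
        case (2 w)
        then show ?case unfolding W by (elim imageE) (rule bexI, rule sym)
      next
        case (3 x y)
        show ?case using q(2)[OF H[OF 3(1)] H[OF 3(2)]] by (simp only: graded_part_def regular_module_simps partial_object.simps monoid.simps ring.simps module.simps)
      next
        case (4 x c)
        show ?case using q(3)[OF scalar_carrier H[OF 4], of c]
          by (simp only: graded_part_def regular_module_simps quot_algebra_sel(7) partial_object.simps monoid.simps ring.simps module.simps)
      next
        case 5
        show ?case using q0[symmetric] by (simp only: graded_part_def regular_module_simps partial_object.simps monoid.simps ring.simps module.simps)
      qed
    qed (rule rgrade_fin)
    show "rgrade ?Q j \<subseteq> genideal ?Q ((\<lambda>i. ?q (X i)) ` {..<e})" if j: "0 < j" for j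
    proof -
      let ?m = "genideal ?Q ((\<lambda>i. ?q (X i)) ` {..<e})"
      have sub: "(\<lambda>i. ?q (X i)) ` {..<e} \<subseteq> carrier ?Q" using q(1) X_carrier by auto
      have "ideal {r \<in> carrier R. ?q r \<in> ?m} R"
        by (rule ring_hom_ring.ideal_vimage[OF hr Q.genideal_ideal[OF sub]])
      moreover have "X ` {..<e} \<subseteq> {r \<in> carrier R. ?q r \<in> ?m}"
      proof (rule image_subsetI)
        fix i assume i: "i \<in> {..<e}"
        have "?q (X i) \<in> ?m" by (rule subsetD[OF Q.genideal_self[OF sub]]) (rule imageI[OF i])
        then show "X i \<in> {r \<in> carrier R. ?q r \<in> ?m}" using X_carrier i by simp
      qed
      ultimately have "\<mm> \<subseteq> {r \<in> carrier R. ?q r \<in> ?m}" unfolding \<mm>_def by (rule R.genideal_minimal)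
      then show ?thesis unfolding gr using rgrade_pos[OF j] by (intro image_subsetI) (drule subsetD, assumption, drule subsetD, assumption, elim CollectE conjE)
    qed
  qed simp
qed

end

section \<open>Polynomial rings\<close>

lemma wdegree_superset:
  "finite A \<Longrightarrow> Poly_Mapping.keys m \<subseteq> A \<Longrightarrow> wdegree d m = (\<Sum>i\<in>A. Poly_Mapping.lookup m i * d i)"
  unfolding wdegree_def by (intro sum.mono_neutral_left) (auto simp: in_keys_iff)

lemma wdegree_add: "wdegree d (a + b) = wdegree d a + wdegree d b"
proof -
  let ?A = "Poly_Mapping.keys a \<union> Poly_Mapping.keys b"
  have "wdegree d (a + b) = (\<Sum>i\<in>?A. Poly_Mapping.lookup (a + b) i * d i)"
    by (rule wdegree_superset) (simp, rule Poly_Mapping.keys_add)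
  then show ?thesis
    by (simp add: wdegree_superset[of ?A a] wdegree_superset[of ?A b] lookup_add ring_distribs sum.distrib)
qed

lemma wdegree_single [simp]: "wdegree d (Poly_Mapping.single i n) = n * d i"
  by (simp add: wdegree_def)

lemma wdegree_pos:
  assumes "\<And>i. i < e \<Longrightarrow> 1 \<le> d i" "Poly_Mapping.keys m \<subseteq> {..<e}" "i \<in> Poly_Mapping.keys m"
  shows "Poly_Mapping.lookup m i \<le> wdegree d m" "0 < wdegree d m"
proof -
  have "1 \<le> d i" using assms by auto
  then have "Poly_Mapping.lookup m i \<le> Poly_Mapping.lookup m i * d i" by simp
  also have "\<dots> \<le> wdegree d m" unfolding wdegree_def by (rule member_le_sum) (use assms(3) in auto)
  finally show "Poly_Mapping.lookup m i \<le> wdegree d m" .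
  then show "0 < wdegree d m" using assms(3) by (simp add: in_keys_iff)
qed

text \<open>As every variable has positive degree, the exponents are bounded by the weight.\<close>

lemma finite_monomials_of_weight:
  assumes "\<And>i. i < e \<Longrightarrow> 1 \<le> d i"
  shows "finite {m. Poly_Mapping.keys m \<subseteq> {..<e} \<and> int (wdegree d m) = j}" (is "finite ?S")
proof -
  let ?F = "{f. \<forall>i. (i \<in> {..<e} \<longrightarrow> f i \<in> {..nat j}) \<and> (i \<notin> {..<e} \<longrightarrow> f i = (0::nat))}"
  have "Poly_Mapping.lookup ` ?S \<subseteq> ?F"
  proof (intro subsetI CollectI allI conjI impI)
    fix f i assume "f \<in> Poly_Mapping.lookup ` ?S"
    then obtain m where m: "f = Poly_Mapping.lookup m" "Poly_Mapping.keys m \<subseteq> {..<e}" "int (wdegree d m) = j" by auto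
    show "f i \<in> {..nat j}"
    proof (cases "i \<in> Poly_Mapping.keys m")
      case True
      then show ?thesis using wdegree_pos(1)[of e d m i] assms m True by simp
    next
      case False
      then have "Poly_Mapping.lookup m i = 0" by (simp add: in_keys_iff)
      then show ?thesis using m(1) by simp
    qed
    show "f i = 0" if "i \<notin> {..<e}" using m that by (auto simp: in_keys_iff)
  qed
  moreover have "finite ?F" by (rule finite_set_of_finite_funs) simp_all
  ultimately have "finite (Poly_Mapping.lookup ` ?S)" by (rule finite_subset)
  then show ?thesis by (rule finite_imageD) (simp add: inj_on_def)
qed

definition wpart :: "(nat \<Rightarrow> nat) \<Rightarrow> int \<Rightarrow> ((nat \<Rightarrow>\<^sub>0 nat) \<Rightarrow>\<^sub>0 'k::field) \<Rightarrow> ((nat \<Rightarrow>\<^sub>0 nat) \<Rightarrow>\<^sub>0 'k)"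
  where "wpart d j p = Poly_Mapping.Abs_poly_mapping (\<lambda>m. if int (wdegree d m) = j then Poly_Mapping.lookup p m else 0)"

lemma lookup_wpart: "Poly_Mapping.lookup (wpart d j p) m = (if int (wdegree d m) = j then Poly_Mapping.lookup p m else 0)"
proof -
  have "finite {m. (if int (wdegree d m) = j then Poly_Mapping.lookup p m else 0) \<noteq> 0}"
    by (rule finite_subset[OF _ finite_lookup[of p]]) auto
  then show ?thesis unfolding wpart_def by simp
qed

lemma keys_wpart: "Poly_Mapping.keys (wpart d j p) = {m \<in> Poly_Mapping.keys p. int (wdegree d m) = j}"
  by (auto simp: in_keys_iff lookup_wpart split: if_splits)

lemma poly_algebra_sel [simp]:
  "p \<in> carrier (poly_algebra e d) \<longleftrightarrow> (\<forall>m\<in>Poly_Mapping.keys p. Poly_Mapping.keys m \<subseteq> {..<e})"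
  "monoid.mult (poly_algebra e d) = (*)" "one (poly_algebra e d) = 1" "zero (poly_algebra e d) = 0" "add (poly_algebra e d) = (+)"
  "p \<in> rgrade (poly_algebra e d) j \<longleftrightarrow> (\<forall>m\<in>Poly_Mapping.keys p. Poly_Mapping.keys m \<subseteq> {..<e} \<and> int (wdegree d m) = j)"
  "scalar (poly_algebra e d) = Poly_Mapping.single 0"
  by (simp_all add: poly_algebra_def)

lemma keys_mult_closed:
  assumes "m \<in> Poly_Mapping.keys (p * q)"
  obtains a b where "a \<in> Poly_Mapping.keys p" "b \<in> Poly_Mapping.keys q" "m = a + b"
  using assms Poly_Mapping.keys_mult[of p q] by blast

lemma poly_algebra_mult_closed:
  assumes "\<forall>m\<in>Poly_Mapping.keys p. Poly_Mapping.keys m \<subseteq> {..<e}" "\<forall>m\<in>Poly_Mapping.keys q. Poly_Mapping.keys m \<subseteq> {..<e}"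
    and "m \<in> Poly_Mapping.keys (p * q)"
  shows "Poly_Mapping.keys m \<subseteq> {..<(e::nat)}"
proof -
  obtain a b where ab: "a \<in> Poly_Mapping.keys p" "b \<in> Poly_Mapping.keys q" "m = a + b" using assms(3) by (rule keys_mult_closed)
  have "Poly_Mapping.keys m \<subseteq> Poly_Mapping.keys a \<union> Poly_Mapping.keys b" unfolding ab(3) by (rule Poly_Mapping.keys_add)
  also have "\<dots> \<subseteq> {..<e}" using assms(1,2) ab(1,2) by (intro Un_least) simp_all
  finally show ?thesis .
qed

lemma poly_algebra_add_closed:
  assumes "\<forall>m\<in>Poly_Mapping.keys p. P m" "\<forall>m\<in>Poly_Mapping.keys q. P m"
  shows "\<forall>m\<in>Poly_Mapping.keys (p + q). P m"
proof
  fix m assume "m \<in> Poly_Mapping.keys (p + q)"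
  then have "m \<in> Poly_Mapping.keys p \<union> Poly_Mapping.keys q" by (rule subsetD[OF Poly_Mapping.keys_add])
  then show "P m" using assms by (elim UnE) simp_all
qed

lemma sum_of_monomials: "(\<Sum>m\<in>Poly_Mapping.keys p. Poly_Mapping.single m (Poly_Mapping.lookup p m)) = p"
proof (rule poly_mapping_eqI)
  fix k
  have "Poly_Mapping.lookup (\<Sum>m\<in>Poly_Mapping.keys p. Poly_Mapping.single m (Poly_Mapping.lookup p m)) k =
      (\<Sum>m\<in>Poly_Mapping.keys p. if m = k then Poly_Mapping.lookup p m else 0)"
    by (simp add: lookup_sum lookup_single when_def)
  also have "\<dots> = Poly_Mapping.lookup p k" by (simp add: in_keys_iff)
  finally show "Poly_Mapping.lookup (\<Sum>m\<in>Poly_Mapping.keys p. Poly_Mapping.single m (Poly_Mapping.lookup p m)) k = Poly_Mapping.lookup p k" .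
qed

lemma poly_algebra_cring: "cring (poly_algebra e d :: ((nat \<Rightarrow>\<^sub>0 nat) \<Rightarrow>\<^sub>0 'k::field, 'k) graded_algebra)"
proof (rule cringI)
  show "abelian_group (poly_algebra e d :: ((nat \<Rightarrow>\<^sub>0 nat) \<Rightarrow>\<^sub>0 'k, 'k) graded_algebra)"
  proof (rule abelian_groupI)
    show "\<exists>y\<in>carrier (poly_algebra e d). y \<oplus>\<^bsub>poly_algebra e d\<^esub> x = \<zero>\<^bsub>poly_algebra e d\<^esub>"
      if "x \<in> carrier (poly_algebra e d)" for x :: "(nat \<Rightarrow>\<^sub>0 nat) \<Rightarrow>\<^sub>0 'k"
      using that by (intro bexI[of _ "- x"]) simp_all
    show "x \<oplus>\<^bsub>poly_algebra e d\<^esub> y \<in> carrier (poly_algebra e d)"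
      if "x \<in> carrier (poly_algebra e d)" "y \<in> carrier (poly_algebra e d)" for x y :: "(nat \<Rightarrow>\<^sub>0 nat) \<Rightarrow>\<^sub>0 'k"
      unfolding poly_algebra_sel by (rule poly_algebra_add_closed) (use that in simp_all)
  qed (simp_all add: add_ac)
  show "comm_monoid (poly_algebra e d :: ((nat \<Rightarrow>\<^sub>0 nat) \<Rightarrow>\<^sub>0 'k, 'k) graded_algebra)"
  proof (rule comm_monoidI)
    show "x \<otimes>\<^bsub>poly_algebra e d\<^esub> y \<in> carrier (poly_algebra e d)"
      if "x \<in> carrier (poly_algebra e d)" "y \<in> carrier (poly_algebra e d)" for x y :: "(nat \<Rightarrow>\<^sub>0 nat) \<Rightarrow>\<^sub>0 'k"
      unfolding poly_algebra_sel by (rule ballI, rule poly_algebra_mult_closed[of x e y]) (use that in simp_all)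
  qed (simp_all add: mult_ac)
qed (simp add: ring_distribs)

lemma lookup_scalar_mult: "Poly_Mapping.lookup (Poly_Mapping.single 0 c * p) m = c * Poly_Mapping.lookup p m"
  for p :: "(nat \<Rightarrow>\<^sub>0 nat) \<Rightarrow>\<^sub>0 'k::field"
proof -
  have "Poly_Mapping.lookup (Poly_Mapping.map ((*) c) p) m = c * Poly_Mapping.lookup p m"
    by (simp add: Poly_Mapping.map.rep_eq when_def)
  then show ?thesis by (simp add: mult_map_scale_conv_mult)
qed

text \<open>Coefficients of monomials separate polynomials, and there are finitely many monomials of given
weight. A monomial of positive weight is a multiple of a variable.\<close>

theorem poly_algebra_connected:
  assumes d: "\<And>i. i < e \<Longrightarrow> 1 \<le> d i"
  shows "connected_algebra (poly_algebra e d :: ((nat \<Rightarrow>\<^sub>0 nat) \<Rightarrow>\<^sub>0 'k::field, 'k) graded_algebra) e d poly_var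
    (genideal (poly_algebra e d) (poly_var ` {..<e}))"
proof -
  let ?S = "poly_algebra e d :: ((nat \<Rightarrow>\<^sub>0 nat) \<Rightarrow>\<^sub>0 'k, 'k) graded_algebra"
  let ?m = "genideal ?S (poly_var ` {..<e})"
  have cr: "cring ?S" by (rule poly_algebra_cring)
  interpret S: cring ?S by (rule cr)
  have modS: "module ?S (regular_module ?S)"
  proof (rule moduleI[OF cr])
    show "abelian_group (regular_module ?S)"
    proof (rule abelian_groupI)
      show "\<exists>y\<in>carrier (regular_module ?S). y \<oplus>\<^bsub>regular_module ?S\<^esub> x = \<zero>\<^bsub>regular_module ?S\<^esub>"
        if "x \<in> carrier (regular_module ?S)" for x
        using that by (intro bexI[of _ "- x"]) simp_all
      show "x \<oplus>\<^bsub>regular_module ?S\<^esub> y \<in> carrier (regular_module ?S)"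
        if "x \<in> carrier (regular_module ?S)" "y \<in> carrier (regular_module ?S)" for x y
        using S.a_closed[of x y] that by (simp only: regular_module_simps)
    qed (simp_all add: add_ac)
    show "r \<odot>\<^bsub>regular_module ?S\<^esub> x \<in> carrier (regular_module ?S)"
      if "r \<in> carrier ?S" "x \<in> carrier (regular_module ?S)" for r x
      using S.m_closed[of r x] that by (simp only: regular_module_simps)
  qed (simp_all add: ring_distribs mult_ac)
  interpret SM: module ?S "regular_module ?S" by (rule modS)
  have inv_eq: "\<ominus>\<^bsub>regular_module ?S\<^esub> x = - x" if "x \<in> carrier ?S" for x
    by (rule SM.M.minus_equality) (use that in simp_all)
  have fs: "finsum (regular_module ?S) f B = sum f B" if "finite B" "\<And>j. j \<in> B \<Longrightarrow> f j \<in> carrier ?S" for f and B :: "int set"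
    using that
  proof (induction B rule: finite_induct)
    case (insert j B)
    have IH: "finsum (regular_module ?S) f B = sum f B"
      by (rule insert.IH) (rule insert.prems, rule insertI2)
    have "finsum (regular_module ?S) f (insert j B) = f j \<oplus>\<^bsub>regular_module ?S\<^esub> finsum (regular_module ?S) f B"
    proof (rule SM.M.finsum_insert[OF insert.hyps])
      show "f \<in> B \<rightarrow> carrier (regular_module ?S)" unfolding regular_module_simps by (intro Pi_I insert.prems insertI2)
      show "f j \<in> carrier (regular_module ?S)" unfolding regular_module_simps by (rule insert.prems) (rule insertI1)
    qed
    also have "\<dots> = f j + sum f B" unfolding IH by simp
    also have "\<dots> = sum f (insert j B)" using insert.hyps by simp
    finally show ?case .
  next
    case empty
    have "finsum (regular_module ?S) f {} = \<zero>\<^bsub>regular_module ?S\<^esub>" by (rule SM.M.finsum_empty)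
    then show ?case by simp
  qed
  have gS: "graded_module ?S (regular_module ?S)"
  proof (rule graded_moduleI[where p = "wpart d", OF modS])
    fix j
    show "subgroup (mgrade (regular_module ?S) j) (add_monoid (regular_module ?S))"
    proof (rule SM.M.add.subgroupI)
      show "mgrade (regular_module ?S) j \<subseteq> carrier (regular_module ?S)" by (rule subsetI) simp
      have "0 \<in> mgrade (regular_module ?S) j" by simp
      then show "mgrade (regular_module ?S) j \<noteq> {}" by (rule ex_in_conv[THEN iffD1, OF exI])
      show "\<ominus>\<^bsub>regular_module ?S\<^esub> a \<in> mgrade (regular_module ?S) j" if a: "a \<in> mgrade (regular_module ?S) j" for a
      proof -
        have "a \<in> carrier ?S" using a by simp
        from inv_eq[OF this] show ?thesis using a by simp
      qed
      show "a \<oplus>\<^bsub>regular_module ?S\<^esub> b \<in> mgrade (regular_module ?S) j"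
        if "a \<in> mgrade (regular_module ?S) j" "b \<in> mgrade (regular_module ?S) j" for a b
        unfolding regular_module_simps poly_algebra_sel by (rule poly_algebra_add_closed) (use that in simp_all)
    qed
  next
    fix r x :: "(nat \<Rightarrow>\<^sub>0 nat) \<Rightarrow>\<^sub>0 'k" and i j
    assume r: "r \<in> rgrade ?S i" and x: "x \<in> mgrade (regular_module ?S) j"
    have "int (wdegree d m) = i + j" if m: "m \<in> Poly_Mapping.keys (r * x)" for m
    proof -
      obtain a b where ab: "a \<in> Poly_Mapping.keys r" "b \<in> Poly_Mapping.keys x" "m = a + b" using m by (rule keys_mult_closed)
      then have "int (wdegree d a) = i" "int (wdegree d b) = j" using r x by simp_all
      then show ?thesis unfolding ab(3) by (simp add: wdegree_add)
    qed
    moreover have "Poly_Mapping.keys m \<subseteq> {..<e}" if "m \<in> Poly_Mapping.keys (r * x)" for m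
      by (rule poly_algebra_mult_closed[OF _ _ that]) (use r x in simp_all)
    ultimately show "r \<odot>\<^bsub>regular_module ?S\<^esub> x \<in> mgrade (regular_module ?S) (i + j)" by simp
  next
    fix x j assume "x \<in> carrier (regular_module ?S)"
    then show "wpart d j x \<in> mgrade (regular_module ?S) j" by (simp add: keys_wpart)
  next
    fix x y j assume "x \<in> carrier (regular_module ?S)" "y \<in> carrier (regular_module ?S)"
    show "wpart d j (x \<oplus>\<^bsub>regular_module ?S\<^esub> y) = wpart d j x \<oplus>\<^bsub>regular_module ?S\<^esub> wpart d j y"
      by (rule poly_mapping_eqI) (simp add: lookup_wpart lookup_add)
  next
    fix x i j assume x: "x \<in> mgrade (regular_module ?S) i"
    have "wpart d j x = (if j = i then x else 0)"
      by (rule poly_mapping_eqI) (use x in \<open>auto simp: lookup_wpart in_keys_iff\<close>)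
    then show "wpart d j x = (if j = i then x else \<zero>\<^bsub>regular_module ?S\<^esub>)" by simp
  next
    fix x assume x: "x \<in> carrier (regular_module ?S)"
    let ?B = "(\<lambda>m. int (wdegree d m)) ` Poly_Mapping.keys x"
    have w0: "wpart d j x = 0" if "j \<notin> ?B" for j
      by (rule poly_mapping_eqI) (use that in \<open>auto simp: lookup_wpart in_keys_iff\<close>)
    have "x = (\<Sum>j\<in>?B. wpart d j x)"
    proof (rule poly_mapping_eqI)
      fix m
      have "Poly_Mapping.lookup (\<Sum>j\<in>?B. wpart d j x) m = (\<Sum>j\<in>?B. if int (wdegree d m) = j then Poly_Mapping.lookup x m else 0)"
        by (simp add: lookup_sum lookup_wpart)
      also have "\<dots> = (if int (wdegree d m) \<in> ?B then Poly_Mapping.lookup x m else 0)" by (rule sum.delta') simp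
      also have "\<dots> = Poly_Mapping.lookup x m" by (auto simp: in_keys_iff image_iff)
      finally show "Poly_Mapping.lookup x m = Poly_Mapping.lookup (\<Sum>j\<in>?B. wpart d j x) m" by (rule sym)
    qed
    moreover have "finsum (regular_module ?S) (\<lambda>j. wpart d j x) ?B = (\<Sum>j\<in>?B. wpart d j x)"
      by (rule fs) (use x in \<open>simp_all add: keys_wpart\<close>)
    ultimately show "\<exists>B. finite B \<and> (\<forall>j. j \<notin> B \<longrightarrow> wpart d j x = \<zero>\<^bsub>regular_module ?S\<^esub>) \<and>
        x = (\<Oplus>\<^bsub>regular_module ?S\<^esub>j\<in>B. wpart d j x)"
      using w0 by (intro exI[of _ ?B] conjI) simp_all
  qed
  have var: "poly_var ` {..<e} \<subseteq> carrier ?S" by (auto simp: poly_var_def)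
  interpret m: ideal ?m ?S by (rule S.genideal_ideal[OF var])
  have varm: "poly_var i \<in> ?m" if "i < e" for i using subsetD[OF S.genideal_self[OF var]] that by auto
  show ?thesis
  proof (rule connected_algebra.intro[OF cr gS])
    show "\<one>\<^bsub>?S\<^esub> \<noteq> \<zero>\<^bsub>?S\<^esub>" by simp
    show "scalar ?S (a + b) = scalar ?S a \<oplus>\<^bsub>?S\<^esub> scalar ?S b" for a b by (simp add: single_add)
    show "scalar ?S (a * b) = scalar ?S a \<otimes>\<^bsub>?S\<^esub> scalar ?S b" for a b by (simp add: mult_single)
    show "scalar ?S 1 = \<one>\<^bsub>?S\<^esub>" by simp
    show "rgrade ?S 0 = range (scalar ?S)"
    proof (intro equalityI subsetI)
      fix p assume p: "p \<in> rgrade ?S 0"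
      have m0: "m = 0" if m: "m \<in> Poly_Mapping.keys p" for m
      proof -
        have k: "Poly_Mapping.keys m \<subseteq> {..<e}" "wdegree d m = 0" using p m by auto
        have "Poly_Mapping.keys m = {}" using wdegree_pos(2)[of e d m] d k by fastforce
        then show ?thesis by simp
      qed
      have "p = Poly_Mapping.single 0 (Poly_Mapping.lookup p 0)"
        by (rule poly_mapping_eqI) (use m0 in \<open>auto simp: lookup_single when_def in_keys_iff\<close>)
      then show "p \<in> range (scalar ?S)" by auto
    next
      fix p assume "p \<in> range (scalar ?S)"
      then obtain c where "p = Poly_Mapping.single 0 c" by auto
      then show "p \<in> rgrade ?S 0" by (cases "c = 0") (simp_all add: wdegree_def)
    qed
    show "rgrade ?S j \<subseteq> {\<zero>\<^bsub>?S\<^esub>}" if j: "j < 0" for j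
    proof
      fix p assume p: "p \<in> rgrade ?S j"
      have "Poly_Mapping.keys p = {}"
      proof (rule ccontr)
        assume "Poly_Mapping.keys p \<noteq> {}"
        then obtain m where "m \<in> Poly_Mapping.keys p" by blast
        then have "int (wdegree d m) = j" using p by simp
        then show False using j by simp
      qed
      then show "p \<in> {\<zero>\<^bsub>?S\<^esub>}" by simp
    qed
    show "fin_graded_part ?S (regular_module ?S) j" for j
      unfolding fin_graded_part_def
    proof (intro exI conjI)
      let ?B = "{m. Poly_Mapping.keys m \<subseteq> {..<e} \<and> int (wdegree d m) = j}"
      show "finite ((\<lambda>m p. Poly_Mapping.lookup p m) ` ?B)" by (rule finite_imageI, rule finite_monomials_of_weight, erule d)
      show "\<forall>\<kappa>\<in>(\<lambda>m p. Poly_Mapping.lookup p m) ` ?B. lin_functional (graded_part ?S (regular_module ?S) j) \<kappa>"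
        by (auto simp: lin_functional_def graded_part_def lookup_add lookup_scalar_mult)
      show "\<forall>x\<in>mgrade (regular_module ?S) j. (\<forall>\<kappa>\<in>(\<lambda>m p. Poly_Mapping.lookup p m) ` ?B. \<kappa> x = 0) \<longrightarrow> x = \<zero>\<^bsub>regular_module ?S\<^esub>"
      proof (intro ballI impI)
        fix x assume x: "x \<in> mgrade (regular_module ?S) j" "\<forall>\<kappa>\<in>(\<lambda>m p. Poly_Mapping.lookup p m) ` ?B. \<kappa> x = 0"
        have "x = 0"
        proof (rule poly_mapping_eqI)
          fix m
          show "Poly_Mapping.lookup x m = Poly_Mapping.lookup 0 m"
          proof (cases "m \<in> Poly_Mapping.keys x")
            case True
            then have "m \<in> ?B" using x(1) by simp
            then show ?thesis using x(2) by simp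
          qed (simp add: in_keys_iff)
        qed
        then show "x = \<zero>\<^bsub>regular_module ?S\<^esub>" by simp
      qed
    qed
    show "poly_var i \<in> rgrade ?S (int (d i))" if "i < e" for i using that by (simp add: poly_var_def)
    show "1 \<le> d i" if "i < e" for i by (rule d[OF that])
    show "rgrade ?S j \<subseteq> ?m" if j: "0 < j" for j
    proof
      fix p assume p: "p \<in> rgrade ?S j"
      have mono: "Poly_Mapping.single m c \<in> ?m" if m: "m \<in> Poly_Mapping.keys p" for m c
      proof -
        have k: "Poly_Mapping.keys m \<subseteq> {..<e}" "0 < wdegree d m" using p m j by auto
        then have "Poly_Mapping.keys m \<noteq> {}" by (auto simp: wdegree_def)
        then obtain i where i: "i \<in> Poly_Mapping.keys m" by blast
        let ?m' = "m - Poly_Mapping.single i 1"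
        have split: "m = Poly_Mapping.single i 1 + ?m'"
          by (rule poly_mapping_eqI) (use i in \<open>auto simp: lookup_add lookup_minus lookup_single when_def in_keys_iff\<close>)
        have "Poly_Mapping.keys ?m' \<subseteq> {..<e}"
          using k(1) by (auto simp: lookup_minus in_keys_iff subset_iff)
        then have c: "Poly_Mapping.single ?m' c \<in> carrier ?S" by simp
        have "Poly_Mapping.single m c = poly_var i * Poly_Mapping.single ?m' c"
          unfolding poly_var_def mult_single using split by simp
        then show ?thesis using m.I_r_closed[OF varm c, of i] i k(1) by auto
      qed
      have "(\<Sum>m\<in>B. Poly_Mapping.single m (Poly_Mapping.lookup p m)) \<in> ?m"
        if "finite B" "B \<subseteq> Poly_Mapping.keys p" for B
        using that
      proof (induction B rule: finite_induct)
        case empty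
        then show ?case using m.zero_closed by simp
      next
        case (insert a B)
        then show ?case using m.a_closed[OF mono[of a "Poly_Mapping.lookup p a"] insert.IH] by simp
      qed
      from this[OF finite_keys subset_refl] show "p \<in> ?m" by (simp only: sum_of_monomials)
    qed
  qed simp
qed

theorem theorem1p8:
  fixes e :: nat
    and d :: "nat \<Rightarrow> nat"
    and I :: "((nat \<Rightarrow>\<^sub>0 nat) \<Rightarrow>\<^sub>0 'k::field) set"
    and L :: "(((nat \<Rightarrow>\<^sub>0 nat) \<Rightarrow>\<^sub>0 'k) set, 'm) graded_module"
    and M :: "'m set"
  assumes deg_pos: "\<And>i. i < e \<Longrightarrow> 1 \<le> d i"
    and homogeneous: "homogeneous_ideal I (poly_algebra e d)"
    and proper: "I \<noteq> carrier (poly_algebra e d)"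
    and R: "R = quot_algebra (poly_algebra e d) I"
    and \<mm>: "\<mm> = irrelevant_ideal e d I"
    and tight: "tight_embedding R \<mm> M L"
    and V: "V = quot_graded_module (submod L (ideal_times R \<mm> L (carrier L))) (ideal_times R \<mm> L M)"
  shows "fps_const (hilbert_series R V) * poincare_series R \<mm> (quot_graded_module (regular_module R) \<mm>)
         \<preceq> poincare_series R \<mm> (submod L M) * (\<Prod>i<e. 1 + fps_const (fls_X ^ d i) * fps_X)"
proof -
  let ?S = "poly_algebra e d :: ((nat \<Rightarrow>\<^sub>0 nat) \<Rightarrow>\<^sub>0 'k, 'k) graded_algebra"
  interpret S: connected_algebra ?S e d poly_var "genideal ?S (poly_var ` {..<e})"
    by (rule poly_algebra_connected) (rule deg_pos)
  obtain H where H: "H \<subseteq> (\<Union>j. rgrade ?S j)" "I = genideal ?S H"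
    using homogeneous unfolding homogeneous_ideal_def by (elim exE conjE)
  have "H \<subseteq> carrier ?S"
  proof
    fix h assume "h \<in> H"
    then obtain j where "h \<in> rgrade ?S j" using H(1) by blast
    then show "h \<in> carrier ?S" using S.RM.mgrade_carrier[of h j] by simp
  qed
  then have I: "ideal I ?S" unfolding H(2) by (rule S.R.genideal_ideal)
  have "connected_algebra R e d (\<lambda>i. I +>\<^bsub>?S\<^esub> poly_var i) \<mm>"
    unfolding R \<mm> irrelevant_ideal_def
    by (rule S.quotient_connected_algebra[OF I S.homogeneous_ideal_stable[OF homogeneous] proper])
  from connected_algebra.tight_embedding_series_inequality[OF this tight V] show ?thesis .
qed

end
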